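(* Let $1<\alpha<2$, $\beta=\alpha/2$, $\sigma=1-\frac{\beta}{2}$, $r\ge 1$ with $r\ne 3-\beta$. Consider the time fractional sine-Gordon problem on $\Omega=(0,L)^2$ and its linearized Alikhanov finite difference scheme on quasi-graded temporal meshes with grading $r$ (both described in the context). Suppose that $\bar u(\bm{x},t)=u(\bm{x},t)-t\phi(\bm{x})$ and $p=D_t^{\beta}\bar u$ satisfy: $\bar u\in C^{4,1}_{\bm{x},t}(\bar\Omega\times[0,T])$, $p\in C^{2,0}_{\bm{x},t}(\bar\Omega\times[0,T])$, and for $l=0,1,2,3$, all $\bm{x}\in\bar\Omega$ and $t\in(0,T]$, $$\sum_{0\le j\le 2}\left|\partial_{\bm{x}}^j\frac{\partial^l\bar u(\bm{x},t)}{\partial t^l}\right|\le C(1+t^{\alpha-l}),\qquad \sum_{0\le j\le 2}\left|\partial_{\bm{x}}^j\frac{\partial^l p(\bm{x},t)}{\partial t^l}\right|\le C(1+t^{\alpha/2-l}).$$ Suppose that the coefficients $g_{n,k}$ of $\delta_t^{\beta,*}$ satisfy (P1) $g_{n,k+1}>g_{n,k}>0$ for $1\le k\le n-1\le N-1$; (P2) $(2\sigma-1)g_{n,n}>\sigma g_{n,n-1}$ for $2\le n\le N$, and that $\tau=\max_n\tau_n$ is sufficiently small. Let $(P^n,\bar U^n)$ be the solution of the scheme, $\tilde p^n=p^n-P^n$ and $\tilde u^n=\bar u^n-\bar U^n$, where $p^n,\bar u^n$ are the grid restrictions of $p(\cdot,t_n),\bar u(\cdot,t_n)$. Then at $t_n=T$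 (i.e. $n=N$), $$\|\tilde p^n\|+\|\nabla_h\tilde u^n\|\lesssim\tau_1^{\min\{1,\frac2r\}}+h^2,$$ where $a\lesssim b$ means $a\le Cb$ with a constant $C>0$ independent of the mesh sizes (of $N$, $M$).
   Context: **Continuous problem.** $\nu>0$, $\kappa$ and $T>0$ are constants, $f(u)=\kappa^2\sin u$, and $u$ solves $D_t^{\alpha}u-\nu\Delta u+f(u)=0$ in $\Omega\times(0,T]$, $u(\cdot,0)=\psi$, $u_t(\cdot,0)=\phi$ in $\Omega$, $u=0$ on $\partial\Omega\times[0,T]$, where $\phi\in C^2(\bar\Omega)$ vanishes on $\partial\Omega$. For $1<\delta<2$ the Caputo derivative is $D_t^{\delta}v(t)=\frac{1}{\Gamma(2-\delta)}\int_0^t(t-s)^{1-\delta}v''(s)\,ds$, and for $0<\delta<1$ it is $D_t^{\delta}v(t)=\frac1{\Gamma(1-\delta)}\int_0^t(t-s)^{-\delta}v'(s)\,ds$. With $\bar u=u-t\phi$ and $p=D_t^\beta\bar u$ the problem is equivalent to the system $D_t^{\beta}p-\nu\Delta\bar u+f(\bar u+t\phi)=\nu t\Delta\phi$, $D_t^\beta\bar u=p$ in $\Omega\times(0,T]$, with $\bar u(\cdot,0)=\psi$, $p(\cdot,0)=0$ and $\bar u=p=0$ on $\partial\Omega\times[0,T]$. $\partial_{\bm x}^jv$ denotes any derivative $\frac{\partial^{j_1+j_2}v}{\partial x^{j_1}\partial y^{j_2}}$ with $j_1,j_2\ge 0$, $j_1+j_2=j$. $C^{m,k}_{\bm x,t}$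 denotes functions with continuous space derivatives up to order $m$ and continuous time derivatives up to order $k$. **Temporal mesh.** For each $N$, $0=t_0<t_1<\dots<t_N=T$, $\tau_n=t_n-t_{n-1}$, $\tau=\max_n\tau_n$. The meshes are quasi-graded: $\tau_1\simeq N^{-r}$, $t_n\simeq\tau_1n^r$, $\tau_n\simeq\tau_1^{1/r}t_n^{1-1/r}$ for $1\le n\le N$, where $a\simeq b$ means that $a/b$ is bounded above and below by positive constants independent of $n$ and $N$. Put $t_n^*=t_n-(1-\sigma)\tau_n$ and, for a sequence $v^n$, $v^{n,*}=\sigma v^n+(1-\sigma)v^{n-1}$. **Discrete fractional derivative (Alikhanov).** $\delta_t^{\beta,*}v^n=\frac1{\Gamma(1-\beta)}\Bigl[\sum_{k=1}^{n-1}\int_{t_{k-1}}^{t_k}(t_n^*-s)^{-\beta}\partial_s\Pi_{2,k}v(s)\,ds+\int_{t_{n-1}}^{t_n^*}(t_n^*-s)^{-\beta}\partial_s\Pi_{1,n}v(s)\,ds\Bigr]$, where $\Pi_{2,k}v$ is the quadratic interpolant of $v$ at $t_{k-1},t_k,t_{k+1}$ and $\Pi_{1,n}v$ the linear interpolant at $t_{n-1},t_n$. Written as $\delta_t^{\beta,*}v^n=\sum_{k=1}^ng_{n,k}(v^k-v^{k-1})$, this defines the coefficients $g_{n,k}$. Explicitly, with $a_{n,n}=\frac{\sigma^{1-\beta}}{\Gamma(2-\beta)}\tau_{n+1}^{1-\beta}$, $a_{n,k}=\frac1{\Gamma(1-\beta)}\int_{t_k}^{t_{k+1}}(t_{n+1}^*-\eta)^{-\beta}d\eta$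 and $b_{n,k}=\frac{1}{\Gamma(1-\beta)}\frac{2}{t_{k+2}-t_k}\int_{t_k}^{t_{k+1}}(t_{n+1}^*-\eta)^{-\beta}(\eta-\frac{t_k+t_{k+1}}2)d\eta$ for $0\le k\le n-1$, one has $g_{1,1}=\tau_1^{-1}a_{0,0}$, and for $n\ge2$: $g_{n,1}=\tau_1^{-1}(a_{n-1,0}-b_{n-1,0})$, $g_{n,k}=\tau_k^{-1}(a_{n-1,k-1}+b_{n-1,k-2}-b_{n-1,k-1})$ for $2\le k\le n-1$, $g_{n,n}=\tau_n^{-1}(a_{n-1,n-1}+b_{n-1,n-2})$. **Space grid.** $h=L/M$, $\bar\Omega_h=\{(x_i,y_j)=(ih,jh):0\le i,j\le M\}$, $\Omega_h=\bar\Omega_h\cap\Omega$, $\partial\Omega_h=\bar\Omega_h\cap\partial\Omega$; $\Delta_h$ is the standard five-point discrete Laplacian. For grid functions vanishing on $\partial\Omega_h$: $(U,V)=h^2\sum_{i,j=1}^{M-1}U_{i,j}V_{i,j}$, $\|U\|=\sqrt{(U,U)}$, and $\|\nabla_hU\|^2=h^2\sum_{i=1}^{M}\sum_{j=1}^{M-1}\bigl(\frac{U_{i,j}-U_{i-1,j}}h\bigr)^2+h^2\sum_{i=1}^{M-1}\sum_{j=1}^{M}\bigl(\frac{U_{i,j}-U_{i,j-1}}h\bigr)^2$. **Scheme.** For $(x_i,y_j)\in\Omega_h$ and $1\le n\le N$: $\delta_t^{\beta,*}P_{i,j}^n-\nu\Delta_h\bar U_{i,j}^{n,*}+F(U_{i,j}^{n,*})=\nu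 t_n^*\Delta\phi_{i,j}$, $\ \delta_t^{\beta,*}\bar U_{i,j}^n=P_{i,j}^{n,*}$, $\ U_{i,j}^n=\bar U_{i,j}^n+t_n\phi_{i,j}$, with $\bar U^0_{i,j}=\psi_{i,j}$, $P^0_{i,j}=0$ on $\Omega_h$ and $\bar U^n_{i,j}=P^n_{i,j}=0$ on $\partial\Omega_h$ for $0\le n\le N$, where $F(U^{n,*}):=f(U^{n-1})+\sigma f'(U^{n-1})(U^n-U^{n-1})$. *)

theory Defs
  imports "HOL-Analysis.Analysis"
begin

(* Functions on the square are curried, w x y, and functions on the space-time cylinder are
   curried as v x y t.  Nothing is assumed about their values outside [0,L] x [0,L] and [0,T],
   so derivatives at points of the closed domain are taken within the closed intervals
   (one-sided at end points). *)

definition dwithin :: "real set \<Rightarrow> (real \<Rightarrow> real) \<Rightarrow> real \<Rightarrow> real" where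
  "dwithin S f x = vector_derivative f (at x within S)"

definition pdx :: "real \<Rightarrow> (real \<Rightarrow> real \<Rightarrow> real) \<Rightarrow> real \<Rightarrow> real \<Rightarrow> real" where
  "pdx L w x y = dwithin {0..L} (\<lambda>s. w s y) x"

definition pdy :: "real \<Rightarrow> (real \<Rightarrow> real \<Rightarrow> real) \<Rightarrow> real \<Rightarrow> real \<Rightarrow> real" where
  "pdy L w x y = dwithin {0..L} (\<lambda>s. w x s) y"

definition space_deriv ::
    "real \<Rightarrow> nat \<Rightarrow> nat \<Rightarrow> (real \<Rightarrow> real \<Rightarrow> real) \<Rightarrow> real \<Rightarrow> real \<Rightarrow> real" where
  "space_deriv L i j w = (pdx L ^^ i) ((pdy L ^^ j) w)"

definition time_deriv :: "real \<Rightarrow> nat \<Rightarrow> (real \<Rightarrow> real) \<Rightarrow> real \<Rightarrow> real" where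
  "time_deriv T l v = (dwithin {0..T} ^^ l) v"

(* Since vector_derivative is total, existence of the derivatives is stated separately:
   here, that of space_deriv L i j w for all i + j \<le> m on the closed square. *)
definition space_differentiable :: "real \<Rightarrow> nat \<Rightarrow> (real \<Rightarrow> real \<Rightarrow> real) \<Rightarrow> bool" where
  "space_differentiable L m w \<longleftrightarrow>
     (\<forall>x\<in>{0..L}. \<forall>y\<in>{0..L}.
        (\<forall>j<m. (\<lambda>s. space_deriv L 0 j w x s) differentiable (at y within {0..L})) \<and>
        (\<forall>i j. i + j < m \<longrightarrow>
           (\<lambda>s. space_deriv L i j w s y) differentiable (at x within {0..L})))"

definition C_space :: "real \<Rightarrow> nat \<Rightarrow> (real \<Rightarrow> real \<Rightarrow> real) \<Rightarrow> bool" where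
  "C_space L m w \<longleftrightarrow>
     space_differentiable L m w \<and>
     (\<forall>i j. i + j \<le> m \<longrightarrow>
        continuous_on ({0..L} \<times> {0..L}) (\<lambda>(x, y). space_deriv L i j w x y))"

definition C_space_time ::
    "real \<Rightarrow> real \<Rightarrow> nat \<Rightarrow> nat \<Rightarrow> (real \<Rightarrow> real \<Rightarrow> real \<Rightarrow> real) \<Rightarrow> bool" where
  "C_space_time L T m k v \<longleftrightarrow>
     (\<forall>t\<in>{0..T}. space_differentiable L m (\<lambda>x y. v x y t)) \<and>
     (\<forall>i j. i + j \<le> m \<longrightarrow>
        continuous_on ({0..L} \<times> {0..L} \<times> {0..T})
          (\<lambda>(x, y, t). space_deriv L i j (\<lambda>x y. v x y t) x y)) \<and>
     (\<forall>l<k. \<forall>x\<in>{0..L}. \<forall>y\<in>{0..L}. \<forall>t\<in>{0..T}.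
        time_deriv T l (v x y) differentiable (at t within {0..T})) \<and>
     (\<forall>l\<le>k. continuous_on ({0..L} \<times> {0..L} \<times> {0..T})
        (\<lambda>(x, y, t). time_deriv T l (v x y) t))"

(* The derivatives d_x^j d_t^l v with j \<le> 2 and l \<le> 3 exist for 0 < t \<le> T, and their sum is at
   most C (1 + t^(q - l)).  The inner sum runs over all spatial multi-indices of order j; as C is
   a generic constant this is the same as bounding every choice of one derivative of each order. *)
definition weakly_singular_bound ::
    "real \<Rightarrow> real \<Rightarrow> real \<Rightarrow> real \<Rightarrow> (real \<Rightarrow> real \<Rightarrow> real \<Rightarrow> real) \<Rightarrow> bool" where
  "weakly_singular_bound L T q C v \<longleftrightarrow>
     (\<forall>l<3. \<forall>x\<in>{0..L}. \<forall>y\<in>{0..L}. \<forall>t\<in>{0<..T}.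
        time_deriv T l (v x y) differentiable (at t within {0..T})) \<and>
     (\<forall>l\<le>3. \<forall>t\<in>{0<..T}. space_differentiable L 2 (\<lambda>x y. time_deriv T l (v x y) t)) \<and>
     (\<forall>l\<le>3. \<forall>x\<in>{0..L}. \<forall>y\<in>{0..L}. \<forall>t\<in>{0<..T}.
        (\<Sum>j\<le>2. \<Sum>i\<le>j. \<bar>space_deriv L i (j - i) (\<lambda>x y. time_deriv T l (v x y) t) x y\<bar>)
          \<le> C * (1 + t powr (q - real l)))"

(* Meant for 0 < \<delta> < 1 and 1 < \<delta> < 2.  The derivatives in the integrand only matter for 0 < s < t. *)
definition caputo :: "real \<Rightarrow> (real \<Rightarrow> real) \<Rightarrow> real \<Rightarrow> real" where
  "caputo \<delta> v t =
     (if \<delta> < 1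
      then 1 / Gamma (1 - \<delta>) * integral {0..t} (\<lambda>s. (t - s) powr (- \<delta>) * deriv v s)
      else 1 / Gamma (2 - \<delta>) * integral {0..t} (\<lambda>s. (t - s) powr (1 - \<delta>) * deriv (deriv v) s))"

(* Only used at interior points of the square. *)
definition laplacian :: "(real \<Rightarrow> real \<Rightarrow> real) \<Rightarrow> real \<Rightarrow> real \<Rightarrow> real" where
  "laplacian w x y = deriv (deriv (\<lambda>s. w s y)) x + deriv (deriv (\<lambda>s. w x s)) y"

definition sg_source :: "real \<Rightarrow> real \<Rightarrow> real" where
  "sg_source \<kappa> u = \<kappa>\<^sup>2 * sin u"

definition sine_gordon_solution ::
    "real \<Rightarrow> real \<Rightarrow> real \<Rightarrow> real \<Rightarrow> real \<Rightarrow> (real \<Rightarrow> real \<Rightarrow> real) \<Rightarrow> (real \<Rightarrow> real \<Rightarrow> real) \<Rightarrow>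
     (real \<Rightarrow> real \<Rightarrow> real \<Rightarrow> real) \<Rightarrow> bool" where
  "sine_gordon_solution L T \<alpha> \<nu> \<kappa> \<psi> \<phi> u \<longleftrightarrow>
     (\<forall>x\<in>{0<..<L}. \<forall>y\<in>{0<..<L}. \<forall>t\<in>{0<..T}.
        caputo \<alpha> (u x y) t - \<nu> * laplacian (\<lambda>x y. u x y t) x y + sg_source \<kappa> (u x y t) = 0) \<and>
     (\<forall>x\<in>{0<..<L}. \<forall>y\<in>{0<..<L}.
        u x y 0 = \<psi> x y \<and> ((u x y) has_real_derivative \<phi> x y) (at 0 within {0..T})) \<and>
     (\<forall>x\<in>{0..L}. \<forall>y\<in>{0..L}. \<forall>t\<in>{0..T}.
        x = 0 \<or> x = L \<or> y = 0 \<or> y = L \<longrightarrow> u x y t = 0)"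

definition mesh_step :: "(nat \<Rightarrow> real) \<Rightarrow> nat \<Rightarrow> real" where
  "mesh_step t n = t n - t (n - 1)"

definition temporal_mesh :: "real \<Rightarrow> nat \<Rightarrow> (nat \<Rightarrow> real) \<Rightarrow> bool" where
  "temporal_mesh T N t \<longleftrightarrow> t 0 = 0 \<and> t N = T \<and> (\<forall>n\<in>{1..N}. t (n - 1) < t n)"

definition uniformly_equivalent :: "(nat \<Rightarrow> nat \<Rightarrow> real) \<Rightarrow> (nat \<Rightarrow> nat \<Rightarrow> real) \<Rightarrow> bool" where
  "uniformly_equivalent a b \<longleftrightarrow>
     (\<exists>c>0. \<exists>C>0. \<forall>N\<ge>1. \<forall>n\<in>{1..N}. c \<le> a N n / b N n \<and> a N n / b N n \<le> C)"

(* A family of meshes, one for each N \<ge> 1: the points of the N-th mesh are t N 0, ..., t N N. *)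
definition quasi_graded :: "real \<Rightarrow> real \<Rightarrow> (nat \<Rightarrow> nat \<Rightarrow> real) \<Rightarrow> bool" where
  "quasi_graded T r t \<longleftrightarrow>
     (\<forall>N\<ge>1. temporal_mesh T N (t N)) \<and>
     uniformly_equivalent (\<lambda>N n. mesh_step (t N) 1) (\<lambda>N n. real N powr (- r)) \<and>
     uniformly_equivalent (\<lambda>N n. t N n) (\<lambda>N n. mesh_step (t N) 1 * real n powr r) \<and>
     uniformly_equivalent (\<lambda>N n. mesh_step (t N) n)
       (\<lambda>N n. mesh_step (t N) 1 powr (1 / r) * t N n powr (1 - 1 / r))"

definition t_star :: "real \<Rightarrow> (nat \<Rightarrow> real) \<Rightarrow> nat \<Rightarrow> real" where
  "t_star \<sigma> t n = t n - (1 - \<sigma>) * mesh_step t n"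

definition avg_star :: "real \<Rightarrow> (nat \<Rightarrow> real) \<Rightarrow> nat \<Rightarrow> real" where
  "avg_star \<sigma> v n = \<sigma> * v n + (1 - \<sigma>) * v (n - 1)"

definition linear_interpolant :: "(nat \<Rightarrow> real) \<Rightarrow> (nat \<Rightarrow> real) \<Rightarrow> nat \<Rightarrow> real \<Rightarrow> real" where
  "linear_interpolant t v n s =
     v (n - 1) * (s - t n) / (t (n - 1) - t n) + v n * (s - t (n - 1)) / (t n - t (n - 1))"

definition quadratic_interpolant :: "(nat \<Rightarrow> real) \<Rightarrow> (nat \<Rightarrow> real) \<Rightarrow> nat \<Rightarrow> real \<Rightarrow> real" where
  "quadratic_interpolant t v k s =
     v (k - 1) * ((s - t k) * (s - t (k + 1))) / ((t (k - 1) - t k) * (t (k - 1) - t (k + 1))) +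
     v k * ((s - t (k - 1)) * (s - t (k + 1))) / ((t k - t (k - 1)) * (t k - t (k + 1))) +
     v (k + 1) * ((s - t (k - 1)) * (s - t k)) / ((t (k + 1) - t (k - 1)) * (t (k + 1) - t k))"

definition alikhanov_deriv ::
    "real \<Rightarrow> real \<Rightarrow> (nat \<Rightarrow> real) \<Rightarrow> (nat \<Rightarrow> real) \<Rightarrow> nat \<Rightarrow> real" where
  "alikhanov_deriv \<beta> \<sigma> t v n =
     1 / Gamma (1 - \<beta>) *
       ((\<Sum>k=1..n-1. integral {t (k - 1)..t k}
           (\<lambda>s. (t_star \<sigma> t n - s) powr (- \<beta>) * deriv (quadratic_interpolant t v k) s)) +
        integral {t (n - 1)..t_star \<sigma> t n}
           (\<lambda>s. (t_star \<sigma> t n - s) powr (- \<beta>) * deriv (linear_interpolant t v n) s))"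

definition alikhanov_a :: "real \<Rightarrow> real \<Rightarrow> (nat \<Rightarrow> real) \<Rightarrow> nat \<Rightarrow> nat \<Rightarrow> real" where
  "alikhanov_a \<beta> \<sigma> t n k =
     (if k = n
      then \<sigma> powr (1 - \<beta>) / Gamma (2 - \<beta>) * mesh_step t (n + 1) powr (1 - \<beta>)
      else 1 / Gamma (1 - \<beta>) *
        integral {t k..t (k + 1)} (\<lambda>\<eta>. (t_star \<sigma> t (n + 1) - \<eta>) powr (- \<beta>)))"

definition alikhanov_b :: "real \<Rightarrow> real \<Rightarrow> (nat \<Rightarrow> real) \<Rightarrow> nat \<Rightarrow> nat \<Rightarrow> real" where
  "alikhanov_b \<beta> \<sigma> t n k =
     1 / Gamma (1 - \<beta>) * (2 / (t (k + 2) - t k)) *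
       integral {t k..t (k + 1)}
         (\<lambda>\<eta>. (t_star \<sigma> t (n + 1) - \<eta>) powr (- \<beta>) * (\<eta> - (t k + t (k + 1)) / 2))"

definition alikhanov_g :: "real \<Rightarrow> real \<Rightarrow> (nat \<Rightarrow> real) \<Rightarrow> nat \<Rightarrow> nat \<Rightarrow> real" where
  "alikhanov_g \<beta> \<sigma> t n k =
     (let a = alikhanov_a \<beta> \<sigma> t (n - 1); b = alikhanov_b \<beta> \<sigma> t (n - 1) in
      (if n = 1 then a 0
       else if k = 1 then a 0 - b 0
       else if k < n then a (k - 1) + b (k - 2) - b (k - 1)
       else a (n - 1) + b (n - 2)) / mesh_step t k)"

lemma deriv_quadratic_interpolant:
  assumes "t (k - 1) < t k" "t k < t (k + 1)"
  shows "deriv (quadratic_interpolant t v k) s =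
    (v k - v (k - 1)) / (t k - t (k - 1)) +
    ((v (k + 1) - v k) / (t (k + 1) - t k) - (v k - v (k - 1)) / (t k - t (k - 1))) *
      (2 / (t (k + 1) - t (k - 1)) * (s - (t (k - 1) + t k) / 2))"
proof -
  define a b c where "a = t (k - 1)" and "b = t k" and "c = t (k + 1)"
  have lt: "a < b" "b < c" using assms by (auto simp: a_def b_def c_def)
  define x y where "x = b - a" and "y = c - b"
  have xy: "x > 0" "y > 0" "b = a + x" "c = a + x + y" using lt by (auto simp: x_def y_def)
  have "((\<lambda>s. A * ((s - b) * (s - c)) / p + B * ((s - a) * (s - c)) / q + C * ((s - a) * (s - b)) / r)
      has_real_derivative A * ((s - c) + (s - b)) / p + B * ((s - c) + (s - a)) / q
        + C * ((s - b) + (s - a)) / r) (at s)" for A B C p q r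
    by (intro DERIV_add DERIV_cdivide DERIV_cmult) (auto intro!: derivative_eq_intros)
  then have D: "(quadratic_interpolant t v k has_real_derivative
     v (k - 1) * ((s - c) + (s - b)) / ((a - b) * (a - c)) +
     v k * ((s - c) + (s - a)) / ((b - a) * (b - c)) +
     v (k + 1) * ((s - b) + (s - a)) / ((c - a) * (c - b))) (at s)"
    unfolding quadratic_interpolant_def a_def b_def c_def .
  have "v (k - 1) * ((s - c) + (s - b)) / ((a - b) * (a - c)) +
     v k * ((s - c) + (s - a)) / ((b - a) * (b - c)) +
     v (k + 1) * ((s - b) + (s - a)) / ((c - a) * (c - b))
    = (v k - v (k - 1)) / (b - a) + ((v (k + 1) - v k) / (c - b) - (v k - v (k - 1)) / (b - a)) *
      (2 / (c - a) * (s - (a + b) / 2))"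
  proof -
    have nz: "a - b \<noteq> 0" "a - c \<noteq> 0" "b - a \<noteq> 0" "b - c \<noteq> 0" "c - a \<noteq> 0" "c - b \<noteq> 0" "x + y \<noteq> 0"
      using lt xy by auto
    show ?thesis
      unfolding xy using xy(1,2) nz(7) by (simp add: divide_simps) (simp add: algebra_simps)
  qed
  with D show ?thesis using DERIV_imp_deriv[OF D] by (simp add: a_def b_def c_def)
qed

lemma alikhanov_sum_regroup:
  fixes a b s :: "nat \<Rightarrow> real"
  shows "(\<Sum>k=1..m. a (k - 1) * s k + b (k - 1) * (s (Suc k) - s k)) =
    (\<Sum>k=1..m. (a (k - 1) - b (k - 1) + (if k = 1 then 0 else b (k - 2))) * s k)
      + (if m = 0 then 0 else b (m - 1) * s (Suc m))"
  by (induction m) (auto simp: algebra_simps)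

(* alikhanov_g are the coefficients of the increments in the operator defined by interpolation. *)
lemma alikhanov_deriv_coefficients:
  assumes mesh: "temporal_mesh T N t" and "0 < \<beta>" "\<beta> < 1" "0 < \<sigma>" "n \<in> {1..N}"
  shows "alikhanov_deriv \<beta> \<sigma> t v n = (\<Sum>k=1..n. alikhanov_g \<beta> \<sigma> t n k * (v k - v (k - 1)))"
proof -
  define sl where "sl k = (v k - v (k - 1)) / mesh_step t k" for k
  define a b where "a = alikhanov_a \<beta> \<sigma> t (n - 1)" and "b = alikhanov_b \<beta> \<sigma> t (n - 1)"
  define ts where "ts = t_star \<sigma> t n"
  have inc: "t (k - 1) < t k" if "k \<in> {1..N}" for k using mesh that by (auto simp: temporal_mesh_def)
  have stp: "mesh_step t k > 0" if "k \<in> {1..N}" for k using inc[OF that] by (simp add: mesh_step_def)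
  have mono: "t i \<le> t j" if "i \<le> j" "j \<le> N" for i j
    using that
  proof (induction j)
    case (Suc j) then show ?case using inc[of "Suc j"] by (cases "i = Suc j") auto
  qed auto
  have ts: "ts = t (n - 1) + \<sigma> * mesh_step t n"
    by (simp add: ts_def t_star_def mesh_step_def algebra_simps)
  have tsgt: "t (n - 1) < ts" using stp[of n] assms by (simp add: ts)
  have n1: "n - 1 + 1 = n" using assms by simp
  have I: "1 / Gamma (1 - \<beta>) * integral {t (k - 1)..t k}
           (\<lambda>s. (ts - s) powr (- \<beta>) * deriv (quadratic_interpolant t v k) s)
      = a (k - 1) * sl k + b (k - 1) * (sl (Suc k) - sl k)" if k: "k \<in> {1..n-1}" for k
  proof -
    have kk: "k - 1 + 1 = k" "k - 1 + 2 = k + 1" using k by auto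
    have lt: "t (k - 1) < t k" "t k < t (k + 1)" using inc[of k] inc[of "k+1"] k assms by auto
    have "n - 1 \<le> N" using assms by auto
    then have tk: "t k < ts" using mono[of k "n - 1"] k tsgt by force
    have c: "continuous_on {t (k - 1)..t k} (\<lambda>s. (ts - s) powr (- \<beta>))"
      by (intro continuous_intros) (use tk in auto)
    have c2: "continuous_on {t (k - 1)..t k} (\<lambda>s. (ts - s) powr (- \<beta>) * (s - (t (k - 1) + t k) / 2))"
      by (intro continuous_intros c)
    have e: "(ts - s) powr (- \<beta>) * deriv (quadratic_interpolant t v k) s =
       sl k * (ts - s) powr (- \<beta>) + ((sl (Suc k) - sl k) * (2 / (t (k + 1) - t (k - 1)))) *
         ((ts - s) powr (- \<beta>) * (s - (t (k - 1) + t k) / 2))" for s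
    proof -
      have "deriv (quadratic_interpolant t v k) s =
          sl k + (sl (Suc k) - sl k) * (2 / (t (k + 1) - t (k - 1)) * (s - (t (k - 1) + t k) / 2))"
        using deriv_quadratic_interpolant[OF lt, of v s] by (simp add: sl_def mesh_step_def)
      moreover have "A * (B + C * (D * E)) = B * A + (C * D) * (A * E)" for A B C D E :: real
        by (simp add: distrib_left mult_ac)
      ultimately show ?thesis by presburger
    qed
    have "integral {t (k - 1)..t k} (\<lambda>s. (ts - s) powr (- \<beta>) * deriv (quadratic_interpolant t v k) s)
       = sl k * integral {t (k - 1)..t k} (\<lambda>s. (ts - s) powr (- \<beta>)) + 
        ((sl (Suc k) - sl k) * (2 / (t (k + 1) - t (k - 1)))) * 
         integral {t (k - 1)..t k} (\<lambda>s. (ts - s) powr (- \<beta>) * (s - (t (k - 1) + t k) / 2))"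
      unfolding e
      by (intro integral_unique has_integral_add has_integral_mult_right integrable_integral
          integrable_continuous_interval c c2)
    note I0 = this
    have gen: "G * (A * X + (B * D) * Y) = (G * X) * A + (G * D * Y) * B" for G A B D X Y :: real
      by (simp add: distrib_left mult_ac)
    have ne: "k - 1 \<noteq> n - 1" using k by auto
    show ?thesis
      unfolding a_def b_def alikhanov_a_def alikhanov_b_def n1 kk ts_def[symmetric]
        if_not_P[OF ne] I0 by (rule gen)
  qed
  have J: "1 / Gamma (1 - \<beta>) * integral {t (n - 1)..ts}
           (\<lambda>s. (ts - s) powr (- \<beta>) * deriv (linear_interpolant t v n) s) = a (n - 1) * sl n"
  proof -
    have d: "deriv (linear_interpolant t v n) s = sl n" for s
    proof -
      have ne: "t (n - 1) - t n \<noteq> 0" "t n - t (n - 1) \<noteq> 0" using inc[of n] assms by auto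
      have "(linear_interpolant t v n has_real_derivative
          v (n - 1) / (t (n - 1) - t n) + v n / (t n - t (n - 1))) (at s)"
        unfolding linear_interpolant_def
        by (rule derivative_eq_intros refl | use ne in simp)+
      moreover have "v (n - 1) / (t (n - 1) - t n) + v n / (t n - t (n - 1)) = sl n"
        using ne unfolding sl_def mesh_step_def by (simp add: divide_simps) (simp add: algebra_simps)
      ultimately show ?thesis using DERIV_imp_deriv by metis
    qed
    define w where "w = \<sigma> * mesh_step t n"
    have w: "w > 0" using stp[of n] assms by (simp add: w_def)
    have "((\<lambda>x. x powr (- \<beta>)) has_integral (w powr (- \<beta> + 1) / (- \<beta> + 1))) {0..w}"
      by (rule has_integral_powr_from_0) (use assms w in auto)
    then have "((\<lambda>x. (-1 * x + ts) powr (- \<beta>)) has_integral (w powr (1 - \<beta>) / (1 - \<beta>))) 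
        {t (n - 1)..ts}"
      using has_integral_affinity[of "\<lambda>x. x powr (- \<beta>)" "w powr (1 - \<beta>) / (1 - \<beta>)" 0 w "-1" ts]
      by (simp add: ts w_def algebra_simps)
    then have "integral {t (n - 1)..ts} (\<lambda>s. (ts - s) powr (- \<beta>)) = w powr (1 - \<beta>) / (1 - \<beta>)"
      by (intro integral_unique) (simp add: algebra_simps)
    moreover have "Gamma (2 - \<beta>) = (1 - \<beta>) * Gamma (1 - \<beta>)"
      using Gamma_plus1[of "1 - \<beta>"] nonpos_Ints_nonpos[of "1 - \<beta>"] assms by auto
    moreover have "w powr (1 - \<beta>) = \<sigma> powr (1 - \<beta>) * mesh_step t n powr (1 - \<beta>)"
      using stp[of n] assms by (simp add: w_def powr_mult)
    ultimately show ?thesis unfolding d a_def alikhanov_a_def n1 by simp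
  qed
  have "alikhanov_deriv \<beta> \<sigma> t v n =
     (\<Sum>k=1..n-1. a (k - 1) * sl k + b (k - 1) * (sl (Suc k) - sl k)) + a (n - 1) * sl n"
    unfolding alikhanov_deriv_def ts_def[symmetric] distrib_left sum_distrib_left J
    using I by simp
  also have "\<dots> = (\<Sum>k=1..n-1. (a (k - 1) - b (k - 1) + (if k = 1 then 0 else b (k - 2))) * sl k)
      + (a (n - 1) + (if n = 1 then 0 else b (n - 2))) * sl n"
    unfolding alikhanov_sum_regroup using assms by (auto simp: algebra_simps numeral_2_eq_2)
  also have "\<dots> = (\<Sum>k=1..n-1. alikhanov_g \<beta> \<sigma> t n k * (v k - v (k - 1))) +
      alikhanov_g \<beta> \<sigma> t n n * (v n - v (n - 1))"
  proof -
    have "(\<Sum>k=1..n-1. (a (k - 1) - b (k - 1) + (if k = 1 then 0 else b (k - 2))) * sl k) =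
      (\<Sum>k=1..n-1. alikhanov_g \<beta> \<sigma> t n k * (v k - v (k - 1)))"
      by (rule sum.cong) (auto simp: alikhanov_g_def Let_def a_def b_def sl_def)
    moreover have "(a (n - 1) + (if n = 1 then 0 else b (n - 2))) * sl n =
       alikhanov_g \<beta> \<sigma> t n n * (v n - v (n - 1))"
      using assms by (auto simp: alikhanov_g_def Let_def a_def b_def sl_def)
    ultimately show ?thesis by simp
  qed
  also have "\<dots> = (\<Sum>k=1..n. alikhanov_g \<beta> \<sigma> t n k * (v k - v (k - 1)))"
    using assms by (cases n) auto
  finally show ?thesis .
qed

definition property_P1 :: "real \<Rightarrow> real \<Rightarrow> (nat \<Rightarrow> real) \<Rightarrow> nat \<Rightarrow> bool" where
  "property_P1 \<beta> \<sigma> t N \<longleftrightarrow>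
     (\<forall>n k. 1 \<le> k \<and> k \<le> n - 1 \<and> n - 1 \<le> N - 1 \<longrightarrow>
        alikhanov_g \<beta> \<sigma> t n (k + 1) > alikhanov_g \<beta> \<sigma> t n k \<and> alikhanov_g \<beta> \<sigma> t n k > 0)"

definition property_P2 :: "real \<Rightarrow> real \<Rightarrow> (nat \<Rightarrow> real) \<Rightarrow> nat \<Rightarrow> bool" where
  "property_P2 \<beta> \<sigma> t N \<longleftrightarrow>
     (\<forall>n. 2 \<le> n \<and> n \<le> N \<longrightarrow>
        (2 * \<sigma> - 1) * alikhanov_g \<beta> \<sigma> t n n > \<sigma> * alikhanov_g \<beta> \<sigma> t n (n - 1))"

(* Grid functions are indexed by (i, j) with i, j \<le> M; other values are irrelevant. *)
definition discrete_laplacian :: "real \<Rightarrow> (nat \<Rightarrow> nat \<Rightarrow> real) \<Rightarrow> nat \<Rightarrow> nat \<Rightarrow> real" where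
  "discrete_laplacian h V i j =
     (V (i + 1) j + V (i - 1) j + V i (j + 1) + V i (j - 1) - 4 * V i j) / h\<^sup>2"

definition grid_norm :: "real \<Rightarrow> nat \<Rightarrow> (nat \<Rightarrow> nat \<Rightarrow> real) \<Rightarrow> real" where
  "grid_norm h M V = sqrt (h\<^sup>2 * (\<Sum>i=1..M-1. \<Sum>j=1..M-1. V i j * V i j))"

definition grid_grad_norm :: "real \<Rightarrow> nat \<Rightarrow> (nat \<Rightarrow> nat \<Rightarrow> real) \<Rightarrow> real" where
  "grid_grad_norm h M V =
     sqrt (h\<^sup>2 * (\<Sum>i=1..M. \<Sum>j=1..M-1. ((V i j - V (i - 1) j) / h)\<^sup>2) +
           h\<^sup>2 * (\<Sum>i=1..M-1. \<Sum>j=1..M. ((V i j - V i (j - 1)) / h)\<^sup>2))"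

definition linearized_source :: "real \<Rightarrow> real \<Rightarrow> (nat \<Rightarrow> real) \<Rightarrow> nat \<Rightarrow> real" where
  "linearized_source \<kappa> \<sigma> U n =
     sg_source \<kappa> (U (n - 1)) + \<sigma> * deriv (sg_source \<kappa>) (U (n - 1)) * (U n - U (n - 1))"

(* P n i j and Ub n i j are the unknowns P^n_{i,j} and \bar U^n_{i,j}. *)
definition alikhanov_scheme ::
    "real \<Rightarrow> real \<Rightarrow> real \<Rightarrow> real \<Rightarrow> real \<Rightarrow> (real \<Rightarrow> real \<Rightarrow> real) \<Rightarrow> (real \<Rightarrow> real \<Rightarrow> real) \<Rightarrow>
     nat \<Rightarrow> nat \<Rightarrow> (nat \<Rightarrow> real) \<Rightarrow>
     (nat \<Rightarrow> nat \<Rightarrow> nat \<Rightarrow> real) \<Rightarrow> (nat \<Rightarrow> nat \<Rightarrow> nat \<Rightarrow> real) \<Rightarrow> bool" where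
  "alikhanov_scheme L \<beta> \<sigma> \<nu> \<kappa> \<psi> \<phi> M N t P Ub \<longleftrightarrow>
     (let h = L / real M;
          U = (\<lambda>n i j. Ub n i j + t n * \<phi> (real i * h) (real j * h))
      in
       (\<forall>n\<in>{1..N}. \<forall>i\<in>{1..M-1}. \<forall>j\<in>{1..M-1}.
          alikhanov_deriv \<beta> \<sigma> t (\<lambda>k. P k i j) n
            - \<nu> * discrete_laplacian h (\<lambda>i j. avg_star \<sigma> (\<lambda>k. Ub k i j) n) i j
            + linearized_source \<kappa> \<sigma> (\<lambda>k. U k i j) n
            = \<nu> * t_star \<sigma> t n * laplacian \<phi> (real i * h) (real j * h) \<and>
          alikhanov_deriv \<beta> \<sigma> t (\<lambda>k. Ub k i j) n = avg_star \<sigma> (\<lambda>k. P k i j) n) \<and>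
       (\<forall>i\<in>{1..M-1}. \<forall>j\<in>{1..M-1}.
          Ub 0 i j = \<psi> (real i * h) (real j * h) \<and> P 0 i j = 0) \<and>
       (\<forall>n\<le>N. \<forall>i\<le>M. \<forall>j\<le>M. i = 0 \<or> i = M \<or> j = 0 \<or> j = M \<longrightarrow>
          Ub n i j = 0 \<and> P n i j = 0))"

end

theory Submission
  imports Defs
begin

text \<open>Write \<open>a\<close> and \<open>w\<close> for the errors in \<open>p\<close> and \<open>ubar\<close>, \<open>z = (a, w)\<close>, and let
\<open>E n\<close> be the square root of \<open>\<parallel>a n\<parallel>\<^sup>2 + \<nu> \<parallel>\<nabla> w n\<parallel>\<^sup>2\<close>.  The errors solve the scheme with residuals on the
right-hand side.  Testing with the weighted average at \<open>t\<^sub>n\<^sup>*\<close> makes the terms that couple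
\<open>a\<close> and \<open>w\<close> cancel (lemma \<open>energy_orthogonality\<close>), and the two conditions on the
coefficients turn the remaining product into the discrete derivative of the norm itself rather than
of its square (lemma \<open>energy_inequality\<close>).  So \<open>E\<close> satisfies the scalar inequality

  \<open>\<delta> E n \<le> \<lambda> (E n + E (n - 1)) + R n\<close>,

where \<open>R n\<close> is the size of the residuals and \<open>\<lambda>\<close> comes from the nonlinearity.

Put \<open>m = min 1 (2 / r)\<close> and \<open>\<xi> n = t 1 / t n\<close>.  The truncation error at \<open>t\<^sub>n\<^sup>*\<close> is of order
\<open>\<xi> n\<close> to the power \<open>m + \<epsilon>\<close> for some \<open>\<epsilon> > 0\<close> (lemma \<open>truncation_error\<close>): quadratic
interpolation has third order, and on the last interval the choice of \<open>\<sigma>\<close> removes the leading error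
of linear interpolation.  Averaging in time and linearizing the source cost
\<open>\<xi> n powr m * t n powr \<beta>\<close>, and the five-point Laplacian costs \<open>h\<^sup>2\<close>.  The first of these is
\<open>t 1 powr m\<close> times \<open>\<xi> n powr \<epsilon> * t n powr (- m)\<close>, and the others are at most a multiple of
\<open>(t 1 powr m + h\<^sup>2) * t n powr (- \<beta>)\<close>.

The scalar inequality is solved by comparison with barriers (lemma \<open>comparison_principle\<close>).  A
function that jumps in the first step and then grows exponentially absorbs the terms with \<open>\<lambda>\<close>
and the forcing \<open>t n powr (- \<beta>)\<close>.  It cannot absorb the initial layer \<open>\<xi> n powr \<epsilon> * t n powr (- m)\<close>
when \<open>m > \<beta>\<close>.  For this the second barrier jumps in the first step and then decays like
\<open>t powr (\<beta> - m)\<close>.  It is large near zero but bounded at the final time, which is why the rate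
\<open>t 1 powr m\<close> is available at \<open>t = T\<close>.  In the critical case \<open>m = 1\<close> the pure power is
annihilated by the fractional derivative; a lower-order correction makes the derivative positive, and the
factor \<open>\<xi> n powr \<epsilon>\<close> in the forcing is what makes this correction sufficient.

The regularity assumptions enter through one class of functions of time, with a singularity
\<open>s powr (\<beta> - l)\<close> of the \<open>l\<close>-th derivative.  It contains the values of \<open>ubar\<close> and \<open>p\<close> at a point,
their differences between points and the discrete Laplacians of \<open>ubar\<close>, so the residuals of both equations
follow from the same estimates.  That the solution satisfies the first-order system at all is the
identity between the twofold derivative of order \<open>\<beta>\<close> and the one of order \<open>2 \<beta>\<close>
(lemma \<open>fractional_derivative_composition\<close>).\<close>

section \<open>Coefficients of the discrete fractional derivative\<close>

lemma temporal_mesh_less: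
  assumes "temporal_mesh T N t" "i < j" "j \<le> N"
  shows "t i < t j"
  using assms(2,3)
proof (induction j)
  case (Suc j)
  have "t j < t (Suc j)" using assms(1) Suc.prems by (force simp: temporal_mesh_def)
  then show ?case using Suc by (cases "i = j") auto
qed simp

lemma temporal_mesh_le:
  assumes "temporal_mesh T N t" "i \<le> j" "j \<le> N"
  shows "t i \<le> t j"
  using temporal_mesh_less[OF assms(1), of i j] assms by (cases "i = j") auto

lemma integral_antisymmetric_weight:
  fixes a b :: real
  assumes "a \<le> b"
  shows "((\<lambda>x. x - (a + b) / 2) has_integral 0) {a..b}"
proof -
  have "((\<lambda>x. x - (a + b) / 2) has_integral ((b - (a + b) / 2)\<^sup>2 / 2 - (a - (a + b) / 2)\<^sup>2 / 2)) {a..b}"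
    by (rule fundamental_theorem_of_calculus[OF assms])
      (auto intro!: derivative_eq_intros simp: has_real_derivative_iff_has_vector_derivative[symmetric])
  moreover have "(b - (a + b) / 2)\<^sup>2 / 2 - (a - (a + b) / 2)\<^sup>2 / 2 = 0"
    by (simp add: power2_eq_square field_simps)
  ultimately show ?thesis by simp
qed

lemma t_star_eq: "t_star \<sigma> t n = t (n - 1) + \<sigma> * mesh_step t n"
  by (simp add: t_star_def mesh_step_def algebra_simps)

lemma continuous_on_kernel:
  fixes a b s \<beta> :: real
  assumes "b < s"
  shows "continuous_on {a..b} (\<lambda>x. (s - x) powr (- \<beta>))"
  by (intro continuous_intros) (use assms in auto)

lemma kernel_mono:
  fixes x y s \<beta> :: real
  assumes "x \<le> y" "y < s" "0 < \<beta>"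
  shows "(s - x) powr (- \<beta>) \<le> (s - y) powr (- \<beta>)"
  using assms by (intro powr_mono2') auto

text \<open>The weight is antisymmetric about the midpoint of the interval and the kernel increases, so the
positive half outweighs the negative one.\<close>

lemma alikhanov_b_nonneg:
  assumes "temporal_mesh T N t" "n \<in> {1..N}" "k + 2 \<le> n" "0 < \<beta>" "\<beta> < 1" "0 < \<sigma>"
  shows "alikhanov_b \<beta> \<sigma> t (n - 1) k \<ge> 0"
proof -
  define ts where "ts = t_star \<sigma> t n"
  have n1: "n - 1 + 1 = n" using assms by simp
  have st: "t (n - 1) < t n" using temporal_mesh_less[OF assms(1), of "n - 1" n] assms by auto
  have lt: "t k < t (k + 1)" "t (k + 1) < t (k + 2)"
    using temporal_mesh_less[OF assms(1)] assms by auto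
  have le: "t (k + 1) \<le> t (n - 1)" using temporal_mesh_le[OF assms(1), of "k + 1" "n - 1"] assms by auto
  have tsgt: "t (k + 1) < ts" using le st assms by (auto simp: ts_def t_star_eq mesh_step_def intro: le_less_trans)
  define m where "m = (t k + t (k + 1)) / 2"
  have c: "continuous_on {t k..t (k + 1)} (\<lambda>x. (ts - x) powr (- \<beta>))"
    using continuous_on_kernel[OF tsgt] .
  have "0 = integral {t k..t (k + 1)} (\<lambda>x. (ts - m) powr (- \<beta>) * (x - m))"
  proof -
    have "((\<lambda>x. (ts - m) powr (- \<beta>) * (x - m)) has_integral (ts - m) powr (- \<beta>) * 0) {t k..t (k + 1)}"
      unfolding m_def using lt by (intro has_integral_mult_right integral_antisymmetric_weight) auto
    from integral_unique[OF this] show ?thesis by (simp only: mult_zero_right)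
  qed
  also have "\<dots> \<le> integral {t k..t (k + 1)} (\<lambda>x. (ts - x) powr (- \<beta>) * (x - m))"
  proof (rule integral_le)
    show "(\<lambda>x. (ts - m) powr - \<beta> * (x - m)) integrable_on {t k..t (k + 1)}"
      by (intro integrable_continuous_interval continuous_intros)
    show "(\<lambda>x. (ts - x) powr - \<beta> * (x - m)) integrable_on {t k..t (k + 1)}"
      by (intro integrable_continuous_interval continuous_intros c)
    fix x assume x: "x \<in> {t k..t (k + 1)}"
    show "(ts - m) powr - \<beta> * (x - m) \<le> (ts - x) powr - \<beta> * (x - m)"
    proof (cases "x \<ge> m")
      case True
      then show ?thesis using kernel_mono[of m x ts \<beta>] x tsgt assms by (intro mult_right_mono) auto
    next
      case False
      then show ?thesis using kernel_mono[of x m ts \<beta>] x tsgt assms lt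
        by (intro mult_right_mono_neg) (auto simp: m_def)
    qed
  qed
  finally have "0 \<le> integral {t k..t (k + 1)} (\<lambda>x. (ts - x) powr (- \<beta>) * (x - m))" .
  moreover have "Gamma (1 - \<beta>) > 0" using assms by (intro Gamma_real_pos) auto
  ultimately show ?thesis using lt
    unfolding alikhanov_b_def n1 ts_def[symmetric] m_def[symmetric]
    by (intro mult_nonneg_nonneg) auto
qed

text \<open>The difference is the integral of the kernel against
\<open>1 - 2 (x - mid) / (t (k + 2) - t k)\<close>.  This weight is nonnegative and has the same integral as
\<open>1\<close>, so replacing the increasing kernel by its value at the left end gives a lower bound.\<close>

lemma alikhanov_a_minus_b_lower:
  assumes "temporal_mesh T N t" "n \<in> {1..N}" "k + 2 \<le> n" "0 < \<beta>" "\<beta> < 1" "0 < \<sigma>"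
  shows "alikhanov_a \<beta> \<sigma> t (n - 1) k - alikhanov_b \<beta> \<sigma> t (n - 1) k
    \<ge> (t_star \<sigma> t n - t k) powr (- \<beta>) * (t (k + 1) - t k) / Gamma (1 - \<beta>)"
proof -
  define ts where "ts = t_star \<sigma> t n"
  have n1: "n - 1 + 1 = n" using assms by simp
  have st: "t (n - 1) < t n" using temporal_mesh_less[OF assms(1), of "n - 1" n] assms by auto
  have lt: "t k < t (k + 1)" "t (k + 1) < t (k + 2)"
    using temporal_mesh_less[OF assms(1)] assms by auto
  have le: "t (k + 1) \<le> t (n - 1)" using temporal_mesh_le[OF assms(1), of "k + 1" "n - 1"] assms by auto
  have tsgt: "t (k + 1) < ts" using le st assms by (auto simp: ts_def t_star_eq mesh_step_def intro: le_less_trans)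
  define m where "m = (t k + t (k + 1)) / 2"
  define w where "w = 2 / (t (k + 2) - t k)"
  have w: "w > 0" using lt by (simp add: w_def)
  have G: "Gamma (1 - \<beta>) > 0" using assms by (intro Gamma_real_pos) auto
  let ?f = "\<lambda>x. (ts - x) powr (- \<beta>)"
  have c: "continuous_on {t k..t (k + 1)} ?f"
    using continuous_on_kernel[OF tsgt] .
  have *: "integral {t k..t (k + 1)} (\<lambda>x. ?f (t k) * (1 - w * (x - m)))
      \<le> integral {t k..t (k + 1)} (\<lambda>x. ?f x * (1 - w * (x - m)))"
  proof (rule integral_le)
    show "(\<lambda>x. ?f (t k) * (1 - w * (x - m))) integrable_on {t k..t (k + 1)}"
      by (intro integrable_continuous_interval continuous_intros)
    show "(\<lambda>x. ?f x * (1 - w * (x - m))) integrable_on {t k..t (k + 1)}"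
      by (intro integrable_continuous_interval continuous_intros c)
    fix x assume x: "x \<in> {t k..t (k + 1)}"
    have "2 * (x - m) \<le> t (k + 2) - t k" using x lt by (auto simp: m_def field_simps)
    then have "0 \<le> 1 - w * (x - m)" using lt by (auto simp: w_def divide_simps)
    then show "?f (t k) * (1 - w * (x - m)) \<le> ?f x * (1 - w * (x - m))"
      using kernel_mono[of "t k" x ts \<beta>] x tsgt assms by (intro mult_right_mono) auto
  qed
  have "((\<lambda>x. ?f (t k) * (1 - w * (x - m))) has_integral ?f (t k) * ((t (k + 1) - t k) * 1 - w * 0)) {t k..t (k + 1)}"
    using integral_antisymmetric_weight[of "t k" "t (k + 1)"] lt has_integral_const_real[of "1::real" "t k" "t (k+1)"]
    by (intro has_integral_mult_right has_integral_diff) (auto simp: m_def)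
  then have 1: "integral {t k..t (k + 1)} (\<lambda>x. ?f (t k) * (1 - w * (x - m))) = ?f (t k) * (t (k + 1) - t k)"
    by (simp only: integral_unique mult_1_right mult_zero_right diff_zero)
  have "integral {t k..t (k + 1)} (\<lambda>x. ?f x * (1 - w * (x - m))) =
     integral {t k..t (k + 1)} (\<lambda>x. ?f x - w * (?f x * (x - m)))"
    by (simp add: algebra_simps)
  also have "\<dots> = integral {t k..t (k + 1)} ?f - w * integral {t k..t (k + 1)} (\<lambda>x. ?f x * (x - m))"
    by (intro integral_unique has_integral_diff has_integral_mult_right integrable_integral
        integrable_continuous_interval continuous_intros c)
  finally have 2: "?f (t k) * (t (k + 1) - t k) \<le>
    integral {t k..t (k + 1)} ?f - w * integral {t k..t (k + 1)} (\<lambda>x. ?f x * (x - m))"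
    using * 1 by linarith
  have "alikhanov_a \<beta> \<sigma> t (n - 1) k - alikhanov_b \<beta> \<sigma> t (n - 1) k =
    (integral {t k..t (k + 1)} ?f - w * integral {t k..t (k + 1)} (\<lambda>x. ?f x * (x - m))) / Gamma (1 - \<beta>)"
    using assms unfolding alikhanov_a_def alikhanov_b_def n1 ts_def[symmetric] m_def[symmetric] w_def[symmetric]
    by (simp add: diff_divide_distrib)
  then show ?thesis using divide_right_mono[OF 2, of "Gamma (1 - \<beta>)"] G unfolding ts_def by simp
qed

text \<open>Besides the difference bounded above, a coefficient contains only the nonnegative term
\<^const>\<open>alikhanov_b\<close> of the interval to its left.  On the last interval the exact integral exceeds the bound by the
factor \<open>\<sigma> / (1 - \<beta>) \<ge> 1\<close>.\<close>

lemma alikhanov_g_lower: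
  assumes mesh: "temporal_mesh T N t" and n: "n \<in> {1..N}" and k: "k \<in> {1..n}"
    and b: "0 < \<beta>" "\<beta> < 1" and s: "\<sigma> = 1 - \<beta> / 2"
  shows "alikhanov_g \<beta> \<sigma> t n k \<ge> (t_star \<sigma> t n - t (k - 1)) powr (- \<beta>) / Gamma (1 - \<beta>)"
proof -
  have G: "Gamma (1 - \<beta>) > 0" using assms by (intro Gamma_real_pos) auto
  have s0: "\<sigma> > 0" using b s by auto
  have st: "t (k - 1) < t k" using temporal_mesh_less[OF mesh, of "k - 1" k] n k by auto
  have Gam: "Gamma (2 - \<beta>) = (1 - \<beta>) * Gamma (1 - \<beta>)"
      using Gamma_plus1[of "1 - \<beta>"] nonpos_Ints_nonpos[of "1 - \<beta>"] assms by auto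
  show ?thesis
  proof (cases "k = n")
    case True
    define d where "d = mesh_step t n"
    have d: "d > 0" using st True by (simp add: d_def mesh_step_def)
    have ts: "t_star \<sigma> t n - t (k - 1) = \<sigma> * d" using True by (simp add: t_star_eq d_def)
    have n1: "n - 1 + 1 = n" using n by simp
    have b0: "(if n = 1 then 0 else alikhanov_b \<beta> \<sigma> t (n - 1) (n - 2)) \<ge> 0"
      using alikhanov_b_nonneg[OF mesh n _ b s0, of "n - 2"] n by (cases "n = 1") auto
    have g: "alikhanov_g \<beta> \<sigma> t n k = (alikhanov_a \<beta> \<sigma> t (n - 1) (n - 1) +
        (if n = 1 then 0 else alikhanov_b \<beta> \<sigma> t (n - 1) (n - 2))) / d"
      using True n by (auto simp: alikhanov_g_def Let_def d_def)
    have "(\<sigma> * d) powr (- \<beta>) / Gamma (1 - \<beta>) \<le> alikhanov_a \<beta> \<sigma> t (n - 1) (n - 1) / d"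
    proof -
      have "alikhanov_a \<beta> \<sigma> t (n - 1) (n - 1) / d
          = \<sigma> powr (1 - \<beta>) * d powr (1 - \<beta>) / d / ((1 - \<beta>) * Gamma (1 - \<beta>))"
        unfolding alikhanov_a_def n1 d_def[symmetric] Gam by simp
      also have "d powr (1 - \<beta>) = d powr (- \<beta>) * d"
        using d by (simp add: powr_diff powr_minus field_simps)
      also have "\<sigma> powr (1 - \<beta>) = \<sigma> powr (- \<beta>) * \<sigma>"
        using s0 by (simp add: powr_diff powr_minus field_simps)
      also have "\<sigma> powr (- \<beta>) * \<sigma> * (d powr (- \<beta>) * d) / d / ((1 - \<beta>) * Gamma (1 - \<beta>))
          = (\<sigma> * d) powr (- \<beta>) / Gamma (1 - \<beta>) * (\<sigma> / (1 - \<beta>))"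
        using d s0 G by (simp add: powr_mult mult_ac)
      finally have eq: "alikhanov_a \<beta> \<sigma> t (n - 1) (n - 1) / d =
          (\<sigma> * d) powr (- \<beta>) / Gamma (1 - \<beta>) * (\<sigma> / (1 - \<beta>))" .
      have "1 \<le> \<sigma> / (1 - \<beta>)" using b s by (simp add: field_simps)
      then show ?thesis unfolding eq
        using G mult_left_mono[of 1 "\<sigma> / (1 - \<beta>)" "(\<sigma> * d) powr (- \<beta>) / Gamma (1 - \<beta>)"] by simp
    qed
    also have "\<dots> \<le> alikhanov_g \<beta> \<sigma> t n k"
      unfolding g using b0 d by (intro divide_right_mono) auto
    finally show ?thesis unfolding ts .
  next
    case False
    then have kn: "k < n" using k by auto
    have k2: "k - 1 + 2 \<le> n" "k - 1 + 1 = k" using kn k by auto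
    have "mesh_step t k > 0" using st by (simp add: mesh_step_def)
    have b0: "(if k = 1 then 0 else alikhanov_b \<beta> \<sigma> t (n - 1) (k - 2)) \<ge> 0"
      using alikhanov_b_nonneg[OF mesh n _ b s0, of "k - 2"] kn k by (cases "k = 1") auto
    have g: "alikhanov_g \<beta> \<sigma> t n k = (alikhanov_a \<beta> \<sigma> t (n - 1) (k - 1) - alikhanov_b \<beta> \<sigma> t (n - 1) (k - 1) +
        (if k = 1 then 0 else alikhanov_b \<beta> \<sigma> t (n - 1) (k - 2))) / mesh_step t k"
      using kn k by (auto simp: alikhanov_g_def Let_def)
    have "(t_star \<sigma> t n - t (k - 1)) powr (- \<beta>) / Gamma (1 - \<beta>) =
      (t_star \<sigma> t n - t (k - 1)) powr (- \<beta>) * (t k - t (k - 1)) / Gamma (1 - \<beta>) / mesh_step t k"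
      using st by (simp add: mesh_step_def)
    also have "\<dots> \<le> alikhanov_g \<beta> \<sigma> t n k"
      unfolding g using alikhanov_a_minus_b_lower[OF mesh n k2(1) b s0] b0 \<open>mesh_step t k > 0\<close>
      unfolding k2(2) by (intro divide_right_mono) auto
    finally show ?thesis .
  qed
qed

section \<open>Comparison principle and energy inequality\<close>

lemma summation_by_parts_increments:
  fixes g v :: "nat \<Rightarrow> real"
  assumes "n \<ge> 1"
  shows "(\<Sum>k=1..n. g k * (v k - v (k - 1))) =
    g n * v n - (\<Sum>k=1..n-1. (g (k + 1) - g k) * v k) - g 1 * v 0"
  using assms
proof (induction n rule: dec_induct)
  case (step n)
  then have "(\<Sum>k=1..n. (g (k + 1) - g k) * v k) = (\<Sum>k=1..n-1. (g (k + 1) - g k) * v k) + (g (n + 1) - g n) * v n"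
    by (cases n) auto
  then show ?case using step by (simp add: algebra_simps)
qed (simp add: right_diff_distrib)

text \<open>Summation by parts writes the operator as \<open>g n n * v n\<close> minus a combination of earlier values
with nonnegative coefficients, so a difference that was nonpositive before step \<open>n\<close> stays nonpositive; the
implicit term is absorbed because \<open>lam < g n n\<close>.\<close>

lemma comparison_principle:
  fixes g :: "nat \<Rightarrow> nat \<Rightarrow> real"
  assumes mono: "\<And>n k. \<lbrakk>1 \<le> k; k < n; n \<le> N\<rbrakk> \<Longrightarrow> g n k \<le> g n (k + 1)"
    and pos: "\<And>n. \<lbrakk>1 \<le> n; n \<le> N\<rbrakk> \<Longrightarrow> 0 \<le> g n 1"
    and lam: "\<And>n. \<lbrakk>1 \<le> n; n \<le> N\<rbrakk> \<Longrightarrow> lam < g n n" "0 \<le> lam"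
    and E: "\<And>n. \<lbrakk>1 \<le> n; n \<le> N\<rbrakk> \<Longrightarrow>
        (\<Sum>k=1..n. g n k * (E k - E (k - 1))) \<le> lam * (E n + E (n - 1)) + R n"
    and B: "\<And>n. \<lbrakk>1 \<le> n; n \<le> N\<rbrakk> \<Longrightarrow>
        lam * (B n + B (n - 1)) + R n \<le> (\<Sum>k=1..n. g n k * (B k - B (k - 1)))"
    and init: "E 0 \<le> B 0" and n: "n \<le> N"
  shows "E n \<le> B n"
  using n
proof (induction n rule: less_induct)
  case (less n)
  show ?case
  proof (cases "n = 0")
    case False
    then have n: "1 \<le> n" "n \<le> N" using less.prems by auto
    let ?D = "\<lambda>k. E k - B k"
    have D: "?D k \<le> 0" if "k < n" for k using less.IH[of k] that less.prems by auto
    have "(\<Sum>k=1..n. g n k * (?D k - ?D (k - 1))) =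
        (\<Sum>k=1..n. g n k * (E k - E (k - 1)) - g n k * (B k - B (k - 1)))"
      by (intro sum.cong) (auto simp: algebra_simps)
    also have "\<dots> = (\<Sum>k=1..n. g n k * (E k - E (k - 1))) - (\<Sum>k=1..n. g n k * (B k - B (k - 1)))"
      by (rule sum_subtractf)
    also have "\<dots> \<le> (lam * (E n + E (n - 1)) + R n) - (lam * (B n + B (n - 1)) + R n)"
      using E[OF n] B[OF n] by linarith
    also have "\<dots> = lam * (?D n + ?D (n - 1))" by (simp add: algebra_simps)
    also have "\<dots> \<le> lam * ?D n" using D[of "n - 1"] n lam by (intro mult_left_mono) auto
    finally have 1: "(\<Sum>k=1..n. g n k * (?D k - ?D (k - 1))) \<le> lam * ?D n" .
    have 2: "(\<Sum>k=1..n-1. (g n (k + 1) - g n k) * ?D k) \<le> 0"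
      using mono[of _ n] D n by (intro sum_nonpos mult_nonneg_nonpos) auto
    have 3: "g n 1 * ?D 0 \<le> 0" using pos[OF n] init by (intro mult_nonneg_nonpos) auto
    have "(g n n - lam) * ?D n \<le> 0"
      using 1 2 3 unfolding summation_by_parts_increments[OF n(1), of "g n" ?D]
      by (simp add: algebra_simps)
    then show ?thesis using lam(1)[OF n] by (simp add: mult_le_0_iff)
  qed (use init in simp)
qed

lemma L2_set_inner_le: "(\<Sum>i\<in>S. a i * b i) \<le> L2_set a S * L2_set b (S :: 'i set)"
proof -
  have "(\<Sum>i\<in>S. a i * b i) \<le> (\<Sum>i\<in>S. \<bar>a i\<bar> * \<bar>b i\<bar>)"
    by (intro sum_mono) (metis abs_ge_self abs_mult)
  then show ?thesis using L2_set_mult_ineq[of a b S] by linarith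
qed

lemma L2_set_scale: "L2_set (\<lambda>i. c * a i) S = \<bar>c\<bar> * L2_set a S"
  unfolding L2_set_def by (simp add: power_mult_distrib sum_distrib_left[symmetric] real_sqrt_mult)

lemma L2_set_power2: "(\<Sum>i\<in>S. a i * a i) = (L2_set a S)\<^sup>2"
  unfolding L2_set_def by (simp add: sum_nonneg power2_eq_square)

text \<open>This gives an inequality for the norm itself, where the usual argument gives one for its square.
After summation by parts all terms with \<open>z k\<close>, \<open>k < n - 1\<close>, have the right sign for the
Cauchy-Schwarz inequality.  The two leading terms need care: they contain the product of \<open>z n\<close> and
\<open>z (n - 1)\<close>, and its coefficient \<open>(1 - \<sigma>) g n - \<sigma> (g n - g (n - 1))\<close> is nonpositive by the second
condition on the coefficients.\<close>

lemma energy_inequality: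
  fixes g :: "nat \<Rightarrow> real" and z :: "nat \<Rightarrow> 'i \<Rightarrow> real" and S :: "'i set"
  assumes n: "1 \<le> n" and mono: "\<And>k. \<lbrakk>1 \<le> k; k < n\<rbrakk> \<Longrightarrow> g k \<le> g (k + 1)" and pos: "0 \<le> g 1"
    and sg: "1 / 2 \<le> \<sigma>" "\<sigma> \<le> 1" and P2: "2 \<le> n \<Longrightarrow> \<sigma> * g (n - 1) \<le> (2 * \<sigma> - 1) * g n"
  defines "E \<equiv> \<lambda>k. L2_set (z k) S"
  shows "(\<Sum>i\<in>S. (\<Sum>k=1..n. g k * (z k i - z (k - 1) i)) * (\<sigma> * z n i + (1 - \<sigma>) * z (n - 1) i))
    \<ge> (\<sigma> * E n + (1 - \<sigma>) * E (n - 1)) * (\<Sum>k=1..n. g k * (E k - E (k - 1)))"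
proof -
  define zs where "zs i = \<sigma> * z n i + (1 - \<sigma>) * z (n - 1) i" for i
  define ip where "ip a b = (\<Sum>i\<in>S. a i * b i)" for a b :: "'i \<Rightarrow> real"
  define Es where "Es = \<sigma> * E n + (1 - \<sigma>) * E (n - 1)"
  have E0: "E k \<ge> 0" for k unfolding E_def by (rule L2_set_nonneg)
  have Es0: "Es \<ge> 0" unfolding Es_def using E0 sg by auto
  have Ezs: "L2_set zs S \<le> Es"
  proof -
    have "L2_set zs S \<le> L2_set (\<lambda>i. \<sigma> * z n i) S + L2_set (\<lambda>i. (1 - \<sigma>) * z (n - 1) i) S"
      unfolding zs_def by (rule L2_set_triangle_ineq)
    then show ?thesis using sg by (simp add: L2_set_scale Es_def E_def)
  qed
  \<comment> \<open>the norm of the average is at most the average of the norms, so every product with a past value is under control\<close>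
  have ipE: "ip (z k) zs \<le> E k * Es" for k
  proof -
    have "ip (z k) zs \<le> E k * L2_set zs S" unfolding ip_def E_def by (rule L2_set_inner_le)
    also have "\<dots> \<le> E k * Es" using Ezs E0 by (intro mult_left_mono) auto
    finally show ?thesis .
  qed
  have zsn: "ip (z n) zs = \<sigma> * (E n)\<^sup>2 + (1 - \<sigma>) * ip (z n) (z (n - 1))"
    unfolding ip_def zs_def E_def L2_set_power2[symmetric] sum_distrib_left sum.distrib[symmetric]
    by (rule sum.cong) (simp_all add: algebra_simps)
  have zsp: "ip (z (n - 1)) zs = \<sigma> * ip (z n) (z (n - 1)) + (1 - \<sigma>) * (E (n - 1))\<^sup>2"
    unfolding ip_def zs_def E_def L2_set_power2[symmetric] sum_distrib_left sum.distrib[symmetric]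
    by (rule sum.cong) (simp_all add: algebra_simps)
  have abel: "(\<Sum>k=1..n. g k * (v k - v (k - 1))) = g n * v n - (if n = 1 then g 1 * v 0 else (g n - g (n - 1)) * v (n - 1))
     - (if n = 1 then 0 else (\<Sum>k=1..n-2. (g (k + 1) - g k) * v k) + g 1 * v 0)" for v :: "nat \<Rightarrow> real"
  proof (cases "n = 1")
    case False
    then have "(\<Sum>k=1..n-1. (g (k + 1) - g k) * v k) = (\<Sum>k=1..n-2. (g (k + 1) - g k) * v k) + (g n - g (n - 1)) * v (n - 1)"
    proof -
      obtain m where "n = Suc (Suc m)" using n False by (cases n; cases "n - 1") auto
      then show ?thesis by simp
    qed
    then show ?thesis using False unfolding summation_by_parts_increments[OF n] by simp
  qed (simp add: right_diff_distrib)
  \<comment> \<open>the coefficient of the value at \<open>n - 1\<close>; in the first step it is the coefficient of the initial value\<close>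
  define \<theta> where "\<theta> = (if n = 1 then g 1 else g n - g (n - 1))"
  have th: "(1 - \<sigma>) * g n \<le> \<sigma> * \<theta>"
    using P2 n sg pos mult_right_mono[of "1 - \<sigma>" \<sigma> "g 1"]
    by (cases "n = 1") (auto simp: \<theta>_def algebra_simps)
  have lead: "g n * ip (z n) zs - \<theta> * ip (z (n - 1)) zs \<ge> Es * (g n * E n - \<theta> * E (n - 1))"
  proof -
    have "(\<sigma> * \<theta> - (1 - \<sigma>) * g n) * ip (z n) (z (n - 1)) \<le> (\<sigma> * \<theta> - (1 - \<sigma>) * g n) * (E n * E (n - 1))"
      using th unfolding ip_def E_def by (intro mult_left_mono L2_set_inner_le) auto
    then show ?thesis unfolding zsn zsp Es_def by (simp add: algebra_simps power2_eq_square)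
  qed
  let ?T = "\<lambda>v. if n = 1 then 0 else (\<Sum>k=1..n-2. (g (k + 1) - g k) * v k) + g 1 * v 0"
  have tail: "?T (\<lambda>k. ip (z k) zs) \<le> Es * ?T E"
  proof -
    have "(\<Sum>k=1..n-2. (g (k + 1) - g k) * ip (z k) zs) \<le> (\<Sum>k=1..n-2. (g (k + 1) - g k) * (E k * Es))"
      using mono ipE by (intro sum_mono mult_left_mono) auto
    moreover have "g 1 * ip (z 0) zs \<le> g 1 * (E 0 * Es)" using pos ipE by (intro mult_left_mono) auto
    ultimately show ?thesis by (simp add: algebra_simps sum_distrib_left)
  qed
  have "(\<Sum>i\<in>S. (\<Sum>k=1..n. g k * (z k i - z (k - 1) i)) * zs i) =
     (\<Sum>k=1..n. g k * (ip (z k) zs - ip (z (k - 1)) zs))"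
    unfolding ip_def sum_distrib_right sum_distrib_left sum_subtractf[symmetric]
    by (subst sum.swap) (simp add: algebra_simps)
  also have "\<dots> = g n * ip (z n) zs - \<theta> * ip (z (n - 1)) zs - ?T (\<lambda>k. ip (z k) zs)"
    unfolding abel[of "\<lambda>k. ip (z k) zs"] \<theta>_def by simp
  also have "\<dots> \<ge> Es * (g n * E n - \<theta> * E (n - 1)) - Es * ?T E"
    using lead tail by linarith
  also have "Es * (g n * E n - \<theta> * E (n - 1)) - Es * ?T E = Es * (\<Sum>k=1..n. g k * (E k - E (k - 1)))"
    unfolding abel[of E] \<theta>_def by (simp add: algebra_simps)
  finally show ?thesis unfolding zs_def Es_def .
qed

section \<open>Quasi-graded meshes and sums over the kernel\<close>

lemma powr_increment_ge:
  fixes a b \<kappa> :: real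
  assumes "0 \<le> a" "a \<le> b" "0 < b" "0 \<le> \<kappa>" "\<kappa> < 1"
  shows "(b - a) * b powr (- \<kappa>) \<le> (b powr (1 - \<kappa>) - a powr (1 - \<kappa>)) / (1 - \<kappa>)"
proof -
  have "a powr (1 - \<kappa>) * b powr \<kappa> \<le> (1 - \<kappa>) * a + \<kappa> * b"
    using Youngs_inequality_0[of "1 - \<kappa>" \<kappa> a b] assms by (cases "a = 0") auto
  then have "a powr (1 - \<kappa>) * b powr \<kappa> * b powr (- \<kappa>) \<le> ((1 - \<kappa>) * a + \<kappa> * b) * b powr (- \<kappa>)"
    by (intro mult_right_mono) auto
  moreover have "b powr \<kappa> * b powr (- \<kappa>) = 1" using assms by (simp add: powr_minus)
  ultimately have "a powr (1 - \<kappa>) \<le> ((1 - \<kappa>) * a + \<kappa> * b) * b powr (- \<kappa>)"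
    by (simp add: mult.assoc)
  moreover have "b powr (1 - \<kappa>) = b * b powr (- \<kappa>)"
    using assms by (simp add: powr_diff powr_minus field_simps)
  ultimately have "(1 - \<kappa>) * ((b - a) * b powr (- \<kappa>)) \<le> b powr (1 - \<kappa>) - a powr (1 - \<kappa>)"
    by (simp add: algebra_simps)
  then show ?thesis using assms by (simp add: field_simps)
qed

lemma kernel_increment_le:
  fixes x y s \<beta> :: real
  assumes "x < y" "y < s" "0 < \<beta>"
  shows "(s - y) powr (- \<beta>) - (s - x) powr (- \<beta>) \<le> \<beta> * (y - x) * (s - y) powr (- \<beta> - 1)"
proof -
  have "\<exists>z>x. z < y \<and> (s - y) powr (- \<beta>) - (s - x) powr (- \<beta>) = (y - x) * (\<beta> * (s - z) powr (- \<beta> - 1))"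
    using assms by (intro MVT2) (auto intro!: derivative_eq_intros)
  then obtain z where z: "x < z" "z < y"
    "(s - y) powr (- \<beta>) - (s - x) powr (- \<beta>) = (y - x) * (\<beta> * (s - z) powr (- \<beta> - 1))" by blast
  have "(s - z) powr (- \<beta> - 1) \<le> (s - y) powr (- \<beta> - 1)"
    using assms z by (intro powr_mono2') auto
  then have "(y - x) * (\<beta> * (s - z) powr (- \<beta> - 1)) \<le> (y - x) * (\<beta> * (s - y) powr (- \<beta> - 1))"
    using assms z by (intro mult_left_mono) auto
  then show ?thesis using z(3) by (simp add: mult_ac)
qed

text \<open>One constant \<open>D\<close> serves for all comparisons that quasi-gradedness provides.  The step size at
\<open>t n\<close> is compared with \<open>t n * (t 1 / t n) powr (1 / r)\<close>, another form of
\<open>t 1 powr (1 / r) * t n powr (1 - 1 / r)\<close>: the ratio \<open>t 1 / t n\<close> is the only small quantity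
in all estimates below.\<close>

locale graded_meshes =
  fixes T r \<beta> \<sigma> D :: real and t :: "nat \<Rightarrow> nat \<Rightarrow> real"
  assumes T_pos: "0 < T" and r_ge_1: "1 \<le> r" and beta: "1 / 2 < \<beta>" "\<beta> < 1"
    and sigma: "\<sigma> = 1 - \<beta> / 2" and D_ge_1: "1 \<le> D"
    and mesh: "1 \<le> N \<Longrightarrow> temporal_mesh T N (t N)"
    and step_le: "n \<in> {1..N} \<Longrightarrow>
      mesh_step (t N) n \<le> D * (t N n * (t N 1 / t N n) powr (1 / r))"
    and step_ge: "n \<in> {1..N} \<Longrightarrow>
      t N n * (t N 1 / t N n) powr (1 / r) \<le> D * mesh_step (t N) n"
    and ratio: "2 \<le> n \<Longrightarrow> n \<le> N \<Longrightarrow> t N n \<le> D * t N (n - 1)"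
    and growth_le: "n \<in> {1..N} \<Longrightarrow> t N n \<le> D * (t N 1 * real n powr r)"
    and growth_ge: "n \<in> {1..N} \<Longrightarrow> t N 1 * real n powr r \<le> D * t N n"
begin

abbreviation xi :: "nat \<Rightarrow> nat \<Rightarrow> real" where "xi N n \<equiv> t N 1 / t N n"
abbreviation ts :: "nat \<Rightarrow> nat \<Rightarrow> real" where "ts N n \<equiv> t_star \<sigma> (t N) n"
abbreviation ker :: "nat \<Rightarrow> nat \<Rightarrow> real \<Rightarrow> real" where "ker N n x \<equiv> (ts N n - x) powr (- \<beta>)"
abbreviation dker :: "nat \<Rightarrow> nat \<Rightarrow> nat \<Rightarrow> real" where
  "dker N n k \<equiv> ker N n (t N k) - ker N n (t N (k - 1))"
abbreviation dt :: "nat \<Rightarrow> nat \<Rightarrow> real" where "dt N n \<equiv> mesh_step (t N) n"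
abbreviation g :: "nat \<Rightarrow> nat \<Rightarrow> nat \<Rightarrow> real" where "g N n k \<equiv> alikhanov_g \<beta> \<sigma> (t N) n k"
abbreviation \<delta> :: "nat \<Rightarrow> (nat \<Rightarrow> real) \<Rightarrow> nat \<Rightarrow> real" where
  "\<delta> N v n \<equiv> alikhanov_deriv \<beta> \<sigma> (t N) v n"

lemma sigma_bounds: "1 / 2 < \<sigma>" "\<sigma> < 1" using beta sigma by auto

lemma t_0: "1 \<le> N \<Longrightarrow> t N 0 = 0" using mesh[of N] by (simp add: temporal_mesh_def)
lemma t_N: "1 \<le> N \<Longrightarrow> t N N = T" using mesh[of N] by (simp add: temporal_mesh_def)

lemma t_less: "\<lbrakk>i < j; j \<le> N\<rbrakk> \<Longrightarrow> t N i < t N j"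
  using temporal_mesh_less[OF mesh[of N]] by force
lemma t_le: "\<lbrakk>i \<le> j; j \<le> N\<rbrakk> \<Longrightarrow> t N i \<le> t N j"
  using t_less[of i j N] by (cases "i = j") auto
lemma t_pos: "\<lbrakk>1 \<le> n; n \<le> N\<rbrakk> \<Longrightarrow> 0 < t N n"
  using t_less[of 0 n N] t_0[of N] by auto
lemma t_le_T: "\<lbrakk>n \<le> N; 1 \<le> N\<rbrakk> \<Longrightarrow> t N n \<le> T"
  using t_le[of n N N] t_N[of N] by auto
lemma t_nonneg: "\<lbrakk>n \<le> N; 1 \<le> N\<rbrakk> \<Longrightarrow> 0 \<le> t N n"
  using t_le[of 0 n N] t_0[of N] by auto
lemma dt_pos: "\<lbrakk>1 \<le> n; n \<le> N\<rbrakk> \<Longrightarrow> 0 < dt N n"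
  using t_less[of "n - 1" n N] by (simp add: mesh_step_def)
lemma dt_1: "1 \<le> N \<Longrightarrow> dt N 1 = t N 1" using t_0 by (simp add: mesh_step_def)
lemma dt_le_t: "\<lbrakk>1 \<le> n; n \<le> N\<rbrakk> \<Longrightarrow> dt N n \<le> t N n"
  using t_nonneg[of "n - 1" N] by (simp add: mesh_step_def)

lemma xi_pos: "\<lbrakk>1 \<le> n; n \<le> N\<rbrakk> \<Longrightarrow> 0 < xi N n" using t_pos[of n N] t_pos[of 1 N] by auto
lemma xi_le_1: "\<lbrakk>1 \<le> n; n \<le> N\<rbrakk> \<Longrightarrow> xi N n \<le> 1" using t_pos[of n N] t_le[of 1 n N] by auto

lemma ts_eq: "ts N n = t N (n - 1) + \<sigma> * dt N n" by (rule t_star_eq)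
lemma ts_gt: "\<lbrakk>1 \<le> n; n \<le> N\<rbrakk> \<Longrightarrow> t N (n - 1) < ts N n"
  using dt_pos[of n N] sigma_bounds by (simp add: ts_eq)
lemma ts_lt: "\<lbrakk>1 \<le> n; n \<le> N\<rbrakk> \<Longrightarrow> ts N n < t N n"
  using dt_pos[of n N] sigma_bounds by (simp add: t_star_def)
lemma ts_ge_half: "\<lbrakk>1 \<le> n; n \<le> N\<rbrakk> \<Longrightarrow> t N n / 2 \<le> ts N n"
proof -
  assume n: "1 \<le> n" "n \<le> N"
  have "(1 - \<sigma>) * dt N n \<le> 1 / 2 * t N n"
    using dt_le_t[OF n] dt_pos[OF n] sigma_bounds by (intro mult_mono) auto
  then show ?thesis by (simp add: t_star_def)
qed
lemma ts_pos: "\<lbrakk>1 \<le> n; n \<le> N\<rbrakk> \<Longrightarrow> 0 < ts N n"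
  using ts_ge_half[of n N] t_pos[of n N] by auto
lemma t_less_ts: "\<lbrakk>k < n; n \<le> N\<rbrakk> \<Longrightarrow> t N k < ts N n"
  using ts_gt[of n N] t_le[of k "n - 1" N] by (cases n) auto

lemma dker_nonneg: "\<lbrakk>k < n; n \<le> N\<rbrakk> \<Longrightarrow> 0 \<le> dker N n k"
  using kernel_mono[of "t N (k - 1)" "t N k" "ts N n" \<beta>] t_le[of "k - 1" k N] t_less_ts[of k n N] beta
  by auto

lemma g_lower:
  assumes "1 \<le> k" "k \<le> n" "n \<le> N"
  shows "(t N n - t N (k - 1)) powr (- \<beta>) / Gamma (1 - \<beta>) \<le> g N n k"
    and "ker N n (t N (k - 1)) / Gamma (1 - \<beta>) \<le> g N n k"
proof -
  have G: "Gamma (1 - \<beta>) > 0" using beta by (intro Gamma_real_pos) auto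
  show *: "ker N n (t N (k - 1)) / Gamma (1 - \<beta>) \<le> g N n k"
    using alikhanov_g_lower[OF mesh[of N], of n k \<beta> \<sigma>] assms beta sigma by auto
  have "(t N n - t N (k - 1)) powr (- \<beta>) \<le> ker N n (t N (k - 1))"
    using ts_lt[of n N] t_less_ts[of "k - 1" n N] assms beta by (intro powr_mono2') auto
  then show "(t N n - t N (k - 1)) powr (- \<beta>) / Gamma (1 - \<beta>) \<le> g N n k"
    using * G divide_right_mono[of _ _ "Gamma (1 - \<beta>)"] by (meson less_imp_le order_trans)
qed

lemma deriv_eq_g:
  assumes "n \<in> {1..N}"
  shows "\<delta> N v n = (\<Sum>k=1..n. g N n k * (v k - v (k - 1)))"
  using alikhanov_deriv_coefficients[OF mesh[of N], of \<beta> \<sigma> n v] assms beta sigma_bounds by auto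

text \<open>A Riemann sum with right end points: it lies below the integral if the power decreases, and is at
most the length times the last value if the power increases.\<close>

lemma sum_powr_le:
  assumes "\<kappa> < 1"
  shows "\<exists>C>0. \<forall>N. \<forall>n\<in>{1..N}. (\<Sum>k=1..n. dt N k * t N k powr (- \<kappa>)) \<le> C * t N n powr (1 - \<kappa>)"
proof (cases "0 \<le> \<kappa>")
  case True
  have "(\<Sum>k=1..n. dt N k * t N k powr (- \<kappa>)) \<le> 1 / (1 - \<kappa>) * t N n powr (1 - \<kappa>)" if n: "n \<in> {1..N}" for N n
  proof -
    have "(\<Sum>k=1..n. dt N k * t N k powr (- \<kappa>)) \<le>
        (\<Sum>k=1..n. t N k powr (1 - \<kappa>) / (1 - \<kappa>) - t N (k - 1) powr (1 - \<kappa>) / (1 - \<kappa>))"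
    proof (rule sum_mono)
      fix k assume k: "k \<in> {1..n}"
      show "dt N k * t N k powr (- \<kappa>) \<le> t N k powr (1 - \<kappa>) / (1 - \<kappa>) - t N (k - 1) powr (1 - \<kappa>) / (1 - \<kappa>)"
        using powr_increment_ge[of "t N (k - 1)" "t N k" \<kappa>] t_le[of "k - 1" k N] t_pos[of k N]
          t_nonneg[of "k - 1" N] n k True assms le_trans[of "k - 1" n N]
        by (auto simp add: mesh_step_def diff_divide_distrib)
    qed
    also have "\<dots> = t N n powr (1 - \<kappa>) / (1 - \<kappa>) - t N 0 powr (1 - \<kappa>) / (1 - \<kappa>)"
      using sum_telescope''[of 0 n "\<lambda>k. t N k powr (1 - \<kappa>) / (1 - \<kappa>)"] by simp
    finally show ?thesis using t_0[of N] n assms by simp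
  qed
  then show ?thesis using assms by (intro exI[of _ "1 / (1 - \<kappa>)"]) auto
next
  case False
  have "(\<Sum>k=1..n. dt N k * t N k powr (- \<kappa>)) \<le> 1 * t N n powr (1 - \<kappa>)" if n: "n \<in> {1..N}" for N n
  proof -
    have "(\<Sum>k=1..n. dt N k * t N k powr (- \<kappa>)) \<le> (\<Sum>k=1..n. (t N k - t N (k - 1)) * t N n powr (- \<kappa>))"
    proof (rule sum_mono)
      fix k assume k: "k \<in> {1..n}"
      have "t N k powr (- \<kappa>) \<le> t N n powr (- \<kappa>)"
        using t_pos[of k N] t_le[of k n N] k n False by (intro powr_mono2) auto
      then show "dt N k * t N k powr (- \<kappa>) \<le> (t N k - t N (k - 1)) * t N n powr (- \<kappa>)"
        using dt_pos[of k N] k n by (auto simp: mesh_step_def intro!: mult_left_mono)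
    qed
    also have "\<dots> = t N n * t N n powr (- \<kappa>)"
      using sum_telescope''[of 0 n "t N"] n t_0[of N] by (simp add: sum_distrib_right[symmetric])
    also have "\<dots> = t N n powr (1 - \<kappa>)"
      using t_pos[of n N] n by (simp add: powr_diff powr_minus field_simps)
    finally show ?thesis by simp
  qed
  then show ?thesis by (intro exI[of _ 1]) auto
qed

text \<open>The increments of the kernel are what remains of it after integration by parts, and all
errors of interpolation are summed with them.  While \<open>t k \<le> t n / 4\<close>, an increment is at most a multiple of
\<open>dt k * t n powr (- \<beta> - 1)\<close>, and the sum is dominated by the integral of a power, which converges at
zero because \<open>\<theta> - b < 1\<close>.  For larger \<open>t k\<close> the weights are comparable with their values at \<open>t n\<close> and the
increments telescope to \<open>dt n powr (- \<beta>)\<close>; this loses the factor \<open>\<xi> n powr (- \<beta> / r)\<close>.\<close>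

lemma kernel_weighted_sum:
  fixes a b \<theta> :: real
  assumes a: "0 \<le> a" "\<theta> \<le> a - \<beta> / r" and th: "\<theta> - b < 1"
  shows "\<exists>C>0. \<forall>N. \<forall>n\<in>{1..N}. (\<Sum>k=1..n-1. dker N n k * (xi N k powr a * t N k powr b))
      \<le> C * (xi N n powr \<theta> * t N n powr (b - \<beta>))"
proof -
  obtain C0 where C0: "C0 > 0"
    "\<And>N n. n \<in> {1..N} \<Longrightarrow> (\<Sum>k=1..n. dt N k * t N k powr (- (\<theta> - b))) \<le> C0 * t N n powr (1 - (\<theta> - b))"
    using sum_powr_le[OF th] by metis
  define C1 where "C1 = \<beta> * 4 powr (\<beta> + 1)"
  define C2 where "C2 = 4 powr a * 4 powr \<bar>b\<bar>"
  define C3 where "C3 = (\<sigma> / D) powr (- \<beta>)"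
  have ath: "\<theta> \<le> a" using a(2) beta r_ge_1 by (smt (verit) divide_nonneg_pos)
  have main: "(\<Sum>k=1..n-1. dker N n k * (xi N k powr a * t N k powr b))
      \<le> (C1 * C0 + C2 * C3) * (xi N n powr \<theta> * t N n powr (b - \<beta>))" if n: "n \<in> {1..N}" for N n
  proof -
    have tn: "0 < t N n" using t_pos n by auto
    have x1: "0 < xi N n" "xi N n \<le> 1" using xi_pos xi_le_1 n by auto
    let ?far = "\<lambda>k. C1 * (t N n powr (- \<beta> - 1) * t N 1 powr \<theta>) * (dt N k * t N k powr (- (\<theta> - b)))"
    let ?near = "\<lambda>k. C2 * (xi N n powr a * t N n powr b) * dker N n k"
    \<comment> \<open>one bound covers each \<open>k\<close>, according to the position of \<open>t k\<close> relative to \<open>t n / 4\<close>\<close>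
    have each: "dker N n k * (xi N k powr a * t N k powr b) \<le> ?far k + ?near k" if k: "k \<in> {1..n-1}" for k
    proof -
      have tk: "0 < t N k" "t N k \<le> t N n" "t N k < ts N n" "t N (k - 1) < t N k"
        using t_pos[of k N] t_le[of k n N] t_less_ts[of k n N] t_less[of "k - 1" k N] k n by auto
      have t1: "0 < t N 1" using t_pos[of 1 N] n by auto
      have x: "0 < xi N k" "xi N k \<le> 1" using xi_pos[of k N] xi_le_1[of k N] k n by auto
      have dk: "0 \<le> dker N n k" using dker_nonneg[of k n N] k n by auto
      have kN: "1 \<le> k" "k \<le> N" using k n by auto
      have far0: "0 \<le> ?far k" using dt_pos[OF kN] beta by (auto simp: C1_def)
      have near0: "0 \<le> ?near k" using dk by (auto simp: C2_def)
      show ?thesis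
      proof (cases "t N k \<le> t N n / 4")
        case True
        have "dker N n k \<le> \<beta> * (t N k - t N (k - 1)) * (ts N n - t N k) powr (- \<beta> - 1)"
          using kernel_increment_le[of "t N (k - 1)" "t N k" "ts N n" \<beta>] tk beta by auto
        also have "(ts N n - t N k) powr (- \<beta> - 1) \<le> (t N n / 4) powr (- \<beta> - 1)"
          using ts_ge_half[of n N] n True tn beta by (intro powr_mono2') auto
        also have "(t N n / 4) powr (- \<beta> - 1) = 4 powr (\<beta> + 1) * t N n powr (- \<beta> - 1)"
          using tn by (simp add: powr_divide powr_diff powr_minus powr_add field_simps)
        finally have 1: "dker N n k \<le> C1 * dt N k * t N n powr (- \<beta> - 1)"
          using beta tk by (simp add: C1_def mesh_step_def mult_ac mult_left_mono)
        have "xi N k powr a \<le> xi N k powr \<theta>" using x ath by (intro powr_mono') auto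
        also have "\<dots> = t N 1 powr \<theta> * t N k powr (- \<theta>)"
          using tk t1 by (simp add: powr_divide powr_minus field_simps)
        finally have "xi N k powr a * t N k powr b \<le> t N 1 powr \<theta> * t N k powr (- \<theta>) * t N k powr b"
          by (intro mult_right_mono) auto
        also have "\<dots> = t N 1 powr \<theta> * t N k powr (- (\<theta> - b))"
          by (simp add: mult.assoc powr_add[symmetric])
        finally have 2: "xi N k powr a * t N k powr b \<le> t N 1 powr \<theta> * t N k powr (- (\<theta> - b))" .
        have "dker N n k * (xi N k powr a * t N k powr b) \<le>
            C1 * dt N k * t N n powr (- \<beta> - 1) * (t N 1 powr \<theta> * t N k powr (- (\<theta> - b)))"
          by (rule mult_mono[OF 1 2]) (use dk dt_pos[OF kN] beta in \<open>auto simp: C1_def\<close>)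
        also have "\<dots> = ?far k" by (simp add: mult_ac)
        finally show ?thesis using near0 by linarith
      next
        case False
        have "xi N k \<le> 4 * xi N n" using False tk tn t1 by (simp add: field_simps)
        then have "xi N k powr a \<le> (4 * xi N n) powr a" using x a by (intro powr_mono2) auto
        also have "\<dots> = 4 powr a * xi N n powr a" using x1 by (intro powr_mult)
        finally have 1: "xi N k powr a \<le> 4 powr a * xi N n powr a" .
        have 2: "t N k powr b \<le> 4 powr \<bar>b\<bar> * t N n powr b"
        proof (cases "0 \<le> b")
          case True
          then have "t N k powr b \<le> 1 * t N n powr b" using tk by (simp add: powr_mono2)
          also have "\<dots> \<le> 4 powr \<bar>b\<bar> * t N n powr b" by (intro mult_right_mono ge_one_powr_ge_zero) auto
          finally show ?thesis .
        next
          case neg: False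
          have "t N k powr b \<le> (t N n / 4) powr b" using False tk tn neg by (intro powr_mono2') auto
          also have "\<dots> = 4 powr \<bar>b\<bar> * t N n powr b"
            using tn neg by (simp add: powr_divide powr_minus field_simps)
          finally show ?thesis .
        qed
        have "dker N n k * (xi N k powr a * t N k powr b) \<le>
            dker N n k * ((4 powr a * xi N n powr a) * (4 powr \<bar>b\<bar> * t N n powr b))"
          using 1 2 dk by (intro mult_left_mono mult_mono) auto
        also have "\<dots> = ?near k" by (simp add: C2_def mult_ac)
        finally show ?thesis using far0 by linarith
      qed
    qed
    have "(\<Sum>k=1..n-1. dker N n k * (xi N k powr a * t N k powr b)) \<le> (\<Sum>k=1..n-1. ?far k + ?near k)"
      by (intro sum_mono each)
    also have "\<dots> = (\<Sum>k=1..n-1. ?far k) + (\<Sum>k=1..n-1. ?near k)" by (rule sum.distrib)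
    also have "(\<Sum>k=1..n-1. ?far k) \<le> C1 * C0 * (xi N n powr \<theta> * t N n powr (b - \<beta>))"
    proof -
      have "(\<Sum>k=1..n-1. ?far k) \<le> (\<Sum>k=1..n. ?far k)"
      proof (rule sum_mono2)
        fix k assume "k \<in> {1..n} - {1..n-1}"
        then have "0 < dt N k" using dt_pos[of k N] n by auto
        then show "0 \<le> ?far k" using beta by (auto simp: C1_def)
      qed auto
      also have "\<dots> = C1 * (t N n powr (- \<beta> - 1) * t N 1 powr \<theta>) * (\<Sum>k=1..n. dt N k * t N k powr (- (\<theta> - b)))"
        by (rule sum_distrib_left[symmetric])
      also have "\<dots> \<le> C1 * (t N n powr (- \<beta> - 1) * t N 1 powr \<theta>) * (C0 * t N n powr (1 - (\<theta> - b)))"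
        using C0(2)[OF n] beta by (intro mult_left_mono) (auto simp: C1_def)
      also have "\<dots> = C1 * C0 * (t N 1 powr \<theta> * (t N n powr (- \<beta> - 1) * t N n powr (1 - (\<theta> - b))))"
        by (simp add: mult_ac)
      also have "t N n powr (- \<beta> - 1) * t N n powr (1 - (\<theta> - b)) = t N n powr (- \<theta>) * t N n powr (b - \<beta>)"
        by (simp add: powr_add[symmetric] algebra_simps)
      also have "t N 1 powr \<theta> * (t N n powr (- \<theta>) * t N n powr (b - \<beta>)) = xi N n powr \<theta> * t N n powr (b - \<beta>)"
        using tn t_pos[of 1 N] n by (simp add: powr_divide powr_minus field_simps)
      finally show ?thesis .
    qed
    also have "(\<Sum>k=1..n-1. ?near k) \<le> C2 * C3 * (xi N n powr \<theta> * t N n powr (b - \<beta>))"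
    proof -
      have "(\<Sum>k=1..n-1. dker N n k) = ker N n (t N (n - 1)) - ker N n (t N 0)"
        using sum_telescope''[of 0 "n - 1" "\<lambda>k. ker N n (t N k)"] by simp
      also have "\<dots> \<le> ker N n (t N (n - 1))" by simp
      also have "\<dots> = (\<sigma> * dt N n) powr (- \<beta>)" by (simp add: ts_eq)
      also have "\<dots> \<le> (\<sigma> / D * (t N n * xi N n powr (1 / r))) powr (- \<beta>)"
      proof (rule powr_mono2')
        show "0 < \<sigma> / D * (t N n * xi N n powr (1 / r))"
          using sigma_bounds D_ge_1 tn x1 by (intro mult_pos_pos divide_pos_pos) auto
        show "\<sigma> / D * (t N n * xi N n powr (1 / r)) \<le> \<sigma> * dt N n"
          using step_ge[OF n] sigma_bounds D_ge_1 by (simp add: field_simps)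
      qed (use beta in auto)
      also have "\<dots> = C3 * (t N n powr (- \<beta>) * xi N n powr (- (\<beta> / r)))"
      proof -
        have "(\<sigma> / D * (t N n * xi N n powr (1 / r))) powr (- \<beta>) =
            (\<sigma> / D) powr (- \<beta>) * (t N n powr (- \<beta>) * (xi N n powr (1 / r)) powr (- \<beta>))"
          using sigma_bounds D_ge_1 tn by (subst powr_mult, simp_all, subst powr_mult, simp_all)
        also have "(xi N n powr (1 / r)) powr (- \<beta>) = xi N n powr (- (\<beta> / r))"
          by (simp only: powr_powr) simp
        finally show ?thesis by (simp add: C3_def)
      qed
      finally have "(\<Sum>k=1..n-1. ?near k) \<le> C2 * (xi N n powr a * t N n powr b) * (C3 * (t N n powr (- \<beta>) * xi N n powr (- (\<beta> / r))))"
        unfolding sum_distrib_left[symmetric] by (intro mult_left_mono) (auto simp: C2_def)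
      also have "\<dots> = C2 * C3 * ((xi N n powr a * xi N n powr (- (\<beta> / r))) * (t N n powr b * t N n powr (- \<beta>)))"
        by (simp add: mult_ac)
      also have "\<dots> = C2 * C3 * (xi N n powr (a - \<beta> / r) * t N n powr (b - \<beta>))"
        by (simp add: powr_add[symmetric])
      also have "\<dots> \<le> C2 * C3 * (xi N n powr \<theta> * t N n powr (b - \<beta>))"
        using x1 a by (intro mult_left_mono mult_right_mono powr_mono') (auto simp: C2_def C3_def)
      finally show ?thesis .
    qed
    finally show ?thesis by (simp add: algebra_simps)
  qed
  have "0 < C1 * C0 + C2 * C3"
    using C0(1) beta sigma_bounds D_ge_1 by (auto simp: C1_def C2_def C3_def intro!: add_pos_pos mult_pos_pos)
  with main show ?thesis by blast
qed

end

section \<open>An exponential barrier\<close>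

context graded_meshes
begin

lemma Gam_pos: "0 < Gamma (1 - \<beta>)" using beta by (intro Gamma_real_pos) auto

lemma P1_mono:
  assumes "property_P1 \<beta> \<sigma> (t N) N"
  shows "\<lbrakk>1 \<le> k; k < n; n \<le> N\<rbrakk> \<Longrightarrow> g N n k \<le> g N n (k + 1)"
    and "\<lbrakk>1 \<le> k; k \<le> n; n \<le> N\<rbrakk> \<Longrightarrow> 0 < g N n k"
proof -
  show "g N n k \<le> g N n (k + 1)" if "1 \<le> k" "k < n" "n \<le> N"
  proof -
    have "1 \<le> k \<and> k \<le> n - 1 \<and> n - 1 \<le> N - 1" using that by auto
    then show ?thesis using assms unfolding property_P1_def by (meson less_imp_le)
  qed
  show "0 < g N n k" if k: "1 \<le> k" "k \<le> n" "n \<le> N"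
  proof -
    have "0 < ker N n (t N (k - 1)) / Gamma (1 - \<beta>)"
    proof (rule divide_pos_pos[OF _ Gam_pos])
      have "k - 1 < n" using k by auto
      from t_less_ts[OF this k(3)] show "0 < ker N n (t N (k - 1))" by simp
    qed
    then show ?thesis using g_lower(2)[OF k] by linarith
  qed
qed

lemma P1_mono_le:
  assumes "property_P1 \<beta> \<sigma> (t N) N" "1 \<le> j" "j \<le> k" "k \<le> n" "n \<le> N"
  shows "g N n j \<le> g N n k"
  using assms(3,4)
proof (induction k rule: dec_induct)
  case (step k)
  then show ?case using P1_mono(1)[OF assms(1), of k n] assms by fastforce
qed simp

text \<open>Drop the increments up to \<open>t j\<close> and replace the later coefficients by the smallest of them, the
one that sees the kernel at \<open>t j\<close>; the remaining sum telescopes.\<close>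

lemma deriv_increasing_ge:
  assumes P1: "property_P1 \<beta> \<sigma> (t N) N" and n: "n \<in> {1..N}" and j: "j < n"
    and inc: "\<And>k. 1 \<le> k \<Longrightarrow> k \<le> n \<Longrightarrow> v (k - 1) \<le> v k"
  shows "(t N n - t N j) powr (- \<beta>) / Gamma (1 - \<beta>) * (v n - v j) \<le> \<delta> N v n"
proof -
  have mono: "v i \<le> v k" if "i \<le> k" "k \<le> n" for i k
    using that
  proof (induction k rule: dec_induct)
    case (step m)
    then show ?case using inc[of "Suc m"] by auto
  qed simp
  have "(t N n - t N j) powr (- \<beta>) / Gamma (1 - \<beta>) * (v n - v j) \<le> g N n (j + 1) * (v n - v j)"
    using g_lower(1)[of "j + 1" n N] j n mono[of j n] by (intro mult_right_mono) auto
  also have "g N n (j + 1) * (v n - v j) = (\<Sum>k=j+1..n. g N n (j + 1) * (v k - v (k - 1)))"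
    using sum_telescope''[of j n v] j by (simp add: sum_distrib_left[symmetric])
  also have "\<dots> \<le> (\<Sum>k=j+1..n. g N n k * (v k - v (k - 1)))"
    using P1_mono_le[OF P1, of "j + 1"] inc n by (intro sum_mono mult_right_mono) auto
  also have "\<dots> \<le> (\<Sum>k=1..n. g N n k * (v k - v (k - 1)))"
  proof (rule sum_mono2)
    fix k assume "k \<in> {1..n} - {j+1..n}"
    then show "0 \<le> g N n k * (v k - v (k - 1))"
      using P1_mono(2)[OF P1, of k n] inc[of k] n by auto
  qed auto
  finally show ?thesis unfolding deriv_eq_g[OF n] .
qed

text \<open>The barrier is \<open>exp (\<Lambda> * t n)\<close> after a jump from \<open>0\<close> in the first step.  Its memory since time
\<open>0\<close>, where it jumped by at least \<open>1\<close>, gives \<open>t n powr (- \<beta>)\<close>.  Its memory since a node at distance between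
\<open>1 / (2 \<Lambda>)\<close> and \<open>1 / \<Lambda>\<close>, over which it has grown by a fixed factor, gives a multiple of \<open>\<Lambda> powr \<beta>\<close> times
its value, and this beats the terms with \<open>lam\<close> for large \<open>\<Lambda>\<close>.\<close>

lemma exponential_barrier:
  assumes lam: "0 \<le> lam"
  shows "\<exists>\<tau>0>0. \<exists>c>0. \<exists>K>0. \<forall>N\<ge>1. property_P1 \<beta> \<sigma> (t N) N \<longrightarrow> (\<forall>n\<in>{1..N}. dt N n \<le> \<tau>0) \<longrightarrow>
    (\<exists>W. W 0 = 0 \<and> (\<forall>n\<in>{1..N}. 0 \<le> W n \<and> W n \<le> K \<and>
       c * t N n powr (- \<beta>) + lam * (W n + W (n - 1)) \<le> \<delta> N W n))"
proof -
  define G where "G = Gamma (1 - \<beta>)"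
  have G: "0 < G" using Gam_pos by (simp add: G_def)
  \<comment> \<open>large enough that half of \<open>\<Lambda> powr \<beta> / (3 * G)\<close> exceeds \<open>2 * lam\<close>\<close>
  define \<Lambda> where "\<Lambda> = (12 * lam * G + 1) powr (1 / \<beta>)"
  have Lam: "1 \<le> \<Lambda>" unfolding \<Lambda>_def using lam G beta by (intro ge_one_powr_ge_zero) auto
  have LamB: "\<Lambda> powr \<beta> = 12 * lam * G + 1" unfolding \<Lambda>_def using lam G beta by (simp add: powr_powr)
  define W :: "nat \<Rightarrow> nat \<Rightarrow> real" where "W N n = (if n = 0 then 0 else exp (\<Lambda> * t N n))" for N n
  have main: "0 \<le> W N n \<and> W N n \<le> exp (\<Lambda> * T) \<and>
       1 / (2 * G) * t N n powr (- \<beta>) + lam * (W N n + W N (n - 1)) \<le> \<delta> N (W N) n"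
    if P1: "property_P1 \<beta> \<sigma> (t N) N" and N: "1 \<le> N" and small: "\<forall>n\<in>{1..N}. dt N n \<le> 1 / (2 * \<Lambda>)"
      and n: "n \<in> {1..N}" for N n
  proof -
    have tn: "0 < t N n" using t_pos n by auto
    have W0: "0 \<le> W N k" for k by (simp add: W_def)
    have inc: "W N (k - 1) \<le> W N k" if "1 \<le> k" "k \<le> n" for k
      using t_le[of "k - 1" k N] that n Lam by (auto simp: W_def)
    have Wn: "W N n = exp (\<Lambda> * t N n)" using n by (simp add: W_def)
    have W1: "1 \<le> W N n" unfolding Wn using tn Lam by simp
    have up: "W N n \<le> exp (\<Lambda> * T)" unfolding Wn using t_le_T[of n N] n Lam by simp
    have first: "t N n powr (- \<beta>) / G \<le> \<delta> N (W N) n"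
    proof -
      have "t N n powr (- \<beta>) / G * 1 \<le> (t N n - t N 0) powr (- \<beta>) / G * (W N n - W N 0)"
        using W1 G t_0[OF N] by (intro mult_mono) (auto simp: W_def)
      also have "\<dots> \<le> \<delta> N (W N) n"
        unfolding G_def using n inc by (intro deriv_increasing_ge[OF P1 n]) auto
      finally show ?thesis by simp
    qed
    have second: "\<Lambda> powr \<beta> / (3 * G) * W N n \<le> \<delta> N (W N) n"
    proof -
      \<comment> \<open>some recent node sees a growth by at least a third of the present value; if no node is old enough, the initial jump does\<close>
      have "\<exists>j<n. t N n - t N j \<le> 1 / \<Lambda> \<and> W N n / 3 \<le> W N n - W N j"
      proof (cases "t N n \<le> 1 / \<Lambda>")
        case True
        then show ?thesis using n t_0[OF N] W0[of n] by (intro exI[of _ 0]) (auto simp: W_def)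
      next
        case False
        define J where "J = {j. j < n \<and> t N j \<le> t N n - 1 / (2 * \<Lambda>)}"
        have "1 / (2 * \<Lambda>) \<le> 1 / \<Lambda>" using Lam by (simp add: field_simps)
        then have "0 \<in> J" unfolding J_def using False n t_0[OF N] by auto
        then have J: "finite J" "J \<noteq> {}" unfolding J_def by auto
        define j where "j = Max J"
        have jJ: "j \<in> J" unfolding j_def using J by (rule Max_in)
        have "Suc j \<notin> J" using Max_ge[OF J(1), of "Suc j"] unfolding j_def by auto
        then have j1: "t N n - 1 / (2 * \<Lambda>) < t N (Suc j)" using jJ tn Lam
          by (cases "Suc j = n") (auto simp: J_def)
        have "t N (Suc j) - t N j \<le> 1 / (2 * \<Lambda>)"
          using small jJ n by (force simp: J_def mesh_step_def)
        moreover have "1 / (2 * \<Lambda>) + 1 / (2 * \<Lambda>) = 1 / \<Lambda>" using Lam by simp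
        ultimately have a: "t N n - t N j \<le> 1 / \<Lambda>" using j1 by linarith
        have "W N j \<le> exp (\<Lambda> * t N j)" by (simp add: W_def)
        also have "\<dots> \<le> exp (\<Lambda> * t N n - 1 / 2)"
        proof -
          have "\<Lambda> * t N j \<le> \<Lambda> * (t N n - 1 / (2 * \<Lambda>))" using jJ Lam by (intro mult_left_mono) (auto simp: J_def)
          then show ?thesis using Lam by (simp add: algebra_simps)
        qed
        also have "\<dots> = W N n / exp (1 / 2)" unfolding Wn by (simp add: exp_diff)
        also have "\<dots> \<le> W N n / (3 / 2)"
          using exp_ge_add_one_self[of "1/2::real"] W1 by (intro divide_left_mono) auto
        finally have "W N n / 3 \<le> W N n - W N j" by simp
        then show ?thesis using a jJ by (auto simp: J_def)
      qed
      then obtain j where j: "j < n" "t N n - t N j \<le> 1 / \<Lambda>" "W N n / 3 \<le> W N n - W N j" by blast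
      have "\<Lambda> powr \<beta> = (1 / \<Lambda>) powr (- \<beta>)" using Lam by (simp add: powr_divide powr_minus field_simps)
      also have "\<dots> \<le> (t N n - t N j) powr (- \<beta>)"
        using j t_less[of j n N] n beta by (intro powr_mono2') auto
      finally have "\<Lambda> powr \<beta> / G * (W N n / 3) \<le> (t N n - t N j) powr (- \<beta>) / G * (W N n - W N j)"
        using j G W1 by (intro mult_mono divide_right_mono) auto
      also have "\<dots> \<le> \<delta> N (W N) n"
        unfolding G_def using j inc by (intro deriv_increasing_ge[OF P1 n]) auto
      finally show ?thesis by (simp add: field_simps)
    qed
    have arith: "a / 2 + b \<le> d" if "b \<le> c / 2" "a \<le> d" "c \<le> d" for a b c d :: real
      using that by linarith
    have "lam * (W N n + W N (n - 1)) \<le> lam * (2 * W N n)"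
      using inc[of n] n lam by (intro mult_left_mono) auto
    also have "\<dots> \<le> \<Lambda> powr \<beta> / (6 * G) * W N n"
      unfolding LamB using G W1 by (simp add: field_simps)
    finally have "lam * (W N n + W N (n - 1)) \<le> \<Lambda> powr \<beta> / (3 * G) * W N n / 2" by simp
    then have "t N n powr (- \<beta>) / G / 2 + lam * (W N n + W N (n - 1)) \<le> \<delta> N (W N) n"
      using first second by (intro arith)
    then show ?thesis using W0 up by simp
  qed
  show ?thesis
  proof (rule exI[of _ "1 / (2 * \<Lambda>)"], rule conjI, use Lam in simp,
      rule exI[of _ "1 / (2 * G)"], rule conjI, use G in simp,
      rule exI[of _ "exp (\<Lambda> * T)"], rule conjI, simp, intro allI impI)
    fix N :: nat assume "1 \<le> N" "property_P1 \<beta> \<sigma> (t N) N" "\<forall>n\<in>{1..N}. dt N n \<le> 1 / (2 * \<Lambda>)"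
    then show "\<exists>W. W 0 = 0 \<and> (\<forall>n\<in>{1..N}. 0 \<le> W n \<and> W n \<le> exp (\<Lambda> * T) \<and>
       1 / (2 * G) * t N n powr (- \<beta>) + lam * (W n + W (n - 1)) \<le> \<delta> N W n)"
      using main by (intro exI[of _ "W N"] conjI ballI) (auto simp: W_def)
  qed
qed

end

section \<open>Interpolation errors seen through the kernel\<close>

text \<open>Integration by parts moves the derivative onto the kernel, whose own derivative has a sign and
integrates to a difference of kernel values.\<close>

lemma kernel_by_parts:
  fixes a b s \<beta> M :: real
  assumes ab: "a < b" "b < s" and beta: "0 < \<beta>"
    and cont: "continuous_on {a..b} w" and zero: "w a = 0" "w b = 0"
    and deriv: "\<And>x. x \<in> {a<..<b} \<Longrightarrow> (w has_real_derivative w' x) (at x)"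
    and M: "\<And>x. x \<in> {a..b} \<Longrightarrow> \<bar>w x\<bar> \<le> M"
  shows "\<exists>I. ((\<lambda>x. (s - x) powr (- \<beta>) * w' x) has_integral I) {a..b} \<and>
    \<bar>I\<bar> \<le> M * ((s - b) powr (- \<beta>) - (s - a) powr (- \<beta>))"
proof -
  define f' where "f' x = \<beta> * (s - x) powr (- \<beta> - 1)" for x
  have df: "((\<lambda>x. (s - x) powr (- \<beta>)) has_real_derivative f' x) (at x)" if "x \<le> b" for x
    using that ab unfolding f'_def by (auto intro!: derivative_eq_intros)
  have f'0: "0 \<le> f' x" for x using beta by (simp add: f'_def)
  have cf': "continuous_on {a..b} f'"
    unfolding f'_def by (intro continuous_intros) (use ab in auto)
  have cf: "continuous_on {a..b} (\<lambda>x. (s - x) powr (- \<beta>))" by (rule continuous_on_kernel[OF ab(2)])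
  define J where "J = integral {a..b} (\<lambda>x. f' x * w x)"
  have J: "((\<lambda>x. w x * f' x) has_integral J) {a..b}"
    unfolding J_def by (subst mult.commute)
      (intro integrable_integral integrable_continuous_interval continuous_intros cont cf')
  have "((\<lambda>x. w' x * (s - x) powr (- \<beta>)) has_integral - J) {a..b}"
  proof (rule integration_by_parts_interior[OF bounded_bilinear_mult])
    show "((\<lambda>x. w x * f' x) has_integral w b * (s - b) powr - \<beta> - w a * (s - a) powr - \<beta> - - J) {a..b}"
      using J zero by simp
  qed (use ab cont cf df deriv in \<open>auto simp: has_real_derivative_iff_has_vector_derivative[symmetric]\<close>)
  then have 1: "((\<lambda>x. (s - x) powr (- \<beta>) * w' x) has_integral - J) {a..b}" by (simp add: mult.commute)
  have F: "(f' has_integral ((s - b) powr (- \<beta>) - (s - a) powr (- \<beta>))) {a..b}"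
    using ab df by (intro fundamental_theorem_of_calculus)
      (auto simp: has_real_derivative_iff_has_vector_derivative[symmetric] intro: has_field_derivative_at_within)
  have "\<bar>w x * f' x\<bar> \<le> M * f' x" if "x \<in> {a..b}" for x
    using M[OF that] f'0[of x] by (simp add: abs_mult mult_right_mono)
  then have le: "w x * f' x \<le> M * f' x" "- (w x * f' x) \<le> M * f' x" if "x \<in> {a..b}" for x
    using that by (force simp: abs_le_iff)+
  have "J \<le> M * ((s - b) powr (- \<beta>) - (s - a) powr (- \<beta>))"
    by (rule has_integral_le[OF J has_integral_mult_right[OF F]]) (use le in auto)
  moreover have "- J \<le> M * ((s - b) powr (- \<beta>) - (s - a) powr (- \<beta>))"
    by (rule has_integral_le[OF has_integral_neg[OF J] has_integral_mult_right[OF F]]) (use le in auto)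
  ultimately show ?thesis using 1 by (intro exI[of _ "- J"]) auto
qed

lemma quadratic_interpolant_newton:
  fixes t v :: "nat \<Rightarrow> real"
  assumes "t (k - 1) < t k" "t k < t (k + 1)"
  defines "m \<equiv> \<lambda>k. (v k - v (k - 1)) / (t k - t (k - 1))"
  shows "quadratic_interpolant t v k s = v (k - 1) + m k * (s - t (k - 1)) +
    (m (k + 1) - m k) / (t (k + 1) - t (k - 1)) * ((s - t (k - 1)) * (s - t k))"
proof -
  define x y where "x = t k - t (k - 1)" and "y = t (k + 1) - t k"
  have xy: "x > 0" "y > 0" "t k = t (k - 1) + x" "t (k + 1) = t (k - 1) + x + y"
    using assms by (auto simp: x_def y_def)
  define a where "a = t (k - 1)"
  have k1: "k + 1 - 1 = k" by simp
  show ?thesis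
    unfolding quadratic_interpolant_def m_def k1 xy(3,4) a_def[symmetric]
    using xy(1,2) by (simp add: divide_simps add_nonneg_eq_0_iff) (simp add: algebra_simps)
qed

lemma quadratic_interpolant_nodes:
  assumes "t (k - 1) < t k" "t k < t (k + 1)"
  shows "quadratic_interpolant t v k (t (k - 1)) = v (k - 1)"
    "quadratic_interpolant t v k (t k) = v k"
    "quadratic_interpolant t v k (t (k + 1)) = v (k + 1)"
  using assms unfolding quadratic_interpolant_def by auto

lemma quadratic_interpolant_deriv:
  assumes "t (k - 1) < t k" "t k < t (k + 1)"
  shows "(quadratic_interpolant t v k has_real_derivative deriv (quadratic_interpolant t v k) s) (at s)"
proof -
  have "quadratic_interpolant t v k differentiable (at s)"
    unfolding quadratic_interpolant_def
    using assms by (intro derivative_intros differentiable_divide) auto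
  then show ?thesis
    using DERIV_deriv_iff_real_differentiable by blast
qed

lemma continuous_on_deriv_quadratic_interpolant:
  assumes "t (k - 1) < t k" "t k < t (k + 1)"
  shows "continuous_on S (deriv (quadratic_interpolant t v k))"
  unfolding deriv_quadratic_interpolant[OF assms]
  by (intro continuous_intros)

text \<open>The interpolation error vanishes at both ends of the interval, so the derivative can be moved onto
the kernel and a bound on the error itself, not on its derivative, is enough.\<close>

lemma interval_interpolation_error:
  fixes \<beta> s M :: real
  assumes t: "t (k - 1) < t k" "t k < t (k + 1)" and s: "t k < s" and beta: "0 < \<beta>"
    and cont: "continuous_on {t (k - 1)..t k} F" and nodes: "F (t (k - 1)) = v (k - 1)" "F (t k) = v k"
    and deriv: "\<And>x. x \<in> {t (k - 1)<..<t k} \<Longrightarrow> (F has_real_derivative F' x) (at x)"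
    and M: "\<And>x. x \<in> {t (k - 1)..t k} \<Longrightarrow> \<bar>F x - quadratic_interpolant t v k x\<bar> \<le> M"
  shows "\<exists>J. ((\<lambda>x. (s - x) powr (- \<beta>) * F' x) has_integral J) {t (k - 1)..t k} \<and>
    \<bar>integral {t (k - 1)..t k} (\<lambda>x. (s - x) powr (- \<beta>) * deriv (quadratic_interpolant t v k) x) - J\<bar>
     \<le> M * ((s - t k) powr (- \<beta>) - (s - t (k - 1)) powr (- \<beta>))"
proof -
  let ?q = "quadratic_interpolant t v k" and ?I = "{t (k - 1)..t k}"
  let ?f = "\<lambda>x. (s - x) powr (- \<beta>)"
  have "continuous_on ?I ?q"
    using quadratic_interpolant_deriv[OF t] by (meson DERIV_atLeastAtMost_imp_continuous_on)
  then have "\<exists>I. ((\<lambda>x. ?f x * (F' x - deriv ?q x)) has_integral I) ?I \<and>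
      \<bar>I\<bar> \<le> M * (?f (t k) - ?f (t (k - 1)))"
    using t s beta cont nodes deriv M quadratic_interpolant_deriv[OF t] quadratic_interpolant_nodes[OF t, of v]
    by (intro kernel_by_parts[where w = "\<lambda>x. F x - ?q x"])
      (auto intro!: continuous_intros derivative_intros)
  then obtain I where I: "((\<lambda>x. ?f x * (F' x - deriv ?q x)) has_integral I) ?I"
      "\<bar>I\<bar> \<le> M * (?f (t k) - ?f (t (k - 1)))" by blast
  define Q where "Q = integral ?I (\<lambda>x. ?f x * deriv ?q x)"
  have Q: "((\<lambda>x. ?f x * deriv ?q x) has_integral Q) ?I"
    unfolding Q_def by (intro integrable_integral integrable_continuous_interval continuous_intros
      continuous_on_kernel[OF s] continuous_on_deriv_quadratic_interpolant[OF t])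
  have "((\<lambda>x. ?f x * F' x) has_integral I + Q) ?I"
    using has_integral_add[OF I(1) Q] by (simp add: algebra_simps)
  then show ?thesis using I(2) unfolding Q_def[symmetric] by (intro exI[of _ "I + Q"]) auto
qed

lemma quadratic_interpolant_oscillation:
  fixes \<mu> :: real
  assumes t: "t (k - 1) < t k" "t k < t (k + 1)"
    and lip: "\<bar>v k - v (k - 1)\<bar> \<le> \<mu> * (t k - t (k - 1))" "\<bar>v (k + 1) - v k\<bar> \<le> \<mu> * (t (k + 1) - t k)"
    and s: "s \<in> {t (k - 1)..t k}"
  shows "\<bar>quadratic_interpolant t v k s - v (k - 1)\<bar> \<le> 3 * \<mu> * (t k - t (k - 1))"
proof -
  define m where "m k = (v k - v (k - 1)) / (t k - t (k - 1))" for k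
  define d where "d = t k - t (k - 1)"
  have d: "0 < d" using t by (simp add: d_def)
  have m: "\<bar>m k\<bar> \<le> \<mu>" "\<bar>m (k + 1)\<bar> \<le> \<mu>"
    using lip t by (auto simp: m_def abs_divide divide_le_eq)
  have mu: "0 \<le> \<mu>" using m by linarith
  have s1: "0 \<le> s - t (k - 1)" "s - t (k - 1) \<le> d" "\<bar>s - t k\<bar> \<le> d" using s by (auto simp: d_def)
  have "\<bar>m k * (s - t (k - 1))\<bar> \<le> \<mu> * d" unfolding abs_mult using m s1 mu by (intro mult_mono) auto
  moreover have "\<bar>(m (k + 1) - m k) / (t (k + 1) - t (k - 1)) * ((s - t (k - 1)) * (s - t k))\<bar> \<le> 2 * \<mu> * d"
  proof -
    have "\<bar>(m (k + 1) - m k) / (t (k + 1) - t (k - 1)) * ((s - t (k - 1)) * (s - t k))\<bar> \<le> (2 * \<mu>) / d * (d * d)"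
      unfolding abs_mult abs_divide using m s1 mu d t
      by (intro mult_mono frac_le) (auto simp: d_def)
    then show ?thesis using d by simp
  qed
  moreover have "quadratic_interpolant t v k s - v (k - 1) = m k * (s - t (k - 1)) +
      (m (k + 1) - m k) / (t (k + 1) - t (k - 1)) * ((s - t (k - 1)) * (s - t k))"
    unfolding quadratic_interpolant_newton[OF t, of v s] m_def by simp
  moreover have "\<bar>Q\<bar> \<le> 3 * y" if "\<bar>A\<bar> \<le> y" "\<bar>B\<bar> \<le> 2 * y" "Q = A + B" for A B Q y :: real
    using that by linarith
  ultimately show ?thesis unfolding d_def[symmetric] mult.assoc by blast
qed

lemma linear_interpolant_deriv:
  assumes "t (n - 1) < t n"
  shows "deriv (linear_interpolant t v n) s = (v n - v (n - 1)) / (t n - t (n - 1))"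
proof -
  have ne: "t (n - 1) - t n \<noteq> 0" "t n - t (n - 1) \<noteq> 0" using assms by auto
  have "(linear_interpolant t v n has_real_derivative
      v (n - 1) / (t (n - 1) - t n) + v n / (t n - t (n - 1))) (at s)"
    unfolding linear_interpolant_def by (rule derivative_eq_intros refl | use ne in simp)+
  moreover have "v (n - 1) / (t (n - 1) - t n) + v n / (t n - t (n - 1)) = (v n - v (n - 1)) / (t n - t (n - 1))"
    using ne by (simp add: divide_simps) (simp add: algebra_simps)
  ultimately show ?thesis using DERIV_imp_deriv by metis
qed

lemma kernel_integral:
  fixes a s \<beta> :: real
  assumes "a \<le> s" "\<beta> < 1"
  shows "((\<lambda>x. (s - x) powr (- \<beta>)) has_integral (s - a) powr (1 - \<beta>) / (1 - \<beta>)) {a..s}"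
proof -
  have "((\<lambda>x. (s - x) powr (- \<beta>)) has_integral
     (- ((s - s) powr (1 - \<beta>) / (1 - \<beta>)) - - ((s - a) powr (1 - \<beta>) / (1 - \<beta>)))) {a..s}"
  proof (intro fundamental_theorem_of_calculus_interior)
    have "continuous_on {a..s} (\<lambda>x. (s - x) powr (1 - \<beta>))"
      using assms by (intro continuous_on_powr' continuous_intros) auto
    then show "continuous_on {a..s} (\<lambda>x. - ((s - x) powr (1 - \<beta>) / (1 - \<beta>)))"
      using assms by (intro continuous_on_minus continuous_on_divide continuous_on_const) auto
    fix x assume x: "x \<in> {a<..<s}"
    have "((\<lambda>x. (s - x) powr (1 - \<beta>)) has_real_derivative (- (1 - \<beta>) * (s - x) powr (- \<beta>))) (at x)"
      using x by (auto intro!: derivative_eq_intros simp: algebra_simps)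
    moreover have "- (- (1 - \<beta>) * (s - x) powr (- \<beta>) / (1 - \<beta>)) = (s - x) powr (- \<beta>)"
      using assms by (simp add: field_simps)
    ultimately have "((\<lambda>x. - ((s - x) powr (1 - \<beta>) / (1 - \<beta>))) has_real_derivative (s - x) powr (- \<beta>)) (at x)"
      using DERIV_minus[OF DERIV_cdivide, of _ _ x UNIV "1 - \<beta>"] by metis
    then
    show "((\<lambda>x. - ((s - x) powr (1 - \<beta>) / (1 - \<beta>))) has_vector_derivative (s - x) powr (- \<beta>)) (at x)"
      by (simp add: has_real_derivative_iff_has_vector_derivative[symmetric])
  qed (use assms in auto)
  then show ?thesis using assms by simp
qed

section \<open>A decaying barrier\<close>

text \<open>The decaying barrier.  For \<open>q = 1 - \<beta>\<close> the power \<open>x powr (- q)\<close> alone spans the kernel of the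
Riemann-Liouville derivative of order \<open>\<beta>\<close>, and its decay would use up exactly what the initial jump contributes.
The correction with \<open>s powr e\<close> slows the decay near the start \<open>s\<close> of the decay and leaves a positive rest.\<close>

definition barrier_fun :: "real \<Rightarrow> real \<Rightarrow> real \<Rightarrow> real \<Rightarrow> real" where
  "barrier_fun q e s x = x powr (- q) - q / (2 * (q + e)) * s powr e * x powr (- q - e)"

definition barrier_slope :: "real \<Rightarrow> real \<Rightarrow> real \<Rightarrow> real \<Rightarrow> real" where
  "barrier_slope q e s x = q * x powr (- q - 1) - q / 2 * s powr e * x powr (- q - e - 1)"

lemma barrier_ratio:
  fixes e s x b :: real
  assumes "0 < s" "s \<le> x" "0 \<le> e"
  shows "s powr e * x powr (b - e) \<le> x powr b"
proof -
  have "s powr e * x powr (b - e) \<le> x powr e * x powr (b - e)"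
    using assms by (intro mult_right_mono powr_mono2) auto
  also have "\<dots> = x powr b" using assms by (simp add: powr_add[symmetric])
  finally show ?thesis .
qed

lemma barrier_slope_bounds:
  assumes "0 < q" "q \<le> 1" "0 < e" "0 < s" "s \<le> x"
  shows "0 \<le> barrier_slope q e s x" "barrier_slope q e s x \<le> x powr (- q - 1)"
proof -
  have "s powr e * x powr (- q - e - 1) \<le> x powr (- q - 1)"
    using barrier_ratio[of s x e "- q - 1"] assms by (simp add: algebra_simps)
  then have "q / 2 * (s powr e * x powr (- q - e - 1)) \<le> q / 2 * x powr (- q - 1)"
    using assms by (intro mult_left_mono) auto
  also have "\<dots> \<le> q * x powr (- q - 1)" using assms by (intro mult_right_mono) auto
  finally show "0 \<le> barrier_slope q e s x" by (simp add: barrier_slope_def mult.assoc)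
  have "barrier_slope q e s x \<le> q * x powr (- q - 1)" unfolding barrier_slope_def using assms by simp
  also have "\<dots> \<le> 1 * x powr (- q - 1)" using assms by (intro mult_right_mono) auto
  finally show "barrier_slope q e s x \<le> x powr (- q - 1)" by simp
qed

lemma barrier_fun_deriv:
  assumes "0 < q" "0 < e" "0 < x"
  shows "(barrier_fun q e s has_real_derivative - barrier_slope q e s x) (at x)"
proof -
  have "(barrier_fun q e s has_real_derivative
     - q * x powr (- q - 1) - q / (2 * (q + e)) * s powr e * ((- q - e) * x powr (- q - e - 1))) (at x)"
    unfolding barrier_fun_def using assms by (auto intro!: derivative_eq_intros)
  moreover have "q / (2 * (q + e)) * s powr e * ((- q - e) * x powr (- q - e - 1)) =
     - (q / 2 * s powr e * x powr (- q - e - 1))" (is "?l = _")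
  proof -
    have "c * S * ((- q - e) * X) = - (c * (q + e)) * S * X" for c S X :: real
      by (simp add: algebra_simps)
    then have "?l = - (q / (2 * (q + e)) * (q + e)) * s powr e * x powr (- q - e - 1)" .
    also have "q / (2 * (q + e)) * (q + e) = q / 2" using assms by (simp add: field_simps)
    finally show ?thesis by simp
  qed
  then have "- q * x powr (- q - 1) - q / (2 * (q + e)) * s powr e * ((- q - e) * x powr (- q - e - 1))
      = - barrier_slope q e s x"
    unfolding barrier_slope_def by linarith
  ultimately show ?thesis by (simp only:)
qed

lemma barrier_fun_bounds:
  assumes "0 < q" "0 < e" "0 < s" "s \<le> x"
  shows "x powr (- q) / 2 \<le> barrier_fun q e s x" "barrier_fun q e s x \<le> x powr (- q)"
proof -
  have "q / (2 * (q + e)) * (s powr e * x powr (- q - e)) \<le> 1 / 2 * x powr (- q)"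
    using assms barrier_ratio[of s x e "- q"] by (intro mult_mono) (auto simp: field_simps)
  then show "x powr (- q) / 2 \<le> barrier_fun q e s x" by (simp add: barrier_fun_def mult.assoc)
  show "barrier_fun q e s x \<le> x powr (- q)" unfolding barrier_fun_def using assms by simp
qed

text \<open>An explicit function whose decrease dominates the integral of \<open>(T - x) powr (- \<beta>) * barrier_slope q e s x\<close>.
With \<open>G x = T powr (- \<beta>) * x powr (\<beta> - 1) - (T - x) powr (1 - \<beta>) * x powr (\<beta> - 1) / T\<close> one has
\<open>G' x = (1 - \<beta>) * x powr (\<beta> - 2) * ((T - x) powr (- \<beta>) - T powr (- \<beta>))\<close>.  Hence if the slope is
written as \<open>(1 - \<beta>) * x powr (\<beta> - 2) * \<omega> x\<close>, the function \<open>T powr (- \<beta>) * barrier_fun - \<omega> * G\<close> has the derivative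
\<open>- (T - x) powr (- \<beta>) * slope - \<omega>' * G\<close>, and \<open>\<omega>'\<close> and \<open>G\<close> are nonnegative.\<close>

definition barrier_potential :: "real \<Rightarrow> real \<Rightarrow> real \<Rightarrow> real \<Rightarrow> real \<Rightarrow> real \<Rightarrow> real" where
  "barrier_potential \<beta> q e s T x = T powr (- \<beta>) * barrier_fun q e s x -
     q / (1 - \<beta>) * (x powr (1 - \<beta> - q) - s powr e / 2 * x powr (1 - \<beta> - q - e)) *
     (T powr (- \<beta>) * x powr (\<beta> - 1) - (T - x) powr (1 - \<beta>) * x powr (\<beta> - 1) / T)"

lemma barrier_potential_deriv:
  assumes q: "0 < q" "q \<le> 1 - \<beta>" and b: "0 < \<beta>" "\<beta> < 1" and e: "0 < e" and s: "0 < s" "s \<le> x" "x < T"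
  shows "\<exists>d. (barrier_potential \<beta> q e s T has_real_derivative d) (at x) \<and>
    d \<le> - ((T - x) powr (- \<beta>) * barrier_slope q e s x)"
proof -
  have x: "0 < x" using s by auto
  define E where "E = 1 - \<beta> - q"
  have E: "0 \<le> E" using q by (simp add: E_def)
  define om where "om = q / (1 - \<beta>) * (x powr E - s powr e / 2 * x powr (E - e))"
  define om' where "om' = q / (1 - \<beta>) * (E * x powr (E - 1) - s powr e / 2 * ((E - e) * x powr (E - e - 1)))"
  define G where "G = T powr (- \<beta>) * x powr (\<beta> - 1) - (T - x) powr (1 - \<beta>) * x powr (\<beta> - 1) / T"
  define G' where "G' = T powr (- \<beta>) * ((\<beta> - 1) * x powr (\<beta> - 1 - 1)) -
     (- (1 - \<beta>) * (T - x) powr (1 - \<beta> - 1) * x powr (\<beta> - 1) + (T - x) powr (1 - \<beta>) * ((\<beta> - 1) * x powr (\<beta> - 1 - 1))) / T"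
  have D: "(barrier_potential \<beta> q e s T has_real_derivative
      T powr (- \<beta>) * (- barrier_slope q e s x) - (om' * G + om * G')) (at x)"
    unfolding barrier_potential_def E_def[symmetric]
  proof (rule DERIV_diff[OF DERIV_cmult[OF barrier_fun_deriv[OF q(1) e x]]])
    show "((\<lambda>x. q / (1 - \<beta>) * (x powr E - s powr e / 2 * x powr (E - e)) *
         (T powr - \<beta> * x powr (\<beta> - 1) - (T - x) powr (1 - \<beta>) * x powr (\<beta> - 1) / T))
        has_real_derivative om' * G + om * G') (at x)"
    proof -
      have 1: "((\<lambda>x. q / (1 - \<beta>) * (x powr E - s powr e / 2 * x powr (E - e))) has_real_derivative om') (at x)"
        unfolding om'_def by (intro DERIV_cmult DERIV_diff has_real_derivative_powr x)
      have "((\<lambda>x. (T - x) powr (1 - \<beta>)) has_real_derivative (- (1 - \<beta>) * (T - x) powr (1 - \<beta> - 1))) (at x)"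
        using s by (auto intro!: derivative_eq_intros simp: algebra_simps)
      from DERIV_mult[OF this has_real_derivative_powr[OF x, of "\<beta> - 1"]]
      have 2: "((\<lambda>x. T powr - \<beta> * x powr (\<beta> - 1) - (T - x) powr (1 - \<beta>) * x powr (\<beta> - 1) / T) has_real_derivative G') (at x)"
        unfolding G'_def
        by (intro DERIV_cmult DERIV_diff has_real_derivative_powr x DERIV_cdivide) (simp add: mult_ac add_ac)
      show ?thesis using DERIV_mult[OF 1 2] by (simp add: om_def G_def mult_ac add_ac)
    qed
  qed
  \<comment> \<open>the two signs that make the extra term of the derivative favourable\<close>
  have G0: "0 \<le> G"
  proof -
    have "(T - x) powr (1 - \<beta>) / T \<le> T powr (1 - \<beta>) / T"
      using s x b by (intro divide_right_mono powr_mono2) auto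
    also have "\<dots> = T powr (- \<beta>)" using s x by (simp add: powr_diff powr_minus field_simps)
    finally have "(T - x) powr (1 - \<beta>) / T * x powr (\<beta> - 1) \<le> T powr (- \<beta>) * x powr (\<beta> - 1)"
      by (intro mult_right_mono) auto
    then show ?thesis by (simp add: G_def)
  qed
  have om'0: "0 \<le> om'"
  proof -
    have w: "0 \<le> s powr e * x powr (E - 1 - e)" "s powr e * x powr (E - 1 - e) \<le> x powr (E - 1)"
      using barrier_ratio[of s x e "E - 1"] s e by auto
    have "(E - e) / 2 * (s powr e * x powr (E - 1 - e)) \<le> E * x powr (E - 1)"
    proof (cases "E \<le> e")
      case True
      then have "(E - e) / 2 * (s powr e * x powr (E - 1 - e)) \<le> 0" using w by (intro mult_nonpos_nonneg) auto
      then show ?thesis using E by (meson mult_nonneg_nonneg order_trans powr_ge_zero)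
    next
      case False
      then show ?thesis using w e by (intro mult_mono) auto
    qed
    then have "0 \<le> E * x powr (E - 1) - s powr e / 2 * ((E - e) * x powr (E - e - 1))"
      by (simp add: algebra_simps)
    then show ?thesis unfolding om'_def using q b by (intro mult_nonneg_nonneg) auto
  qed
  have slope: "om * (1 - \<beta>) * x powr (\<beta> - 2) = barrier_slope q e s x"
  proof -
    have p: "x powr E * x powr (\<beta> - 2) = x powr (- q - 1)" "x powr (E - e) * x powr (\<beta> - 2) = x powr (- q - e - 1)"
      unfolding powr_add[symmetric] by (rule arg_cong[where f = "(powr) x"], simp add: E_def)+
    have "om * (1 - \<beta>) * x powr (\<beta> - 2) =
      q * (x powr E * x powr (\<beta> - 2) - s powr e / 2 * (x powr (E - e) * x powr (\<beta> - 2)))"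
      unfolding om_def using b by (simp add: field_simps)
    then show ?thesis unfolding p barrier_slope_def by (simp add: algebra_simps)
  qed
  have G'_eq: "G' = (1 - \<beta>) * x powr (\<beta> - 2) * ((T - x) powr (- \<beta>) - T powr (- \<beta>))"
  proof -
    have a: "(T - x) powr (1 - \<beta>) = (T - x) * (T - x) powr (- \<beta>)"
      using s by (simp add: powr_diff powr_minus field_simps)
    have b': "x powr (\<beta> - 1) = x * x powr (\<beta> - 2)"
      using x by (simp add: powr_diff field_simps power2_eq_square)
    have c: "1 - \<beta> - 1 = - \<beta>" "\<beta> - 1 - 1 = \<beta> - 2" by auto
    have "(- (1 - \<beta>) * (T - x) powr (- \<beta>) * (x * x powr (\<beta> - 2)) + (T - x) * (T - x) powr (- \<beta>) * ((\<beta> - 1) * x powr (\<beta> - 2)))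
       = - (1 - \<beta>) * (T - x) powr (- \<beta>) * x powr (\<beta> - 2) * T" by (simp add: algebra_simps)
    note bracket = this
    have "T \<noteq> 0" using s x by auto
    then show ?thesis unfolding G'_def a b' c bracket
      by (subst nonzero_mult_div_cancel_right) (auto simp: algebra_simps)
  qed
  have "T powr (- \<beta>) * (- barrier_slope q e s x) - (om' * G + om * G') =
      - ((T - x) powr (- \<beta>) * barrier_slope q e s x) - om' * G"
    unfolding G'_eq slope[symmetric] by (simp add: algebra_simps)
  also have "\<dots> \<le> - ((T - x) powr (- \<beta>) * barrier_slope q e s x)" using om'0 G0 by simp
  finally show ?thesis using D by blast
qed

lemma barrier_potential_continuous:
  assumes "0 < a" "\<beta> < 1" "0 < T"
  shows "continuous_on {a..T} (barrier_potential \<beta> q e s T)"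
proof -
  have "continuous_on {a..T} (\<lambda>x. (T - x) powr (1 - \<beta>))"
    using assms by (intro continuous_on_powr' continuous_intros) auto
  moreover have "continuous_on {a..T} (\<lambda>x. x powr c)" for c
    by (intro continuous_on_powr continuous_on_id continuous_on_const) (use assms in auto)
  ultimately show ?thesis
    unfolding barrier_potential_def barrier_fun_def
    by (intro continuous_on_diff continuous_on_mult continuous_on_divide continuous_on_const)
      (use assms in auto)
qed

text \<open>The total decrease over \<open>{s..T}\<close> stays below the contribution \<open>T powr (- \<beta>) * barrier_fun q e s s\<close>
of the initial jump by a definite amount.  The gain comes from the correction: it survives at \<open>T\<close>
with the factor \<open>1 / 2\<close> in \<open>\<omega>\<close> but only with \<open>q / (2 (q + e))\<close> in the barrier.\<close>

lemma barrier_potential_total: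
  assumes q: "0 < q" "q \<le> 1 - \<beta>" and b: "0 < \<beta>" "\<beta> < 1" and e: "0 < e" and s: "0 < s" "s < T"
  shows "barrier_potential \<beta> q e s T s - barrier_potential \<beta> q e s T T \<le>
    T powr (- \<beta>) * barrier_fun q e s s - e / (2 * (q + e)) * (s / T) powr e * T powr (- q - \<beta>)"
proof -
  have T: "0 < T" using s by auto
  have left: "barrier_potential \<beta> q e s T s \<le> T powr (- \<beta>) * barrier_fun q e s s"
  proof -
    have "(T - s) powr (1 - \<beta>) / T \<le> T powr (1 - \<beta>) / T"
      using s b by (intro divide_right_mono powr_mono2) auto
    also have "\<dots> = T powr (- \<beta>)" using T by (simp add: powr_diff powr_minus field_simps)
    finally have "(T - s) powr (1 - \<beta>) / T * s powr (\<beta> - 1) \<le> T powr (- \<beta>) * s powr (\<beta> - 1)"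
      by (intro mult_right_mono) auto
    then have 1: "0 \<le> T powr (- \<beta>) * s powr (\<beta> - 1) - (T - s) powr (1 - \<beta>) * s powr (\<beta> - 1) / T" by simp
    have "s powr e * s powr (b - e) = s powr b" for b by (simp add: powr_add[symmetric])
    from this[of "1 - \<beta> - q"]
    have "s powr e * s powr (1 - \<beta> - q - e) = s powr (1 - \<beta> - q)" .
    then have 2: "0 \<le> s powr (1 - \<beta> - q) - s powr e / 2 * s powr (1 - \<beta> - q - e)" by simp
    show ?thesis unfolding barrier_potential_def using 1 2 q b by (simp add: mult_nonneg_nonneg)
  qed
  define \<rho> where "\<rho> = (s / T) powr e"
  have rho: "0 \<le> \<rho>" "\<rho> \<le> 1" unfolding \<rho>_def using s e powr_mono2[of e "s/T" 1] by auto
  have rho_eq: "\<rho> = s powr e * T powr (- e)"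
    unfolding \<rho>_def using s T by (simp add: powr_divide powr_minus_divide)
  have p: "s powr e * T powr (b - e) = \<rho> * T powr b" for b
    unfolding rho_eq mult.assoc powr_add[symmetric] by simp
  have p1: "s powr e * T powr (- q - e) = \<rho> * T powr (- q)" by (rule p)
  have p2: "s powr e * T powr (1 - \<beta> - q - e) = \<rho> * T powr (1 - \<beta> - q)" by (rule p)
  have p3: "T powr (1 - \<beta> - q) * T powr (\<beta> - 1) = T powr (- q)"
    by (simp add: powr_add[symmetric])
  have p4: "T powr (- \<beta>) * T powr (- q) = T powr (- q - \<beta>)"
    unfolding powr_add[symmetric] by (rule arg_cong[where f = "(powr) T"]) simp
  have "barrier_potential \<beta> q e s T T = T powr (- \<beta>) * (T powr (- q) - q / (2 * (q + e)) * (s powr e * T powr (- q - e)))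
     - q / (1 - \<beta>) * (T powr (1 - \<beta> - q) - (s powr e * T powr (1 - \<beta> - q - e)) / 2) * (T powr (- \<beta>) * T powr (\<beta> - 1))"
    unfolding barrier_potential_def barrier_fun_def by (simp add: mult.assoc)
  also have "\<dots> = T powr (- \<beta>) * T powr (- q) * (1 - q / (2 * (q + e)) * \<rho>)
     - q / (1 - \<beta>) * (1 - \<rho> / 2) * (T powr (- \<beta>) * (T powr (1 - \<beta> - q) * T powr (\<beta> - 1)))"
    unfolding p1 p2 by (simp add: algebra_simps)
  also have "\<dots> = T powr (- q - \<beta>) * (1 - q / (2 * (q + e)) * \<rho> - q / (1 - \<beta>) * (1 - \<rho> / 2))"
    unfolding p3 p4 by (simp add: algebra_simps)
  finally have TT: "barrier_potential \<beta> q e s T T =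
     T powr (- q - \<beta>) * (1 - q / (2 * (q + e)) * \<rho> - q / (1 - \<beta>) * (1 - \<rho> / 2))" .
  define c where "c = q / (1 - \<beta>)"
  have c: "c \<le> 1" unfolding c_def using q b by simp
  have half: "1 / 2 - q / (2 * (q + e)) = e / (2 * (q + e))" using q e by (simp add: field_simps)
  have "(1 - c) * \<rho> \<le> 1 - c" using c rho by (simp add: mult_left_le)
  moreover have "c * \<rho> \<le> \<rho>" using mult_right_mono[of c 1 \<rho>] c rho by simp
  ultimately have "(1 / 2 - q / (2 * (q + e))) * \<rho> \<le> 1 - q / (2 * (q + e)) * \<rho> - c * (1 - \<rho> / 2)"
    by (simp add: algebra_simps)
  then have "T powr (- q - \<beta>) * (e / (2 * (q + e)) * \<rho>) \<le> barrier_potential \<beta> q e s T T"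
    unfolding TT c_def[symmetric] half by (intro mult_left_mono) auto
  then show ?thesis using left unfolding \<rho>_def by (simp add: mult_ac)
qed

lemma barrier_fun_lipschitz:
  assumes "0 < q" "q \<le> 1" "0 < e" "0 < s" "s \<le> x" "x \<le> y" "0 < a" "a \<le> x"
  shows "0 \<le> barrier_fun q e s x - barrier_fun q e s y"
    and "barrier_fun q e s x - barrier_fun q e s y \<le> a powr (- q - 1) * (y - x)"
proof -
  have "0 \<le> barrier_fun q e s x - barrier_fun q e s y \<and>
    barrier_fun q e s x - barrier_fun q e s y \<le> a powr (- q - 1) * (y - x)"
  proof (cases "x = y")
    case False
    then have xy: "x < y" using assms by simp
    have "\<exists>z>x. z < y \<and> barrier_fun q e s y - barrier_fun q e s x = (y - x) * (- barrier_slope q e s z)"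
      using xy assms by (intro MVT2 barrier_fun_deriv) auto
    then obtain z where z: "x < z" "z < y"
      "barrier_fun q e s x - barrier_fun q e s y = (y - x) * barrier_slope q e s z" by (auto simp: algebra_simps)
    have "barrier_slope q e s z \<le> z powr (- q - 1)" "0 \<le> barrier_slope q e s z"
      using barrier_slope_bounds[of q e s z] z assms by auto
    moreover have "z powr (- q - 1) \<le> a powr (- q - 1)" using z assms by (intro powr_mono2') auto
    ultimately have "0 \<le> barrier_slope q e s z" "barrier_slope q e s z \<le> a powr (- q - 1)" by auto
    then show ?thesis unfolding z(3) using xy by (simp add: mult_ac mult_left_mono)
  qed simp
  then show "0 \<le> barrier_fun q e s x - barrier_fun q e s y"
    "barrier_fun q e s x - barrier_fun q e s y \<le> a powr (- q - 1) * (y - x)" by auto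
qed

lemma barrier_potential_integral_le:
  assumes q: "0 < q" "q \<le> 1 - \<beta>" and b: "0 < \<beta>" "\<beta> < 1" and e: "0 < e"
    and s: "0 < s" "s \<le> x" "x \<le> y" "y < T"
    and J: "((\<lambda>z. (T - z) powr (- \<beta>) * barrier_slope q e s z) has_integral J) {x..y}"
  shows "J \<le> barrier_potential \<beta> q e s T x - barrier_potential \<beta> q e s T y"
proof -
  let ?Z = "barrier_potential \<beta> q e s T"
  have D: "(?Z has_real_derivative deriv ?Z z) (at z)" "deriv ?Z z \<le> - ((T - z) powr (- \<beta>) * barrier_slope q e s z)"
    if z: "z \<in> {x..y}" for z
  proof -
    obtain d where d: "(?Z has_real_derivative d) (at z)" "d \<le> - ((T - z) powr (- \<beta>) * barrier_slope q e s z)"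
      using barrier_potential_deriv[OF q b e s(1), of z T] z s by auto
    then show "(?Z has_real_derivative deriv ?Z z) (at z)"
      "deriv ?Z z \<le> - ((T - z) powr (- \<beta>) * barrier_slope q e s z)"
      using DERIV_imp_deriv[OF d(1)] by simp_all
  qed
  have "(deriv ?Z has_integral ?Z y - ?Z x) {x..y}"
    using s D(1) by (intro fundamental_theorem_of_calculus)
      (auto simp: has_real_derivative_iff_has_vector_derivative[symmetric] intro: has_field_derivative_at_within)
  from has_integral_neg[OF this] have "((\<lambda>z. - deriv ?Z z) has_integral ?Z x - ?Z y) {x..y}" by simp
  then show ?thesis using D(2) by (intro has_integral_le[OF J]) (auto simp: le_minus_iff)
qed

lemma barrier_potential_decreasing:
  assumes q: "0 < q" "q \<le> 1 - \<beta>" and b: "0 < \<beta>" "\<beta> < 1" and e: "0 < e"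
    and s: "0 < s" "s \<le> x" "x \<le> T"
  shows "barrier_potential \<beta> q e s T T \<le> barrier_potential \<beta> q e s T x"
proof -
  let ?Z = "barrier_potential \<beta> q e s T"
  have "- ?Z x \<le> - ?Z T"
  proof (rule DERIV_nonneg_imp_increasing_open[OF s(3)])
    show "continuous_on {x..T} (\<lambda>x. - ?Z x)"
      using barrier_potential_continuous[of x \<beta> T q e s] s b by (intro continuous_on_minus) auto
    fix z assume z: "x < z" "z < T"
    obtain d where d: "(?Z has_real_derivative d) (at z)" "d \<le> - ((T - z) powr (- \<beta>) * barrier_slope q e s z)"
      using barrier_potential_deriv[OF q b e s(1), of z T] z s by auto
    have "0 \<le> (T - z) powr (- \<beta>) * barrier_slope q e s z"
      using barrier_slope_bounds(1)[of q e s z] q b e s z by auto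
    then show "\<exists>d. ((\<lambda>x. - ?Z x) has_real_derivative d) (at z) \<and> 0 \<le> d"
      using DERIV_minus[OF d(1)] d(2) by (intro exI[of _ "- d"]) auto
  qed
  then show ?thesis by simp
qed

context graded_meshes
begin

text \<open>The function \<open>v\<close> vanishes up to \<open>s = t p\<close> and then follows the decrease of the barrier.  Interval by
interval its discrete derivative is the exact integral, bounded by the potential, plus an interpolation error.
The slope of the barrier on an interval and its neighbour is at most \<open>(t k / D) powr (- q - 1)\<close>, so the error
sums to \<open>\<xi> n powr ((1 - \<beta>) / r)\<close> relative to the main term.\<close>

lemma decaying_part_le:
  assumes q: "0 < q" "q \<le> 1 - \<beta>" and e: "0 < e" and p: "1 \<le> p" "p < n" "n \<le> N"
  defines "s \<equiv> t N p"
  defines "v \<equiv> \<lambda>k. barrier_fun q e s s - barrier_fun q e s (max (t N k) s)"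
  shows "Gamma (1 - \<beta>) * \<delta> N v n \<le>
    barrier_potential \<beta> q e s (ts N n) s - barrier_potential \<beta> q e s (ts N n) (ts N n) +
    4 * D powr (q + 2) * (\<Sum>k=1..n-1. dker N n k * (xi N k powr (1 / r) * t N k powr (- q))) +
    D powr (q + 2) / (1 - \<beta>) * (xi N n powr ((1 - \<beta>) / r) * t N n powr (- q - \<beta>))"
proof -
  define Z where "Z = barrier_potential \<beta> q e s (ts N n)"
  \<comment> \<open>\<open>F\<close> is the function that \<open>v\<close> samples, and \<open>\<mu> k\<close> bounds its slope from \<open>t (k - 1)\<close> onwards\<close>
  define F where "F x = barrier_fun q e s s - barrier_fun q e s (max x s)" for x
  define \<mu> where "\<mu> k = (t N k / D) powr (- q - 1)" for k
  have v: "v k = F (t N k)" for k by (simp add: v_def F_def)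
  have s: "0 < s" unfolding s_def using t_pos[of p N] p by auto
  have q1: "q \<le> 1" using q beta by auto
  have D0: "0 < D" using D_ge_1 by auto
  have mu_eq: "\<mu> k = D powr (q + 1) * t N k powr (- q - 1)" if "0 < t N k" for k
    using that D0 unfolding \<mu>_def by (simp add: powr_divide powr_minus powr_diff powr_add field_simps)
  have lip: "0 \<le> F y - F x" "F y - F x \<le> \<mu> k * (y - x)"
    if k: "1 \<le> k" "k \<le> N" and x: "t N (k - 1) \<le> x" "x \<le> y" for k x y
  proof -
    have tk: "0 < t N k" using t_pos k by auto
    have a: "t N k / D \<le> max x s"
    proof (cases "k \<le> p")
      case True
      then have "t N k \<le> s" unfolding s_def using t_le p by auto
      moreover have "t N k / D \<le> t N k" using tk D_ge_1 by (simp add: divide_le_eq mult_le_cancel_left1)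
      ultimately show ?thesis by auto
    next
      case False
      then have "t N k \<le> D * t N (k - 1)" using ratio[of k N] k p by auto
      then have "t N k / D \<le> t N (k - 1)" using D0 by (simp add: divide_le_eq mult.commute)
      then show ?thesis using x by auto
    qed
    have mx: "max x s \<le> max y s" "max y s - max x s \<le> y - x" using x by auto
    have *: "0 \<le> barrier_fun q e s (max x s) - barrier_fun q e s (max y s)"
      "barrier_fun q e s (max x s) - barrier_fun q e s (max y s) \<le> \<mu> k * (max y s - max x s)"
      unfolding \<mu>_def using barrier_fun_lipschitz[OF q(1) q1 e s _ mx(1) _ a] tk D0 by auto
    show "0 \<le> F y - F x" using * by (simp add: F_def)
    have "\<mu> k * (max y s - max x s) \<le> \<mu> k * (y - x)"
      using mx by (intro mult_left_mono) (auto simp: \<mu>_def)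
    then show "F y - F x \<le> \<mu> k * (y - x)" using * by (simp add: F_def)
  qed
  have contF: "continuous_on A F" if "A \<subseteq> {0..}" for A
  proof -
    have "continuous_on A (\<lambda>x. max x s powr c)" for c
      by (intro continuous_intros) (use s in auto)
    then show ?thesis unfolding F_def barrier_fun_def
      by (intro continuous_on_diff continuous_on_mult continuous_on_const) auto
  qed
  have each: "integral {t N (k - 1)..t N k} (\<lambda>x. ker N n x * deriv (quadratic_interpolant (t N) v k) x)
      \<le> Z (max (t N (k - 1)) s) - Z (max (t N k) s) + 4 * \<mu> k * dt N k * dker N n k"
    if k: "k \<in> {1..n-1}" for k
  proof -
    have lt: "t N (k - 1) < t N k" "t N k < t N (k + 1)" "t N k < ts N n" "0 \<le> t N (k - 1)" "0 < t N k"
      using t_less[of "k - 1" k N] t_less[of k "k + 1" N] t_less_ts[of k n N] t_nonneg[of "k - 1" N]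
        t_pos[of k N] k p by auto
    have kN: "1 \<le> k" "k \<le> N" using k p by auto
    define F' where "F' x = (if k \<le> p then 0 else barrier_slope q e s x)" for x
    have M: "\<bar>F x - quadratic_interpolant (t N) v k x\<bar> \<le> 4 * \<mu> k * dt N k" if x: "x \<in> {t N (k - 1)..t N k}" for x
    proof -
      have "\<bar>quadratic_interpolant (t N) v k x - v (k - 1)\<bar> \<le> 3 * \<mu> k * (t N k - t N (k - 1))"
        using lip[OF kN, of "t N (k - 1)" "t N k"] lip[OF kN, of "t N k" "t N (k + 1)"] lt x
        by (intro quadratic_interpolant_oscillation) (auto simp: v)
      moreover have "\<bar>F x - F (t N (k - 1))\<bar> \<le> \<mu> k * (t N k - t N (k - 1))"
      proof -
        have "\<bar>F x - F (t N (k - 1))\<bar> \<le> \<mu> k * (x - t N (k - 1))"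
          using lip[OF kN, of "t N (k - 1)" x] x by auto
        also have "\<dots> \<le> \<mu> k * (t N k - t N (k - 1))" using x by (intro mult_left_mono) (auto simp: \<mu>_def)
        finally show ?thesis .
      qed
      moreover have "\<bar>a - b\<bar> \<le> 4 * y" if "\<bar>b - c\<bar> \<le> 3 * y" "\<bar>a - c\<bar> \<le> y" for a b c y :: real
        using that by linarith
      ultimately show ?thesis unfolding v mesh_step_def mult.assoc by blast
    qed
    have deriv: "(F has_real_derivative F' x) (at x)" if x: "x \<in> {t N (k - 1)<..<t N k}" for x
    proof (cases "k \<le> p")
      case True
      then have "t N k \<le> s" unfolding s_def using t_le p by auto
      then have "eventually (\<lambda>y. y \<in> {..<s}) (nhds x)" using x by (intro eventually_nhds_in_open) auto
      then have "eventually (\<lambda>y. F y = 0) (nhds x)" by eventually_elim (simp add: F_def max_def)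
      then show ?thesis using True by (subst DERIV_cong_ev[of x x F "\<lambda>_. 0"]) (auto simp: F'_def)
    next
      case False
      then have "s \<le> t N (k - 1)" unfolding s_def using t_le[of p "k - 1" N] kN by auto
      then have xs: "s < x" using x by auto
      then have "eventually (\<lambda>y. y \<in> {s<..}) (nhds x)" by (intro eventually_nhds_in_open) auto
      then have "eventually (\<lambda>y. F y = barrier_fun q e s s - barrier_fun q e s y) (nhds x)"
        by eventually_elim (simp add: F_def max_def)
      moreover have "((\<lambda>y. barrier_fun q e s s - barrier_fun q e s y) has_real_derivative 0 - - barrier_slope q e s x) (at x)"
        using xs s by (intro DERIV_diff DERIV_const barrier_fun_deriv q e) auto
      ultimately show ?thesis using False
        by (subst DERIV_cong_ev[OF refl _ refl]) (auto simp: F'_def)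
    qed
    have nodes: "F (t N (k - 1)) = v (k - 1)" "F (t N k) = v k" by (auto simp: v)
    obtain J where J: "((\<lambda>x. ker N n x * F' x) has_integral J) {t N (k - 1)..t N k}"
      "\<bar>integral {t N (k - 1)..t N k} (\<lambda>x. ker N n x * deriv (quadratic_interpolant (t N) v k) x) - J\<bar>
        \<le> 4 * \<mu> k * dt N k * dker N n k"
      using interval_interpolation_error[OF lt(1,2,3) _ contF nodes deriv M, of \<beta>] beta lt by auto
    have "J \<le> Z (max (t N (k - 1)) s) - Z (max (t N k) s)"
    proof (cases "k \<le> p")
      case True
      then have "t N k \<le> s" unfolding s_def using t_le p by auto
      moreover have "J = 0" using J(1) True by (simp add: F'_def)
      ultimately show ?thesis using lt by (simp add: max_def)
    next
      case False
      then have "s \<le> t N (k - 1)" unfolding s_def using t_le[of p "k - 1" N] kN by auto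
      then show ?thesis using J(1) False lt beta
        barrier_potential_integral_le[OF q _ _ e s, of "t N (k - 1)" "t N k" "ts N n" J]
        by (simp add: F'_def Z_def max_def)
    qed
    then show ?thesis using J(2) by linarith
  qed
  have n: "1 \<le> n" "n \<le> N" using p by auto
  have tn: "0 < t N n" using t_pos n by auto
  have sn: "s \<le> t N (n - 1)" unfolding s_def using t_le[of p "n - 1" N] p by auto
  have tlt: "t N (n - 1) < t N n" "t N (n - 1) < ts N n" using t_less[of "n - 1" n N] ts_gt n by auto
  have last: "integral {t N (n - 1)..ts N n} (\<lambda>x. ker N n x * deriv (linear_interpolant (t N) v n) x)
      \<le> D powr (q + 2) / (1 - \<beta>) * (xi N n powr ((1 - \<beta>) / r) * t N n powr (- q - \<beta>))"
  proof -
    define m where "m = (v n - v (n - 1)) / dt N n"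
    have m: "m \<le> \<mu> n" unfolding m_def v using lip(2)[OF n, of "t N (n - 1)" "t N n"] tlt dt_pos[OF n]
      by (simp add: divide_le_eq mesh_step_def)
    have "((\<lambda>x. ker N n x * m) has_integral ((\<sigma> * dt N n) powr (1 - \<beta>) / (1 - \<beta>) * m)) {t N (n - 1)..ts N n}"
      using has_integral_mult_left[OF kernel_integral[of "t N (n - 1)" "ts N n" \<beta>], of m] tlt beta
      by (simp add: ts_eq)
    moreover have "deriv (linear_interpolant (t N) v n) x = m" for x
      using linear_interpolant_deriv[OF tlt(1), of v x] by (simp add: m_def mesh_step_def)
    ultimately have "integral {t N (n - 1)..ts N n} (\<lambda>x. ker N n x * deriv (linear_interpolant (t N) v n) x)
       = (\<sigma> * dt N n) powr (1 - \<beta>) / (1 - \<beta>) * m"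
      by (simp only: integral_unique)
    also have "\<dots> \<le> (D * (t N n * xi N n powr (1 / r))) powr (1 - \<beta>) / (1 - \<beta>) * \<mu> n"
    proof (rule mult_mono[OF divide_right_mono[OF powr_mono2] m])
      have "\<sigma> * dt N n \<le> 1 * dt N n" using sigma_bounds dt_pos[OF n] by (intro mult_right_mono) auto
      then show "\<sigma> * dt N n \<le> D * (t N n * xi N n powr (1 / r))" using step_le[of n N] n by auto
      show "0 \<le> m" unfolding m_def v using lip(1)[OF n, of "t N (n - 1)" "t N n"] tlt dt_pos[OF n] by auto
    qed (use beta sigma_bounds dt_pos[OF n] in auto)
    also have "\<dots> = D powr (1 - \<beta>) * D powr (q + 1) / (1 - \<beta>) *
        ((t N n powr (1 - \<beta>) * t N n powr (- q - 1)) * (xi N n powr (1 / r)) powr (1 - \<beta>))"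
      unfolding mu_eq[OF tn] using D0 tn xi_pos[OF n] by (simp add: powr_mult)
    also have "D powr (1 - \<beta>) * D powr (q + 1) = D powr (q + 2 - \<beta>)"
      unfolding powr_add[symmetric] by (simp add: algebra_simps)
    also have "t N n powr (1 - \<beta>) * t N n powr (- q - 1) = t N n powr (- q - \<beta>)"
      unfolding powr_add[symmetric] by (rule arg_cong[where f = "(powr) (t N n)"]) simp
    also have "(xi N n powr (1 / r)) powr (1 - \<beta>) = xi N n powr ((1 - \<beta>) / r)"
      by (simp add: powr_powr)
    also have "D powr (q + 2 - \<beta>) / (1 - \<beta>) * (t N n powr (- q - \<beta>) * xi N n powr ((1 - \<beta>) / r)) \<le>
       D powr (q + 2) / (1 - \<beta>) * (t N n powr (- q - \<beta>) * xi N n powr ((1 - \<beta>) / r))"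
      using D_ge_1 beta by (intro mult_right_mono divide_right_mono powr_mono) auto
    finally show ?thesis by (simp add: mult_ac)
  qed
  have G: "Gamma (1 - \<beta>) * \<delta> N v n =
      (\<Sum>k=1..n-1. integral {t N (k - 1)..t N k} (\<lambda>x. ker N n x * deriv (quadratic_interpolant (t N) v k) x)) +
      integral {t N (n - 1)..ts N n} (\<lambda>x. ker N n x * deriv (linear_interpolant (t N) v n) x)"
    unfolding alikhanov_deriv_def using Gam_pos by simp
  have "(\<Sum>k=1..n-1. integral {t N (k - 1)..t N k} (\<lambda>x. ker N n x * deriv (quadratic_interpolant (t N) v k) x))
     \<le> (\<Sum>k=1..n-1. (Z (max (t N (k - 1)) s) - Z (max (t N k) s)) + 4 * \<mu> k * dt N k * dker N n k)"
    by (intro sum_mono each)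
  also have "\<dots> = (\<Sum>k=1..n-1. Z (max (t N (k - 1)) s) - Z (max (t N k) s)) + (\<Sum>k=1..n-1. 4 * \<mu> k * dt N k * dker N n k)"
    by (rule sum.distrib)
  also have "(\<Sum>k=1..n-1. Z (max (t N (k - 1)) s) - Z (max (t N k) s)) = Z s - Z (t N (n - 1))"
    using sum_telescope''[of 0 "n - 1" "\<lambda>k. - Z (max (t N k) s)"] sn s t_0[of N] n by (simp add: max_def)
  also have "(\<Sum>k=1..n-1. 4 * \<mu> k * dt N k * dker N n k) \<le>
      (\<Sum>k=1..n-1. 4 * D powr (q + 2) * (dker N n k * (xi N k powr (1 / r) * t N k powr (- q))))"
  proof (rule sum_mono)
    fix k assume k: "k \<in> {1..n-1}"
    then have kN: "1 \<le> k" "k \<le> N" "k \<in> {1..N}" using p by auto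
    have tk: "0 < t N k" using t_pos kN by auto
    have dk: "0 \<le> dker N n k" using dker_nonneg[of k n N] k p by auto
    have "\<mu> k * dt N k \<le> (D powr (q + 1) * t N k powr (- q - 1)) * (D * (t N k * xi N k powr (1 / r)))"
      unfolding mu_eq[OF tk] using step_le[OF kN(3)] by (intro mult_left_mono) auto
    also have "\<dots> = (D powr (q + 1) * D) * (t N k powr (- q - 1) * t N k) * xi N k powr (1 / r)"
      by (simp add: mult_ac)
    also have "D powr (q + 1) * D = D powr (q + 2)"
      using D0 by (simp add: powr_add power2_eq_square)
    also have "t N k powr (- q - 1) * t N k = t N k powr (- q)" using tk by (simp add: powr_diff)
    finally have "4 * dker N n k * (\<mu> k * dt N k) \<le> 4 * dker N n k * (D powr (q + 2) * t N k powr (- q) * xi N k powr (1 / r))"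
      using dk by (intro mult_left_mono) auto
    then show "4 * \<mu> k * dt N k * dker N n k \<le> 4 * D powr (q + 2) * (dker N n k * (xi N k powr (1 / r) * t N k powr (- q)))"
      by (simp only: mult_ac)
  qed
  also have "\<dots> = 4 * D powr (q + 2) * (\<Sum>k=1..n-1. dker N n k * (xi N k powr (1 / r) * t N k powr (- q)))"
    by (rule sum_distrib_left[symmetric])
  finally have sum: "(\<Sum>k=1..n-1. integral {t N (k - 1)..t N k} (\<lambda>x. ker N n x * deriv (quadratic_interpolant (t N) v k) x))
    \<le> Z s - Z (t N (n - 1)) + 4 * D powr (q + 2) * (\<Sum>k=1..n-1. dker N n k * (xi N k powr (1 / r) * t N k powr (- q)))"
    by simp
  have "Z (ts N n) \<le> Z (t N (n - 1))"
    unfolding Z_def using barrier_potential_decreasing[OF q _ _ e s sn, of "ts N n"] tlt beta by auto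
  then show ?thesis using sum last unfolding G Z_def by linarith
qed

abbreviation eps :: real where "eps \<equiv> (1 - \<beta>) / (2 * r)"

lemma eps_pos: "0 < eps" using beta r_ge_1 by simp

lemma deriv_linear: "n \<in> {1..N} \<Longrightarrow>
  \<delta> N (\<lambda>k. a * v k + b * w k) n = a * \<delta> N v n + b * \<delta> N w n"
  unfolding deriv_eq_g sum_distrib_left sum.distrib[symmetric]
  by (intro sum.cong) (auto simp: algebra_simps)

lemma deriv_jump:
  assumes "n \<in> {1..N}"
  shows "\<delta> N (\<lambda>k. if k = 0 then 0 else a) n = g N n 1 * a"
proof -
  have "(\<Sum>k=1..n. g N n k * ((if k = 0 then 0 else a) - (if k - 1 = 0 then 0 else a)))
     = (\<Sum>k=1..n. if k = 1 then g N n 1 * a else 0)"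
    by (intro sum.cong) auto
  then show ?thesis unfolding deriv_eq_g[OF assms] using assms by simp
qed

lemma g_first_lower:
  assumes "n \<in> {1..N}"
  shows "ts N n powr (- \<beta>) \<le> Gamma (1 - \<beta>) * g N n 1" "t N n powr (- \<beta>) \<le> Gamma (1 - \<beta>) * g N n 1"
  using g_lower[of 1 n N] t_0[of N] assms Gam_pos by (auto simp: divide_le_eq mult.commute)

text \<open>The barrier jumps in the first step to \<open>barrier_fun q e s s\<close> with \<open>s = t p\<close>, is constant until \<open>t p\<close>
and decays afterwards, where \<open>q = m - \<beta>\<close>.  The gain of the potential is of order
\<open>(s / t n) powr eps * t n powr (- m)\<close>, while the discretization error is of order
\<open>\<xi> n powr (2 * eps) * t n powr (- m)\<close>, smaller by the factor \<open>\<xi> p powr (2 * eps)\<close>.  Starting the decay only at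
the node \<open>p\<close>, fixed independently of \<open>N\<close>, makes this factor as small as needed.\<close>

lemma decaying_barrier_steep:
  assumes m: "\<beta> < m" "m \<le> 1"
  shows "\<exists>p\<ge>1. \<exists>c>0. \<exists>K>0. \<forall>N\<ge>p. \<exists>V. V 0 = 0 \<and>
    (\<forall>n\<in>{1..N}. 0 \<le> V n \<and> V n \<le> K * t N n powr (- \<beta>) \<and> c * (xi N n powr eps * t N n powr (- m)) \<le> \<delta> N V n)"
proof -
  define q where "q = m - \<beta>"
  define e where "e = eps"
  have q: "0 < q" "q \<le> 1 - \<beta>" using m by (auto simp: q_def)
  have e: "0 < e" using eps_pos by (simp add: e_def)
  have e2: "(1 - \<beta>) / r = 2 * e" using r_ge_1 by (simp add: e_def field_simps)
  define c0 where "c0 = e / (2 * (q + e))"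
  have c0: "0 < c0" using q e by (simp add: c0_def)
  have e_le: "2 * e \<le> 1 - \<beta>"
    unfolding e2[symmetric] using r_ge_1 beta by (simp add: divide_le_eq mult_le_cancel_left1)
  have "2 * e \<le> 1 / r - \<beta> / r" unfolding e2[symmetric] by (simp add: diff_divide_distrib)
  moreover have "2 * e - - q < 1" using e_le q beta by linarith
  ultimately obtain C where C: "0 < C" "\<And>N n. n \<in> {1..N} \<Longrightarrow>
      (\<Sum>k=1..n-1. dker N n k * (xi N k powr (1 / r) * t N k powr (- q)))
      \<le> C * (xi N n powr (2 * e) * t N n powr (- q - \<beta>))"
    using kernel_weighted_sum[of "1 / r" "2 * e" "- q"] r_ge_1 by force
  define Ce where "Ce = 4 * D powr (q + 2) * C + D powr (q + 2) / (1 - \<beta>)"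
  have Ce: "0 < Ce" unfolding Ce_def using C D_ge_1 beta by (intro add_pos_pos) auto
  \<comment> \<open>the discretization error may use up half of the gain\<close>
  define \<eta> where "\<eta> = c0 / (2 * Ce)"
  have eta: "0 < \<eta>" using c0 Ce by (simp add: \<eta>_def)
  \<comment> \<open>\<open>\<xi> p\<close> is at most \<open>D / p powr r\<close>, so a large \<open>p\<close> makes \<open>\<xi> p powr (2 * e) \<le> \<eta>\<close>, whatever \<open>N\<close> is\<close>
  obtain p :: nat where p: "max 1 (D / \<eta> powr (1 / (2 * e))) \<le> real p" using real_arch_simple by blast
  then have p1: "1 \<le> p" by simp
  have Dp: "D / real p powr r \<le> \<eta> powr (1 / (2 * e))"
  proof -
    have "D \<le> real p * \<eta> powr (1 / (2 * e))" using p eta by (simp add: divide_le_eq)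
    also have "\<dots> \<le> real p powr r * \<eta> powr (1 / (2 * e))"
      using powr_mono[of 1 r "real p"] r_ge_1 p1 by (intro mult_right_mono) auto
    finally show ?thesis using p1 by (simp add: divide_le_eq mult.commute)
  qed
  define c1 where "c1 = (D * real p powr r) powr (- q) / 2"
  have c1: "0 < c1" using D_ge_1 p1 by (simp add: c1_def)
  define c where "c = min (c0 / 2) c1 / Gamma (1 - \<beta>)"
  have c: "0 < c" using c0 c1 Gam_pos by (simp add: c_def)
  define K where "K = T powr (\<beta> - q)"
  have K: "0 < K" using T_pos by (simp add: K_def)
  have main: "\<exists>V. V 0 = 0 \<and> (\<forall>n\<in>{1..N}. 0 \<le> V n \<and> V n \<le> K * t N n powr (- \<beta>) \<and>
      c * (xi N n powr eps * t N n powr (- m)) \<le> \<delta> N V n)" if N: "p \<le> N" for N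
  proof -
    define s where "s = t N p"
    have s: "0 < s" unfolding s_def using t_pos p1 N by auto
    define Hs where "Hs = barrier_fun q e s s"
    define v where "v k = barrier_fun q e s s - barrier_fun q e s (max (t N k) s)" for k
    define V where "V k = (if k = 0 then 0 else barrier_fun q e s (max (t N k) s))" for k
    have Hs: "s powr (- q) / 2 \<le> Hs" unfolding Hs_def using barrier_fun_bounds[of q e s s] q e s by auto
    have Hs0: "0 \<le> Hs" using Hs by (meson divide_nonneg_pos order_trans powr_ge_zero zero_less_numeral)
    have xip: "xi N p \<le> D / real p powr r"
      using growth_ge[of p N] p1 N s by (simp add: s_def field_simps)
    have V: "V = (\<lambda>k. 1 * (if k = 0 then 0 else Hs) + (- 1) * v k)"
      using t_0[of N] N p1 s by (auto simp: V_def Hs_def v_def max_def)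
    have props: "0 \<le> V n \<and> V n \<le> K * t N n powr (- \<beta>) \<and>
      c * (xi N n powr eps * t N n powr (- m)) \<le> \<delta> N V n" if n: "n \<in> {1..N}" for n
    proof -
      have n1: "1 \<le> n" "n \<le> N" using n by auto
      have tn: "0 < t N n" using t_pos n1 by auto
      have x: "0 < xi N n" "xi N n \<le> 1" using xi_pos xi_le_1 n1 by auto
      have dV: "\<delta> N V n = g N n 1 * Hs - \<delta> N v n"
        unfolding V deriv_linear[OF n] deriv_jump[OF n] by simp
      have b: "max (t N n) s powr (- q) / 2 \<le> V n" "V n \<le> max (t N n) s powr (- q)"
        using barrier_fun_bounds[of q e s "max (t N n) s"] q e s n1 by (auto simp: V_def)
      have V0: "0 \<le> V n" using b(1) by (meson divide_nonneg_pos order_trans powr_ge_zero zero_less_numeral)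
      have "max (t N n) s powr (- q) \<le> t N n powr (- q)" using tn q by (intro powr_mono2') auto
      then have "V n \<le> t N n powr (- q)" using b(2) by linarith
      also have "t N n powr (- q) = t N n powr (\<beta> - q) * t N n powr (- \<beta>)"
        by (simp add: powr_add[symmetric])
      also have "\<dots> \<le> K * t N n powr (- \<beta>)"
        unfolding K_def using tn t_le_T[of n N] n1 q beta by (intro mult_right_mono powr_mono2) auto
      finally have VK: "V n \<le> K * t N n powr (- \<beta>)" .
      have mq: "- m = - q - \<beta>" by (simp add: q_def)
      have "min (c0 / 2) c1 * (xi N n powr e * t N n powr (- q - \<beta>)) \<le> Gamma (1 - \<beta>) * \<delta> N V n"
      proof (cases "p < n")
        case True
        define Z where "Z = barrier_potential \<beta> q e s (ts N n)"
        have sts: "s < ts N n" unfolding s_def using t_less_ts True n1 by auto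
        have tst: "0 < ts N n" "ts N n \<le> t N n" using ts_pos ts_lt n1 by (auto intro: less_imp_le)
        have "Gamma (1 - \<beta>) * \<delta> N v n \<le> Z s - Z (ts N n) +
            4 * D powr (q + 2) * (\<Sum>k=1..n-1. dker N n k * (xi N k powr (1 / r) * t N k powr (- q))) +
            D powr (q + 2) / (1 - \<beta>) * (xi N n powr (2 * e) * t N n powr (- q - \<beta>))"
          using decaying_part_le[OF q e p1 True n1(2)] unfolding Z_def s_def v_def e2 .
        moreover have "4 * D powr (q + 2) * (\<Sum>k=1..n-1. dker N n k * (xi N k powr (1 / r) * t N k powr (- q)))
           \<le> 4 * D powr (q + 2) * (C * (xi N n powr (2 * e) * t N n powr (- q - \<beta>)))"
          using C(2)[OF n] by (intro mult_left_mono) auto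
        ultimately have "Gamma (1 - \<beta>) * \<delta> N v n \<le> Z s - Z (ts N n) + Ce * (xi N n powr (2 * e) * t N n powr (- q - \<beta>))"
          unfolding Ce_def by (simp add: algebra_simps)
        moreover have "Z s - Z (ts N n) \<le> ts N n powr (- \<beta>) * Hs - c0 * (s / ts N n) powr e * ts N n powr (- q - \<beta>)"
          unfolding Z_def c0_def Hs_def using barrier_potential_total[OF q _ _ e s sts] beta by auto
        moreover have "ts N n powr (- \<beta>) * Hs \<le> Gamma (1 - \<beta>) * g N n 1 * Hs"
          using g_first_lower(1)[OF n] Hs0 by (intro mult_right_mono) auto
        moreover have "c0 * ((s / t N n) powr e * t N n powr (- q - \<beta>)) \<le> c0 * ((s / ts N n) powr e * ts N n powr (- q - \<beta>))"
          using c0 s tst tn e q beta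
          by (intro mult_left_mono mult_mono powr_mono2 powr_mono2' divide_left_mono) auto
        moreover have "Ce * (xi N n powr (2 * e) * t N n powr (- q - \<beta>)) \<le> c0 / 2 * ((s / t N n) powr e * t N n powr (- q - \<beta>))"
        proof -
          have "xi N n = xi N p * (s / t N n)" using s by (simp add: s_def)
          moreover have "0 < xi N p" using xi_pos p1 N by auto
          ultimately have "xi N n powr (2 * e) = xi N p powr (2 * e) * (s / t N n) powr (2 * e)"
            using s tn by (simp only: powr_mult)
          also have "\<dots> \<le> \<eta> * (s / t N n) powr e"
          proof (rule mult_mono)
            have "xi N p powr (2 * e) \<le> (\<eta> powr (1 / (2 * e))) powr (2 * e)"
              using xip Dp \<open>0 < xi N p\<close> e by (intro powr_mono2) auto
            then show "xi N p powr (2 * e) \<le> \<eta>" using eta e by (simp add: powr_powr)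
            have "s / t N n \<le> 1" using sts tst tn by simp
            then show "(s / t N n) powr (2 * e) \<le> (s / t N n) powr e" using s tn e by (intro powr_mono') auto
          qed (use eta in auto)
          finally have "Ce * (xi N n powr (2 * e) * t N n powr (- q - \<beta>)) \<le>
              Ce * (\<eta> * (s / t N n) powr e * t N n powr (- q - \<beta>))"
            using Ce by (intro mult_left_mono mult_right_mono) auto
          also have "\<dots> = c0 / 2 * ((s / t N n) powr e * t N n powr (- q - \<beta>))"
            using Ce by (simp add: \<eta>_def)
          finally show ?thesis .
        qed
        ultimately have 1: "c0 / 2 * ((s / t N n) powr e * t N n powr (- q - \<beta>)) \<le> Gamma (1 - \<beta>) * \<delta> N V n"
          unfolding dV right_diff_distrib by (simp add: mult.assoc)
        have "t N 1 \<le> s" unfolding s_def using t_le p1 N by auto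
        then have "xi N n powr e \<le> (s / t N n) powr e"
          using x tn e by (intro powr_mono2 divide_right_mono) auto
        then have "min (c0 / 2) c1 * (xi N n powr e * t N n powr (- q - \<beta>)) \<le> c0 / 2 * ((s / t N n) powr e * t N n powr (- q - \<beta>))"
          using c0 by (intro mult_mono mult_right_mono) auto
        then show ?thesis using 1 by linarith
      next
        case False
        \<comment> \<open>before the decay starts only the jump contributes, and finitely many nodes are comparable with \<open>t 1\<close>\<close>
        have "v k = 0" if "k \<le> n" for k
          using t_le[of k p N] that False N by (simp add: v_def s_def max_def)
        then have "\<delta> N v n = 0" unfolding deriv_eq_g[OF n] by (intro sum.neutral) auto
        then have "Gamma (1 - \<beta>) * \<delta> N V n = Gamma (1 - \<beta>) * g N n 1 * Hs" unfolding dV by simp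
        moreover have "t N n powr (- \<beta>) * (s powr (- q) / 2) \<le> Gamma (1 - \<beta>) * g N n 1 * Hs"
          using g_first_lower(2)[OF n] Hs Gam_pos by (intro mult_mono) (auto intro: order_trans[OF powr_ge_zero])
        moreover have "c1 * t N n powr (- q) \<le> s powr (- q) / 2"
        proof -
          have "s \<le> D * (t N 1 * real p powr r)" unfolding s_def using growth_le p1 N by auto
          also have "\<dots> \<le> D * (t N n * real p powr r)"
            using t_le[of 1 n N] n1 D_ge_1 by (intro mult_left_mono mult_right_mono) auto
          finally have "(D * real p powr r * t N n) powr (- q) \<le> s powr (- q)"
            using s q by (intro powr_mono2') (auto simp: mult_ac)
          then show ?thesis unfolding c1_def using tn D_ge_1 by (simp add: powr_mult)
        qed
        moreover have "min (c0 / 2) c1 * (xi N n powr e * t N n powr (- q - \<beta>)) \<le> t N n powr (- \<beta>) * (c1 * t N n powr (- q))"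
        proof -
          have "xi N n powr e \<le> 1" using x e powr_mono2[of e "xi N n" 1] by auto
          then have "min (c0 / 2) c1 * (xi N n powr e * t N n powr (- q - \<beta>)) \<le> c1 * (1 * t N n powr (- q - \<beta>))"
            using c1 by (intro mult_mono mult_right_mono) auto
          moreover have "t N n powr (- \<beta>) * t N n powr (- q) = t N n powr (- q - \<beta>)"
            unfolding powr_add[symmetric] by (rule arg_cong[where f = "(powr) (t N n)"]) simp
          ultimately show ?thesis by (simp add: mult_ac)
        qed
        moreover have "t N n powr (- \<beta>) * (c1 * t N n powr (- q)) \<le> t N n powr (- \<beta>) * (s powr (- q) / 2)"
          using calculation(3) by (intro mult_left_mono) auto
        ultimately show ?thesis by linarith
      qed
      then have "c * (xi N n powr eps * t N n powr (- m)) \<le> \<delta> N V n"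
        unfolding c_def mq e_def[symmetric] using Gam_pos by (simp add: field_simps)
      then show ?thesis using V0 VK by simp
    qed
    have "V 0 = 0" by (simp add: V_def)
    then show ?thesis using props by (intro exI[of _ V]) blast
  qed
  show ?thesis using p1 c K main by blast
qed

text \<open>For \<open>m \<le> \<beta>\<close> the jump alone suffices, because \<open>t powr (- m)\<close> is dominated by
\<open>t powr (- \<beta>)\<close>.\<close>

lemma decaying_barrier:
  assumes m: "0 < m" "m \<le> 1"
  shows "\<exists>p\<ge>1. \<exists>c>0. \<exists>K>0. \<forall>N\<ge>p. \<exists>V. V 0 = 0 \<and>
    (\<forall>n\<in>{1..N}. 0 \<le> V n \<and> V n \<le> K * t N n powr (- \<beta>) \<and> c * (xi N n powr eps * t N n powr (- m)) \<le> \<delta> N V n)"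
proof (cases "\<beta> < m")
  case True
  then show ?thesis using decaying_barrier_steep m by blast
next
  case False
  define c where "c = T powr (m - \<beta>) / Gamma (1 - \<beta>)"
  have c: "0 < c" using Gam_pos T_pos by (simp add: c_def)
  define V :: "nat \<Rightarrow> real" where "V k = (if k = 0 then 0 else 1)" for k
  have "0 \<le> V n \<and> V n \<le> T powr \<beta> * t N n powr (- \<beta>) \<and> c * (xi N n powr eps * t N n powr (- m)) \<le> \<delta> N V n"
    if n: "n \<in> {1..N}" for n N
  proof -
    have n1: "1 \<le> n" "n \<le> N" using n by auto
    have tn: "0 < t N n" "t N n \<le> T" using t_pos[of n N] t_le_T[of n N] n1 by auto
    have x: "0 < xi N n" "xi N n \<le> 1" using xi_pos xi_le_1 n1 by auto
    have "1 = t N n powr \<beta> * t N n powr (- \<beta>)" using tn by (simp add: powr_add[symmetric])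
    also have "\<dots> \<le> T powr \<beta> * t N n powr (- \<beta>)" using tn beta by (intro mult_right_mono powr_mono2) auto
    finally have 1: "V n \<le> T powr \<beta> * t N n powr (- \<beta>)" using n1 by (simp add: V_def)
    have "T powr (m - \<beta>) * (xi N n powr eps * t N n powr (- m)) \<le> t N n powr (m - \<beta>) * (1 * t N n powr (- m))"
      using tn x eps_pos False m powr_mono2[of eps "xi N n" 1] by (intro mult_mono powr_mono2') auto
    also have "\<dots> = t N n powr (- \<beta>)" by (simp add: powr_add[symmetric])
    also have "\<dots> \<le> Gamma (1 - \<beta>) * \<delta> N V n"
      using g_first_lower(2)[OF n] deriv_jump[OF n, of 1] unfolding V_def by simp
    finally have "c * (xi N n powr eps * t N n powr (- m)) \<le> \<delta> N V n"
      unfolding c_def using Gam_pos by (simp add: field_simps)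
    then show ?thesis using 1 by (simp add: V_def)
  qed
  moreover have "V 0 = 0" by (simp add: V_def)
  moreover have "0 < T powr \<beta>" using T_pos by simp
  ultimately show ?thesis using c by (intro exI[of _ "1::nat"] conjI exI[of _ c] exI[of _ "T powr \<beta>"] allI impI exI[of _ V]) auto
qed

section \<open>Stability at the final time\<close>

text \<open>The comparison function is \<open>a * V + b * W\<close> with the decaying barrier \<open>V\<close> and the exponential barrier \<open>W\<close>.
The terms \<open>lam * (V n + V (n - 1))\<close> are at most a multiple of \<open>t n powr (- \<beta>)\<close>, and \<open>W\<close> absorbs them.  At the final time both
barriers are bounded independently of \<open>N\<close>.\<close>

lemma stability:
  assumes m: "0 < m" "m \<le> 1" and lam: "0 \<le> lam"
  shows "\<exists>K>0. \<exists>\<tau>0>0. \<forall>N\<ge>1. property_P1 \<beta> \<sigma> (t N) N \<longrightarrow> (\<forall>n\<in>{1..N}. dt N n \<le> \<tau>0) \<longrightarrow>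
    (\<forall>E \<theta>1 \<theta>2. 0 \<le> \<theta>1 \<longrightarrow> 0 \<le> \<theta>2 \<longrightarrow> E 0 = 0 \<longrightarrow>
      (\<forall>n\<in>{1..N}. \<delta> N E n \<le> lam * (E n + E (n - 1)) +
          (\<theta>1 * (xi N n powr eps * t N n powr (- m)) + \<theta>2 * t N n powr (- \<beta>))) \<longrightarrow>
      E N \<le> K * (\<theta>1 + \<theta>2))"
proof -
  obtain p c K1 where p: "1 \<le> p" and c: "0 < c" and K1: "0 < K1" and
    V: "\<And>N. p \<le> N \<Longrightarrow> \<exists>V. V 0 = 0 \<and> (\<forall>n\<in>{1..N}. 0 \<le> V n \<and> V n \<le> K1 * t N n powr (- \<beta>) \<and>
      c * (xi N n powr eps * t N n powr (- m)) \<le> \<delta> N V n)"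
    using decaying_barrier[OF m] by blast
  obtain \<tau>1 c2 K2 where t1: "0 < \<tau>1" and c2: "0 < c2" and K2: "0 < K2" and
    W: "\<And>N. \<lbrakk>1 \<le> N; property_P1 \<beta> \<sigma> (t N) N; \<forall>n\<in>{1..N}. dt N n \<le> \<tau>1\<rbrakk> \<Longrightarrow>
      \<exists>W. W 0 = 0 \<and> (\<forall>n\<in>{1..N}. 0 \<le> W n \<and> W n \<le> K2 \<and>
         c2 * t N n powr (- \<beta>) + lam * (W n + W (n - 1)) \<le> \<delta> N W n)"
    using exponential_barrier[OF lam] by metis
  \<comment> \<open>\<open>\<tau>2\<close> makes the diagonal coefficient exceed \<open>lam\<close>, and \<open>T / p\<close> forces \<open>p \<le> N\<close>\<close>
  define \<tau>2 where "\<tau>2 = (Gamma (1 - \<beta>) * (lam + 1)) powr (- (1 / \<beta>))"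
  have t2: "0 < \<tau>2" using Gam_pos lam by (simp add: \<tau>2_def)
  define \<tau>0 where "\<tau>0 = min \<tau>1 (min \<tau>2 (T / real p))"
  have t0: "0 < \<tau>0" using t1 t2 T_pos p by (simp add: \<tau>0_def)
  define L where "L = lam * K1 * (1 + D powr \<beta>) / c"
  have L: "0 \<le> L" using lam K1 c by (simp add: L_def)
  define K where "K = K1 * T powr (- \<beta>) / c + (1 + L) / c2 * K2"
  have L1: "0 < 1 + L" using L by simp
  have K: "0 < K" unfolding K_def
    by (rule add_pos_pos) (use K1 T_pos c c2 K2 L1 in \<open>auto intro!: mult_pos_pos divide_pos_pos\<close>)
  have main: "E N \<le> K * (\<theta>1 + \<theta>2)"
    if N: "1 \<le> N" and P1: "property_P1 \<beta> \<sigma> (t N) N" and small: "\<forall>n\<in>{1..N}. dt N n \<le> \<tau>0"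
      and th: "0 \<le> \<theta>1" "0 \<le> \<theta>2" and E0: "E 0 = 0"
      and E: "\<forall>n\<in>{1..N}. \<delta> N E n \<le> lam * (E n + E (n - 1)) +
          (\<theta>1 * (xi N n powr eps * t N n powr (- m)) + \<theta>2 * t N n powr (- \<beta>))"
    for N E \<theta>1 \<theta>2
  proof -
    have "T = (\<Sum>n=1..N. dt N n)"
      using sum_telescope''[of 0 N "t N"] N t_0[OF N] t_N[OF N] by (simp add: mesh_step_def)
    also have "\<dots> \<le> (\<Sum>n=1..N. \<tau>0)" using small by (intro sum_mono) auto
    also have "\<dots> = real N * \<tau>0" by simp
    also have "\<dots> \<le> real N * (T / real p)" by (rule mult_left_mono) (auto simp: \<tau>0_def)
    finally have pN: "p \<le> N" using T_pos p by (simp add: field_simps)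
    obtain V where V0: "V 0 = 0" and V: "\<And>n. n \<in> {1..N} \<Longrightarrow> 0 \<le> V n" "\<And>n. n \<in> {1..N} \<Longrightarrow> V n \<le> K1 * t N n powr (- \<beta>)"
      "\<And>n. n \<in> {1..N} \<Longrightarrow> c * (xi N n powr eps * t N n powr (- m)) \<le> \<delta> N V n"
      using V[OF pN] by blast
    have "\<forall>n\<in>{1..N}. dt N n \<le> \<tau>1" using small by (auto simp: \<tau>0_def)
    then obtain W where W0: "W 0 = 0" and W: "\<And>n. n \<in> {1..N} \<Longrightarrow> 0 \<le> W n" "\<And>n. n \<in> {1..N} \<Longrightarrow> W n \<le> K2"
      "\<And>n. n \<in> {1..N} \<Longrightarrow> c2 * t N n powr (- \<beta>) + lam * (W n + W (n - 1)) \<le> \<delta> N W n"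
      using W[OF N P1] by blast
    define a where "a = \<theta>1 / c"
    define b where "b = (\<theta>2 + L * \<theta>1) / c2"
    have ab: "0 \<le> a" "0 \<le> b" using th c c2 L by (auto simp: a_def b_def)
    define B where "B k = a * V k + b * W k" for k
    have BN: "B N \<le> K * (\<theta>1 + \<theta>2)"
    proof -
      have NN: "N \<in> {1..N}" using N by simp
      have "B N \<le> a * (K1 * T powr (- \<beta>)) + b * K2"
        unfolding B_def using V(2)[OF NN] W(2)[OF NN] ab t_N[OF N] by (intro add_mono mult_left_mono) auto
      also have "b \<le> (1 + L) / c2 * (\<theta>1 + \<theta>2)"
        unfolding b_def using c2 L th by (simp add: divide_right_mono algebra_simps)
      also have "a * (K1 * T powr (- \<beta>)) \<le> K1 * T powr (- \<beta>) / c * (\<theta>1 + \<theta>2)"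
        unfolding a_def using th K1 c by (simp add: field_simps)
      finally show ?thesis using K2 unfolding K_def by (simp add: algebra_simps)
    qed
    have glam: "lam < g N n n" if n: "1 \<le> n" "n \<le> N" for n
    proof -
      have "lam + 1 = \<tau>2 powr (- \<beta>) / Gamma (1 - \<beta>)"
        unfolding \<tau>2_def using Gam_pos less_imp_neq[OF Gam_pos, symmetric] lam beta by (simp add: powr_powr)
      also have "\<dots> \<le> dt N n powr (- \<beta>) / Gamma (1 - \<beta>)"
        using small n dt_pos[OF n] beta Gam_pos by (intro divide_right_mono powr_mono2') (auto simp: \<tau>0_def)
      also have "\<dots> \<le> g N n n" using g_lower(1)[of n n N] n by (simp add: mesh_step_def)
      finally show ?thesis by simp
    qed
    have "E N \<le> B N"
    proof (rule comparison_principle[where g = "g N" and lam = lam and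
          R = "\<lambda>n. \<theta>1 * (xi N n powr eps * t N n powr (- m)) + \<theta>2 * t N n powr (- \<beta>)"])
      fix n assume n: "1 \<le> n" "n \<le> N"
      then have nN: "n \<in> {1..N}" by simp
      show "(\<Sum>k = 1..n. g N n k * (E k - E (k - 1))) \<le> lam * (E n + E (n - 1)) +
           (\<theta>1 * (xi N n powr eps * t N n powr - m) + \<theta>2 * t N n powr - \<beta>)"
        using E[rule_format, OF nN] unfolding deriv_eq_g[OF nN] .
      have Vn: "V n + V (n - 1) \<le> K1 * (1 + D powr \<beta>) * t N n powr (- \<beta>)"
      proof (cases "n = 1")
        case True
        then show ?thesis using V(2)[OF nN] V0 K1 by (simp add: algebra_simps add_increasing2)
      next
        case False
        then have n2: "n - 1 \<in> {1..N}" "2 \<le> n" using n by auto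
        have "t N n / D \<le> t N (n - 1)" using ratio[of n N] n2 n D_ge_1 by (simp add: divide_le_eq mult.commute)
        then have "t N (n - 1) powr (- \<beta>) \<le> (t N n / D) powr (- \<beta>)"
          using t_pos[OF n] D_ge_1 beta by (intro powr_mono2') auto
        also have "\<dots> = D powr \<beta> * t N n powr (- \<beta>)"
          using t_pos[OF n] D_ge_1 by (simp add: powr_divide powr_minus field_simps)
        finally have "K1 * t N (n - 1) powr (- \<beta>) \<le> K1 * (D powr \<beta> * t N n powr (- \<beta>))" using K1 by simp
        then show ?thesis using V(2)[OF nN] V(2)[OF n2(1)] by (simp add: algebra_simps)
      qed
      have 1: "a * (lam * (V n + V (n - 1))) \<le> L * \<theta>1 * t N n powr (- \<beta>)"
      proof -
        have "a * (lam * (V n + V (n - 1))) \<le> a * (lam * (K1 * (1 + D powr \<beta>) * t N n powr (- \<beta>)))"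
          using Vn ab lam by (intro mult_left_mono) auto
        then show ?thesis by (simp add: a_def L_def mult_ac)
      qed
      have 2: "\<theta>1 * (xi N n powr eps * t N n powr (- m)) \<le> a * \<delta> N V n"
        using mult_left_mono[OF V(3)[OF nN] ab(1)] c by (simp add: a_def)
      have 3: "(\<theta>2 + L * \<theta>1) * t N n powr (- \<beta>) + b * (lam * (W n + W (n - 1))) \<le> b * \<delta> N W n"
        using mult_left_mono[OF W(3)[OF nN] ab(2)] c2 by (simp add: b_def distrib_left)
      have "lam * (B n + B (n - 1)) = a * (lam * (V n + V (n - 1))) + b * (lam * (W n + W (n - 1)))"
        by (simp add: B_def algebra_simps)
      then have "lam * (B n + B (n - 1)) + (\<theta>1 * (xi N n powr eps * t N n powr - m) + \<theta>2 * t N n powr - \<beta>)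
         \<le> a * \<delta> N V n + b * \<delta> N W n"
        using 1 2 3 by (simp add: distrib_right)
      also have "\<dots> = (\<Sum>k = 1..n. g N n k * (B k - B (k - 1)))"
        using deriv_linear[OF nN, of a V b W] unfolding deriv_eq_g[OF nN] B_def by simp
      finally show "lam * (B n + B (n - 1)) + (\<theta>1 * (xi N n powr eps * t N n powr - m) + \<theta>2 * t N n powr - \<beta>)
         \<le> (\<Sum>k = 1..n. g N n k * (B k - B (k - 1)))" .
    qed (use P1_mono[OF P1] glam lam E0 V0 W0 in \<open>auto simp: B_def intro: less_imp_le\<close>)
    then show ?thesis using BN by simp
  qed
  show ?thesis using K t0 main by blast
qed

end

section \<open>Weakly singular functions and the truncation error\<close>

text \<open>The functions \<open>v l\<close> are the derivatives of \<open>v 0\<close>, given as a sequence so that sums and differences,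
for which the derivatives are known, stay in the class without computing iterated derivatives again.  At \<open>0\<close> only
continuity of \<open>v 0\<close> is required, at \<open>T\<close> the derivatives are one-sided.\<close>

definition weakly_singular :: "real \<Rightarrow> real \<Rightarrow> real \<Rightarrow> (nat \<Rightarrow> real \<Rightarrow> real) \<Rightarrow> bool" where
  "weakly_singular T \<beta> K v \<longleftrightarrow> continuous_on {0..T} (v 0) \<and>
     (\<forall>l<3. \<forall>s\<in>{0<..T}. (v l has_real_derivative v (Suc l) s) (at s within {0..T})) \<and>
     (\<forall>l\<in>{1..3}. \<forall>s\<in>{0<..T}. \<bar>v l s\<bar> \<le> K * s powr (\<beta> - real l))"

lemma weakly_singular_deriv:
  assumes "weakly_singular T \<beta> K v" "l < 3" "0 < s" "s < T"
  shows "(v l has_real_derivative v (Suc l) s) (at s)"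
proof -
  have "(v l has_real_derivative v (Suc l) s) (at s within {0..T})"
    using assms by (auto simp: weakly_singular_def)
  moreover have "at s within {0..T} = at s" using assms by (intro at_within_interior) auto
  ultimately show ?thesis by simp
qed

lemma weakly_singular_bound_at:
  assumes "weakly_singular T \<beta> K v" "1 \<le> l" "l \<le> 3" "0 < s" "s \<le> T"
  shows "\<bar>v l s\<bar> \<le> K * s powr (\<beta> - real l)"
  using assms by (auto simp: weakly_singular_def)

lemma weakly_singular_const_nonneg:
  assumes "weakly_singular T \<beta> K v" "0 < T"
  shows "0 \<le> K"
proof -
  have "0 \<le> K * T powr (\<beta> - 1)" using weakly_singular_bound_at[OF assms(1), of 1 T] assms(2) by simp
  then show ?thesis using assms(2) by (simp add: zero_le_mult_iff)
qed

lemma weakly_singular_continuous: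
  assumes "weakly_singular T \<beta> K v" "l < 3"
  shows "continuous_on {0<..T} (v l)"
proof -
  have "continuous (at s within {0<..T}) (v l)" if "s \<in> {0<..T}" for s
  proof -
    have "(v l has_real_derivative v (Suc l) s) (at s within {0..T})"
      using assms that by (auto simp: weakly_singular_def)
    then have "continuous (at s within {0..T}) (v l)" by (rule DERIV_continuous)
    then show ?thesis by (rule continuous_within_subset) auto
  qed
  then show ?thesis by (simp add: continuous_on_eq_continuous_within)
qed

lemma weakly_singular_increment:
  assumes v: "weakly_singular T \<beta> K v" and l: "l < 3" and x: "0 < x" "x \<le> y" "y \<le> T" and b: "\<beta> < 1"
  shows "\<bar>v l y - v l x\<bar> \<le> K * x powr (\<beta> - real l - 1) * (y - x)"
proof (cases "x = y")
  case False
  have "continuous_on {x..y} (v l)"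
    using weakly_singular_continuous[OF v l] by (rule continuous_on_subset) (use x in auto)
  moreover have "v l differentiable (at z)" if "x < z" "z < y" for z
    using weakly_singular_deriv[OF v l, of z] that x real_differentiable_def by fastforce
  ultimately obtain d z where z: "x < z" "z < y" "DERIV (v l) z :> d" "v l y - v l x = (y - x) * d"
    using MVT[of x y "v l"] x False by (metis less_eq_real_def)
  have "d = v (Suc l) z" using weakly_singular_deriv[OF v l, of z] z x DERIV_unique by force
  moreover have "\<bar>v (Suc l) z\<bar> \<le> K * z powr (\<beta> - real (Suc l))"
    using weakly_singular_bound_at[OF v, of "Suc l" z] l z x by auto
  moreover have "K * z powr (\<beta> - real (Suc l)) \<le> K * x powr (\<beta> - real (Suc l))"
    using weakly_singular_const_nonneg[OF v] z x b by (intro mult_left_mono powr_mono2') auto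
  ultimately have "\<bar>d\<bar> \<le> K * x powr (\<beta> - real l - 1)" by (simp add: algebra_simps)
  then show ?thesis unfolding z(4) abs_mult using z by (simp add: mult.commute mult_left_mono)
qed simp

text \<open>Near \<open>0\<close> no bound for the derivative is uniform, but its singularity is integrable:
\<open>v 0\<close> is compared with \<open>\<plusminus> K / \<beta> * s powr \<beta>\<close>, whose derivative dominates.\<close>

lemma weakly_singular_oscillation:
  assumes v: "weakly_singular T \<beta> K v" and x: "0 \<le> x" "x \<le> y" "y \<le> T" and b: "0 < \<beta>"
  shows "\<bar>v 0 y - v 0 x\<bar> \<le> K / \<beta> * y powr \<beta>"
proof -
  have c: "continuous_on {x..y} (v 0)"
    using v x unfolding weakly_singular_def by (auto intro: continuous_on_subset)
  have cp: "continuous_on {x..y} (\<lambda>s. s powr \<beta>)"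
    using x b by (intro continuous_on_powr' continuous_intros) auto
  have dp: "((\<lambda>s. K / \<beta> * s powr \<beta>) has_real_derivative K * s powr (\<beta> - 1)) (at s)" if "x < s" for s
    using that x b by (auto intro!: derivative_eq_intros)
  have d: "(v 0 has_real_derivative v 1 s) (at s)" "\<bar>v 1 s\<bar> \<le> K * s powr (\<beta> - 1)" if "x < s" "s < y" for s
    using weakly_singular_deriv[OF v, of 0 s] weakly_singular_bound_at[OF v, of 1 s] that x by auto
  have "K / \<beta> * x powr \<beta> - v 0 x \<le> K / \<beta> * y powr \<beta> - v 0 y"
  proof (rule DERIV_nonneg_imp_increasing_open[OF x(2)])
    show "continuous_on {x..y} (\<lambda>s. K / \<beta> * s powr \<beta> - v 0 s)"
      by (intro continuous_on_diff continuous_on_mult continuous_on_const c cp)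
    fix s assume s: "x < s" "s < y"
    show "\<exists>d. ((\<lambda>s. K / \<beta> * s powr \<beta> - v 0 s) has_real_derivative d) (at s) \<and> 0 \<le> d"
      using DERIV_diff[OF dp[OF s(1)] d(1)[OF s]] d(2)[OF s] by (intro exI[of _ "K * s powr (\<beta> - 1) - v 1 s"]) auto
  qed
  moreover have "K / \<beta> * x powr \<beta> + v 0 x \<le> K / \<beta> * y powr \<beta> + v 0 y"
  proof (rule DERIV_nonneg_imp_increasing_open[OF x(2)])
    show "continuous_on {x..y} (\<lambda>s. K / \<beta> * s powr \<beta> + v 0 s)"
      by (intro continuous_on_add continuous_on_mult continuous_on_const c cp)
    fix s assume s: "x < s" "s < y"
    show "\<exists>d. ((\<lambda>s. K / \<beta> * s powr \<beta> + v 0 s) has_real_derivative d) (at s) \<and> 0 \<le> d"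
      using DERIV_add[OF dp[OF s(1)] d(1)[OF s]] d(2)[OF s] by (intro exI[of _ "K * s powr (\<beta> - 1) + v 1 s"]) auto
  qed
  moreover have "0 \<le> K / \<beta> * x powr \<beta>"
  proof (cases "0 < T")
    case True
    then show ?thesis using weakly_singular_const_nonneg[OF v True] b by auto
  next
    case False
    then have "x = 0" using x by linarith
    then show ?thesis by simp
  qed
  ultimately show ?thesis by linarith
qed

text \<open>Subtracting a multiple of the cubic polynomial of the nodes produces a fourth zero at \<open>s\<close>; Rolle's
theorem on three levels then yields a point where the third derivative equals six times the multiplier.\<close>

lemma three_point_interpolation_error:
  fixes e0 e1 e2 e3 :: "real \<Rightarrow> real"
  assumes x: "x0 < x1" "x1 < x2" and zero: "e0 x0 = 0" "e0 x1 = 0" "e0 x2 = 0"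
    and cont: "continuous_on {x0..x2} e0"
    and d: "\<And>s. \<lbrakk>x0 < s; s < x2\<rbrakk> \<Longrightarrow> (e0 has_real_derivative e1 s) (at s)"
      "\<And>s. \<lbrakk>x0 < s; s < x2\<rbrakk> \<Longrightarrow> (e1 has_real_derivative e2 s) (at s)"
      "\<And>s. \<lbrakk>x0 < s; s < x2\<rbrakk> \<Longrightarrow> (e2 has_real_derivative e3 s) (at s)"
    and M: "\<And>s. \<lbrakk>x0 < s; s < x2\<rbrakk> \<Longrightarrow> \<bar>e3 s\<bar> \<le> M"
    and s: "x0 \<le> s" "s \<le> x1"
  shows "\<bar>e0 s\<bar> \<le> M * ((s - x0) * (x1 - s) * (x2 - s))"
proof (cases "s = x0 \<or> s = x1")
  case False
  then have s: "x0 < s" "s < x1" using s by auto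
  define w where "w y = (y - x0) * (y - x1) * (y - x2)" for y
  define w1 where "w1 y = 3 * y\<^sup>2 - 2 * (x0 + x1 + x2) * y + (x0 * x1 + x0 * x2 + x1 * x2)" for y
  define w2 where "w2 y = 6 * y - 2 * (x0 + x1 + x2)" for y
  have dw: "(w has_real_derivative w1 y) (at y)" "(w1 has_real_derivative w2 y) (at y)"
    "(w2 has_real_derivative 6) (at y)" for y
    unfolding w_def w1_def w2_def
    by (auto intro!: derivative_eq_intros simp: algebra_simps power2_eq_square)
  have ws: "w s \<noteq> 0" using s x by (auto simp: w_def)
  \<comment> \<open>the multiplier that puts a fourth zero at \<open>s\<close>\<close>
  define k where "k = e0 s / w s"
  have step: "\<exists>z. a < z \<and> z < b \<and> f' z = 0"
    if h: "a < b" "f a = f b" "continuous_on {a..b} f" and df: "\<And>z. \<lbrakk>a < z; z < b\<rbrakk> \<Longrightarrow> (f has_real_derivative f' z) (at z)"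
    for a b and f f' :: "real \<Rightarrow> real"
  proof -
    have "f differentiable (at z)" if "a < z" "z < b" for z
      using df[OF that] real_differentiable_def by blast
    then obtain z where "a < z" "z < b" "DERIV f z :> 0" using Rolle[OF h] by blast
    then show ?thesis using df[of z] DERIV_unique by blast
  qed
  define p0 where "p0 y = e0 y - k * w y" for y
  define p1 where "p1 y = e1 y - k * w1 y" for y
  define p2 where "p2 y = e2 y - k * w2 y" for y
  have dp: "(p0 has_real_derivative p1 y) (at y)" "(p1 has_real_derivative p2 y) (at y)"
    "(p2 has_real_derivative (e3 y - k * 6)) (at y)" if "x0 < y" "y < x2" for y
    unfolding p0_def p1_def p2_def using that d dw by (auto intro!: DERIV_diff DERIV_cmult)
  have c0: "continuous_on {x0..x2} p0"
    unfolding p0_def w_def by (intro continuous_intros cont)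
  have p0: "p0 x0 = 0" "p0 s = 0" "p0 x1 = 0" "p0 x2 = 0"
    using zero ws by (auto simp: p0_def k_def) (auto simp: w_def)
  have cp: "continuous_on {a..b} p1" "continuous_on {a..b} p2" if "x0 < a" "b < x2" for a b
    using dp that by (meson DERIV_atLeastAtMost_imp_continuous_on less_le_trans le_less_trans)+
  obtain z1 where z1: "x0 < z1" "z1 < s" "p1 z1 = 0"
    using step[of x0 s p0 p1] p0 s x dp continuous_on_subset[OF c0] by fastforce
  obtain z2 where z2: "s < z2" "z2 < x1" "p1 z2 = 0"
    using step[of s x1 p0 p1] p0 s x dp continuous_on_subset[OF c0] by fastforce
  obtain z3 where z3: "x1 < z3" "z3 < x2" "p1 z3 = 0"
    using step[of x1 x2 p0 p1] p0 s x dp continuous_on_subset[OF c0] by fastforce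
  obtain y1 where y1: "z1 < y1" "y1 < z2" "p2 y1 = 0"
    using step[of z1 z2 p1 p2] z1 z2 x dp cp by fastforce
  obtain y2 where y2: "z2 < y2" "y2 < z3" "p2 y2 = 0"
    using step[of z2 z3 p1 p2] z1 z2 z3 x s dp cp by fastforce
  obtain z where z: "y1 < z" "z < y2" "e3 z - k * 6 = 0"
    using step[of y1 y2 p2 "\<lambda>y. e3 y - k * 6"] y1 y2 z1 z2 z3 x s dp cp by fastforce
  have "\<bar>e3 z\<bar> \<le> M" using M[of z] z y1 y2 z1 z2 z3 x s by auto
  then have "\<bar>k\<bar> \<le> M" using z(3) by auto
  moreover have "\<bar>w s\<bar> = (s - x0) * (x1 - s) * (x2 - s)" unfolding w_def using s x by (simp add: abs_mult)
  moreover have "\<bar>e0 s\<bar> = \<bar>k\<bar> * \<bar>w s\<bar>" using ws by (simp add: k_def abs_divide)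
  moreover have "0 \<le> \<bar>w s\<bar>" by simp
  ultimately show ?thesis by (metis mult_right_mono)
qed (use zero in auto)

text \<open>This is what singles out \<open>\<sigma> = 1 - \<beta> / 2\<close>: the slope of a linear interpolant is exact at the
midpoint up to second order, and the first-order part of its error is orthogonal to the kernel on
\<open>{a..s}\<close>.\<close>

lemma kernel_integral_zero_mean:
  fixes a d \<beta> :: real
  assumes "0 < d" "0 < \<beta>" "\<beta> < 1"
  defines "s \<equiv> a + (1 - \<beta> / 2) * d"
  shows "((\<lambda>x. (s - x) powr (- \<beta>) * (x - (a + d / 2))) has_integral 0) {a..s}"
proof -
  have sa: "0 < s - a" "s - a = (1 - \<beta> / 2) * d" using assms by (auto simp: s_def)
  have 1: "((\<lambda>x. (s - (a + d / 2)) * (s - x) powr (- \<beta>)) has_integral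
      (s - (a + d / 2)) * ((s - a) powr (1 - \<beta>) / (1 - \<beta>))) {a..s}"
    using assms sa by (intro has_integral_mult_right kernel_integral) auto
  have 2: "((\<lambda>x. (s - x) powr (- (\<beta> - 1))) has_integral (s - a) powr (1 - (\<beta> - 1)) / (1 - (\<beta> - 1))) {a..s}"
    using assms sa by (intro kernel_integral) auto
  have I: "((\<lambda>x. (s - (a + d / 2)) * (s - x) powr (- \<beta>) - (s - x) powr (- (\<beta> - 1))) has_integral
     ((s - (a + d / 2)) * ((s - a) powr (1 - \<beta>) / (1 - \<beta>)) - (s - a) powr (1 - (\<beta> - 1)) / (1 - (\<beta> - 1)))) {a..s}"
    by (rule has_integral_diff[OF 1 2])
  have Z: "(s - (a + d / 2)) * ((s - a) powr (1 - \<beta>) / (1 - \<beta>)) - (s - a) powr (1 - (\<beta> - 1)) / (1 - (\<beta> - 1)) = 0"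
  proof -
    have P: "(s - a) powr (1 - (\<beta> - 1)) = (s - a) powr (1 - \<beta>) * (s - a)"
      using sa(1) powr_add[of "s - a" "1 - \<beta>" 1] by (simp add: algebra_simps)
    have Q: "s - (a + d / 2) = (1 - \<beta>) / 2 * d" using sa(2) by (simp add: algebra_simps)
    have R: "(1 - \<beta>) / 2 * d * (A / (1 - \<beta>)) - A * (s - a) / (1 - (\<beta> - 1)) = 0" for A
    proof -
      have "(s - a) / (1 - (\<beta> - 1)) = d / 2" unfolding sa(2) using assms(2,3) by (simp add: field_simps)
      then have "A * (s - a) / (1 - (\<beta> - 1)) = A * (d / 2)" by (metis times_divide_eq_right)
      moreover have "(1 - \<beta>) / 2 * d * (A / (1 - \<beta>)) = A * (d / 2)" using assms(3) by (simp add: field_simps)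
      ultimately show ?thesis by linarith
    qed
    show ?thesis unfolding P Q by (rule R)
  qed
  have eq: "(s - (a + d / 2)) * (s - x) powr (- \<beta>) - (s - x) powr (- (\<beta> - 1)) = (s - x) powr (- \<beta>) * (x - (a + d / 2))"
    if "x \<in> {a..s}" for x
  proof (cases "x = s")
    case False
    then have "(s - x) powr (- (\<beta> - 1)) = (s - x) powr (- \<beta>) * (s - x)"
      using that powr_add[of "s - x" "- \<beta>" 1] by (simp add: algebra_simps)
    then show ?thesis by (simp add: algebra_simps)
  qed simp
  show ?thesis by (rule has_integral_eq[OF eq I[unfolded Z]])
qed

lemma beta_kernel_integral:
  fixes a c s :: real
  assumes "a < 1" "0 < c" "0 < s"
  shows "((\<lambda>x. (s - x) powr (- a) * x powr (c - 1)) has_integral s powr (c - a) * Beta c (1 - a)) {0..s}"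
proof -
  have "((\<lambda>x. x powr (c - 1) * (1 - x) powr (1 - a - 1)) has_integral Beta c (1 - a)) {0..1}"
    using assms by (intro has_integral_Beta_real) auto
  from has_integral_affinity'[OF this[folded cbox_interval], of "1 / s" 0]
  have "((\<lambda>x. (x / s) powr (c - 1) * (1 - x / s) powr (- a)) has_integral s * Beta c (1 - a)) {0..s}"
    using assms by (simp add: cbox_interval mult.commute)
  from has_integral_mult_right[OF this, of "s powr (c - 1 - a)"]
  have I: "((\<lambda>x. s powr (c - 1 - a) * ((x / s) powr (c - 1) * (1 - x / s) powr (- a))) has_integral
      s powr (c - 1 - a) * (s * Beta c (1 - a))) {0..s}" .
  have eq: "s powr (c - 1 - a) * ((x / s) powr (c - 1) * (1 - x / s) powr (- a)) = (s - x) powr (- a) * x powr (c - 1)"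
    if "x \<in> {0..s}" for x
  proof -
    have "1 - x / s = (s - x) / s" using assms by (simp add: field_simps)
    then have "s powr (c - 1 - a) * ((x / s) powr (c - 1) * (1 - x / s) powr (- a))
       = s powr (c - 1 - a) * (x powr (c - 1) / s powr (c - 1) * ((s - x) powr (- a) / s powr (- a)))"
      using that assms by (simp add: powr_divide)
    also have "\<dots> = (s powr (c - 1 - a) / (s powr (c - 1) * s powr (- a))) * ((s - x) powr (- a) * x powr (c - 1))"
      by simp
    also have "s powr (c - 1) * s powr (- a) = s powr (c - 1 - a)"
      unfolding powr_add[symmetric] by simp
    finally show ?thesis using assms by simp
  qed
  have val: "s powr (c - 1 - a) * (s * Beta c (1 - a)) = s powr (c - a) * Beta c (1 - a)"
    using assms powr_add[of s "c - 1 - a" 1] by (simp add: algebra_simps)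
  show ?thesis by (rule has_integral_eq[OF eq I[unfolded val]])
qed

text \<open>Domination by a Beta integral, which has singularities at both ends.\<close>

lemma singular_kernel_integrable:
  fixes a c s K :: real
  assumes "a < 1" "0 < c" "0 < s" and cont: "continuous_on {0<..<s} h"
    and bound: "\<And>x. \<lbrakk>0 < x; x < s\<rbrakk> \<Longrightarrow> \<bar>h x\<bar> \<le> K * x powr (c - 1)"
  shows "(\<lambda>x. (s - x) powr (- a) * h x) absolutely_integrable_on {0..s}"
    and "\<bar>integral {0..s} (\<lambda>x. (s - x) powr (- a) * h x)\<bar> \<le> K * (s powr (c - a) * Beta c (1 - a))"
proof -
  let ?g = "\<lambda>x. K * ((s - x) powr (- a) * x powr (c - 1))"
  define f where "f x = (if x \<in> {0<..<s} then (s - x) powr (- a) * h x else 0)" for x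
  have g: "(?g has_integral K * (s powr (c - a) * Beta c (1 - a))) {0..s}"
    by (intro has_integral_mult_right beta_kernel_integral assms)
  have neg: "negligible {0, s}" by simp
  have le: "norm (f x) \<le> ?g x" if "x \<in> {0..s}" for x
  proof (cases "x \<in> {0<..<s}")
    case True
    then have "(s - x) powr (- a) * \<bar>h x\<bar> \<le> (s - x) powr (- a) * (K * x powr (c - 1))"
      using bound by (intro mult_left_mono) auto
    then show ?thesis using True by (simp add: f_def abs_mult mult_ac)
  next
    case False
    then have "x = 0 \<or> x = s" using that by auto
    then show ?thesis using False by (auto simp: f_def)
  qed
  have meas: "f \<in> borel_measurable (lebesgue_on {0..s})"
  proof -
    have "continuous_on {0<..<s} (\<lambda>x. (s - x) powr (- a) * h x)"
      by (intro continuous_intros cont) auto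
    then have "(\<lambda>x. (s - x) powr (- a) * h x) \<in> borel_measurable (lebesgue_on {0<..<s})"
      by (intro continuous_imp_measurable_on_sets_lebesgue) auto
    then have "(\<lambda>x. if x \<in> {0<..<s} then (s - x) powr (- a) * h x else 0) \<in> borel_measurable lebesgue"
      by (subst borel_measurable_if) auto
    then have "f \<in> borel_measurable lebesgue" unfolding f_def .
    then show ?thesis by (rule measurable_restrict_space1)
  qed
  have f: "f absolutely_integrable_on {0..s}"
    by (rule measurable_bounded_by_integrable_imp_absolutely_integrable[OF meas _ has_integral_integrable[OF g] le]) auto
  have eq: "f x = (s - x) powr (- a) * h x" if "x \<in> {0..s} - {0, s}" for x
    using that by (auto simp: f_def)
  show "(\<lambda>x. (s - x) powr (- a) * h x) absolutely_integrable_on {0..s}"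
    by (rule absolutely_integrable_spike[OF f neg]) (use eq in auto)
  have "integral {0..s} (\<lambda>x. (s - x) powr (- a) * h x) = integral {0..s} f"
    by (rule integral_spike[OF neg]) (use eq in auto)
  moreover have "norm (integral {0..s} f) \<le> integral {0..s} ?g"
    using f le g by (intro integral_norm_bound_integral) (auto simp: has_integral_integrable set_lebesgue_integral_eq_integral)
  ultimately show "\<bar>integral {0..s} (\<lambda>x. (s - x) powr (- a) * h x)\<bar> \<le> K * (s powr (c - a) * Beta c (1 - a))"
    by (simp only: integral_unique[OF g] real_norm_def)
qed

lemma caputo_less_1: "\<delta> < 1 \<Longrightarrow> caputo \<delta> v t =
    1 / Gamma (1 - \<delta>) * integral {0..t} (\<lambda>s. (t - s) powr (- \<delta>) * deriv v s)"
  by (simp add: caputo_def)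

lemma integral_mesh_split:
  fixes f :: "real \<Rightarrow> real" and t :: "nat \<Rightarrow> real"
  assumes "f integrable_on {t 0..b}" and "\<And>k. k < n \<Longrightarrow> t k \<le> t (Suc k)" and "t n \<le> b"
  shows "integral {t 0..b} f = (\<Sum>k=1..n. integral {t (k - 1)..t k} f) + integral {t n..b} f"
  using assms(2,3)
proof (induction n)
  case (Suc n)
  have le: "t n \<le> t (Suc n)" using Suc.prems by auto
  have "t 0 \<le> t n" if "\<And>k. k < n \<Longrightarrow> t k \<le> t (Suc k)"
    using that by (induction n) (auto intro: order_trans)
  then have "t 0 \<le> t n" using Suc.prems by auto
  then have "f integrable_on {t n..b}"
    using assms(1) by (rule_tac integrable_on_subinterval) auto
  then have "integral {t n..t (Suc n)} f + integral {t (Suc n)..b} f = integral {t n..b} f"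
    using le Suc.prems by (intro Henstock_Kurzweil_Integration.integral_combine) auto
  moreover have "t n \<le> b" using le Suc.prems(2) by (rule order_trans)
  ultimately show ?case using Suc by simp
qed simp

text \<open>Remove the first-order part \<open>v 2 a * (s - mid)\<close> of the slope error.  What remains is the derivative of
a function with equal values at \<open>a\<close> and \<open>b\<close>, so it vanishes somewhere, and its own derivative
\<open>v 2 x - v 2 a\<close> is small.\<close>

lemma linear_interpolation_slope_error:
  assumes v: "weakly_singular T \<beta> K v" and ab: "0 < a" "a < b" "b \<le> T" and s: "a \<le> s" "s < b" and beta: "\<beta> < 1"
  shows "\<bar>v 1 s - (v 0 b - v 0 a) / (b - a) - v 2 a * (s - (a + (b - a) / 2))\<bar>
    \<le> K * a powr (\<beta> - 3) * (b - a)\<^sup>2"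
proof -
  define m where "m = (v 0 b - v 0 a) / (b - a)"
  define mid where "mid = a + (b - a) / 2"
  define e where "e x = v 0 x - v 0 a - m * (x - a) - v 2 a / 2 * ((x - a) * (x - b))" for x
  define e1 where "e1 x = v 1 x - m - v 2 a * (x - mid)" for x
  define M where "M = K * a powr (\<beta> - 3)"
  have T: "0 < T" using ab by auto
  have M: "0 \<le> M" using weakly_singular_const_nonneg[OF v T] by (simp add: M_def)
  have de: "(e has_real_derivative e1 x) (at x)" if "a < x" "x < b" for x
    unfolding e_def e1_def mid_def using weakly_singular_deriv[OF v, of 0 x] that ab
    by (auto intro!: derivative_eq_intros simp: field_simps)
  have de1: "(e1 has_real_derivative v 2 x - v 2 a) (at x)" if "a \<le> x" "x < b" for x
    unfolding e1_def mid_def using weakly_singular_deriv[OF v, of 1 x] that ab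
    by (auto intro!: derivative_eq_intros simp: numeral_2_eq_2)
  have ce: "continuous_on {a..b} e"
  proof -
    have "continuous_on {a..b} (v 0)"
      using v ab unfolding weakly_singular_def by (auto intro: continuous_on_subset)
    then show ?thesis unfolding e_def by (intro continuous_intros)
  qed
  have "m * (b - a) = v 0 b - v 0 a" using ab by (simp add: m_def)
  then have "e a = e b" by (simp add: e_def)
  then obtain z where z: "a < z" "z < b" "DERIV e z :> 0"
    using Rolle[OF ab(2) _ ce] de real_differentiable_def by blast
  have e1z: "e1 z = 0" using DERIV_unique[OF de[OF z(1,2)] z(3)] .
  have "\<bar>e1 s - e1 z\<bar> \<le> M * (b - a) * \<bar>s - z\<bar>"
  proof (rule field_differentiable_bound[of "{a..<b}", where f' = "\<lambda>x. v 2 x - v 2 a", simplified real_norm_def])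
    show "convex {a..<b}" by (rule convex_real_interval)
    fix x assume x: "x \<in> {a..<b}"
    show "(e1 has_real_derivative v 2 x - v 2 a) (at x within {a..<b})"
      using de1[of x] x by (auto intro: has_field_derivative_at_within)
    have "\<bar>v 2 x - v 2 a\<bar> \<le> M * (x - a)"
      using weakly_singular_increment[OF v, of 2 a x] x ab beta unfolding M_def by (simp add: algebra_simps)
    also have "\<dots> \<le> M * (b - a)" using x M by (intro mult_left_mono) auto
    finally show "\<bar>v 2 x - v 2 a\<bar> \<le> M * (b - a)" .
  qed (use s z in auto)
  also have "\<dots> \<le> M * (b - a) * (b - a)" using s z M ab by (intro mult_left_mono) auto
  finally have "\<bar>e1 s\<bar> \<le> M * (b - a) * (b - a)" unfolding e1z by simp
  then show ?thesis unfolding e1_def m_def mid_def M_def by (simp add: power2_eq_square mult.assoc)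
qed

context graded_meshes
begin

lemma step_bounds_ratio:
  assumes "n \<in> {1..N}"
  shows "dt N n \<le> D\<^sup>2 * (t N n * xi N n powr (1 / r))"
    and "n < N \<Longrightarrow> dt N (n + 1) \<le> D\<^sup>2 * (t N n * xi N n powr (1 / r))"
proof -
  have n: "1 \<le> n" "n \<le> N" using assms by auto
  have tn: "0 < t N n" using t_pos n by auto
  have nn: "0 \<le> t N n * xi N n powr (1 / r)" using tn by simp
  have "dt N n \<le> D * (t N n * xi N n powr (1 / r))" by (rule step_le[OF assms])
  also have "\<dots> \<le> D\<^sup>2 * (t N n * xi N n powr (1 / r))"
    using nn D_ge_1 by (intro mult_right_mono) (auto simp: power2_eq_square mult_le_cancel_left1)
  finally show "dt N n \<le> D\<^sup>2 * (t N n * xi N n powr (1 / r))" .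
  assume lt: "n < N"
  have "dt N (n + 1) \<le> D * (t N (n + 1) * xi N (n + 1) powr (1 / r))" using step_le[of "n + 1" N] lt by auto
  also have "\<dots> \<le> D * ((D * t N n) * xi N n powr (1 / r))"
  proof (intro mult_left_mono mult_mono powr_mono2)
    show "t N (n + 1) \<le> D * t N n" using ratio[of "n + 1" N] lt n by auto
    show "xi N (n + 1) \<le> xi N n"
      using t_pos[of 1 N] t_pos[of n N] t_le[of n "n + 1" N] lt n by (intro divide_left_mono) auto
    show "0 \<le> xi N (n + 1)" using xi_pos[of "n + 1" N] lt by auto
  qed (use r_ge_1 D_ge_1 tn in auto)
  finally show "dt N (n + 1) \<le> D\<^sup>2 * (t N n * xi N n powr (1 / r))" by (simp add: power2_eq_square mult_ac)
qed

lemma prev_power_le: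
  assumes "2 \<le> n" "n \<le> N" "a \<le> 0"
  shows "t N (n - 1) powr a \<le> D powr (- a) * t N n powr a"
proof -
  have tn: "0 < t N n" using t_pos assms by auto
  have "t N n / D \<le> t N (n - 1)" using ratio[of n N] assms D_ge_1 by (simp add: divide_le_eq mult.commute)
  then have "t N (n - 1) powr a \<le> (t N n / D) powr a" using tn D_ge_1 assms by (intro powr_mono2') auto
  also have "\<dots> = D powr (- a) * t N n powr a"
    using tn D_ge_1 by (simp add: powr_divide powr_minus field_simps)
  finally show ?thesis .
qed

text \<open>On the first interval the oscillation of the function and of the interpolant is all that is
available, and \<open>\<xi> 1 = 1\<close>.  Later the third derivative on an interval and its right neighbour is comparable with
its value at \<open>t k\<close>, and the cube of the step size supplies \<open>\<xi> k powr (3 / r)\<close>.\<close>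

lemma quadratic_interpolation_weakly_singular:
  assumes v: "weakly_singular T \<beta> K v" and k: "1 \<le> k" "k < N" and s: "s \<in> {t N (k - 1)..t N k}"
  shows "\<bar>v 0 s - quadratic_interpolant (t N) (\<lambda>k. v 0 (t N k)) k s\<bar> \<le>
     (4 / \<beta> + 2 * D powr 9) * K * (xi N k powr (3 / r) * t N k powr \<beta>)"
proof -
  let ?v = "\<lambda>k. v 0 (t N k)" and ?q = "quadratic_interpolant (t N) (\<lambda>k. v 0 (t N k)) k"
  have lt: "t N (k - 1) < t N k" "t N k < t N (k + 1)" "t N (k + 1) \<le> T" "0 < t N k" "0 \<le> t N (k - 1)"
    using t_less[of "k - 1" k N] t_less[of k "k + 1" N] t_le_T[of "k + 1" N] t_pos[of k N] t_nonneg[of "k - 1" N] k by auto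
  have K: "0 \<le> K" using weakly_singular_const_nonneg[OF v T_pos] .
  have x: "0 < xi N k" using xi_pos k by auto
  have nn: "0 \<le> K * (xi N k powr (3 / r) * t N k powr \<beta>)" using K by auto
  show ?thesis
  proof (cases "k = 1")
    case True
    define \<mu> where "\<mu> = K / \<beta> * t N 1 powr (\<beta> - 1)"
    have t1: "t N 1 powr (\<beta> - 1) * t N 1 = t N 1 powr \<beta>" using lt True by (simp add: powr_diff)
    have mu: "\<mu> * t N 1 = K / \<beta> * t N 1 powr \<beta>" unfolding \<mu>_def mult.assoc t1 ..
    have t0: "t N 0 = 0" using t_0 k by auto
    have "\<bar>?q s - ?v (k - 1)\<bar> \<le> 3 * \<mu> * (t N k - t N (k - 1))"
    proof (rule quadratic_interpolant_oscillation[OF lt(1,2) _ _ s])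
      have "\<bar>v 0 (t N 1) - v 0 0\<bar> \<le> K / \<beta> * t N 1 powr \<beta>"
        using weakly_singular_oscillation[OF v, of 0 "t N 1"] lt True beta by auto
      then show "\<bar>v 0 (t N k) - v 0 (t N (k - 1))\<bar> \<le> \<mu> * (t N k - t N (k - 1))"
        using True t0 mu by simp
      have "\<bar>v 0 (t N 2) - v 0 (t N 1)\<bar> \<le> K * t N 1 powr (\<beta> - 1) * (t N 2 - t N 1)"
        using weakly_singular_increment[OF v, of 0 "t N 1" "t N 2"] lt True beta by (auto simp: numeral_2_eq_2)
      also have "\<dots> \<le> \<mu> * (t N 2 - t N 1)"
      proof (rule mult_right_mono)
        have "K * 1 \<le> K * (1 / \<beta>)" using K beta by (intro mult_left_mono) auto
        then show "K * t N 1 powr (\<beta> - 1) \<le> \<mu>" unfolding \<mu>_def by (intro mult_right_mono) auto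
        show "0 \<le> t N 2 - t N 1" using lt True by (simp add: numeral_2_eq_2)
      qed
      finally show "\<bar>v 0 (t N (k + 1)) - v 0 (t N k)\<bar> \<le> \<mu> * (t N (k + 1) - t N k)"
        using True by (simp add: numeral_2_eq_2)
    qed
    then have 1: "\<bar>?q s - v 0 0\<bar> \<le> 3 * (K / \<beta> * t N 1 powr \<beta>)" using True t0 mu by simp
    have "\<bar>v 0 s - v 0 0\<bar> \<le> K / \<beta> * s powr \<beta>"
      using weakly_singular_oscillation[OF v, of 0 s] s lt beta by auto
    also have "\<dots> \<le> K / \<beta> * t N 1 powr \<beta>"
      using s True lt K beta by (intro mult_left_mono powr_mono2) auto
    finally have "\<bar>v 0 s - ?q s\<bar> \<le> 4 * (K / \<beta> * t N 1 powr \<beta>)" using 1 by linarith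
    also have "\<dots> = 4 / \<beta> * (K * (xi N k powr (3 / r) * t N k powr \<beta>))" using True lt by simp
    also have "\<dots> \<le> (4 / \<beta> + 2 * D powr 9) * (K * (xi N k powr (3 / r) * t N k powr \<beta>))"
      using nn by (intro mult_right_mono) auto
    finally show ?thesis by (simp add: mult_ac)
  next
    case False
    then have k2: "2 \<le> k" using k by auto
    define a where "a = t N (k - 1)"
    have a: "0 < a" "a < T" using t_pos[of "k - 1" N] lt k2 k by (auto simp: a_def)
    define M where "M = K * a powr (\<beta> - 3)"
    define A B mid where "A = (?v k - ?v (k - 1)) / (t N k - t N (k - 1))"
      and "B = ((?v (k + 1) - ?v k) / (t N (k + 1) - t N k) - A) * (2 / (t N (k + 1) - t N (k - 1)))"
      and "mid = (t N (k - 1) + t N k) / 2"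
    have dq: "deriv ?q x = A + B * (x - mid)" for x
      using deriv_quadratic_interpolant[OF lt(1,2), of ?v x] unfolding A_def B_def mid_def mult.assoc .
    have cv: "continuous_on {a..t N (k + 1)} (v 0)"
      using v lt a unfolding weakly_singular_def by (auto intro: continuous_on_subset)
    have cq: "continuous_on S ?q" for S
      using quadratic_interpolant_deriv[OF lt(1,2)] continuous_on_eq_continuous_at DERIV_isCont
      by (meson continuous_at_imp_continuous_on)
    have "\<bar>v 0 s - ?q s\<bar> \<le> M * ((s - a) * (t N k - s) * (t N (k + 1) - s))"
    proof (rule three_point_interpolation_error[where ?e0.0 = "\<lambda>s. v 0 s - ?q s" and ?e1.0 = "\<lambda>s. v 1 s - (A + B * (s - mid))"
          and ?e2.0 = "\<lambda>s. v 2 s - B" and ?e3.0 = "v 3"])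
      show "a < t N k" "t N k < t N (k + 1)" "a \<le> s" "s \<le> t N k" using lt s by (auto simp: a_def)
      show "v 0 a - ?q a = 0" "v 0 (t N k) - ?q (t N k) = 0" "v 0 (t N (k + 1)) - ?q (t N (k + 1)) = 0"
        unfolding a_def quadratic_interpolant_nodes[OF lt(1,2)] by simp_all
      show "continuous_on {a..t N (k + 1)} (\<lambda>s. v 0 s - ?q s)" by (intro continuous_on_diff cv cq)
      fix y assume y: "a < y" "y < t N (k + 1)"
      then have yT: "0 < y" "y < T" using a lt by auto
      show "((\<lambda>s. v 0 s - ?q s) has_real_derivative v 1 y - (A + B * (y - mid))) (at y)"
        using weakly_singular_deriv[OF v _ yT, of 0] quadratic_interpolant_deriv[OF lt(1,2), of ?v y]
        unfolding dq by (auto intro: DERIV_diff)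
      show "((\<lambda>s. v 1 s - (A + B * (s - mid))) has_real_derivative v 2 y - B) (at y)"
        using weakly_singular_deriv[OF v _ yT, of 1]
        by (auto intro!: derivative_eq_intros simp: numeral_2_eq_2)
      show "((\<lambda>s. v 2 s - B) has_real_derivative v 3 y) (at y)"
        using weakly_singular_deriv[OF v _ yT, of 2]
        by (auto intro!: derivative_eq_intros simp: numeral_3_eq_3 numeral_2_eq_2)
      have "\<bar>v 3 y\<bar> \<le> K * y powr (\<beta> - 3)" using weakly_singular_bound_at[OF v, of 3 y] yT by auto
      also have "\<dots> \<le> M" unfolding M_def using y a K beta by (intro mult_left_mono powr_mono2') auto
      finally show "\<bar>v 3 y\<bar> \<le> M" .
    qed
    also have "\<dots> \<le> (K * (D powr 3 * t N k powr (\<beta> - 3))) * (Y * Y * (Y + Y))"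
      if Y: "Y = D\<^sup>2 * (t N k * xi N k powr (1 / r))" for Y
    proof (rule mult_mono)
      have "a powr (\<beta> - 3) \<le> D powr (- (\<beta> - 3)) * t N k powr (\<beta> - 3)"
        unfolding a_def using prev_power_le[of k N "\<beta> - 3"] k2 k beta by auto
      also have "\<dots> \<le> D powr 3 * t N k powr (\<beta> - 3)"
        using D_ge_1 beta by (intro mult_right_mono powr_mono) auto
      finally show "M \<le> K * (D powr 3 * t N k powr (\<beta> - 3))" unfolding M_def using K by (intro mult_left_mono)
      have st: "dt N k \<le> Y" "dt N (k + 1) \<le> Y" unfolding Y using step_bounds_ratio[of k N] k by auto
      have "s - a \<le> Y" "t N k - s \<le> Y" "t N (k + 1) - s \<le> Y + Y"
        using st s by (auto simp: mesh_step_def a_def)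
      then show "(s - a) * (t N k - s) * (t N (k + 1) - s) \<le> Y * Y * (Y + Y)"
        using s lt by (intro mult_mono) (auto simp: a_def)
    qed (use K s lt in \<open>auto simp: a_def\<close>)
    finally have "\<bar>v 0 s - ?q s\<bar> \<le> (K * (D powr 3 * t N k powr (\<beta> - 3))) * (2 * (D\<^sup>2 * (t N k * xi N k powr (1 / r))) ^ 3)"
      by (simp add: power3_eq_cube algebra_simps)
    also have "\<dots> = 2 * D powr 9 * (K * (xi N k powr (3 / r) * t N k powr \<beta>))"
    proof -
      have p: "(xi N k powr (1 / r)) ^ 3 = xi N k powr (3 / r)"
        unfolding power3_eq_cube powr_add[symmetric] by (rule arg_cong[where f = "(powr) (xi N k)"]) simp
      have q: "t N k powr (\<beta> - 3) * t N k ^ 3 = t N k powr \<beta>"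
        using lt by (simp add: powr_diff)
      have d: "D powr 3 * (D\<^sup>2) ^ 3 = D powr 9"
        using D_ge_1 by (simp add: power_mult[symmetric] powr_numeral power_add[symmetric])
      have "(K * (D powr 3 * t N k powr (\<beta> - 3))) * (2 * (D\<^sup>2 * (t N k * xi N k powr (1 / r))) ^ 3)
        = 2 * (D powr 3 * (D\<^sup>2) ^ 3) * (K * ((xi N k powr (1 / r)) ^ 3 * (t N k powr (\<beta> - 3) * t N k ^ 3)))"
        unfolding power_mult_distrib by (simp only: mult_ac)
      then show ?thesis unfolding p q d .
    qed
    also have "\<dots> \<le> (4 / \<beta> + 2 * D powr 9) * (K * (xi N k powr (3 / r) * t N k powr \<beta>))"
      using nn beta by (intro mult_right_mono) auto
    finally show ?thesis by (simp add: mult_ac)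
  qed
qed

text \<open>The number \<open>(3 - \<beta>) / r\<close> exceeds \<open>2 / r\<close> by \<open>2 * eps\<close>.\<close>

lemma exponent_bounds:
  assumes "0 < m" "m \<le> 1" "m \<le> 2 / r"
  shows "m + eps \<le> (3 - \<beta>) / r" "m + eps - \<beta> < 1" "m + eps \<le> 3 / r - \<beta> / r"
proof -
  have "m + eps \<le> 2 / r + (1 - \<beta>) / (2 * r)" using assms by simp
  also have "\<dots> \<le> (3 - \<beta>) / r" using r_ge_1 beta by (simp add: field_simps)
  finally show 1: "m + eps \<le> (3 - \<beta>) / r" .
  then show "m + eps \<le> 3 / r - \<beta> / r" by (simp add: diff_divide_distrib)
  have "eps \<le> (1 - \<beta>) / 2" using r_ge_1 beta by (intro divide_left_mono) auto
  moreover have "m + a - \<beta> < 1" if "a \<le> (1 - \<beta>) / 2" for a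
    using that assms(2) beta by (simp add: field_simps)
  ultimately show "m + eps - \<beta> < 1" by blast
qed

text \<open>The slope of the interpolant differs from \<open>v 1\<close> by a first-order part, which the kernel does not see,
and a second-order rest.\<close>

lemma last_interval_error:
  assumes v: "weakly_singular T \<beta> K v" and n: "2 \<le> n" "n \<le> N"
  shows "\<bar>integral {t N (n - 1)..ts N n} (\<lambda>x. ker N n x *
      deriv (linear_interpolant (t N) (\<lambda>k. v 0 (t N k)) n) x) -
     integral {t N (n - 1)..ts N n} (\<lambda>x. ker N n x * v 1 x)\<bar>
     \<le> D powr 6 / (1 - \<beta>) * K * xi N n powr ((3 - \<beta>) / r)"
proof -
  define a b m where "a = t N (n - 1)" and "b = t N n" and "m = (v 0 b - v 0 a) / (b - a)"
  define mid where "mid = a + (b - a) / 2"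
  have n1: "1 \<le> n" "n \<in> {1..N}" using n by auto
  have K: "0 \<le> K" using weakly_singular_const_nonneg[OF v T_pos] .
  have x: "0 < xi N n" using xi_pos n by auto
  have ab: "0 < a" "a < b" "b \<le> T" "b - a = dt N n"
    unfolding a_def b_def using t_pos[of "n - 1" N] t_less[of "n - 1" n N] t_le_T[of n N] n by (auto simp: mesh_step_def)
  have "ts N n = a + (1 - \<beta> / 2) * (b - a)"
    unfolding a_def b_def by (simp add: t_star_eq mesh_step_def sigma)
  then have ts: "a < ts N n" "ts N n < b" "ts N n = a + (1 - \<beta> / 2) * (b - a)"
    using ts_gt[of n N] ts_lt[of n N] n by (auto simp: a_def b_def)
  have c1: "continuous_on {a..ts N n} (v 1)"
    using weakly_singular_continuous[OF v, of 1] by (rule continuous_on_subset) (use ab ts in auto)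
  define M where "M = K * a powr (\<beta> - 3) * (b - a)\<^sup>2"
  define h where "h s = v 1 s - m - v 2 a * (s - mid)" for s
  have h: "\<bar>h s\<bar> \<le> M" if "s \<in> {a..ts N n}" for s
    unfolding h_def m_def mid_def M_def
    using linear_interpolation_slope_error[OF v ab(1-3), of s] that ts beta by auto
  have ch: "continuous_on {a..ts N n} h" unfolding h_def by (intro continuous_intros c1)
  have kI: "((\<lambda>s. ker N n s * c) has_integral (ts N n - a) powr (1 - \<beta>) / (1 - \<beta>) * c) {a..ts N n}" for c
    using has_integral_mult_left[OF kernel_integral[of a "ts N n" \<beta>], of c] ts beta by auto
  have hI: "(\<lambda>s. ker N n s * h s) integrable_on {a..ts N n}"
  proof (rule measurable_bounded_by_integrable_imp_integrable[OF _ has_integral_integrable[OF kI[of M]]])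
    have "(\<lambda>s. ker N n s) \<in> borel_measurable (lebesgue_on {a..ts N n})"
      using has_integral_integrable[OF kI[of 1]] by (auto dest: integrable_imp_measurable)
    moreover have "h \<in> borel_measurable (lebesgue_on {a..ts N n})"
      using ch by (intro continuous_imp_measurable_on_sets_lebesgue) auto
    ultimately show "(\<lambda>s. ker N n s * h s) \<in> borel_measurable (lebesgue_on {a..ts N n})" by simp
    fix s assume "s \<in> {a..ts N n}"
    then show "norm (ker N n s * h s) \<le> ker N n s * M" using h by (simp add: abs_mult mult_left_mono)
  qed auto
  have zm: "((\<lambda>s. v 2 a * (ker N n s * (s - mid))) has_integral v 2 a * 0) {a..ts N n}"
    using kernel_integral_zero_mean[of "b - a" \<beta> a] ab beta unfolding mid_def ts(3)[symmetric]
    by (intro has_integral_mult_right) auto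
  have "((\<lambda>s. ker N n s * h s + ker N n s * m + v 2 a * (ker N n s * (s - mid))) has_integral
     integral {a..ts N n} (\<lambda>s. ker N n s * h s) + (ts N n - a) powr (1 - \<beta>) / (1 - \<beta>) * m + v 2 a * 0) {a..ts N n}"
    by (intro has_integral_add integrable_integral hI kI zm)
  then have v1: "integral {a..ts N n} (\<lambda>x. ker N n x * v 1 x) =
     integral {a..ts N n} (\<lambda>s. ker N n s * h s) + (ts N n - a) powr (1 - \<beta>) / (1 - \<beta>) * m"
    by (intro integral_unique) (simp add: h_def algebra_simps)
  have "deriv (linear_interpolant (t N) (\<lambda>k. v 0 (t N k)) n) x = m" for x
    using linear_interpolant_deriv[of "t N" n "\<lambda>k. v 0 (t N k)" x] ab unfolding m_def a_def b_def by simp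
  then have lin: "integral {a..ts N n} (\<lambda>x. ker N n x * deriv (linear_interpolant (t N) (\<lambda>k. v 0 (t N k)) n) x)
      = (ts N n - a) powr (1 - \<beta>) / (1 - \<beta>) * m"
    using integral_unique[OF kI[of m]] by (simp only:)
  have "\<bar>integral {a..ts N n} (\<lambda>s. ker N n s * h s)\<bar> \<le> integral {a..ts N n} (\<lambda>s. ker N n s * M)"
    using h hI has_integral_integrable[OF kI[of M]]
    by (intro integral_norm_bound_integral[where f = "\<lambda>s. ker N n s * h s", simplified real_norm_def])
      (auto simp: abs_mult mult_left_mono)
  also have "\<dots> = (ts N n - a) powr (1 - \<beta>) / (1 - \<beta>) * M" by (rule integral_unique[OF kI])
  also have "\<dots> \<le> (dt N n) powr (1 - \<beta>) / (1 - \<beta>) * (K * (D powr 3 * b powr (\<beta> - 3)) * (dt N n)\<^sup>2)"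
  proof (rule mult_mono)
    show "(ts N n - a) powr (1 - \<beta>) / (1 - \<beta>) \<le> dt N n powr (1 - \<beta>) / (1 - \<beta>)"
      using ts ab beta by (intro divide_right_mono powr_mono2) auto
    have "a powr (\<beta> - 3) \<le> D powr (- (\<beta> - 3)) * b powr (\<beta> - 3)"
      unfolding a_def b_def using prev_power_le[of n N "\<beta> - 3"] n beta by auto
    also have "\<dots> \<le> D powr 3 * b powr (\<beta> - 3)"
      using D_ge_1 beta by (intro mult_right_mono powr_mono) auto
    finally show "M \<le> K * (D powr 3 * b powr (\<beta> - 3)) * (dt N n)\<^sup>2"
      unfolding M_def ab(4) using K by (intro mult_right_mono mult_left_mono) auto
  qed (use beta K in \<open>auto simp: M_def\<close>)
  also have "\<dots> = D powr 3 / (1 - \<beta>) * K * (b powr (\<beta> - 3) * dt N n powr (3 - \<beta>))"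
  proof -
    have "dt N n powr (1 - \<beta>) * (dt N n)\<^sup>2 = dt N n powr (3 - \<beta>)"
      using ab powr_add[of "dt N n" "1 - \<beta>" 2] by simp
    moreover have "A / B * (K * (E * F) * G) = E / B * K * (F * (A * G))" for A B E F G by simp
    ultimately show ?thesis by metis
  qed
  also have "\<dots> \<le> D powr 3 / (1 - \<beta>) * K * (b powr (\<beta> - 3) * (D powr 3 * (b powr (3 - \<beta>) * xi N n powr ((3 - \<beta>) / r))))"
  proof -
    have "dt N n powr (3 - \<beta>) \<le> (D * (b * xi N n powr (1 / r))) powr (3 - \<beta>)"
      using step_le[OF n1(2)] ab beta unfolding b_def by (intro powr_mono2) auto
    also have "\<dots> = D powr (3 - \<beta>) * (b powr (3 - \<beta>) * (xi N n powr (1 / r)) powr (3 - \<beta>))"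
      by (simp only: powr_mult)
    also have "(xi N n powr (1 / r)) powr (3 - \<beta>) = xi N n powr ((3 - \<beta>) / r)" by (simp add: powr_powr)
    also have "D powr (3 - \<beta>) * (b powr (3 - \<beta>) * xi N n powr ((3 - \<beta>) / r)) \<le> D powr 3 * (b powr (3 - \<beta>) * xi N n powr ((3 - \<beta>) / r))"
      using D_ge_1 beta by (intro mult_right_mono powr_mono) auto
    finally show ?thesis using K beta by (intro mult_left_mono) auto
  qed
  also have "\<dots> = D powr 6 / (1 - \<beta>) * K * xi N n powr ((3 - \<beta>) / r)"
  proof -
    have 1: "b powr (\<beta> - 3) * b powr (3 - \<beta>) = 1" using ab by (simp add: powr_add[symmetric])
    have 2: "D powr 3 * D powr 3 = D powr 6" using D_ge_1 by (simp add: powr_add[symmetric])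
    have "D powr 3 / (1 - \<beta>) * K * (b powr (\<beta> - 3) * (D powr 3 * (b powr (3 - \<beta>) * xi N n powr ((3 - \<beta>) / r))))
      = (D powr 3 * D powr 3) / (1 - \<beta>) * K * ((b powr (\<beta> - 3) * b powr (3 - \<beta>)) * xi N n powr ((3 - \<beta>) / r))"
      by (simp add: mult_ac)
    then show ?thesis unfolding 1 2 by simp
  qed
  finally show ?thesis using v1 lin unfolding a_def by simp
qed

lemma caputo_weakly_singular:
  assumes v: "weakly_singular T \<beta> K v" and s: "0 < s" "s \<le> T"
  shows "Gamma (1 - \<beta>) * caputo \<beta> (v 0) s = integral {0..s} (\<lambda>x. (s - x) powr (- \<beta>) * v 1 x)"
    and "(\<lambda>x. (s - x) powr (- \<beta>) * v 1 x) absolutely_integrable_on {0..s}"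
    and "\<bar>integral {0..s} (\<lambda>x. (s - x) powr (- \<beta>) * v 1 x)\<bar> \<le> K * Beta \<beta> (1 - \<beta>)"
proof -
  have "integral {0..s} (\<lambda>x. (s - x) powr (- \<beta>) * deriv (v 0) x) = integral {0..s} (\<lambda>x. (s - x) powr (- \<beta>) * v 1 x)"
  proof (rule integral_spike[of "{0, s}"])
    fix x assume x: "x \<in> {0..s} - {0, s}"
    have "deriv (v 0) x = v 1 x" using weakly_singular_deriv[OF v, of 0 x] x s by (auto intro: DERIV_imp_deriv)
    then show "(s - x) powr (- \<beta>) * v 1 x = (s - x) powr (- \<beta>) * deriv (v 0) x" by simp
  qed auto
  then show "Gamma (1 - \<beta>) * caputo \<beta> (v 0) s = integral {0..s} (\<lambda>x. (s - x) powr (- \<beta>) * v 1 x)"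
    using caputo_less_1[OF beta(2)] Gam_pos by simp
  have c: "continuous_on {0<..<s} (v 1)"
    using weakly_singular_continuous[OF v, of 1] by (rule continuous_on_subset) (use s in auto)
  have b: "\<bar>v 1 x\<bar> \<le> K * x powr (\<beta> - 1)" if "0 < x" "x < s" for x
    using weakly_singular_bound_at[OF v, of 1 x] that s by auto
  show "(\<lambda>x. (s - x) powr (- \<beta>) * v 1 x) absolutely_integrable_on {0..s}"
    by (rule singular_kernel_integrable(1)[OF beta(2) _ s(1) c b]) (use beta in auto)
  show "\<bar>integral {0..s} (\<lambda>x. (s - x) powr (- \<beta>) * v 1 x)\<bar> \<le> K * Beta \<beta> (1 - \<beta>)"
    using singular_kernel_integrable(2)[OF beta(2) _ s(1) c b] beta s by simp
qed

text \<open>The quadratic interpolants contribute \<open>\<xi> k powr (3 / r) * t k powr \<beta>\<close> each, weighted with the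
increments of the kernel, and the last interval contributes order \<open>(3 - \<beta>) / r\<close>.  In the first step there is no smallness,
and none is claimed since \<open>\<xi> 1 = 1\<close>.\<close>

lemma truncation_error:
  assumes m: "0 < m" "m \<le> 1" "m \<le> 2 / r"
  shows "\<exists>C>0. \<forall>N. \<forall>n\<in>{1..N}. \<forall>K v. weakly_singular T \<beta> K v \<longrightarrow>
    \<bar>\<delta> N (\<lambda>k. v 0 (t N k)) n - caputo \<beta> (v 0) (ts N n)\<bar> \<le> C * K * xi N n powr (m + eps)"
proof -
  have r0: "0 \<le> 3 / r" using r_ge_1 by simp
  obtain C where C: "0 < C" and sumC: "\<And>N n. n \<in> {1..N} \<Longrightarrow>
      (\<Sum>k=1..n-1. dker N n k * (xi N k powr (3 / r) * t N k powr \<beta>))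
      \<le> C * (xi N n powr (m + eps) * t N n powr (\<beta> - \<beta>))"
    using kernel_weighted_sum[OF r0 exponent_bounds(3,2)[OF m]] by blast
  define G where "G = Gamma (1 - \<beta>)"
  have G: "0 < G" using Gam_pos by (simp add: G_def)
  define B0 where "B0 = Beta \<beta> (1 - \<beta>)"
  have B0: "0 < B0" unfolding B0_def Beta_def using beta Gamma_real_pos[of \<beta>] Gamma_real_pos[of "1 - \<beta>"] by simp
  define C1 where "C1 = 4 / \<beta> + 2 * D powr 9"
  have C1: "0 < C1" using beta by (simp add: C1_def add_pos_nonneg)
  define C2 where "C2 = (C1 * C + D powr 6 / (1 - \<beta>)) + (1 / (\<beta> * (1 - \<beta>)) + B0)"
  have C2: "0 < C2" unfolding C2_def using C1 C B0 beta
    by (intro add_pos_pos add_pos_nonneg mult_pos_pos divide_nonneg_pos divide_pos_pos) auto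
  have main: "\<bar>G * \<delta> N (\<lambda>k. v 0 (t N k)) n - G * caputo \<beta> (v 0) (ts N n)\<bar> \<le> C2 * K * xi N n powr (m + eps)"
    if n: "n \<in> {1..N}" and v: "weakly_singular T \<beta> K v" for N n K v
  proof -
    define I where "I k = integral {t N (k - 1)..t N k} (\<lambda>x. ker N n x *
       deriv (quadratic_interpolant (t N) (\<lambda>k. v 0 (t N k)) k) x)" for k
    define J where "J k = integral {t N (k - 1)..t N k} (\<lambda>x. ker N n x * v 1 x)" for k
    define Il where "Il = integral {t N (n - 1)..ts N n} (\<lambda>x. ker N n x *
       deriv (linear_interpolant (t N) (\<lambda>k. v 0 (t N k)) n) x)"
    define Jl where "Jl = integral {t N (n - 1)..ts N n} (\<lambda>x. ker N n x * v 1 x)"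
    have n1: "1 \<le> n" "n \<le> N" using n by auto
    have K: "0 \<le> K" using weakly_singular_const_nonneg[OF v T_pos] .
    have x: "0 < xi N n" "xi N n \<le> 1" using xi_pos[OF n1] xi_le_1[OF n1] by auto
    have ts: "0 < ts N n" "ts N n \<le> T" "t N (n - 1) < ts N n"
      using ts_pos[OF n1] ts_lt[OF n1] t_le_T[of n N] ts_gt[OF n1] n1 by auto
    have D: "G * \<delta> N (\<lambda>k. v 0 (t N k)) n = (\<Sum>k=1..n-1. I k) + Il"
      unfolding alikhanov_deriv_def G_def I_def Il_def using Gam_pos by simp
    note cap = caputo_weakly_singular[OF v ts(1,2)]
    show ?thesis
    proof (cases "n = 1")
      case True
      have t1: "0 < t N 1" using t_pos n1 True by auto
      have t0: "t N 0 = 0" using t_0 n1 by auto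
      have d: "deriv (linear_interpolant (t N) (\<lambda>k. v 0 (t N k)) n) x = (v 0 (t N 1) - v 0 0) / t N 1" for x
        using linear_interpolant_deriv[of "t N" n "\<lambda>k. v 0 (t N k)" x] t1 t0 True by simp
      have "((\<lambda>x. ker N n x * ((v 0 (t N 1) - v 0 0) / t N 1)) has_integral
          (ts N n - t N (n - 1)) powr (1 - \<beta>) / (1 - \<beta>) * ((v 0 (t N 1) - v 0 0) / t N 1)) {t N (n - 1)..ts N n}"
        using ts beta by (intro has_integral_mult_left kernel_integral) auto
      then have "Il = (\<sigma> * t N 1) powr (1 - \<beta>) / (1 - \<beta>) * ((v 0 (t N 1) - v 0 0) / t N 1)"
        unfolding Il_def d using True t0 by (simp only: integral_unique) (simp add: ts_eq mesh_step_def)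
      then have "\<bar>Il\<bar> = (\<sigma> * t N 1) powr (1 - \<beta>) / (1 - \<beta>) * (\<bar>v 0 (t N 1) - v 0 0\<bar> / t N 1)"
        using t1 beta by (simp add: abs_mult)
      also have "\<dots> \<le> t N 1 powr (1 - \<beta>) / (1 - \<beta>) * ((K / \<beta> * t N 1 powr \<beta>) / t N 1)"
      proof (intro mult_mono divide_right_mono powr_mono2)
        show "\<bar>v 0 (t N 1) - v 0 0\<bar> \<le> K / \<beta> * t N 1 powr \<beta>"
          using weakly_singular_oscillation[OF v, of 0 "t N 1"] t1 t_le_T[of 1 N] n1 True beta by auto
        show "\<sigma> * t N 1 \<le> t N 1" using sigma_bounds t1 by (simp add: mult_left_le_one_le)
      qed (use sigma_bounds t1 beta in auto)
      also have "\<dots> = 1 / (\<beta> * (1 - \<beta>)) * K * (t N 1 powr (1 - \<beta>) * t N 1 powr \<beta> / t N 1)" by (simp add: mult_ac)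
      also have "t N 1 powr (1 - \<beta>) * t N 1 powr \<beta> / t N 1 = 1" using t1 by (simp add: powr_add[symmetric])
      finally have "\<bar>Il\<bar> \<le> 1 / (\<beta> * (1 - \<beta>)) * K" by simp
      then have "\<bar>G * \<delta> N (\<lambda>k. v 0 (t N k)) n - G * caputo \<beta> (v 0) (ts N n)\<bar> \<le> 1 / (\<beta> * (1 - \<beta>)) * K + K * B0"
        using cap(3) unfolding D cap(1)[folded G_def] B0_def using True by simp
      also have "\<dots> = (1 / (\<beta> * (1 - \<beta>)) + B0) * K" by (simp add: algebra_simps)
      also have "\<dots> \<le> C2 * K"
        unfolding C2_def using K C1 C beta by (intro mult_right_mono) auto
      also have "\<dots> = C2 * K * xi N n powr (m + eps)" using True t1 by simp
      finally show ?thesis .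
    next
      case False
      then have n2: "2 \<le> n" "n \<le> N" using n1 by auto
      have cap_split: "G * caputo \<beta> (v 0) (ts N n) = (\<Sum>k=1..n-1. J k) + Jl"
        unfolding cap(1)[folded G_def] J_def Jl_def
        using integral_mesh_split[of "\<lambda>x. ker N n x * v 1 x" "t N" "ts N n" "n - 1"] cap(2) t_0[of N] n1
          t_le[of _ _ N] ts(3)
        by (auto simp: set_lebesgue_integral_eq_integral)
      have each: "\<bar>I k - J k\<bar> \<le> C1 * K * (dker N n k * (xi N k powr (3 / r) * t N k powr \<beta>))"
        if k: "k \<in> {1..n-1}" for k
      proof -
        have kN: "1 \<le> k" "k < N" using k n2 by auto
        have lt: "t N (k - 1) < t N k" "t N k < t N (k + 1)" "t N k < ts N n" "t N k < T" "0 \<le> t N (k - 1)"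
          using t_less[of "k - 1" k N] t_less[of k "k + 1" N] t_less_ts[of k n N] t_nonneg[of "k - 1" N]
            t_less[of k N N] t_N[of N] kN k n2 by auto
        have c: "continuous_on {t N (k - 1)..t N k} (v 0)"
          using v lt unfolding weakly_singular_def by (auto intro: continuous_on_subset)
        obtain j where j: "((\<lambda>x. ker N n x * v 1 x) has_integral j) {t N (k - 1)..t N k}"
          "\<bar>I k - j\<bar> \<le> C1 * K * (xi N k powr (3 / r) * t N k powr \<beta>) * dker N n k"
          unfolding I_def C1_def
          using interval_interpolation_error[OF lt(1-3) _ c _ _ _ quadratic_interpolation_weakly_singular[OF v kN],
              of \<beta> "v 1"] weakly_singular_deriv[OF v, of 0] lt beta
          by auto
        then have "J k = j" unfolding J_def by (simp only: integral_unique)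
        then show ?thesis using j(2) by (simp only: mult_ac)
      qed
      have "\<bar>(\<Sum>k=1..n-1. I k - J k)\<bar> \<le> (\<Sum>k=1..n-1. C1 * K * (dker N n k * (xi N k powr (3 / r) * t N k powr \<beta>)))"
        by (rule order_trans[OF sum_abs]) (intro sum_mono each)
      also have "\<dots> = C1 * K * (\<Sum>k=1..n-1. dker N n k * (xi N k powr (3 / r) * t N k powr \<beta>))"
        by (rule sum_distrib_left[symmetric])
      also have "\<dots> \<le> C1 * K * (C * (xi N n powr (m + eps) * t N n powr (\<beta> - \<beta>)))"
        using sumC[OF n] C1 K by (intro mult_left_mono) auto
      also have "\<dots> = C1 * C * K * xi N n powr (m + eps)" using t_pos[OF n1] by simp
      finally have 1: "\<bar>(\<Sum>k=1..n-1. I k - J k)\<bar> \<le> C1 * C * K * xi N n powr (m + eps)" .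
      have "\<bar>Il - Jl\<bar> \<le> D powr 6 / (1 - \<beta>) * K * xi N n powr ((3 - \<beta>) / r)"
        unfolding Il_def Jl_def by (rule last_interval_error[OF v n2])
      also have "\<dots> \<le> D powr 6 / (1 - \<beta>) * K * xi N n powr (m + eps)"
        using x exponent_bounds(1)[OF m] K beta by (intro mult_left_mono powr_mono') auto
      finally have 2: "\<bar>Il - Jl\<bar> \<le> D powr 6 / (1 - \<beta>) * K * xi N n powr (m + eps)" .
      have "\<bar>G * \<delta> N (\<lambda>k. v 0 (t N k)) n - G * caputo \<beta> (v 0) (ts N n)\<bar> \<le>
          C1 * C * K * xi N n powr (m + eps) + D powr 6 / (1 - \<beta>) * K * xi N n powr (m + eps)"
        using 1 2 unfolding D cap_split sum_subtractf by linarith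
      also have "\<dots> = (C1 * C + D powr 6 / (1 - \<beta>)) * (K * xi N n powr (m + eps))" by (simp add: algebra_simps)
      also have "\<dots> \<le> C2 * (K * xi N n powr (m + eps))"
        unfolding C2_def using K B0 beta by (intro mult_right_mono) auto
      finally show ?thesis by (simp add: mult.assoc)
    qed
  qed
  have "\<bar>\<delta> N (\<lambda>k. v 0 (t N k)) n - caputo \<beta> (v 0) (ts N n)\<bar> \<le> C2 / G * K * xi N n powr (m + eps)"
    if "n \<in> {1..N}" "weakly_singular T \<beta> K v" for N n K v
  proof -
    have "G * \<bar>\<delta> N (\<lambda>k. v 0 (t N k)) n - caputo \<beta> (v 0) (ts N n)\<bar> \<le> C2 * K * xi N n powr (m + eps)"
      using main[OF that] G by (simp add: right_diff_distrib[symmetric] abs_mult)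
    then show ?thesis using G by (simp add: field_simps)
  qed
  then show ?thesis using C2 G by (intro exI[of _ "C2 / G"]) auto
qed

text \<open>The point \<open>ts n\<close> is the average of the nodes with the weights \<open>\<sigma>\<close> and \<open>1 - \<sigma>\<close>, so the first-order
terms cancel.\<close>

lemma averaging_error:
  assumes m: "0 < m" "m \<le> 2 / r"
  shows "\<exists>C>0. \<forall>N. \<forall>n\<in>{1..N}. \<forall>K v. weakly_singular T \<beta> K v \<longrightarrow>
    \<bar>avg_star \<sigma> (\<lambda>k. v 0 (t N k)) n - v 0 (ts N n)\<bar> \<le> C * K * (xi N n powr m * t N n powr \<beta>)"
proof -
  define C where "C = 1 / \<beta> + D powr 6"
  have C: "0 < C" using beta by (simp add: C_def add_pos_nonneg)
  have main: "\<bar>avg_star \<sigma> (\<lambda>k. v 0 (t N k)) n - v 0 (ts N n)\<bar> \<le> C * K * (xi N n powr m * t N n powr \<beta>)"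
    if n: "n \<in> {1..N}" and v: "weakly_singular T \<beta> K v" for N n K v
  proof -
    define a b c where "a = t N (n - 1)" and "b = t N n" and "c = ts N n"
    have n1: "1 \<le> n" "n \<le> N" using n by auto
    have K: "0 \<le> K" using weakly_singular_const_nonneg[OF v T_pos] .
    have x: "0 < xi N n" "xi N n \<le> 1" using xi_pos[OF n1] xi_le_1[OF n1] by auto
    have ab: "0 \<le> a" "a < c" "c < b" "b \<le> T" "c = a + \<sigma> * dt N n" "b - a = dt N n"
      unfolding a_def b_def c_def
      using t_nonneg[of "n - 1" N] ts_gt[OF n1] ts_lt[OF n1] t_le_T[of n N] n1 by (auto simp: ts_eq mesh_step_def)
    have eq: "avg_star \<sigma> (\<lambda>k. v 0 (t N k)) n - v 0 (ts N n) = \<sigma> * (v 0 b - v 0 c) - (1 - \<sigma>) * (v 0 c - v 0 a)"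
      unfolding avg_star_def a_def b_def c_def by (simp add: algebra_simps)
    have nn: "0 \<le> K * (xi N n powr m * t N n powr \<beta>)" using K by auto
    show ?thesis
    proof (cases "n = 1")
      case True
      have o1: "\<bar>v 0 b - v 0 c\<bar> \<le> K / \<beta> * b powr \<beta>"
        using weakly_singular_oscillation[OF v, of c b] ab beta by auto
      have "\<bar>v 0 c - v 0 a\<bar> \<le> K / \<beta> * c powr \<beta>"
        using weakly_singular_oscillation[OF v, of a c] ab beta by auto
      also have "\<dots> \<le> K / \<beta> * b powr \<beta>" using ab K beta by (intro mult_left_mono powr_mono2) auto
      finally have o2: "\<bar>v 0 c - v 0 a\<bar> \<le> K / \<beta> * b powr \<beta>" .
      have "\<bar>\<sigma> * (v 0 b - v 0 c) - (1 - \<sigma>) * (v 0 c - v 0 a)\<bar> \<le> \<bar>\<sigma> * (v 0 b - v 0 c)\<bar> + \<bar>(1 - \<sigma>) * (v 0 c - v 0 a)\<bar>"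
        by (rule abs_triangle_ineq4)
      also have "\<dots> = \<sigma> * \<bar>v 0 b - v 0 c\<bar> + (1 - \<sigma>) * \<bar>v 0 c - v 0 a\<bar>" using sigma_bounds by (simp add: abs_mult)
      also have "\<dots> \<le> \<sigma> * (K / \<beta> * b powr \<beta>) + (1 - \<sigma>) * (K / \<beta> * b powr \<beta>)"
        using o1 o2 sigma_bounds by (intro add_mono mult_left_mono) auto
      also have "\<dots> = K / \<beta> * b powr \<beta>" by (simp only: distrib_right[symmetric]) simp
      also have "\<dots> = 1 / \<beta> * (K * (xi N n powr m * t N n powr \<beta>))"
        using True t_pos[OF n1] unfolding b_def by simp
      also have "\<dots> \<le> C * (K * (xi N n powr m * t N n powr \<beta>))"
        using nn unfolding C_def by (intro mult_right_mono) auto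
      finally show ?thesis unfolding eq by (simp add: mult.assoc)
    next
      case False
      then have n2: "2 \<le> n" using n1 by auto
      have a: "0 < a" unfolding a_def using t_pos[of "n - 1" N] n2 n1 by auto
      have mv: "\<exists>z. x < z \<and> z < y \<and> v 0 y - v 0 x = (y - x) * v 1 z" if "a \<le> x" "x < y" "y \<le> b" for x y
      proof -
        have "continuous_on {x..y} (v 0)"
          using v that ab unfolding weakly_singular_def by (auto intro: continuous_on_subset)
        moreover have "(v 0 has_real_derivative v 1 z) (at z)" if "x < z" "z < y" for z
          using weakly_singular_deriv[OF v, of 0 z] that a ab \<open>a \<le> x\<close> \<open>y \<le> b\<close> by auto
        ultimately show ?thesis using MVT[of x y "v 0"] that real_differentiable_def DERIV_unique by metis
      qed
      obtain z1 where z1: "c < z1" "z1 < b" "v 0 b - v 0 c = (b - c) * v 1 z1" using mv[of c b] ab by auto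
      obtain z2 where z2: "a < z2" "z2 < c" "v 0 c - v 0 a = (c - a) * v 1 z2" using mv[of a c] ab by auto
      have "b - c = (1 - \<sigma>) * dt N n" "c - a = \<sigma> * dt N n" using ab(5,6) by (auto simp: algebra_simps)
      then have eq2: "\<sigma> * (v 0 b - v 0 c) - (1 - \<sigma>) * (v 0 c - v 0 a) = \<sigma> * (1 - \<sigma>) * dt N n * (v 1 z1 - v 1 z2)"
        unfolding z1(3) z2(3) by (simp add: algebra_simps)
      have "\<bar>v 1 z1 - v 1 z2\<bar> \<le> K * z2 powr (\<beta> - 2) * (z1 - z2)"
        using weakly_singular_increment[OF v, of 1 z2 z1] z1 z2 a ab beta by (simp add: algebra_simps)
      also have "\<dots> \<le> K * a powr (\<beta> - 2) * dt N n"
        using z1 z2 a ab K beta by (intro mult_mono mult_left_mono powr_mono2') auto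
      finally have i: "\<bar>v 1 z1 - v 1 z2\<bar> \<le> K * a powr (\<beta> - 2) * dt N n" .
      have "\<sigma> * (1 - \<sigma>) \<le> 1 * 1" using sigma_bounds by (intro mult_mono) auto
      then have "\<bar>\<sigma> * (1 - \<sigma>) * dt N n * (v 1 z1 - v 1 z2)\<bar> \<le> 1 * dt N n * (K * a powr (\<beta> - 2) * dt N n)"
        unfolding abs_mult using i sigma_bounds dt_pos[OF n1] by (intro mult_mono) auto
      also have "\<dots> = K * (a powr (\<beta> - 2) * (dt N n)\<^sup>2)" by (simp add: power2_eq_square)
      also have "\<dots> \<le> K * ((D powr 2 * b powr (\<beta> - 2)) * (D\<^sup>2 * (b * xi N n powr (1 / r)))\<^sup>2)"
      proof (intro mult_left_mono mult_mono power_mono)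
        have "a powr (\<beta> - 2) \<le> D powr (- (\<beta> - 2)) * b powr (\<beta> - 2)"
          unfolding a_def b_def using prev_power_le[of n N "\<beta> - 2"] n2 n1 beta by auto
        also have "\<dots> \<le> D powr 2 * b powr (\<beta> - 2)"
          using D_ge_1 beta by (intro mult_right_mono powr_mono) auto
        finally show "a powr (\<beta> - 2) \<le> D powr 2 * b powr (\<beta> - 2)" .
        show "dt N n \<le> D\<^sup>2 * (b * xi N n powr (1 / r))" unfolding b_def by (rule step_bounds_ratio(1)[OF n])
      qed (use K dt_pos[OF n1] in auto)
      also have "\<dots> = D powr 6 * (K * (xi N n powr (2 / r) * b powr \<beta>))"
      proof -
        have p: "(xi N n powr (1 / r)) * (xi N n powr (1 / r)) = xi N n powr (2 / r)"
          unfolding powr_add[symmetric] by (rule arg_cong[where f = "(powr) (xi N n)"]) simp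
        have b0: "0 < b" using ab by auto
        have q: "b powr (\<beta> - 2) * (b * b) = b powr \<beta>"
          using b0 by (simp add: powr_diff power2_eq_square)
        have d: "D powr 2 * (D\<^sup>2 * D\<^sup>2) = D powr 6"
          using D_ge_1 by (simp add: power_mult[symmetric] powr_numeral power_add[symmetric])
        have "K * ((D powr 2 * b powr (\<beta> - 2)) * (D\<^sup>2 * (b * xi N n powr (1 / r)))\<^sup>2)
          = (D powr 2 * (D\<^sup>2 * D\<^sup>2)) * (K * ((xi N n powr (1 / r) * xi N n powr (1 / r)) * (b powr (\<beta> - 2) * (b * b))))"
          unfolding power2_eq_square by (simp only: mult_ac)
        then show ?thesis unfolding p q d .
      qed
      also have "\<dots> \<le> D powr 6 * (K * (xi N n powr m * b powr \<beta>))"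
        using x m K by (intro mult_left_mono mult_right_mono powr_mono') auto
      also have "\<dots> \<le> C * (K * (xi N n powr m * t N n powr \<beta>))"
        using nn beta unfolding C_def b_def by (intro mult_right_mono) auto
      finally show ?thesis unfolding eq eq2 by (simp add: mult.assoc)
    qed
  qed
  then show ?thesis using C by (intro exI[of _ C]) auto
qed

text \<open>The linearization of the source has an error quadratic in the increment over one step.\<close>

lemma squared_increment_bound:
  assumes m: "0 < m" "m \<le> 2 / r"
  shows "\<exists>C>0. \<forall>N. \<forall>n\<in>{1..N}. \<forall>K v. weakly_singular T \<beta> K v \<longrightarrow>
    (v 0 (t N n) - v 0 (t N (n - 1)))\<^sup>2 \<le> C * K\<^sup>2 * (xi N n powr m * t N n powr \<beta>)"
proof -
  define C where "C = T powr \<beta> * (1 / \<beta>\<^sup>2 + D powr 6)"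
  have C: "0 < C" using beta T_pos by (simp add: C_def add_pos_nonneg)
  have main: "(v 0 (t N n) - v 0 (t N (n - 1)))\<^sup>2 \<le> C * K\<^sup>2 * (xi N n powr m * t N n powr \<beta>)"
    if n: "n \<in> {1..N}" and v: "weakly_singular T \<beta> K v" for N n K v
  proof -
    define a b where "a = t N (n - 1)" and "b = t N n"
    have n1: "1 \<le> n" "n \<le> N" using n by auto
    have K: "0 \<le> K" using weakly_singular_const_nonneg[OF v T_pos] .
    have x: "0 < xi N n" "xi N n \<le> 1" using xi_pos[OF n1] xi_le_1[OF n1] by auto
    have ab: "0 \<le> a" "a < b" "b \<le> T" "b - a = dt N n"
      unfolding a_def b_def
      using t_nonneg[of "n - 1" N] t_less[of "n - 1" n N] t_le_T[of n N] n1 by (auto simp: mesh_step_def)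
    have bT: "b powr \<beta> \<le> T powr \<beta>" using ab beta by (intro powr_mono2) auto
    have "\<bar>v 0 b - v 0 a\<bar>\<^sup>2 \<le> (1 / \<beta>\<^sup>2 + D powr 6) * K\<^sup>2 * (xi N n powr m * (b powr \<beta> * b powr \<beta>))"
    proof (cases "n = 1")
      case True
      have "\<bar>v 0 b - v 0 a\<bar>\<^sup>2 \<le> (K / \<beta> * b powr \<beta>)\<^sup>2"
        using weakly_singular_oscillation[OF v, of a b] ab beta by (intro power_mono) auto
      also have "\<dots> = 1 / \<beta>\<^sup>2 * K\<^sup>2 * (xi N n powr m * (b powr \<beta> * b powr \<beta>))"
        using True t_pos[OF n1] by (simp add: power2_eq_square field_simps)
      also have "\<dots> \<le> (1 / \<beta>\<^sup>2 + D powr 6) * K\<^sup>2 * (xi N n powr m * (b powr \<beta> * b powr \<beta>))"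
        by (intro mult_right_mono) auto
      finally show ?thesis .
    next
      case False
      then have n2: "2 \<le> n" using n1 by auto
      have a: "0 < a" unfolding a_def using t_pos[of "n - 1" N] n2 n1 by auto
      have "\<bar>v 0 b - v 0 a\<bar> \<le> K * a powr (\<beta> - 1) * dt N n"
        using weakly_singular_increment[OF v, of 0 a b] a ab beta by auto
      also have "\<dots> \<le> K * (D * b powr (\<beta> - 1)) * (D\<^sup>2 * (b * xi N n powr (1 / r)))"
      proof (intro mult_mono mult_left_mono)
        have "a powr (\<beta> - 1) \<le> D powr (- (\<beta> - 1)) * b powr (\<beta> - 1)"
          unfolding a_def b_def using prev_power_le[of n N "\<beta> - 1"] n2 n1 beta by auto
        also have "\<dots> \<le> D powr 1 * b powr (\<beta> - 1)"
          using D_ge_1 beta by (intro mult_right_mono powr_mono) auto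
        finally show "a powr (\<beta> - 1) \<le> D * b powr (\<beta> - 1)" using D_ge_1 by simp
        show "dt N n \<le> D\<^sup>2 * (b * xi N n powr (1 / r))" unfolding b_def by (rule step_bounds_ratio(1)[OF n])
      qed (use K D_ge_1 dt_pos[OF n1] in auto)
      finally have "\<bar>v 0 b - v 0 a\<bar>\<^sup>2 \<le> (K * (D * b powr (\<beta> - 1)) * (D\<^sup>2 * (b * xi N n powr (1 / r))))\<^sup>2"
        by (intro power_mono) auto
      also have "\<dots> = D powr 6 * K\<^sup>2 * (xi N n powr (2 / r) * (b powr \<beta> * b powr \<beta>))"
      proof -
        have p: "(xi N n powr (1 / r)) * (xi N n powr (1 / r)) = xi N n powr (2 / r)"
          unfolding powr_add[symmetric] by (rule arg_cong[where f = "(powr) (xi N n)"]) simp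
        have q: "b powr (\<beta> - 1) * b = b powr \<beta>" using ab by (simp add: powr_diff)
        have d: "D * D\<^sup>2 * (D * D\<^sup>2) = D powr 6"
          using D_ge_1 by (simp add: powr_numeral power2_eq_square eval_nat_numeral)
        have "(K * (D * b powr (\<beta> - 1)) * (D\<^sup>2 * (b * xi N n powr (1 / r))))\<^sup>2 =
          (D * D\<^sup>2 * (D * D\<^sup>2)) * K\<^sup>2 * ((xi N n powr (1 / r)) * (xi N n powr (1 / r)) * ((b powr (\<beta> - 1) * b) * (b powr (\<beta> - 1) * b)))"
          unfolding power2_eq_square by (simp only: mult_ac)
        then show ?thesis unfolding p q d .
      qed
      also have "\<dots> \<le> (1 / \<beta>\<^sup>2 + D powr 6) * K\<^sup>2 * (xi N n powr m * (b powr \<beta> * b powr \<beta>))"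
      proof (rule mult_mono)
        have "xi N n powr (2 / r) \<le> xi N n powr m" using x m by (intro powr_mono') auto
        then show "xi N n powr (2 / r) * (b powr \<beta> * b powr \<beta>) \<le> xi N n powr m * (b powr \<beta> * b powr \<beta>)"
          by (intro mult_right_mono) auto
      qed (auto intro!: mult_right_mono)
      finally show ?thesis .
    qed
    also have "\<dots> \<le> (1 / \<beta>\<^sup>2 + D powr 6) * K\<^sup>2 * (xi N n powr m * (T powr \<beta> * b powr \<beta>))"
      using bT by (intro mult_left_mono mult_right_mono) auto
    finally show ?thesis unfolding C_def a_def b_def by (simp add: mult_ac)
  qed
  then show ?thesis using C by (intro exI[of _ C]) auto
qed

end

section \<open>Composition of fractional derivatives\<close>

text \<open>A bridge from the gauge integral to the Lebesgue integral over the line, in which Fubini's theorem is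
available.\<close>

lemma lborel_integral_absolutely_integrable:
  fixes f :: "real \<Rightarrow> real"
  assumes meas: "f \<in> borel_measurable borel" and f: "f absolutely_integrable_on S" and S: "\<And>x. x \<notin> S \<Longrightarrow> f x = 0"
  shows "integrable lborel f" "integral\<^sup>L lborel f = integral S f"
proof -
  have "(\<lambda>x. indicator S x *\<^sub>R f x) = f" using S by (auto simp: indicator_def fun_eq_iff)
  then have "integrable lebesgue f" using f by (simp add: set_integrable_def)
  then show i: "integrable lborel f" using meas by (simp add: integrable_completion)
  have "(\<lambda>x. if x \<in> S then f x else 0) = f" using S by (auto simp: fun_eq_iff)
  then have "(f has_integral integral\<^sup>L lborel f) S"
    using has_integral_integral_lborel[OF i] has_integral_restrict_UNIV[of S f] by simp
  then show "integral\<^sup>L lborel f = integral S f" by (simp add: integral_unique)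
qed

text \<open>The semigroup law for Abel integrals: after the order of integration is exchanged, the inner integral
over \<open>{y..t}\<close> is a Beta integral.\<close>

lemma abel_kernel_fubini:
  fixes a b c t K :: real
  assumes a: "a < 1" and b: "b < 1" and c: "0 < c" and t: "0 < t" and cont: "continuous_on {0<..<t} g"
    and bound: "\<And>y. \<lbrakk>0 < y; y < t\<rbrakk> \<Longrightarrow> \<bar>g y\<bar> \<le> K * y powr (c - 1)"
  shows "((\<lambda>s. (t - s) powr (- a) * integral {0..s} (\<lambda>y. (s - y) powr (- b) * g y)) has_integral
     Beta (1 - b) (1 - a) * integral {0..t} (\<lambda>y. (t - y) powr (1 - a - b) * g y)) {0..t}"
proof -
  define g' where "g' y = indicator {0<..<t} y *\<^sub>R g y" for y
  define f where "f y s = (if 0 < y \<and> y < s \<and> s < t then (t - s) powr (- a) * (s - y) powr (- b) * g' y else 0)" for y s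
  have mg: "g' \<in> borel_measurable borel"
    unfolding g'_def by (rule borel_measurable_continuous_on_indicator) (use cont in auto)
  have mf: "case_prod f \<in> borel_measurable (lborel \<Otimes>\<^sub>M lborel)"
  proof -
    have "case_prod f = (\<lambda>z. if 0 < fst z \<and> fst z < snd z \<and> snd z < t
        then (t - snd z) powr (- a) * (snd z - fst z) powr (- b) * g' (fst z) else 0)"
      by (auto simp: f_def fun_eq_iff)
    also have "\<dots> \<in> borel_measurable (borel \<Otimes>\<^sub>M borel)"
      using mg by measurable
    finally show ?thesis by (simp add: measurable_lborel1 cong: measurable_cong_sets)
  qed
  have mf1: "f y \<in> borel_measurable borel" "(\<lambda>y. f y s) \<in> borel_measurable borel" for y s
  proof -
    show "f y \<in> borel_measurable borel" unfolding f_def by measurable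
    show "(\<lambda>y. f y s) \<in> borel_measurable borel" unfolding f_def using mg by measurable
  qed
  \<comment> \<open>the inner integral over \<open>s\<close> is a Beta integral\<close>
  have inner: "((\<lambda>s. \<bar>f y s\<bar>) has_integral Beta (1 - b) (1 - a) * ((t - y) powr (1 - a - b) * \<bar>g' y\<bar>)) {y..t}"
    "((\<lambda>s. f y s) has_integral Beta (1 - b) (1 - a) * ((t - y) powr (1 - a - b) * g' y)) {y..t}"
    if y: "0 < y" "y < t" for y
  proof -
    have "((\<lambda>x. (t - y - x) powr (- a) * x powr (1 - b - 1)) has_integral (t - y) powr (1 - b - a) * Beta (1 - b) (1 - a)) (cbox 0 (t - y))"
      using beta_kernel_integral[of a "1 - b" "t - y"] a b y by (simp add: cbox_interval)
    from has_integral_affinity'[OF this, of 1 "- y"]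
    have B: "((\<lambda>s. (t - s) powr (- a) * (s - y) powr (- b)) has_integral Beta (1 - b) (1 - a) * (t - y) powr (1 - a - b)) {y..t}"
      by (simp add: cbox_interval algebra_simps)
    have neg: "negligible {y, t}" by simp
    from has_integral_mult_left[OF B, of "\<bar>g' y\<bar>"]
    have "((\<lambda>s. (t - s) powr (- a) * (s - y) powr (- b) * \<bar>g' y\<bar>) has_integral Beta (1 - b) (1 - a) * ((t - y) powr (1 - a - b) * \<bar>g' y\<bar>)) {y..t}"
      by (simp only: mult.assoc)
    then show "((\<lambda>s. \<bar>f y s\<bar>) has_integral Beta (1 - b) (1 - a) * ((t - y) powr (1 - a - b) * \<bar>g' y\<bar>)) {y..t}"
      by (rule has_integral_spike[OF neg, rotated]) (use y in \<open>auto simp: f_def abs_mult\<close>)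
    from has_integral_mult_left[OF B, of "g' y"]
    have "((\<lambda>s. (t - s) powr (- a) * (s - y) powr (- b) * g' y) has_integral Beta (1 - b) (1 - a) * ((t - y) powr (1 - a - b) * g' y)) {y..t}"
      by (simp only: mult.assoc)
    then show "((\<lambda>s. f y s) has_integral Beta (1 - b) (1 - a) * ((t - y) powr (1 - a - b) * g' y)) {y..t}"
      by (rule has_integral_spike[OF neg, rotated]) (use y in \<open>auto simp: f_def\<close>)
  qed
  have f0: "f y s = 0" if "\<not> (0 < y \<and> y < t)" for y s using that by (auto simp: f_def)
  have int_s: "integrable lborel (f y)"
    "(\<integral>s. norm (f y s) \<partial>lborel) = Beta (1 - b) (1 - a) * ((t - y) powr (1 - a - b) * \<bar>g' y\<bar>)"
    "(\<integral>s. f y s \<partial>lborel) = Beta (1 - b) (1 - a) * ((t - y) powr (1 - a - b) * g' y)" for y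
  proof -
    have "integrable lborel (f y) \<and> (\<integral>s. norm (f y s) \<partial>lborel) = Beta (1 - b) (1 - a) * ((t - y) powr (1 - a - b) * \<bar>g' y\<bar>) \<and>
      (\<integral>s. f y s \<partial>lborel) = Beta (1 - b) (1 - a) * ((t - y) powr (1 - a - b) * g' y)"
    proof (cases "0 < y \<and> y < t")
      case True
      have A: "f y absolutely_integrable_on {y..t}"
        using inner(1,2)[of y] True by (intro absolutely_integrable_onI) (auto intro: has_integral_integrable)
      have z: "f y s = 0" if "s \<notin> {y..t}" for s using that by (auto simp: f_def)
      have An: "(\<lambda>s. norm (f y s)) absolutely_integrable_on {y..t}" using absolutely_integrable_norm[OF A] by (simp add: o_def)
      have mn: "(\<lambda>s. norm (f y s)) \<in> borel_measurable borel" using mf1(1)[of y] by measurable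
      show ?thesis
        using lborel_integral_absolutely_integrable[OF mf1(1) A z]
          lborel_integral_absolutely_integrable[OF mn An] z integral_unique[OF inner(1)[of y]] integral_unique[OF inner(2)[of y]] True
        by auto
    next
      case False
      then have "f y = (\<lambda>s. 0)" "g' y = 0" using f0 by (auto simp: g'_def)
      then show ?thesis by simp
    qed
    then show "integrable lborel (f y)"
      "(\<integral>s. norm (f y s) \<partial>lborel) = Beta (1 - b) (1 - a) * ((t - y) powr (1 - a - b) * \<bar>g' y\<bar>)"
      "(\<integral>s. f y s \<partial>lborel) = Beta (1 - b) (1 - a) * ((t - y) powr (1 - a - b) * g' y)" by auto
  qed
  \<comment> \<open>absolute integrability of the outer integrand\<close>
  have out_abs: "(\<lambda>y. (t - y) powr (- (a + b - 1)) * g' y) absolutely_integrable_on {0..t}"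
  proof (rule singular_kernel_integrable(1)[OF _ c t])
    show "a + b - 1 < 1" using a b by simp
    show "continuous_on {0<..<t} g'" using cont by (subst continuous_on_cong[OF refl, of _ _ g]) (auto simp: g'_def)
    show "\<bar>g' x\<bar> \<le> K * x powr (c - 1)" if "0 < x" "x < t" for x using bound that by (simp add: g'_def)
  qed
  have mo: "(\<lambda>y. (t - y) powr (- (a + b - 1)) * g' y) \<in> borel_measurable borel" using mg by measurable
  have zo: "(t - y) powr (- (a + b - 1)) * g' y = 0" if "y \<notin> {0..t}" for y using that by (auto simp: g'_def)
  note outer = lborel_integral_absolutely_integrable[OF mo out_abs zo]
  have e: "- (a + b - 1) = 1 - a - b" by simp
  have F: "integrable (lborel \<Otimes>\<^sub>M lborel) (case_prod f)"
  proof (rule lborel_pair.Fubini_integrable[OF mf])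
    have "integrable lborel (\<lambda>y. \<bar>(t - y) powr (1 - a - b) * g' y\<bar>)"
      using integrable_abs[OF outer(1)] unfolding e .
    then have "integrable lborel (\<lambda>y. Beta (1 - b) (1 - a) * \<bar>(t - y) powr (1 - a - b) * g' y\<bar>)"
      by (rule integrable_mult_right)
    moreover have "(\<integral>s. norm (case_prod f (y, s)) \<partial>lborel) = Beta (1 - b) (1 - a) * \<bar>(t - y) powr (1 - a - b) * g' y\<bar>" for y
      using int_s(2)[of y] by (simp add: abs_mult)
    ultimately show "integrable lborel (\<lambda>y. \<integral>s. norm (case_prod f (y, s)) \<partial>lborel)"
      by (simp only:)
    show "AE y in lborel. integrable lborel (\<lambda>s. case_prod f (y, s))" using int_s(1) by simp
  qed
  define G where "G s = (\<integral>y. f y s \<partial>lborel)" for s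
  have G1: "integrable lborel G"
    unfolding G_def using lborel_pair.integrable_snd[OF F] by simp
  have G2: "integral\<^sup>L lborel G = Beta (1 - b) (1 - a) * integral {0..t} (\<lambda>y. (t - y) powr (1 - a - b) * g y)"
  proof -
    have "integral\<^sup>L lborel G = (\<integral>y. (\<integral>s. f y s \<partial>lborel) \<partial>lborel)"
      unfolding G_def using lborel_pair.Fubini_integral[of f] F by simp
    also have "\<dots> = Beta (1 - b) (1 - a) * integral {0..t} (\<lambda>y. (t - y) powr (1 - a - b) * g' y)"
      unfolding int_s(3) using outer(2)[unfolded e] by simp
    also have "integral {0..t} (\<lambda>y. (t - y) powr (1 - a - b) * g' y) = integral {0..t} (\<lambda>y. (t - y) powr (1 - a - b) * g y)"
      by (rule integral_spike[of "{0, t}"]) (auto simp: g'_def)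
    finally show ?thesis .
  qed
  have Gs: "G s = (t - s) powr (- a) * integral {0..s} (\<lambda>y. (s - y) powr (- b) * g y)" if s: "0 < s" "s < t" for s
  proof -
    have cs: "continuous_on {0<..<s} g" using cont by (rule continuous_on_subset) (use s in auto)
    have "(\<lambda>y. (s - y) powr (- b) * g y) absolutely_integrable_on {0..s}"
      by (rule singular_kernel_integrable(1)[where K = K, OF b c s(1) cs]) (use bound s in auto)
    then have A0: "(\<lambda>y. (t - s) powr (- a) * ((s - y) powr (- b) * g y)) absolutely_integrable_on {0..s}"
      by simp
    have neg: "negligible {0, s}" by simp
    have A: "(\<lambda>y. f y s) absolutely_integrable_on {0..s}"
      by (rule absolutely_integrable_spike[OF A0 neg]) (use s in \<open>auto simp: f_def g'_def\<close>)
    have z: "f y s = 0" if "y \<notin> {0..s}" for y using that by (auto simp: f_def)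
    have "G s = integral {0..s} (\<lambda>y. f y s)"
      unfolding G_def by (rule lborel_integral_absolutely_integrable(2)[OF mf1(2) A z])
    also have "\<dots> = integral {0..s} (\<lambda>y. (t - s) powr (- a) * ((s - y) powr (- b) * g y))"
      by (rule integral_spike[OF neg]) (use s in \<open>auto simp: f_def g'_def\<close>)
    finally show ?thesis by simp
  qed
  have G0: "G s = 0" if "\<not> (0 < s \<and> s < t)" for s
  proof -
    have "f y s = 0" for y using that by (auto simp: f_def)
    then show ?thesis by (simp add: G_def)
  qed
  have "(\<lambda>s. if s \<in> {0..t} then G s else 0) = G" using G0 by (auto simp: fun_eq_iff)
  then have "(G has_integral integral\<^sup>L lborel G) {0..t}"
    using has_integral_integral_lborel[OF G1] has_integral_restrict_UNIV[of "{0..t}" G] by simp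
  then have "(G has_integral Beta (1 - b) (1 - a) * integral {0..t} (\<lambda>y. (t - y) powr (1 - a - b) * g y)) {0..t}"
    unfolding G2 .
  then show ?thesis
    by (rule has_integral_spike[of "{0, t}", rotated 2]) (use Gs in auto)
qed

text \<open>By Lebesgue's differentiation theorem.\<close>

lemma zero_integrals_negligible:
  fixes h :: "real \<Rightarrow> real"
  assumes "\<And>s. \<lbrakk>0 \<le> s; s \<le> T\<rbrakk> \<Longrightarrow> (h has_integral 0) {0..s}" and T: "0 < T"
  shows "\<exists>N. negligible N \<and> (\<forall>x\<in>{0<..<T} - N. h x = 0)"
proof -
  define u where "u x = (if x \<in> {0..T} then h x else 0)" for x
  have "h integrable_on {0..T}" using assms(1)[of T] T by (auto intro: has_integral_integrable)
  then have "u integrable_on UNIV" unfolding u_def by (simp only: integrable_restrict_UNIV)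
  then have ui: "u integrable_on cbox a b" for a b by (rule integrable_on_subcbox) auto
  obtain N where N: "negligible N" "\<And>x e. \<lbrakk>x \<notin> N; 0 < e\<rbrakk> \<Longrightarrow>
       \<exists>d>0. \<forall>k. 0 < k \<and> k < d \<longrightarrow> norm (integral (cbox x (x + k *\<^sub>R One)) u /\<^sub>R k ^ DIM(real) - u x) < e"
    using integrable_ccontinuous_explicit[OF ui] by blast
  have "h x = 0" if x: "x \<in> {0<..<T} - N" for x
  proof (rule ccontr)
    assume "h x \<noteq> 0"
    then have e: "0 < \<bar>h x\<bar>" by simp
    obtain d where d: "0 < d" "\<And>k. \<lbrakk>0 < k; k < d\<rbrakk> \<Longrightarrow> norm (integral (cbox x (x + k *\<^sub>R One)) u /\<^sub>R k ^ DIM(real) - u x) < \<bar>h x\<bar>"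
      using N(2)[OF _ e, of x] x by blast
    define k where "k = min (d / 2) (T - x)"
    have k: "0 < k" "k < d" "x + k \<le> T" using d(1) x by (auto simp: k_def)
    have "integral {x..x + k} u = integral {x..x + k} h"
      using x k by (intro integral_cong) (auto simp: u_def)
    also have "\<dots> = integral {0..x + k} h - integral {0..x} h"
    proof -
      have "h integrable_on {0..x + k}" using assms(1)[of "x + k"] x k by (auto intro: has_integral_integrable)
      then have "integral {0..x} h + integral {x..x + k} h = integral {0..x + k} h"
        using x k by (intro Henstock_Kurzweil_Integration.integral_combine) auto
      then show ?thesis by simp
    qed
    also have "\<dots> = 0" using assms(1)[of "x + k"] assms(1)[of x] x k by (simp add: integral_unique)
    finally have "integral (cbox x (x + k *\<^sub>R One)) u = 0" by (simp add: cbox_interval)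
    then show False using d(2)[OF k(1,2)] x by (simp add: u_def)
  qed
  then show ?thesis using N(1) by blast
qed

lemma Beta_half: "0 < a \<Longrightarrow> Beta a a = (Gamma a)\<^sup>2 / Gamma (2 * a)" for a :: real
  by (simp add: Beta_def power2_eq_square)

text \<open>With \<open>v1\<close> and \<open>v2\<close> the first two derivatives of a function and \<open>p0\<close> its Caputo derivative of order
\<open>\<beta>\<close>, both sides are Abel integrals of \<open>v2\<close>.  Since \<open>v1 0 = 0\<close>, the function \<open>p0\<close> is the Abel integral
of order \<open>2 - \<beta>\<close> of \<open>v2\<close>, so its derivative \<open>p1\<close> agrees almost everywhere with the Abel integral \<open>w\<close> of order
\<open>1 - \<beta>\<close>, and another integral of order \<open>1 - \<beta>\<close> gives order \<open>2 - 2 * \<beta>\<close>.  The identity for \<open>p1\<close> is obtained from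
the integrals over all \<open>{0..s}\<close>, which avoids differentiating a singular integral.\<close>

lemma fractional_derivative_composition:
  fixes \<beta> T K :: real and v1 v2 p0 p1 :: "real \<Rightarrow> real"
  assumes beta: "1 / 2 < \<beta>" "\<beta> < 1" and T: "0 < T"
    and v1: "continuous_on {0..T} v1" "v1 0 = 0"
    and v1': "\<And>s. \<lbrakk>0 < s; s < T\<rbrakk> \<Longrightarrow> (v1 has_real_derivative v2 s) (at s)"
    and v2: "continuous_on {0<..<T} v2" "\<And>s. \<lbrakk>0 < s; s < T\<rbrakk> \<Longrightarrow> \<bar>v2 s\<bar> \<le> K * s powr (2 * \<beta> - 2)"
    and p0: "continuous_on {0..T} p0"
      "\<And>s. \<lbrakk>0 \<le> s; s \<le> T\<rbrakk> \<Longrightarrow> p0 s = 1 / Gamma (1 - \<beta>) * integral {0..s} (\<lambda>y. (s - y) powr (- \<beta>) * v1 y)"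
    and p1: "\<And>s. \<lbrakk>0 < s; s < T\<rbrakk> \<Longrightarrow> (p0 has_real_derivative p1 s) (at s)"
    and t: "0 < t" "t \<le> T"
  shows "1 / Gamma (1 - \<beta>) * integral {0..t} (\<lambda>s. (t - s) powr (- \<beta>) * p1 s) =
    1 / Gamma (2 - 2 * \<beta>) * integral {0..t} (\<lambda>s. (t - s) powr (1 - 2 * \<beta>) * v2 s)"
proof -
  define G where "G = Gamma (1 - \<beta>)"
  have G: "0 < G" unfolding G_def using beta by (intro Gamma_real_pos) auto
  define c where "c = 2 * \<beta> - 1"
  have c: "0 < c" "\<And>s. \<lbrakk>0 < s; s < T\<rbrakk> \<Longrightarrow> \<bar>v2 s\<bar> \<le> K * s powr (c - 1)" using beta v2 by (auto simp: c_def)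
  define w where "w s = integral {0..s} (\<lambda>y. (s - y) powr (- \<beta>) * v2 y)" for s
  have v1_int: "integral {0..s} (\<lambda>y. (s - y) powr (- 0) * v2 y) = v1 s" if s: "0 \<le> s" "s \<le> T" for s
  proof -
    have "(v2 has_integral v1 s - v1 0) {0..s}"
      using s v1' continuous_on_subset[OF v1(1)]
      by (intro fundamental_theorem_of_calculus_interior)
        (auto simp: has_real_derivative_iff_has_vector_derivative[symmetric])
    then have "integral {0..s} v2 = v1 s" using v1(2) by (simp add: integral_unique)
    moreover have "integral {0..s} (\<lambda>y. (s - y) powr (- 0) * v2 y) = integral {0..s} v2"
      by (rule integral_spike[of "{s}"]) (auto simp: powr_def)
    ultimately show ?thesis by simp
  qed
  have cs: "continuous_on {0<..<s} v2" if "s \<le> T" for s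
    using v2(1) by (rule continuous_on_subset) (use that in auto)
  have p_eq: "G * p0 s = Beta 1 (1 - \<beta>) * integral {0..s} (\<lambda>y. (s - y) powr (1 - \<beta>) * v2 y)"
    if s: "0 < s" "s \<le> T" for s
  proof -
    have "((\<lambda>x. (s - x) powr (- \<beta>) * integral {0..x} (\<lambda>y. (x - y) powr (- 0) * v2 y)) has_integral
      Beta (1 - 0) (1 - \<beta>) * integral {0..s} (\<lambda>y. (s - y) powr (1 - \<beta> - 0) * v2 y)) {0..s}"
      by (rule abel_kernel_fubini[where K = K, OF _ _ c(1) s(1) cs[OF s(2)]]) (use beta c(2) s in auto)
    then have "integral {0..s} (\<lambda>x. (s - x) powr (- \<beta>) * integral {0..x} (\<lambda>y. (x - y) powr (- 0) * v2 y))
       = Beta (1 - 0) (1 - \<beta>) * integral {0..s} (\<lambda>y. (s - y) powr (1 - \<beta> - 0) * v2 y)"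
      by (rule integral_unique)
    moreover have "integral {0..s} (\<lambda>x. (s - x) powr (- \<beta>) * integral {0..x} (\<lambda>y. (x - y) powr (- 0) * v2 y))
       = integral {0..s} (\<lambda>x. (s - x) powr (- \<beta>) * v1 x)"
      using v1_int s by (intro integral_cong) auto
    ultimately show ?thesis using p0(2)[of s] s G by (simp add: G_def)
  qed
  have w_int: "(w has_integral G * p0 s) {0..s}" if s: "0 < s" "s \<le> T" for s
  proof -
    have "((\<lambda>x. (s - x) powr (- 0) * w x) has_integral
      Beta (1 - \<beta>) (1 - 0) * integral {0..s} (\<lambda>y. (s - y) powr (1 - 0 - \<beta>) * v2 y)) {0..s}"
      unfolding w_def by (rule abel_kernel_fubini[where K = K, OF _ _ c(1) s(1) cs[OF s(2)]]) (use beta c(2) s in auto)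
    then have "((\<lambda>x. (s - x) powr (- 0) * w x) has_integral G * p0 s) {0..s}"
      using p_eq[OF s] by (simp add: Beta_commute)
    then show ?thesis by (rule has_integral_spike[of "{s}", rotated 2]) (auto simp: powr_def)
  qed
  have p00: "p0 0 = 0" using p0(2)[of 0] T by simp
  have zero: "((\<lambda>x. w x - G * p1 x) has_integral 0) {0..s}" if s: "0 \<le> s" "s \<le> T" for s
  proof (cases "s = 0")
    case False
    have "(p1 has_integral p0 s - p0 0) {0..s}"
      using s p1 continuous_on_subset[OF p0(1)]
      by (intro fundamental_theorem_of_calculus_interior)
        (auto simp: has_real_derivative_iff_has_vector_derivative[symmetric])
    then have "((\<lambda>x. w x - G * p1 x) has_integral G * p0 s - G * (p0 s - p0 0)) {0..s}"
      using s False by (intro has_integral_diff has_integral_mult_right w_int) auto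
    then show ?thesis using p00 by simp
  qed auto
  obtain N where N: "negligible N" "\<And>x. x \<in> {0<..<T} - N \<Longrightarrow> w x - G * p1 x = 0"
    using zero_integrals_negligible[OF zero T] by blast
  have neg: "negligible (N \<union> {0, t})" using N(1) by simp
  have "((\<lambda>s. (t - s) powr (- \<beta>) * w s) has_integral
      Beta (1 - \<beta>) (1 - \<beta>) * integral {0..t} (\<lambda>y. (t - y) powr (1 - \<beta> - \<beta>) * v2 y)) {0..t}"
    unfolding w_def by (rule abel_kernel_fubini[where K = K, OF _ _ c(1) t(1) cs[OF t(2)]]) (use beta c(2) t in auto)
  then have "((\<lambda>s. (t - s) powr (- \<beta>) * (G * p1 s)) has_integral
      Beta (1 - \<beta>) (1 - \<beta>) * integral {0..t} (\<lambda>y. (t - y) powr (1 - \<beta> - \<beta>) * v2 y)) {0..t}"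
    by (rule has_integral_spike[OF neg, rotated]) (use N(2) t in force)
  then have "integral {0..t} (\<lambda>s. (t - s) powr (- \<beta>) * (G * p1 s)) =
      Beta (1 - \<beta>) (1 - \<beta>) * integral {0..t} (\<lambda>y. (t - y) powr (1 - \<beta> - \<beta>) * v2 y)"
    by (rule integral_unique)
  moreover have "integral {0..t} (\<lambda>s. (t - s) powr (- \<beta>) * (G * p1 s)) = G * integral {0..t} (\<lambda>s. (t - s) powr (- \<beta>) * p1 s)"
    by (simp add: mult.left_commute)
  moreover have "Beta (1 - \<beta>) (1 - \<beta>) = G\<^sup>2 / Gamma (2 - 2 * \<beta>)"
    using Beta_half[of "1 - \<beta>"] beta by (simp add: G_def algebra_simps)
  moreover have "1 - \<beta> - \<beta> = 1 - 2 * \<beta>" by simp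
  ultimately have "G * integral {0..t} (\<lambda>s. (t - s) powr (- \<beta>) * p1 s) =
      G * (G * (1 / Gamma (2 - 2 * \<beta>) * integral {0..t} (\<lambda>y. (t - y) powr (1 - 2 * \<beta>) * v2 y)))"
    by (simp add: power2_eq_square)
  then have "integral {0..t} (\<lambda>s. (t - s) powr (- \<beta>) * p1 s) =
      G * (1 / Gamma (2 - 2 * \<beta>) * integral {0..t} (\<lambda>y. (t - y) powr (1 - 2 * \<beta>) * v2 y))"
    using G by (subst (asm) mult_cancel_left) auto
  then show ?thesis unfolding G_def[symmetric] using G by simp
qed

section \<open>Differences of smooth functions on an interval\<close>

lemma power_growth:
  fixes f f' :: "real \<Rightarrow> real"
  assumes "continuous_on {0..h} f" "f 0 = 0" "\<And>s. \<lbrakk>0 < s; s < h\<rbrakk> \<Longrightarrow> (f has_real_derivative f' s) (at s)"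
    and "\<And>s. \<lbrakk>0 < s; s < h\<rbrakk> \<Longrightarrow> \<bar>f' s\<bar> \<le> M * s ^ k" and "0 \<le> M" "0 \<le> s" "s \<le> h"
  shows "\<bar>f s\<bar> \<le> M * s ^ Suc k"
proof (cases "s = 0")
  case False
  then have s: "0 < s" using assms by simp
  have "continuous_on {0..s} f" using assms(1) by (rule continuous_on_subset) (use assms in auto)
  moreover have "f differentiable (at x)" if "0 < x" "x < s" for x
    using assms(3)[of x] that assms(7) real_differentiable_def by fastforce
  ultimately obtain d z where z: "0 < z" "z < s" "DERIV f z :> d" "f s - f 0 = (s - 0) * d"
    using MVT[of 0 s f] s by (metis less_eq_real_def)
  have "d = f' z" using assms(3)[of z] z assms(7) DERIV_unique by force
  then have "\<bar>d\<bar> \<le> M * z ^ k" using assms(4)[of z] z assms(7) by auto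
  also have "\<dots> \<le> M * s ^ k" using z assms(5) by (intro mult_left_mono power_mono) auto
  finally have "s * \<bar>d\<bar> \<le> s * (M * s ^ k)" using s by (intro mult_left_mono) auto
  then show ?thesis using z(4) assms(2) s by (simp add: abs_mult mult_ac)
qed (use assms in auto)

text \<open>A function with its first \<open>m\<close> derivatives, one-sided at boundary points of \<open>S\<close>.\<close>

definition derivs_on :: "real set \<Rightarrow> nat \<Rightarrow> (nat \<Rightarrow> real \<Rightarrow> real) \<Rightarrow> bool" where
  "derivs_on S m F \<longleftrightarrow> (\<forall>l<m. \<forall>x\<in>S. (F l has_real_derivative F (Suc l) x) (at x within S))"

lemma derivs_on_at:
  assumes "derivs_on {0..L} m F" "l < m" "0 < x" "x < L"
  shows "(F l has_real_derivative F (Suc l) x) (at x)"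
proof -
  have "(F l has_real_derivative F (Suc l) x) (at x within {0..L})"
    using assms by (auto simp: derivs_on_def)
  moreover have "at x within {0..L} = at x" using assms by (intro at_within_interior) auto
  ultimately show ?thesis by simp
qed

lemma derivs_on_continuous: "derivs_on S m F \<Longrightarrow> l < m \<Longrightarrow> continuous_on S (F l)"
  by (meson DERIV_continuous_on derivs_on_def)

lemma derivs_on_shift:
  assumes F: "derivs_on {0..L} m F" "l < m"
  shows "\<lbrakk>0 < x + s; x + s < L\<rbrakk> \<Longrightarrow> ((\<lambda>s. F l (x + s)) has_real_derivative F (Suc l) (x + s)) (at s)"
    and "\<lbrakk>0 < x - s; x - s < L\<rbrakk> \<Longrightarrow> ((\<lambda>s. F l (x - s)) has_real_derivative - F (Suc l) (x - s)) (at s)"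
proof -
  have 1: "((\<lambda>s. x + s) has_real_derivative 1) (at s)" "((\<lambda>s. x - s) has_real_derivative - 1) (at s)"
    by (auto intro!: derivative_eq_intros)
  show "((\<lambda>s. F l (x + s)) has_real_derivative F (Suc l) (x + s)) (at s)" if "0 < x + s" "x + s < L"
    using DERIV_chain2[where f = "F l" and g = "\<lambda>s. x + s" and x = s and s = UNIV, OF derivs_on_at[OF F that] 1(1)] by simp
  show "((\<lambda>s. F l (x - s)) has_real_derivative - F (Suc l) (x - s)) (at s)" if "0 < x - s" "x - s < L"
    using DERIV_chain2[where f = "F l" and g = "\<lambda>s. x - s" and x = s and s = UNIV, OF derivs_on_at[OF F that] 1(2)] by simp
qed

lemma derivs_on_increment:
  assumes "derivs_on {0..L} m F" "l < m" "x \<in> {0..L}" "y \<in> {0..L}"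
    and "\<And>s. s \<in> {0..L} \<Longrightarrow> \<bar>F (Suc l) s\<bar> \<le> B"
  shows "\<bar>F l y - F l x\<bar> \<le> B * \<bar>y - x\<bar>"
  using field_differentiable_bound[of "{0..L}" "F l" "F (Suc l)" B y x] assms
  by (auto simp: derivs_on_def)

lemma second_difference_bound:
  assumes F: "derivs_on {0..L} 2 F" and B: "\<And>s. s \<in> {0..L} \<Longrightarrow> \<bar>F 2 s\<bar> \<le> B"
    and x: "0 \<le> h" "0 \<le> x - h" "x + h \<le> L"
  shows "\<bar>F 0 (x + h) - 2 * F 0 x + F 0 (x - h)\<bar> \<le> 2 * B * h\<^sup>2"
proof -
  have B0: "0 \<le> B" using B[of x] x by force
  define f where "f s = F 0 (x + s) - 2 * F 0 x + F 0 (x - s)" for s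
  have c: "continuous_on {0..h} (\<lambda>s. F l (x + s))" "continuous_on {0..h} (\<lambda>s. F l (x - s))" if "l < 2" for l
    using x by (auto intro!: continuous_on_compose2[OF derivs_on_continuous[OF F that]] continuous_intros)
  have d: "((\<lambda>s. F l (x + s)) has_real_derivative F (Suc l) (x + s)) (at s)"
    "((\<lambda>s. F l (x - s)) has_real_derivative - F (Suc l) (x - s)) (at s)" if "l < 2" "0 < s" "s < h" for l s
    using derivs_on_shift[OF F that(1)] that x by auto
  have "\<bar>f h\<bar> \<le> 2 * B * h ^ Suc 1"
  proof (rule power_growth[where f' = "\<lambda>s. F 1 (x + s) - F 1 (x - s)"])
    show "continuous_on {0..h} f" unfolding f_def by (intro continuous_intros c) auto
    fix s assume s: "0 < s" "s < h"
    show "(f has_real_derivative F 1 (x + s) - F 1 (x - s)) (at s)"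
      unfolding f_def using d[of 0 s] s by (auto intro!: derivative_eq_intros)
    have "\<bar>F 1 (x + s) - F 1 (x - s)\<bar> \<le> B * \<bar>(x + s) - (x - s)\<bar>"
      using s x B by (intro derivs_on_increment[OF F]) (auto simp: numeral_2_eq_2)
    then show "\<bar>F 1 (x + s) - F 1 (x - s)\<bar> \<le> 2 * B * s ^ 1" using s by simp
  qed (use x B0 in \<open>auto simp: f_def\<close>)
  then show ?thesis by (simp add: f_def power2_eq_square)
qed

text \<open>The error \<open>f0\<close> as a function of the step vanishes at \<open>0\<close> together with its first two derivatives, and the
third derivative \<open>F 3 (x + s) - F 3 (x - s)\<close> is of order \<open>s\<close>; each integration adds one power.\<close>

lemma second_difference_consistency:
  assumes F: "derivs_on {0..L} 4 F" and B: "\<And>s. s \<in> {0..L} \<Longrightarrow> \<bar>F 4 s\<bar> \<le> B"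
    and x: "0 \<le> h" "0 \<le> x - h" "x + h \<le> L"
  shows "\<bar>F 0 (x + h) - 2 * F 0 x + F 0 (x - h) - h\<^sup>2 * F 2 x\<bar> \<le> 2 * B * h ^ 4"
proof -
  have B0: "0 \<le> B" using B[of x] x by force
  define f0 where "f0 s = F 0 (x + s) - 2 * F 0 x + F 0 (x - s) - s\<^sup>2 * F 2 x" for s
  define f1 where "f1 s = F 1 (x + s) - F 1 (x - s) - 2 * s * F 2 x" for s
  define f2 where "f2 s = F 2 (x + s) + F 2 (x - s) - 2 * F 2 x" for s
  have c: "continuous_on {0..h} (\<lambda>s. F l (x + s))" "continuous_on {0..h} (\<lambda>s. F l (x - s))" if "l < 4" for l
    using x by (auto intro!: continuous_on_compose2[OF derivs_on_continuous[OF F that]] continuous_intros)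
  have d: "((\<lambda>s. F l (x + s)) has_real_derivative F (Suc l) (x + s)) (at s)"
    "((\<lambda>s. F l (x - s)) has_real_derivative - F (Suc l) (x - s)) (at s)" if "l < 4" "0 < s" "s < h" for l s
    using derivs_on_shift[OF F that(1)] that x by auto
  have f2: "\<bar>f2 s\<bar> \<le> 2 * B * s ^ Suc 1" if "0 \<le> s" "s \<le> h" for s
  proof (rule power_growth[where f' = "\<lambda>s. F 3 (x + s) - F 3 (x - s)"])
    show "continuous_on {0..h} f2" unfolding f2_def by (intro continuous_intros c) auto
    fix s assume s: "0 < s" "s < h"
    show "(f2 has_real_derivative F 3 (x + s) - F 3 (x - s)) (at s)"
      unfolding f2_def using d[of 2 s] s by (auto intro!: derivative_eq_intros simp: numeral_3_eq_3 numeral_2_eq_2)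
    have "\<bar>F 3 (x + s) - F 3 (x - s)\<bar> \<le> B * \<bar>(x + s) - (x - s)\<bar>"
      using s x B by (intro derivs_on_increment[OF F]) (auto simp: eval_nat_numeral)
    then show "\<bar>F 3 (x + s) - F 3 (x - s)\<bar> \<le> 2 * B * s ^ 1" using s by simp
  qed (use x B0 that in \<open>auto simp: f2_def\<close>)
  have f1: "\<bar>f1 s\<bar> \<le> 2 * B * s ^ Suc (Suc 1)" if "0 \<le> s" "s \<le> h" for s
  proof (rule power_growth[where f' = f2])
    show "continuous_on {0..h} f1" unfolding f1_def by (intro continuous_intros c) auto
    fix s assume s: "0 < s" "s < h"
    show "(f1 has_real_derivative f2 s) (at s)"
      unfolding f1_def f2_def using d[of 1 s] s by (auto intro!: derivative_eq_intros simp: numeral_2_eq_2)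
    show "\<bar>f2 s\<bar> \<le> 2 * B * s ^ Suc 1" using f2[of s] s by auto
  qed (use x B0 that in \<open>auto simp: f1_def\<close>)
  have "\<bar>f0 h\<bar> \<le> 2 * B * h ^ Suc (Suc (Suc 1))"
  proof (rule power_growth[where f' = f1])
    show "continuous_on {0..h} f0" unfolding f0_def by (intro continuous_intros c) auto
    fix s assume s: "0 < s" "s < h"
    show "(f0 has_real_derivative f1 s) (at s)"
      unfolding f0_def f1_def using d[of 0 s] s by (auto intro!: derivative_eq_intros)
    show "\<bar>f1 s\<bar> \<le> 2 * B * s ^ Suc (Suc 1)" using f1[of s] s by auto
  qed (use x B0 in \<open>auto simp: f0_def\<close>)
  then show ?thesis by (simp add: f0_def eval_nat_numeral)
qed

lemma deriv_deriv_eq: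
  assumes "derivs_on {0..L} 2 F" "0 < x" "x < L"
  shows "deriv (deriv (F 0)) x = F 2 x"
proof -
  have "eventually (\<lambda>s. s \<in> {0<..<L}) (nhds x)" using assms by (intro eventually_nhds_in_open) auto
  then have "eventually (\<lambda>s. deriv (F 0) s = F 1 s) (nhds x)"
    by eventually_elim (use assms in \<open>auto intro!: DERIV_imp_deriv dest: derivs_on_at[of L 2 F 0]\<close>)
  then have "deriv (deriv (F 0)) x = deriv (F 1) x" by (intro deriv_cong_ev) auto
  also have "\<dots> = F 2 x" using derivs_on_at[OF assms(1), of 1 x] assms by (auto intro!: DERIV_imp_deriv simp: numeral_2_eq_2)
  finally show ?thesis .
qed

section \<open>Space derivatives on the square\<close>

lemma dwithin_works: "f differentiable (at x within S) \<Longrightarrow> (f has_real_derivative dwithin S f x) (at x within S)"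
  by (simp add: dwithin_def vector_derivative_works has_real_derivative_iff_has_vector_derivative)

lemma space_differentiable_derivs_x:
  assumes "space_differentiable L m w" "y \<in> {0..L}"
  shows "derivs_on {0..L} m (\<lambda>l s. space_deriv L l 0 w s y)"
  unfolding derivs_on_def
proof (intro allI impI ballI)
  fix l x assume "l < m" "x \<in> {0..L}"
  then have "(\<lambda>s. space_deriv L l 0 w s y) differentiable (at x within {0..L})"
    using assms unfolding space_differentiable_def by force
  from dwithin_works[OF this]
  show "((\<lambda>s. space_deriv L l 0 w s y) has_real_derivative space_deriv L (Suc l) 0 w x y) (at x within {0..L})"
    by (simp add: space_deriv_def pdx_def)
qed

lemma space_differentiable_derivs_y:
  assumes "space_differentiable L m w" "x \<in> {0..L}"
  shows "derivs_on {0..L} m (\<lambda>l s. space_deriv L 0 l w x s)"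
  unfolding derivs_on_def
proof (intro allI impI ballI)
  fix l y assume "l < m" "y \<in> {0..L}"
  then have "(\<lambda>s. space_deriv L 0 l w x s) differentiable (at y within {0..L})"
    using assms unfolding space_differentiable_def by force
  from dwithin_works[OF this]
  show "((\<lambda>s. space_deriv L 0 l w x s) has_real_derivative space_deriv L 0 (Suc l) w x y) (at y within {0..L})"
    by (simp add: space_deriv_def pdy_def)
qed

lemma space_deriv_0 [simp]: "space_deriv L 0 0 w = w"
  by (simp add: space_deriv_def)

text \<open>In the interior the two-sided derivatives in the Laplacian agree with those within the closed
square.\<close>

lemma laplacian_eq_space_deriv:
  assumes "space_differentiable L 2 w" "0 < x" "x < L" "0 < y" "y < L"
  shows "laplacian w x y = space_deriv L 2 0 w x y + space_deriv L 0 2 w x y"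
  using deriv_deriv_eq[OF space_differentiable_derivs_x[OF assms(1), of y], of x]
    deriv_deriv_eq[OF space_differentiable_derivs_y[OF assms(1), of x], of y] assms
  by (simp add: laplacian_def)

lemma laplacian_add_scaled:
  assumes "space_differentiable L 2 w" "space_differentiable L 2 \<phi>" "0 < x" "x < L" "0 < y" "y < L"
  shows "laplacian (\<lambda>x y. w x y + c * \<phi> x y) x y = laplacian w x y + c * laplacian \<phi> x y"
proof -
  have lin: "deriv (deriv (\<lambda>s. F 0 s + c * H 0 s)) z = F 2 z + c * H 2 z"
    if "derivs_on {0..L} 2 F" "derivs_on {0..L} 2 H" "0 < z" "z < L" for F H z
  proof -
    have "derivs_on {0..L} 2 (\<lambda>l s. F l s + c * H l s)"
      using that unfolding derivs_on_def by (auto intro!: derivative_eq_intros)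
    from deriv_deriv_eq[OF this that(3,4)] show ?thesis .
  qed
  show ?thesis
    unfolding laplacian_eq_space_deriv[OF assms(1,3-6)] laplacian_eq_space_deriv[OF assms(2,3-6)]
    using lin[OF space_differentiable_derivs_x[OF assms(1)] space_differentiable_derivs_x[OF assms(2)], of y y x]
      lin[OF space_differentiable_derivs_y[OF assms(1)] space_differentiable_derivs_y[OF assms(2)], of x x y] assms
    by (simp add: laplacian_def algebra_simps)
qed

section \<open>Grid functions and their discrete energy\<close>

locale grid =
  fixes L h :: real and M :: nat
  assumes L_pos: "0 < L" and M_pos: "1 \<le> M" and h_eq: "h = L / real M"
begin

lemma h_pos: "0 < h" using L_pos M_pos by (simp add: h_eq)
lemma Mh: "real M * h = L" using M_pos by (simp add: h_eq)

lemma node_in: "i \<le> M \<Longrightarrow> real i * h \<in> {0..L}"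
  using h_pos mult_right_mono[of "real i" "real M" h] by (auto simp: Mh)

lemma node_interior: "i \<in> {1..M-1} \<Longrightarrow> 0 < real i * h \<and> real i * h < L"
  using h_pos mult_strict_right_mono[of "real i" "real M" h] by (auto simp: Mh)

lemma node_neighbours:
  assumes "i \<in> {1..M-1}"
  shows "real (i + 1) * h = real i * h + h" "real (i - 1) * h = real i * h - h"
    "0 \<le> real i * h - h" "real i * h + h \<le> L"
proof -
  show 1: "real (i + 1) * h = real i * h + h" "real (i - 1) * h = real i * h - h"
    using assms by (auto simp: algebra_simps of_nat_diff)
  show "0 \<le> real i * h - h" "real i * h + h \<le> L"
    using node_in[of "i - 1"] node_in[of "i + 1"] assms unfolding 1 by auto
qed

lemma discrete_laplacian_bound:
  assumes w: "space_differentiable L 2 w" and ij: "i \<in> {1..M-1}" "j \<in> {1..M-1}"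
    and B: "\<And>x y. \<lbrakk>x \<in> {0..L}; y \<in> {0..L}\<rbrakk> \<Longrightarrow> \<bar>space_deriv L 2 0 w x y\<bar> \<le> B \<and> \<bar>space_deriv L 0 2 w x y\<bar> \<le> B"
  shows "\<bar>discrete_laplacian h (\<lambda>i j. w (real i * h) (real j * h)) i j\<bar> \<le> 4 * B"
proof -
  define x y where "x = real i * h" and "y = real j * h"
  have xy: "x \<in> {0..L}" "y \<in> {0..L}" unfolding x_def y_def using node_in ij by auto
  note nx = node_neighbours[OF ij(1), folded x_def] and ny = node_neighbours[OF ij(2), folded y_def]
  have "\<bar>w (x + h) y - 2 * w x y + w (x - h) y\<bar> \<le> 2 * B * h\<^sup>2"
    using second_difference_bound[OF space_differentiable_derivs_x[OF w xy(2)], of B h x] B xy nx h_pos by auto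
  moreover have "\<bar>w x (y + h) - 2 * w x y + w x (y - h)\<bar> \<le> 2 * B * h\<^sup>2"
    using second_difference_bound[OF space_differentiable_derivs_y[OF w xy(1)], of B h y] B xy ny h_pos by auto
  ultimately have "\<bar>w (x + h) y + w (x - h) y + w x (y + h) + w x (y - h) - 4 * w x y\<bar> \<le> 4 * B * h\<^sup>2"
    by linarith
  then show ?thesis
    unfolding discrete_laplacian_def nx ny x_def[symmetric] y_def[symmetric]
    using h_pos by (simp add: abs_divide divide_le_eq)
qed

lemma discrete_laplacian_consistency:
  assumes w: "space_differentiable L 4 w" and ij: "i \<in> {1..M-1}" "j \<in> {1..M-1}"
    and B: "\<And>x y. \<lbrakk>x \<in> {0..L}; y \<in> {0..L}\<rbrakk> \<Longrightarrow> \<bar>space_deriv L 4 0 w x y\<bar> \<le> B \<and> \<bar>space_deriv L 0 4 w x y\<bar> \<le> B"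
  shows "\<bar>discrete_laplacian h (\<lambda>i j. w (real i * h) (real j * h)) i j - laplacian w (real i * h) (real j * h)\<bar> \<le> 4 * B * h\<^sup>2"
proof -
  define x y where "x = real i * h" and "y = real j * h"
  have xy: "x \<in> {0..L}" "y \<in> {0..L}" unfolding x_def y_def using node_in ij by auto
  note nx = node_neighbours[OF ij(1), folded x_def] and ny = node_neighbours[OF ij(2), folded y_def]
  have w2: "space_differentiable L 2 w" using w by (simp add: space_differentiable_def)
  have lap: "laplacian w x y = space_deriv L 2 0 w x y + space_deriv L 0 2 w x y"
    using laplacian_eq_space_deriv[OF w2] node_interior ij unfolding x_def y_def by auto
  have "\<bar>w (x + h) y - 2 * w x y + w (x - h) y - h\<^sup>2 * space_deriv L 2 0 w x y\<bar> \<le> 2 * B * h ^ 4"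
    using second_difference_consistency[OF space_differentiable_derivs_x[OF w xy(2)], of B h x] B xy nx h_pos by auto
  moreover have "\<bar>w x (y + h) - 2 * w x y + w x (y - h) - h\<^sup>2 * space_deriv L 0 2 w x y\<bar> \<le> 2 * B * h ^ 4"
    using second_difference_consistency[OF space_differentiable_derivs_y[OF w xy(1)], of B h y] B xy ny h_pos by auto
  ultimately have "\<bar>w (x + h) y + w (x - h) y + w x (y + h) + w x (y - h) - 4 * w x y - h\<^sup>2 * laplacian w x y\<bar> \<le> 4 * B * h ^ 4"
    unfolding lap distrib_left by linarith
  also have "4 * B * h ^ 4 = (4 * B * h\<^sup>2) * h\<^sup>2" by (simp add: eval_nat_numeral)
  finally have "\<bar>(w (x + h) y + w (x - h) y + w x (y + h) + w x (y - h) - 4 * w x y - h\<^sup>2 * laplacian w x y) / h\<^sup>2\<bar> \<le> 4 * B * h\<^sup>2"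
    using h_pos by (simp add: abs_divide divide_le_eq)
  then show ?thesis
    unfolding discrete_laplacian_def nx ny x_def[symmetric] y_def[symmetric]
    using h_pos by (simp add: diff_divide_distrib)
qed

end

text \<open>A pair of grid functions as one vector, with the grid values of \<open>a\<close> at the index \<open>0\<close> and the differences of
\<open>u\<close> in the two directions at \<open>1\<close> and \<open>2\<close>.  The scaling makes its Euclidean norm the energy
\<open>\<parallel>a\<parallel>\<^sup>2 + \<nu> \<parallel>\<nabla> u\<parallel>\<^sup>2\<close>; the factors \<open>h\<close> and \<open>1 / h\<close> of the differences cancel.\<close>

definition energy_vector :: "real \<Rightarrow> real \<Rightarrow> (nat \<Rightarrow> nat \<Rightarrow> real) \<Rightarrow> (nat \<Rightarrow> nat \<Rightarrow> real) \<Rightarrow> nat \<times> nat \<times> nat \<Rightarrow> real" where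
  "energy_vector \<nu> h a u = (\<lambda>(c, i, j). if c = 0 then h * a i j
     else sqrt \<nu> * (if c = 1 then u i j - u (i - 1) j else u i j - u i (j - 1)))"

definition energy_index :: "nat \<Rightarrow> (nat \<times> nat \<times> nat) set" where
  "energy_index M = ({0} \<times> {1..M-1} \<times> {1..M-1} \<union> {1} \<times> {1..M} \<times> {1..M-1}) \<union> {2} \<times> {1..M-1} \<times> {1..M}"

lemma sum_energy_index:
  "(\<Sum>x\<in>energy_index M. f x) = (\<Sum>i=1..M-1. \<Sum>j=1..M-1. f (0, i, j)) +
     (\<Sum>i=1..M. \<Sum>j=1..M-1. f (1, i, j)) + (\<Sum>i=1..M-1. \<Sum>j=1..M. f (2, i, j))"
proof -
  have s: "(\<Sum>x\<in>{c} \<times> A \<times> B. f x) = (\<Sum>i\<in>A. \<Sum>j\<in>B. f (c, i, j))" for c and A B :: "nat set"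
    by (simp add: sum.cartesian_product' )
  show ?thesis unfolding energy_index_def
    by (subst sum.union_disjoint; (subst sum.union_disjoint)?) (auto simp: s)
qed

lemma energy_vector_linear:
  "energy_vector \<nu> h (\<lambda>i j. c * a i j + d * b i j) (\<lambda>i j. c * u i j + d * v i j) x =
    c * energy_vector \<nu> h a u x + d * energy_vector \<nu> h b v x"
  by (auto simp: energy_vector_def algebra_simps split: prod.splits)

lemma energy_vector_sum:
  "energy_vector \<nu> h (\<lambda>i j. \<Sum>k\<in>K. c k * a k i j) (\<lambda>i j. \<Sum>k\<in>K. c k * u k i j) x =
    (\<Sum>k\<in>K. c k * energy_vector \<nu> h (a k) (u k) x)"
  by (auto simp: energy_vector_def sum_distrib_left sum_subtractf algebra_simps split: prod.splits intro!: sum.cong)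

context grid
begin

lemma energy_norm:
  assumes "0 \<le> \<nu>"
  shows "(L2_set (energy_vector \<nu> h a u) (energy_index M))\<^sup>2 =
    (grid_norm h M a)\<^sup>2 + \<nu> * (grid_grad_norm h M u)\<^sup>2"
proof -
  have "(L2_set (energy_vector \<nu> h a u) (energy_index M))\<^sup>2 =
    (\<Sum>x\<in>energy_index M. (energy_vector \<nu> h a u x)\<^sup>2)"
    by (simp add: L2_set_def sum_nonneg)
  also have "\<dots> = (\<Sum>i=1..M-1. \<Sum>j=1..M-1. h\<^sup>2 * (a i j * a i j)) +
     ((\<Sum>i=1..M. \<Sum>j=1..M-1. \<nu> * (u i j - u (i - 1) j)\<^sup>2) + (\<Sum>i=1..M-1. \<Sum>j=1..M. \<nu> * (u i j - u i (j - 1))\<^sup>2))"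
    unfolding sum_energy_index using assms
    by (simp add: energy_vector_def power_mult_distrib power2_eq_square[of "a _ _"])
  also have "(\<Sum>i=1..M-1. \<Sum>j=1..M-1. h\<^sup>2 * (a i j * a i j)) = (grid_norm h M a)\<^sup>2"
    unfolding grid_norm_def sum_distrib_left[symmetric]
    by (subst real_sqrt_pow2) (intro mult_nonneg_nonneg sum_nonneg zero_le_square zero_le_power2 refl)+
  also have "(\<Sum>i=1..M. \<Sum>j=1..M-1. \<nu> * (u i j - u (i - 1) j)\<^sup>2) + (\<Sum>i=1..M-1. \<Sum>j=1..M. \<nu> * (u i j - u i (j - 1))\<^sup>2) =
    \<nu> * (grid_grad_norm h M u)\<^sup>2"
  proof -
    have 1: "h\<^sup>2 * (d / h)\<^sup>2 = d\<^sup>2" for d using h_pos by (simp add: power_divide)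
    have "(grid_grad_norm h M u)\<^sup>2 = h\<^sup>2 * (\<Sum>i=1..M. \<Sum>j=1..M-1. ((u i j - u (i - 1) j) / h)\<^sup>2) +
           h\<^sup>2 * (\<Sum>i=1..M-1. \<Sum>j=1..M. ((u i j - u i (j - 1)) / h)\<^sup>2)"
      unfolding grid_grad_norm_def
      by (subst real_sqrt_pow2) (auto intro!: add_nonneg_nonneg mult_nonneg_nonneg sum_nonneg)
    also have "\<dots> = (\<Sum>i=1..M. \<Sum>j=1..M-1. (u i j - u (i - 1) j)\<^sup>2) + (\<Sum>i=1..M-1. \<Sum>j=1..M. (u i j - u i (j - 1))\<^sup>2)"
      unfolding sum_distrib_left 1 ..
    finally show ?thesis by (simp add: sum_distrib_left distrib_left)
  qed
  finally show ?thesis .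
qed

lemma grid_norm_nonneg: "0 \<le> grid_norm h M a" "0 \<le> grid_grad_norm h M u"
  unfolding grid_norm_def grid_grad_norm_def
  by (intro real_sqrt_ge_zero add_nonneg_nonneg mult_nonneg_nonneg sum_nonneg zero_le_square zero_le_power2)+

lemma norms_le_energy:
  assumes "0 < \<nu>"
  shows "grid_norm h M a \<le> L2_set (energy_vector \<nu> h a u) (energy_index M)"
    and "grid_grad_norm h M u \<le> L2_set (energy_vector \<nu> h a u) (energy_index M) / sqrt \<nu>"
proof -
  let ?E = "L2_set (energy_vector \<nu> h a u) (energy_index M)"
  have e: "?E\<^sup>2 = (grid_norm h M a)\<^sup>2 + \<nu> * (grid_grad_norm h M u)\<^sup>2" using energy_norm assms by simp
  then have "(grid_norm h M a)\<^sup>2 \<le> ?E\<^sup>2" using assms by simp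
  then show "grid_norm h M a \<le> ?E" by (rule power2_le_imp_le) (rule L2_set_nonneg)
  have "(sqrt \<nu> * grid_grad_norm h M u)\<^sup>2 \<le> ?E\<^sup>2" using e assms by (simp add: power_mult_distrib)
  then have "sqrt \<nu> * grid_grad_norm h M u \<le> ?E" by (rule power2_le_imp_le) (rule L2_set_nonneg)
  then show "grid_grad_norm h M u \<le> ?E / sqrt \<nu>" using assms by (simp add: le_divide_eq mult.commute)
qed

text \<open>Sum the differences in the first direction from the boundary and apply the Cauchy-Schwarz inequality.\<close>

lemma discrete_poincare:
  assumes U: "\<And>j. j \<in> {1..M-1} \<Longrightarrow> U 0 j = 0"
  shows "grid_norm h M U \<le> L * grid_grad_norm h M U"
proof -
  define Q where "Q j = (\<Sum>l=1..M. (U l j - U (l - 1) j)\<^sup>2)" for j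
  have each: "(U i j)\<^sup>2 \<le> real M * Q j" if "i \<in> {1..M-1}" "j \<in> {1..M-1}" for i j
  proof -
    have "U i j = (\<Sum>l=1..i. U l j - U (l - 1) j)"
      using sum_telescope''[of 0 i "\<lambda>l. U l j"] U[OF that(2)] by simp
    then have "(U i j)\<^sup>2 = (\<Sum>l=1..i. 1 * (U l j - U (l - 1) j))\<^sup>2" by simp
    also have "\<dots> \<le> (\<Sum>l=1..i. 1\<^sup>2) * (\<Sum>l=1..i. (U l j - U (l - 1) j)\<^sup>2)"
      by (rule Cauchy_Schwarz_ineq_sum)
    also have "\<dots> \<le> real M * Q j"
      unfolding Q_def using that by (intro mult_mono sum_mono2) (auto intro: sum_nonneg)
    finally show ?thesis .
  qed
  have "(grid_norm h M U)\<^sup>2 = h\<^sup>2 * (\<Sum>i=1..M-1. \<Sum>j=1..M-1. (U i j)\<^sup>2)"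
    unfolding grid_norm_def
    unfolding power2_eq_square[of "U _ _"]
    by (subst real_sqrt_pow2) (intro mult_nonneg_nonneg sum_nonneg zero_le_square zero_le_power2 refl)+
  also have "\<dots> \<le> h\<^sup>2 * (\<Sum>i=1..M-1. \<Sum>j=1..M-1. real M * Q j)"
    using each by (intro mult_left_mono sum_mono) auto
  also have "\<dots> = h\<^sup>2 * (real (M - 1) * (real M * (\<Sum>j=1..M-1. Q j)))"
    by (simp add: sum_distrib_left)
  also have "\<dots> \<le> h\<^sup>2 * (real M * (real M * (\<Sum>j=1..M-1. Q j)))"
    by (intro mult_left_mono mult_right_mono mult_nonneg_nonneg sum_nonneg) (auto simp: Q_def intro: sum_nonneg)
  also have "\<dots> = L\<^sup>2 * (\<Sum>i=1..M. \<Sum>j=1..M-1. (U i j - U (i - 1) j)\<^sup>2)"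
  proof -
    have "(\<Sum>j=1..M-1. Q j) = (\<Sum>i=1..M. \<Sum>j=1..M-1. (U i j - U (i - 1) j)\<^sup>2)"
      unfolding Q_def by (rule sum.swap)
    then show ?thesis by (simp add: Mh[symmetric] power2_eq_square)
  qed
  also have "\<dots> \<le> L\<^sup>2 * (grid_grad_norm h M U)\<^sup>2"
  proof (rule mult_left_mono)
    have "(grid_grad_norm h M U)\<^sup>2 = (L2_set (energy_vector 1 h (\<lambda>i j. 0) U) (energy_index M))\<^sup>2"
      using energy_norm[of 1 "\<lambda>i j. 0" U] by (simp add: grid_norm_def)
    also have "\<dots> = (\<Sum>x\<in>energy_index M. (energy_vector 1 h (\<lambda>i j. 0) U x)\<^sup>2)"
      by (simp add: L2_set_def sum_nonneg)
    also have "\<dots> = (\<Sum>i=1..M. \<Sum>j=1..M-1. (U i j - U (i - 1) j)\<^sup>2) + (\<Sum>i=1..M-1. \<Sum>j=1..M. (U i j - U i (j - 1))\<^sup>2)"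
      unfolding sum_energy_index by (simp add: energy_vector_def)
    finally show "(\<Sum>i=1..M. \<Sum>j=1..M-1. (U i j - U (i - 1) j)\<^sup>2) \<le> (grid_grad_norm h M U)\<^sup>2"
      by (auto intro!: sum_nonneg)
  qed auto
  finally have "(grid_norm h M U)\<^sup>2 \<le> (L * grid_grad_norm h M U)\<^sup>2" by (simp add: power_mult_distrib)
  then show ?thesis by (rule power2_le_imp_le) (use L_pos grid_norm_nonneg in auto)
qed

lemma second_difference_by_parts:
  fixes u v :: "nat \<Rightarrow> real"
  assumes "v 0 = 0" "v M = 0"
  shows "(\<Sum>i=1..M-1. (u (i + 1) - 2 * u i + u (i - 1)) * v i) = - (\<Sum>i=1..M. (u i - u (i - 1)) * (v i - v (i - 1)))"
proof -
  have "(\<Sum>i=1..M. (u i - u (i - 1)) * (v i - v (i - 1))) =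
     (u M - u (M - 1)) * v M - (\<Sum>k=1..M-1. ((u (k + 1) - u (k + 1 - 1)) - (u k - u (k - 1))) * v k) - (u 1 - u (1 - 1)) * v 0"
    by (rule summation_by_parts_increments[OF M_pos])
  then show ?thesis using assms by (simp add: algebra_simps)
qed

lemma discrete_laplacian_by_parts:
  assumes v: "\<And>i j. \<lbrakk>i \<le> M; j \<le> M; i = 0 \<or> i = M \<or> j = 0 \<or> j = M\<rbrakk> \<Longrightarrow> v i j = 0"
  shows "(\<Sum>i=1..M-1. \<Sum>j=1..M-1. h\<^sup>2 * discrete_laplacian h u i j * v i j) =
    - ((\<Sum>i=1..M. \<Sum>j=1..M-1. (u i j - u (i - 1) j) * (v i j - v (i - 1) j)) +
       (\<Sum>i=1..M-1. \<Sum>j=1..M. (u i j - u i (j - 1)) * (v i j - v i (j - 1))))"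
proof -
  have e: "h\<^sup>2 * discrete_laplacian h u i j * v i j =
      (u (i + 1) j - 2 * u i j + u (i - 1) j) * v i j + (u i (j + 1) - 2 * u i j + u i (j - 1)) * v i j" for i j
  proof -
    have "h\<^sup>2 * (X / h\<^sup>2) = X" for X using h_pos by simp
    then have e: "h\<^sup>2 * discrete_laplacian h u i j = u (i + 1) j + u (i - 1) j + u i (j + 1) + u i (j - 1) - 4 * u i j"
      unfolding discrete_laplacian_def .
    show ?thesis unfolding e by (simp add: algebra_simps)
  qed
  have x: "(\<Sum>i=1..M-1. \<Sum>j=1..M-1. (u (i + 1) j - 2 * u i j + u (i - 1) j) * v i j)
      = - (\<Sum>i=1..M. \<Sum>j=1..M-1. (u i j - u (i - 1) j) * (v i j - v (i - 1) j))"
  proof -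
    have "(\<Sum>i=1..M-1. \<Sum>j=1..M-1. (u (i + 1) j - 2 * u i j + u (i - 1) j) * v i j)
        = (\<Sum>j=1..M-1. \<Sum>i=1..M-1. (u (i + 1) j - 2 * u i j + u (i - 1) j) * v i j)"
      by (rule sum.swap)
    also have "\<dots> = (\<Sum>j=1..M-1. - (\<Sum>i=1..M. (u i j - u (i - 1) j) * (v i j - v (i - 1) j)))"
      using v by (intro sum.cong refl second_difference_by_parts) auto
    also have "\<dots> = - (\<Sum>j=1..M-1. \<Sum>i=1..M. (u i j - u (i - 1) j) * (v i j - v (i - 1) j))"
      by (rule sum_negf)
    also have "(\<Sum>j=1..M-1. \<Sum>i=1..M. (u i j - u (i - 1) j) * (v i j - v (i - 1) j)) =
       (\<Sum>i=1..M. \<Sum>j=1..M-1. (u i j - u (i - 1) j) * (v i j - v (i - 1) j))"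
      by (rule sum.swap)
    finally show ?thesis .
  qed
  have y: "(\<Sum>i=1..M-1. \<Sum>j=1..M-1. (u i (j + 1) - 2 * u i j + u i (j - 1)) * v i j)
      = - (\<Sum>i=1..M-1. \<Sum>j=1..M. (u i j - u i (j - 1)) * (v i j - v i (j - 1)))"
  proof -
    have "(\<Sum>i=1..M-1. \<Sum>j=1..M-1. (u i (j + 1) - 2 * u i j + u i (j - 1)) * v i j)
        = (\<Sum>i=1..M-1. - (\<Sum>j=1..M. (u i j - u i (j - 1)) * (v i j - v i (j - 1))))"
      using v by (intro sum.cong refl second_difference_by_parts) auto
    then show ?thesis by (simp only: sum_negf)
  qed
  show ?thesis unfolding e sum.distrib x y by simp
qed

text \<open>Summation by parts: the discrete Laplacian tested with \<open>v\<close> is minus the product of the gradients, which is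
the contribution of the other two components.  This is the cancellation between the two equations.\<close>

lemma energy_orthogonality:
  assumes nu: "0 \<le> \<nu>" and v: "\<And>i j. \<lbrakk>i \<le> M; j \<le> M; i = 0 \<or> i = M \<or> j = 0 \<or> j = M\<rbrakk> \<Longrightarrow> v i j = 0"
  shows "(\<Sum>x\<in>energy_index M. energy_vector \<nu> h (\<lambda>i j. \<nu> * discrete_laplacian h u i j) v x * energy_vector \<nu> h v u x) = 0"
proof -
  have "(\<Sum>x\<in>energy_index M. energy_vector \<nu> h (\<lambda>i j. \<nu> * discrete_laplacian h u i j) v x * energy_vector \<nu> h v u x)
    = (\<Sum>i=1..M-1. \<Sum>j=1..M-1. \<nu> * (h\<^sup>2 * discrete_laplacian h u i j * v i j)) +
      ((\<Sum>i=1..M. \<Sum>j=1..M-1. \<nu> * ((u i j - u (i - 1) j) * (v i j - v (i - 1) j))) +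
       (\<Sum>i=1..M-1. \<Sum>j=1..M. \<nu> * ((u i j - u i (j - 1)) * (v i j - v i (j - 1)))))"
    unfolding sum_energy_index add.assoc
    by (intro arg_cong2[where f = "(+)"] sum.cong refl)
      (use nu in \<open>simp_all add: energy_vector_def power2_eq_square mult_ac\<close>)
  also have "\<dots> = 0"
  proof -
    have "(\<Sum>i=1..M-1. \<Sum>j=1..M-1. h\<^sup>2 * discrete_laplacian h u i j * v i j) =
      - ((\<Sum>i=1..M. \<Sum>j=1..M-1. (u i j - u (i - 1) j) * (v i j - v (i - 1) j)) +
         (\<Sum>i=1..M-1. \<Sum>j=1..M. (u i j - u i (j - 1)) * (v i j - v i (j - 1))))"
      using v by (rule discrete_laplacian_by_parts)
    then show ?thesis unfolding sum_distrib_left[symmetric] by (simp only: mult_minus_right distrib_left add.left_inverse)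
  qed
  finally show ?thesis .
qed

text \<open>Test the equations for the pair \<open>(a, u)\<close> with its weighted average: the coupling terms cancel,
the energy inequality bounds the left-hand side from below by the averaged norm times the discrete derivative of the norm,
and the Cauchy-Schwarz inequality bounds the right-hand side by the averaged norm times the norm of the residual.\<close>

lemma discrete_energy_estimate:
  fixes g :: "nat \<Rightarrow> real" and a u :: "nat \<Rightarrow> nat \<Rightarrow> nat \<Rightarrow> real"
  assumes n: "1 \<le> n" and mono: "\<And>k. \<lbrakk>1 \<le> k; k < n\<rbrakk> \<Longrightarrow> g k \<le> g (k + 1)" and pos: "0 \<le> g 1"
    and sg: "1 / 2 \<le> \<sigma>" "\<sigma> < 1" and P2: "2 \<le> n \<Longrightarrow> \<sigma> * g (n - 1) \<le> (2 * \<sigma> - 1) * g n"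
    and nu: "0 \<le> \<nu>"
    and eq1: "\<And>i j. \<lbrakk>i \<in> {1..M-1}; j \<in> {1..M-1}\<rbrakk> \<Longrightarrow>
       (\<Sum>k=1..n. g k * (a k i j - a (k - 1) i j)) =
       \<nu> * discrete_laplacian h (\<lambda>i j. avg_star \<sigma> (\<lambda>k. u k i j) n) i j + \<rho>1 i j"
    and eq2: "\<And>i j. \<lbrakk>i \<le> M; j \<le> M\<rbrakk> \<Longrightarrow>
       (\<Sum>k=1..n. g k * (u k i j - u (k - 1) i j)) = avg_star \<sigma> (\<lambda>k. a k i j) n + \<rho>2 i j"
    and bd: "\<And>k i j. \<lbrakk>k \<le> n; i \<le> M; j \<le> M; i = 0 \<or> i = M \<or> j = 0 \<or> j = M\<rbrakk> \<Longrightarrow> a k i j = 0"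
  defines "E \<equiv> \<lambda>k. L2_set (energy_vector \<nu> h (a k) (u k)) (energy_index M)"
  shows "(\<Sum>k=1..n. g k * (E k - E (k - 1))) \<le> L2_set (energy_vector \<nu> h \<rho>1 \<rho>2) (energy_index M)"
proof -
  define S where "S = energy_index M"
  define z where "z k = energy_vector \<nu> h (a k) (u k)" for k
  define as where "as i j = avg_star \<sigma> (\<lambda>k. a k i j) n" for i j
  define us where "us i j = avg_star \<sigma> (\<lambda>k. u k i j) n" for i j
  have as0: "as i j = 0" if "i \<le> M" "j \<le> M" "i = 0 \<or> i = M \<or> j = 0 \<or> j = M" for i j
    using bd[of n i j] bd[of "n - 1" i j] that by (simp add: as_def avg_star_def)
  have zs: "\<sigma> * z n x + (1 - \<sigma>) * z (n - 1) x = energy_vector \<nu> h as us x" for x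
    unfolding as_def us_def z_def avg_star_def energy_vector_linear ..
  have dz: "(\<Sum>k=1..n. g k * (z k x - z (k - 1) x)) =
      energy_vector \<nu> h (\<lambda>i j. \<nu> * discrete_laplacian h us i j) as x + energy_vector \<nu> h \<rho>1 \<rho>2 x"
    if x: "x \<in> S" for x
  proof -
    have "(\<Sum>k=1..n. g k * (z k x - z (k - 1) x)) =
        (\<Sum>k=1..n. g k * z k x) - (\<Sum>k=1..n. g k * z (k - 1) x)"
      by (simp add: right_diff_distrib sum_subtractf)
    also have "\<dots> = 1 * (\<Sum>k=1..n. g k * z k x) + (- 1) * (\<Sum>k=1..n. g k * z (k - 1) x)" by simp
    also have "\<dots> = energy_vector \<nu> h (\<lambda>i j. 1 * (\<Sum>k=1..n. g k * a k i j) + (- 1) * (\<Sum>k=1..n. g k * a (k - 1) i j))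
        (\<lambda>i j. 1 * (\<Sum>k=1..n. g k * u k i j) + (- 1) * (\<Sum>k=1..n. g k * u (k - 1) i j)) x"
      unfolding energy_vector_linear energy_vector_sum z_def ..
    also have "\<dots> = energy_vector \<nu> h (\<lambda>i j. \<Sum>k=1..n. g k * (a k i j - a (k - 1) i j))
        (\<lambda>i j. \<Sum>k=1..n. g k * (u k i j - u (k - 1) i j)) x"
      by (simp add: right_diff_distrib sum_subtractf)
    also have "\<dots> = energy_vector \<nu> h (\<lambda>i j. 1 * (\<nu> * discrete_laplacian h us i j) + 1 * \<rho>1 i j) (\<lambda>i j. 1 * as i j + 1 * \<rho>2 i j) x"
      using x eq1 eq2 unfolding energy_vector_def S_def energy_index_def us_def as_def by auto
    also have "\<dots> = energy_vector \<nu> h (\<lambda>i j. \<nu> * discrete_laplacian h us i j) as x + energy_vector \<nu> h \<rho>1 \<rho>2 x"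
      unfolding energy_vector_linear by simp
    finally show ?thesis .
  qed
  define R where "R = L2_set (energy_vector \<nu> h \<rho>1 \<rho>2) S"
  define Es where "Es = \<sigma> * E n + (1 - \<sigma>) * E (n - 1)"
  have E0: "0 \<le> E k" for k unfolding E_def by (rule L2_set_nonneg)
  have R0: "0 \<le> R" unfolding R_def by (rule L2_set_nonneg)
  have Es0: "0 \<le> Es" using E0 sg by (simp add: Es_def)
  have "Es * (\<Sum>k=1..n. g k * (E k - E (k - 1))) \<le>
      (\<Sum>x\<in>S. (\<Sum>k=1..n. g k * (z k x - z (k - 1) x)) * (\<sigma> * z n x + (1 - \<sigma>) * z (n - 1) x))"
    unfolding Es_def E_def z_def[symmetric] S_def[symmetric]
    using n mono pos sg P2 by (intro energy_inequality) auto
  also have "\<dots> = (\<Sum>x\<in>S. energy_vector \<nu> h (\<lambda>i j. \<nu> * discrete_laplacian h us i j) as x * energy_vector \<nu> h as us x +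
      energy_vector \<nu> h \<rho>1 \<rho>2 x * energy_vector \<nu> h as us x)"
    by (intro sum.cong refl) (simp only: dz zs distrib_right)
  also have "\<dots> = (\<Sum>x\<in>S. energy_vector \<nu> h \<rho>1 \<rho>2 x * energy_vector \<nu> h as us x)"
    unfolding sum.distrib using energy_orthogonality[OF nu as0] by (simp add: S_def)
  also have "\<dots> \<le> R * L2_set (energy_vector \<nu> h as us) S" unfolding R_def by (rule L2_set_inner_le)
  also have "\<dots> \<le> R * Es"
  proof (rule mult_left_mono[OF _ R0])
    have "L2_set (energy_vector \<nu> h as us) S = L2_set (\<lambda>x. \<sigma> * z n x + (1 - \<sigma>) * z (n - 1) x) S" by (simp only: zs)
    also have "\<dots> \<le> L2_set (\<lambda>x. \<sigma> * z n x) S + L2_set (\<lambda>x. (1 - \<sigma>) * z (n - 1) x) S" by (rule L2_set_triangle_ineq)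
    also have "\<dots> = Es" using sg by (simp add: L2_set_scale Es_def E_def z_def S_def)
    finally show "L2_set (energy_vector \<nu> h as us) S \<le> Es" .
  qed
  finally have main: "Es * (\<Sum>k=1..n. g k * (E k - E (k - 1))) \<le> Es * R" by (simp add: mult.commute)
  \<comment> \<open>if the averaged norm vanishes it cannot be cancelled, but then the present norm is zero and the derivative is nonpositive\<close>
  show ?thesis
  proof (cases "Es = 0")
    case False
    then show ?thesis using main Es0 unfolding R_def S_def by simp
  next
    case True
    then have z: "E n = 0"
      using E0[of n] E0[of "n - 1"] sg unfolding Es_def by (simp add: add_nonneg_eq_0_iff)
    have "0 \<le> (\<Sum>k=1..n-1. (g (k + 1) - g k) * E k)" using mono E0 by (intro sum_nonneg) auto
    moreover have "0 \<le> g 1 * E 0" using pos E0 by simp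
    ultimately have "(\<Sum>k=1..n. g k * (E k - E (k - 1))) \<le> 0"
      unfolding summation_by_parts_increments[OF n, of g E] z by simp
    then show ?thesis using R0 unfolding R_def S_def by linarith
  qed
qed

lemma grid_norm_L2: "grid_norm h M a = L2_set (\<lambda>(i, j). h * a i j) ({1..M-1} \<times> {1..M-1})"
proof -
  have "h\<^sup>2 * (\<Sum>i=1..M-1. \<Sum>j=1..M-1. a i j * a i j) = (\<Sum>x\<in>{1..M-1} \<times> {1..M-1}. (case x of (i, j) \<Rightarrow> h * a i j)\<^sup>2)"
    unfolding sum.cartesian_product sum_distrib_left
    by (intro sum.cong) (auto simp: power2_eq_square)
  then show ?thesis by (simp add: grid_norm_def L2_set_def)
qed

text \<open>The residual of the second equation enters only through its differences, because the second
component of the energy is a gradient.\<close>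

lemma residual_norm_le:
  assumes nu: "0 \<le> \<nu>" and r: "0 \<le> r1" "0 \<le> r2" "0 \<le> c"
    and \<rho>1: "\<And>i j. \<lbrakk>i \<in> {1..M-1}; j \<in> {1..M-1}\<rbrakk> \<Longrightarrow> \<bar>\<rho>1 i j\<bar> \<le> r1 + c * (\<bar>u i j\<bar> + \<bar>v i j\<bar>)"
    and \<rho>2: "\<And>i j. \<lbrakk>i \<in> {1..M}; j \<in> {1..M-1}\<rbrakk> \<Longrightarrow> \<bar>\<rho>2 i j - \<rho>2 (i - 1) j\<bar> \<le> r2 * h"
      "\<And>i j. \<lbrakk>i \<in> {1..M-1}; j \<in> {1..M}\<rbrakk> \<Longrightarrow> \<bar>\<rho>2 i j - \<rho>2 i (j - 1)\<bar> \<le> r2 * h"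
  shows "L2_set (energy_vector \<nu> h \<rho>1 \<rho>2) (energy_index M) \<le>
    L * r1 + c * (grid_norm h M u + grid_norm h M v) + 2 * sqrt \<nu> * L * r2"
proof -
  define I where "I = {1..M-1} \<times> {1..M-1}"
  have g1: "grid_norm h M \<rho>1 \<le> L * r1 + c * (grid_norm h M u + grid_norm h M v)"
  proof -
    have "grid_norm h M \<rho>1 = L2_set (\<lambda>x. \<bar>case x of (i, j) \<Rightarrow> h * \<rho>1 i j\<bar>) I"
      unfolding grid_norm_L2 I_def L2_set_def by simp
    also have "\<dots> \<le> L2_set (\<lambda>x. h * r1 + (c * \<bar>case x of (i, j) \<Rightarrow> h * u i j\<bar> + c * \<bar>case x of (i, j) \<Rightarrow> h * v i j\<bar>)) I"
    proof (rule L2_set_mono)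
      fix x assume x: "x \<in> I"
      obtain i j where ij: "x = (i, j)" "i \<in> {1..M-1}" "j \<in> {1..M-1}" using x by (auto simp: I_def)
      have "h * \<bar>\<rho>1 i j\<bar> \<le> h * (r1 + c * (\<bar>u i j\<bar> + \<bar>v i j\<bar>))"
        using \<rho>1[OF ij(2,3)] h_pos by (intro mult_left_mono) auto
      then show "\<bar>case x of (i, j) \<Rightarrow> h * \<rho>1 i j\<bar> \<le> h * r1 + (c * \<bar>case x of (i, j) \<Rightarrow> h * u i j\<bar> + c * \<bar>case x of (i, j) \<Rightarrow> h * v i j\<bar>)"
        using h_pos ij by (simp add: abs_mult algebra_simps)
    qed auto
    also have "\<dots> \<le> L2_set (\<lambda>x. h * r1) I + L2_set (\<lambda>x. c * \<bar>case x of (i, j) \<Rightarrow> h * u i j\<bar> + c * \<bar>case x of (i, j) \<Rightarrow> h * v i j\<bar>) I"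
      by (rule L2_set_triangle_ineq)
    also have "\<dots> \<le> L2_set (\<lambda>x. h * r1) I + (L2_set (\<lambda>x. c * \<bar>case x of (i, j) \<Rightarrow> h * u i j\<bar>) I + L2_set (\<lambda>x. c * \<bar>case x of (i, j) \<Rightarrow> h * v i j\<bar>) I)"
      by (intro add_left_mono L2_set_triangle_ineq)
    also have "L2_set (\<lambda>x. c * \<bar>case x of (i, j) \<Rightarrow> h * u i j\<bar>) I = c * grid_norm h M u"
      unfolding L2_set_scale grid_norm_L2 I_def using r by (simp add: L2_set_def)
    also have "L2_set (\<lambda>x. c * \<bar>case x of (i, j) \<Rightarrow> h * v i j\<bar>) I = c * grid_norm h M v"
      unfolding L2_set_scale grid_norm_L2 I_def using r by (simp add: L2_set_def)
    also have "L2_set (\<lambda>x. h * r1) I \<le> L * r1"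
    proof -
      have "L2_set (\<lambda>x. h * r1) I = sqrt ((real (M - 1) * (h * r1))\<^sup>2)"
        unfolding L2_set_def I_def by (simp add: power_mult_distrib power2_eq_square mult_ac)
      also have "\<dots> = real (M - 1) * (h * r1)" using h_pos r by simp
      also have "\<dots> \<le> real M * (h * r1)" using h_pos r by (intro mult_right_mono) auto
      finally show ?thesis by (simp add: Mh[symmetric])
    qed
    finally show ?thesis by (simp add: algebra_simps)
  qed
  have g2: "grid_grad_norm h M \<rho>2 \<le> 2 * L * r2"
  proof -
    have q: "((\<rho>2 i j - \<rho>2 (i - 1) j) / h)\<^sup>2 \<le> r2\<^sup>2" if "i \<in> {1..M}" "j \<in> {1..M-1}" for i j
    proof -
      have "\<bar>(\<rho>2 i j - \<rho>2 (i - 1) j) / h\<bar> \<le> r2"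
        using \<rho>2(1)[OF that] h_pos by (simp add: abs_divide divide_le_eq)
      then show ?thesis using r by (simp add: abs_le_square_iff[symmetric])
    qed
    have q': "((\<rho>2 i j - \<rho>2 i (j - 1)) / h)\<^sup>2 \<le> r2\<^sup>2" if "i \<in> {1..M-1}" "j \<in> {1..M}" for i j
    proof -
      have "\<bar>(\<rho>2 i j - \<rho>2 i (j - 1)) / h\<bar> \<le> r2"
        using \<rho>2(2)[OF that] h_pos by (simp add: abs_divide divide_le_eq)
      then show ?thesis using r by (simp add: abs_le_square_iff[symmetric])
    qed
    have "(\<Sum>i=1..M. \<Sum>j=1..M-1. ((\<rho>2 i j - \<rho>2 (i - 1) j) / h)\<^sup>2) \<le> (\<Sum>i=1..M. \<Sum>j=1..M-1. r2\<^sup>2)"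
      by (intro sum_mono q)
    also have "\<dots> = real M * (real (M - 1) * r2\<^sup>2)" using M_pos by (simp add: of_nat_diff)
    also have "\<dots> \<le> real M * (real M * r2\<^sup>2)" by (intro mult_left_mono mult_right_mono) auto
    finally have 1: "(\<Sum>i=1..M. \<Sum>j=1..M-1. ((\<rho>2 i j - \<rho>2 (i - 1) j) / h)\<^sup>2) \<le> real M * (real M * r2\<^sup>2)" .
    have "(\<Sum>i=1..M-1. \<Sum>j=1..M. ((\<rho>2 i j - \<rho>2 i (j - 1)) / h)\<^sup>2) \<le> (\<Sum>i=1..M-1. \<Sum>j=1..M. r2\<^sup>2)"
      by (intro sum_mono q')
    also have "\<dots> = real (M - 1) * (real M * r2\<^sup>2)" using M_pos by (simp add: of_nat_diff)
    also have "\<dots> \<le> real M * (real M * r2\<^sup>2)" by (intro mult_right_mono) auto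
    finally have 2: "(\<Sum>i=1..M-1. \<Sum>j=1..M. ((\<rho>2 i j - \<rho>2 i (j - 1)) / h)\<^sup>2) \<le> real M * (real M * r2\<^sup>2)" .
    have "grid_grad_norm h M \<rho>2 \<le> sqrt (h\<^sup>2 * (real M * (real M * r2\<^sup>2)) + h\<^sup>2 * (real M * (real M * r2\<^sup>2)))"
      unfolding grid_grad_norm_def using 1 2 by (intro real_sqrt_le_mono add_mono mult_left_mono) auto
    also have "\<dots> \<le> sqrt ((2 * L * r2)\<^sup>2)"
    proof (rule real_sqrt_le_mono)
      have "(2 * L * r2)\<^sup>2 = 4 * (h\<^sup>2 * (real M * (real M * r2\<^sup>2)))"
        unfolding Mh[symmetric] by (simp add: power2_eq_square)
      moreover have "0 \<le> h\<^sup>2 * (real M * (real M * r2\<^sup>2))" by simp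
      ultimately show "h\<^sup>2 * (real M * (real M * r2\<^sup>2)) + h\<^sup>2 * (real M * (real M * r2\<^sup>2)) \<le> (2 * L * r2)\<^sup>2"
        by linarith
    qed
    also have "\<dots> = 2 * L * r2" using L_pos r by simp
    finally show ?thesis .
  qed
  have "(L2_set (energy_vector \<nu> h \<rho>1 \<rho>2) (energy_index M))\<^sup>2 = (grid_norm h M \<rho>1)\<^sup>2 + (sqrt \<nu> * grid_grad_norm h M \<rho>2)\<^sup>2"
    using energy_norm[OF nu] nu by (simp add: power_mult_distrib)
  also have "\<dots> \<le> (grid_norm h M \<rho>1 + sqrt \<nu> * grid_grad_norm h M \<rho>2)\<^sup>2"
    using grid_norm_nonneg nu by (simp add: power2_sum)
  finally have "L2_set (energy_vector \<nu> h \<rho>1 \<rho>2) (energy_index M) \<le> grid_norm h M \<rho>1 + sqrt \<nu> * grid_grad_norm h M \<rho>2"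
    by (rule power2_le_imp_le) (use grid_norm_nonneg nu in \<open>auto intro!: add_nonneg_nonneg mult_nonneg_nonneg\<close>)
  also have "sqrt \<nu> * grid_grad_norm h M \<rho>2 \<le> sqrt \<nu> * (2 * L * r2)" using g2 nu by (intro mult_left_mono) auto
  finally show ?thesis using g1 by (simp add: algebra_simps)
qed

end

section \<open>Solution values, differences and discrete Laplacians as functions of time\<close>

lemma time_deriv_0 [simp]: "time_deriv T 0 v = v"
  by (simp add: time_deriv_def)

lemma time_deriv_Suc: "time_deriv T (Suc l) v = dwithin {0..T} (time_deriv T l v)"
  by (simp add: time_deriv_def)

lemma time_deriv_works:
  assumes "time_deriv T l v differentiable (at s within {0..T})"
  shows "(time_deriv T l v has_real_derivative time_deriv T (Suc l) v s) (at s within {0..T})"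
  using dwithin_works[OF assms] by (simp add: time_deriv_Suc)

lemma C_space_time_continuous_time:
  assumes "C_space_time L T m k v" "l \<le> k" "x \<in> {0..L}" "y \<in> {0..L}"
  shows "continuous_on {0..T} (time_deriv T l (v x y))"
proof -
  have c: "continuous_on ({0..L} \<times> {0..L} \<times> {0..T}) (\<lambda>(x, y, t). time_deriv T l (v x y) t)"
    using assms unfolding C_space_time_def by blast
  have "continuous_on {0..T} (\<lambda>t. (\<lambda>(x, y, t). time_deriv T l (v x y) t) (x, y, t))"
    by (rule continuous_on_compose2[OF c]) (use assms in \<open>auto intro!: continuous_intros\<close>)
  then show ?thesis by simp
qed

lemma weakly_singular_bound_terms:
  assumes v: "weakly_singular_bound L T q C v" and l: "l \<le> 3" and xy: "x \<in> {0..L}" "y \<in> {0..L}" and s: "0 < s" "s \<le> T"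
    and ij: "i + j \<le> 2"
  shows "\<bar>space_deriv L i j (\<lambda>x y. time_deriv T l (v x y) s) x y\<bar> \<le> C * (1 + s powr (q - real l))"
proof -
  let ?d = "\<lambda>i j. \<bar>space_deriv L i j (\<lambda>x y. time_deriv T l (v x y) s) x y\<bar>"
  have "?d i j = ?d i ((i + j) - i)" by simp
  also have "\<dots> \<le> (\<Sum>a\<le>i + j. ?d a ((i + j) - a))" by (rule member_le_sum) auto
  also have "\<dots> \<le> (\<Sum>b\<le>2. \<Sum>a\<le>b. ?d a (b - a))"
    by (rule member_le_sum[of "i + j" "{..2}" "\<lambda>b. \<Sum>a\<le>b. ?d a (b - a)"]) (use ij in \<open>auto intro: sum_nonneg\<close>)
  also have "\<dots> \<le> C * (1 + s powr (q - real l))"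
    using v l xy s unfolding weakly_singular_bound_def by auto
  finally show ?thesis .
qed

text \<open>On a bounded interval both exponents that occur in the regularity assumptions are covered by the same
singularity.\<close>

lemma singular_power_le:
  fixes s T \<beta> q :: real
  assumes s: "0 < s" "s \<le> T" and l: "1 \<le> l" "l \<le> 3" and b: "0 < \<beta>" "\<beta> < 1" and q: "q = \<beta> \<or> q = 2 * \<beta>"
  shows "1 + s powr (q - real l) \<le> 2 * (1 + T) ^ 3 * s powr (\<beta> - real l)"
    and "1 \<le> (1 + T) ^ 3 * s powr (\<beta> - real l)"
proof -
  have big: "s powr e \<le> (1 + T) ^ 3" if "0 \<le> e" "e \<le> 3" for e
  proof -
    have "s powr e \<le> (1 + T) powr e" using s that by (intro powr_mono2) auto
    also have "\<dots> \<le> (1 + T) powr 3" using s that by (intro powr_mono) auto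
    finally show ?thesis using s by simp
  qed
  have "1 = s powr (real l - \<beta>) * s powr (\<beta> - real l)" using s by (simp add: powr_add[symmetric])
  also have "\<dots> \<le> (1 + T) ^ 3 * s powr (\<beta> - real l)"
    using l b by (intro mult_right_mono big) auto
  finally show 1: "1 \<le> (1 + T) ^ 3 * s powr (\<beta> - real l)" .
  have "s powr (q - real l) = s powr (q - \<beta>) * s powr (\<beta> - real l)" by (simp add: powr_add[symmetric])
  also have "\<dots> \<le> (1 + T) ^ 3 * s powr (\<beta> - real l)"
    using q b by (intro mult_right_mono big) auto
  finally show "1 + s powr (q - real l) \<le> 2 * (1 + T) ^ 3 * s powr (\<beta> - real l)" using 1 by simp
qed

text \<open>Functions of space and time whose time derivatives have the same singularity together with their
space derivatives up to order two.  With \<open>q = 2 * \<beta>\<close> this is the regularity of \<open>ubar\<close>, with \<open>q = \<beta>\<close> that of \<open>p\<close>; the weaker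
singularity of \<open>ubar\<close> is given up in favour of a common class.\<close>

locale regular_family =
  fixes L T \<beta> C q :: real and v :: "real \<Rightarrow> real \<Rightarrow> real \<Rightarrow> real" and m k :: nat
  assumes L_pos: "0 < L" and T_pos: "0 < T" and beta: "0 < \<beta>" "\<beta> < 1" and q: "q = \<beta> \<or> q = 2 * \<beta>"
    and bound: "weakly_singular_bound L T q C v" and smooth: "C_space_time L T m k v"
begin

definition K :: real where "K = C * (2 * (1 + T) ^ 3)"

abbreviation td :: "nat \<Rightarrow> real \<Rightarrow> real \<Rightarrow> real \<Rightarrow> real" where "td l x y s \<equiv> time_deriv T l (v x y) s"

lemma C_nonneg: "0 \<le> C"
proof -
  have "0 \<le> C * (1 + T powr (q - real 0))"
    using weakly_singular_bound_terms[OF bound, of 0 0 0 T 0 0] L_pos T_pos by force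
  moreover have "0 < 1 + T powr (q - real 0)" by (intro add_pos_nonneg) auto
  ultimately show ?thesis by (simp add: zero_le_mult_iff)
qed

lemma K_nonneg: "0 \<le> K" using C_nonneg T_pos by (simp add: K_def)

lemma space_bound:
  assumes "1 \<le> l" "l \<le> 3" "x \<in> {0..L}" "y \<in> {0..L}" "0 < s" "s \<le> T" "i + j \<le> 2"
  shows "\<bar>space_deriv L i j (\<lambda>x y. td l x y s) x y\<bar> \<le> K * s powr (\<beta> - real l)"
proof -
  have "\<bar>space_deriv L i j (\<lambda>x y. td l x y s) x y\<bar> \<le> C * (1 + s powr (q - real l))"
    using weakly_singular_bound_terms[OF bound] assms by auto
  also have "\<dots> \<le> C * (2 * (1 + T) ^ 3 * s powr (\<beta> - real l))"
    using singular_power_le(1)[OF assms(5,6,1,2) beta q] C_nonneg by (intro mult_left_mono)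
  finally show ?thesis by (simp add: K_def mult_ac)
qed

lemma space_diff: "\<lbrakk>l \<le> 3; 0 < s; s \<le> T\<rbrakk> \<Longrightarrow> space_differentiable L 2 (\<lambda>x y. td l x y s)"
  using bound unfolding weakly_singular_bound_def by auto

lemma time_diff: "\<lbrakk>l < 3; x \<in> {0..L}; y \<in> {0..L}; 0 < s; s \<le> T\<rbrakk> \<Longrightarrow>
    ((\<lambda>s. td l x y s) has_real_derivative td (Suc l) x y s) (at s within {0..T})"
  using bound unfolding weakly_singular_bound_def by (auto intro!: time_deriv_works)

lemma cont: "\<lbrakk>x \<in> {0..L}; y \<in> {0..L}\<rbrakk> \<Longrightarrow> continuous_on {0..T} (v x y)"
  using C_space_time_continuous_time[OF smooth, of 0] by simp

lemma point_weakly_singular: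
  assumes "x \<in> {0..L}" "y \<in> {0..L}"
  shows "weakly_singular T \<beta> K (\<lambda>l s. td l x y s)"
  unfolding weakly_singular_def
  using cont[OF assms] time_diff[OF _ assms] space_bound[OF _ _ assms, of _ _ 0 0] by auto

text \<open>The first space derivatives of each time derivative carry the singularity of that time
derivative, so the mean value theorem in space gives a factor proportional to the distance.\<close>

lemma difference_weakly_singular:
  assumes x: "x \<in> {0..L}" "x' \<in> {0..L}" and y: "y \<in> {0..L}" "y' \<in> {0..L}" and xy: "x = x' \<or> y = y'"
  shows "weakly_singular T \<beta> (K * (\<bar>x - x'\<bar> + \<bar>y - y'\<bar>)) (\<lambda>l s. td l x y s - td l x' y' s)"
  unfolding weakly_singular_def
proof (intro conjI allI impI ballI)
  show "continuous_on {0..T} (\<lambda>s. td 0 x y s - td 0 x' y' s)"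
    using cont x y by (auto intro!: continuous_on_diff)
  show "((\<lambda>s. td l x y s - td l x' y' s) has_real_derivative td (Suc l) x y s - td (Suc l) x' y' s) (at s within {0..T})"
    if "l < 3" "s \<in> {0<..T}" for l s
    using that x y by (intro DERIV_diff time_diff) auto
  show "\<bar>td l x y s - td l x' y' s\<bar> \<le> K * (\<bar>x - x'\<bar> + \<bar>y - y'\<bar>) * s powr (\<beta> - real l)"
    if ls: "l \<in> {1..3}" "s \<in> {0<..T}" for l s
  proof -
    define w where "w x y = td l x y s" for x y
    have w: "space_differentiable L 2 w" unfolding w_def using space_diff ls by auto
    have b: "\<bar>space_deriv L i j w x y\<bar> \<le> K * s powr (\<beta> - real l)"
      if "i + j \<le> 2" "x \<in> {0..L}" "y \<in> {0..L}" for i j x y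
      using space_bound ls that unfolding w_def by auto
    have "\<bar>w x y - w x' y'\<bar> \<le> K * s powr (\<beta> - real l) * (\<bar>x - x'\<bar> + \<bar>y - y'\<bar>)"
    proof (cases "y = y'")
      case True
      have "\<bar>space_deriv L 0 0 w x y - space_deriv L 0 0 w x' y\<bar> \<le> K * s powr (\<beta> - real l) * \<bar>x - x'\<bar>"
        using derivs_on_increment[OF space_differentiable_derivs_x[OF w y(1)], of 0 x' x "K * s powr (\<beta> - real l)"] x y b
        by auto
      then show ?thesis using True by simp
    next
      case False
      then have xx: "x = x'" using xy by auto
      have "\<bar>space_deriv L 0 0 w x y - space_deriv L 0 0 w x y'\<bar> \<le> K * s powr (\<beta> - real l) * \<bar>y - y'\<bar>"
        using derivs_on_increment[OF space_differentiable_derivs_y[OF w x(1)], of 0 y' y "K * s powr (\<beta> - real l)"] x y b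
        by auto
      then show ?thesis using xx by simp
    qed
    then show ?thesis unfolding w_def by (simp add: mult_ac)
  qed
qed

text \<open>Second differences are controlled by the second space derivatives, uniformly in \<open>h\<close>.\<close>

lemma laplacian_weakly_singular:
  assumes gr: "grid L h M" and ij: "i \<in> {1..M-1}" "j \<in> {1..M-1}"
  shows "weakly_singular T \<beta> (4 * K)
    (\<lambda>l s. discrete_laplacian h (\<lambda>i j. td l (real i * h) (real j * h) s) i j)"
proof -
  interpret grid L h M by (rule gr)
  have nd: "real i' * h \<in> {0..L}" if "i' \<le> M" for i' using node_in that .
  have idx: "i + 1 \<le> M" "i - 1 \<le> M" "i \<le> M" "j + 1 \<le> M" "j - 1 \<le> M" "j \<le> M" using ij by auto
  show ?thesis unfolding weakly_singular_def
  proof (intro conjI allI impI ballI)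
    show "continuous_on {0..T} (\<lambda>s. discrete_laplacian h (\<lambda>i j. td 0 (real i * h) (real j * h) s) i j)"
      unfolding discrete_laplacian_def time_deriv_0
      by (intro continuous_on_divide continuous_on_add continuous_on_diff continuous_on_mult continuous_on_const cont nd idx)
        (use h_pos in auto)
    show "((\<lambda>s. discrete_laplacian h (\<lambda>i j. td l (real i * h) (real j * h) s) i j) has_real_derivative
        discrete_laplacian h (\<lambda>i j. td (Suc l) (real i * h) (real j * h) s) i j) (at s within {0..T})"
      if "l < 3" "s \<in> {0<..T}" for l s
      unfolding discrete_laplacian_def
      by (intro DERIV_cdivide DERIV_add DERIV_diff DERIV_cmult time_diff nd idx) (use that in auto)
    show "\<bar>discrete_laplacian h (\<lambda>i j. td l (real i * h) (real j * h) s) i j\<bar> \<le> 4 * K * s powr (\<beta> - real l)"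
      if ls: "l \<in> {1..3}" "s \<in> {0<..T}" for l s
      using discrete_laplacian_bound[of "\<lambda>x y. td l x y s" i j "K * s powr (\<beta> - real l)"]
        space_diff[of l s] space_bound[of l _ _ s] ls ij by auto
  qed
qed

end

lemma (in graded_meshes) caputo_diff:
  assumes "weakly_singular T \<beta> K v" "weakly_singular T \<beta> K' w" "weakly_singular T \<beta> K'' (\<lambda>l s. v l s - w l s)"
    and s: "0 < s" "s \<le> T"
  shows "caputo \<beta> (\<lambda>s. v 0 s - w 0 s) s = caputo \<beta> (v 0) s - caputo \<beta> (w 0) s"
proof -
  have "Gamma (1 - \<beta>) * caputo \<beta> (\<lambda>s. v 0 s - w 0 s) s =
      integral {0..s} (\<lambda>x. (s - x) powr (- \<beta>) * (v 1 x - w 1 x))"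
    using caputo_weakly_singular(1)[OF assms(3) s] .
  also have "\<dots> = integral {0..s} (\<lambda>x. (s - x) powr (- \<beta>) * v 1 x - (s - x) powr (- \<beta>) * w 1 x)"
    by (simp only: right_diff_distrib)
  also have "\<dots> = integral {0..s} (\<lambda>x. (s - x) powr (- \<beta>) * v 1 x) - integral {0..s} (\<lambda>x. (s - x) powr (- \<beta>) * w 1 x)"
    using caputo_weakly_singular(2)[OF assms(1) s] caputo_weakly_singular(2)[OF assms(2) s]
    by (intro integral_diff) (auto simp: set_lebesgue_integral_eq_integral)
  also have "\<dots> = Gamma (1 - \<beta>) * (caputo \<beta> (v 0) s - caputo \<beta> (w 0) s)"
    using caputo_weakly_singular(1)[OF assms(1) s] caputo_weakly_singular(1)[OF assms(2) s] by (simp add: right_diff_distrib)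
  finally show ?thesis using Gam_pos by simp
qed

section \<open>The source term\<close>

lemma sg_source_lipschitz: "\<bar>sg_source \<kappa> a - sg_source \<kappa> b\<bar> \<le> \<kappa>\<^sup>2 * \<bar>a - b\<bar>"
proof -
  have "\<bar>sin a - sin b\<bar> \<le> 1 * \<bar>a - b\<bar>"
    using field_differentiable_bound[of UNIV sin cos 1 a b] by (auto intro: DERIV_sin)
  then have "\<kappa>\<^sup>2 * \<bar>sin a - sin b\<bar> \<le> \<kappa>\<^sup>2 * \<bar>a - b\<bar>" by (intro mult_left_mono) auto
  then show ?thesis by (simp add: sg_source_def right_diff_distrib[symmetric] abs_mult)
qed

lemma deriv_sg_source: "deriv (sg_source \<kappa>) a = \<kappa>\<^sup>2 * cos a"
  unfolding sg_source_def by (rule DERIV_imp_deriv) (auto intro!: derivative_eq_intros)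

lemma cos_lipschitz: "\<bar>cos a - cos b\<bar> \<le> \<bar>a - b\<bar>" for a b :: real
  using field_differentiable_bound[of UNIV cos "\<lambda>x. - sin x" 1 a b] by (auto intro: DERIV_cos)

lemma sin_taylor: "\<bar>sin b - sin a - (b - a) * cos a\<bar> \<le> (b - a)\<^sup>2" for a b :: real
proof (cases "a = b")
  case False
  have "\<exists>z. \<bar>z - a\<bar> \<le> \<bar>b - a\<bar> \<and> sin b - sin a = (b - a) * cos z"
  proof (cases "a < b")
    case True
    then obtain z where "a < z" "z < b" "sin b - sin a = (b - a) * cos z"
      using MVT2[of a b sin cos] by (auto intro: DERIV_sin)
    then show ?thesis by (intro exI[of _ z]) auto
  next
    case F: False
    then obtain z where "b < z" "z < a" "sin a - sin b = (a - b) * cos z"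
      using MVT2[of b a sin cos] False by (auto intro: DERIV_sin)
    then show ?thesis by (intro exI[of _ z]) (auto simp: algebra_simps)
  qed
  then obtain z where z: "\<bar>z - a\<bar> \<le> \<bar>b - a\<bar>" "sin b - sin a = (b - a) * cos z" by blast
  have "\<bar>sin b - sin a - (b - a) * cos a\<bar> = \<bar>b - a\<bar> * \<bar>cos z - cos a\<bar>"
    unfolding z(2) by (simp add: right_diff_distrib[symmetric] abs_mult)
  also have "\<dots> \<le> \<bar>b - a\<bar> * \<bar>b - a\<bar>" using cos_lipschitz[of z a] z(1) by (intro mult_left_mono) auto
  finally show ?thesis by (simp add: power2_eq_square)
qed simp

text \<open>The scheme linearizes at the old value; the Taylor remainder of the sine is quadratic in the
increment, and the rest is the error of averaging.\<close>

lemma linearized_source_consistency: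
  assumes "0 \<le> \<sigma>" "\<sigma> \<le> 1"
  shows "\<bar>sg_source \<kappa> w - linearized_source \<kappa> \<sigma> U n\<bar> \<le>
    \<kappa>\<^sup>2 * (\<bar>w - avg_star \<sigma> U n\<bar> + (U n - U (n - 1))\<^sup>2)"
proof -
  define a d where "a = U (n - 1)" and "d = U n - U (n - 1)"
  have avg: "avg_star \<sigma> U n = a + \<sigma> * d" by (simp add: avg_star_def a_def d_def algebra_simps)
  have "\<bar>sin (a + \<sigma> * d) - sin a - \<sigma> * d * cos a\<bar> \<le> (\<sigma> * d)\<^sup>2" using sin_taylor[of "a + \<sigma> * d" a] by simp
  also have "\<dots> \<le> 1 * d\<^sup>2" unfolding power_mult_distrib
    using assms by (intro mult_right_mono) (auto simp: power_le_one)
  finally have "\<kappa>\<^sup>2 * \<bar>sin (a + \<sigma> * d) - sin a - \<sigma> * d * cos a\<bar> \<le> \<kappa>\<^sup>2 * d\<^sup>2" by (intro mult_left_mono) auto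
  moreover have "sg_source \<kappa> (a + \<sigma> * d) - linearized_source \<kappa> \<sigma> U n = \<kappa>\<^sup>2 * (sin (a + \<sigma> * d) - sin a - \<sigma> * d * cos a)"
  proof -
    have "U n = a + d" by (simp add: a_def d_def)
    then show ?thesis
      unfolding linearized_source_def deriv_sg_source sg_source_def a_def[symmetric]
      by (simp add: algebra_simps)
  qed
  ultimately have "\<bar>sg_source \<kappa> (a + \<sigma> * d) - linearized_source \<kappa> \<sigma> U n\<bar> \<le> \<kappa>\<^sup>2 * d\<^sup>2" by (simp add: abs_mult)
  moreover have "\<bar>sg_source \<kappa> w - sg_source \<kappa> (a + \<sigma> * d)\<bar> \<le> \<kappa>\<^sup>2 * \<bar>w - (a + \<sigma> * d)\<bar>" by (rule sg_source_lipschitz)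
  ultimately show ?thesis unfolding avg d_def[symmetric] distrib_left by linarith
qed

text \<open>The linearized source contains the product of a cosine and an increment.  Only the increment of one of
the two grid functions, here \<open>U\<close>, has to be bounded in advance; the difference of the two increments is multiplied by a bounded cosine.\<close>

lemma linearized_source_stability:
  assumes "0 \<le> \<sigma>" "\<sigma> \<le> 1" and Q: "\<bar>U n - U (n - 1)\<bar> \<le> Q"
  shows "\<bar>linearized_source \<kappa> \<sigma> U n - linearized_source \<kappa> \<sigma> V n\<bar> \<le>
    \<kappa>\<^sup>2 * (2 + Q) * (\<bar>U n - V n\<bar> + \<bar>U (n - 1) - V (n - 1)\<bar>)"
proof -
  define a b A B where "a = U (n - 1)" and "b = U n" and "A = V (n - 1)" and "B = V n"
  define X where "X = (cos a - cos A) * (b - a) + cos A * ((b - B) - (a - A))"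
  have "linearized_source \<kappa> \<sigma> U n - linearized_source \<kappa> \<sigma> V n =
      (sg_source \<kappa> a - sg_source \<kappa> A) + \<kappa>\<^sup>2 * (\<sigma> * X)"
    unfolding linearized_source_def deriv_sg_source a_def[symmetric] b_def[symmetric] A_def[symmetric] B_def[symmetric] X_def
    by (simp add: algebra_simps)
  moreover have "\<bar>sg_source \<kappa> a - sg_source \<kappa> A\<bar> \<le> \<kappa>\<^sup>2 * \<bar>a - A\<bar>" by (rule sg_source_lipschitz)
  moreover have "\<bar>\<kappa>\<^sup>2 * (\<sigma> * X)\<bar> \<le> \<kappa>\<^sup>2 * (Q * \<bar>a - A\<bar> + (\<bar>b - B\<bar> + \<bar>a - A\<bar>))"
  proof -
    have "\<bar>(cos a - cos A) * (b - a)\<bar> \<le> \<bar>a - A\<bar> * Q"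
      unfolding abs_mult using cos_lipschitz[of a A] Q by (intro mult_mono) (auto simp: a_def b_def)
    moreover have "\<bar>cos A * ((b - B) - (a - A))\<bar> \<le> 1 * (\<bar>b - B\<bar> + \<bar>a - A\<bar>)"
      unfolding abs_mult by (intro mult_mono) auto
    ultimately have "\<bar>X\<bar> \<le> Q * \<bar>a - A\<bar> + (\<bar>b - B\<bar> + \<bar>a - A\<bar>)" unfolding X_def by (simp add: mult.commute)
    moreover have "\<bar>\<sigma> * X\<bar> \<le> 1 * \<bar>X\<bar>" unfolding abs_mult using assms by (intro mult_right_mono) auto
    ultimately show ?thesis unfolding abs_mult[of "\<kappa>\<^sup>2"] by (intro mult_mono) auto
  qed
  ultimately have "\<bar>linearized_source \<kappa> \<sigma> U n - linearized_source \<kappa> \<sigma> V n\<bar> \<le>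
      \<kappa>\<^sup>2 * \<bar>a - A\<bar> + \<kappa>\<^sup>2 * (Q * \<bar>a - A\<bar> + (\<bar>b - B\<bar> + \<bar>a - A\<bar>))" by linarith
  also have "\<dots> = \<kappa>\<^sup>2 * ((2 + Q) * \<bar>a - A\<bar> + 1 * \<bar>b - B\<bar>)" by (simp add: algebra_simps)
  also have "\<dots> \<le> \<kappa>\<^sup>2 * ((2 + Q) * \<bar>a - A\<bar> + (2 + Q) * \<bar>b - B\<bar>)"
    using Q by (intro mult_left_mono add_left_mono mult_right_mono) auto
  finally show ?thesis unfolding a_def b_def A_def B_def by (simp add: algebra_simps)
qed

section \<open>The equivalent first-order system\<close>

locale sine_gordon_problem = graded_meshes T r \<beta> \<sigma> D t
  for T r \<beta> \<sigma> D :: real and t :: "nat \<Rightarrow> nat \<Rightarrow> real" +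
  fixes L \<alpha> \<nu> \<kappa> C :: real and \<phi> \<psi> :: "real \<Rightarrow> real \<Rightarrow> real" and u ubar p :: "real \<Rightarrow> real \<Rightarrow> real \<Rightarrow> real"
  assumes L_pos: "0 < L" and nu_pos: "0 < \<nu>" and alpha: "\<alpha> = 2 * \<beta>"
    and phi: "C_space L 2 \<phi>"
    and phi_boundary: "\<lbrakk>x \<in> {0..L}; y \<in> {0..L}; x = 0 \<or> x = L \<or> y = 0 \<or> y = L\<rbrakk> \<Longrightarrow> \<phi> x y = 0"
    and solution: "sine_gordon_solution L T \<alpha> \<nu> \<kappa> \<psi> \<phi> u"
    and ubar_eq: "ubar = (\<lambda>x y s. u x y s - s * \<phi> x y)"
    and p_eq: "p = (\<lambda>x y s. caputo \<beta> (ubar x y) s)"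
    and ubar_smooth: "C_space_time L T 4 1 ubar" and p_smooth: "C_space_time L T 2 0 p"
    and ubar_bound: "weakly_singular_bound L T \<alpha> C ubar"
    and p_bound: "weakly_singular_bound L T \<beta> C p"
begin

sublocale U: regular_family L T \<beta> C \<alpha> ubar 4 1
  using L_pos T_pos beta alpha ubar_bound ubar_smooth by unfold_locales auto

sublocale P: regular_family L T \<beta> C \<beta> p 2 0
  using L_pos T_pos beta p_bound p_smooth by unfold_locales auto

lemma u_eq: "u x y s = ubar x y s + s * \<phi> x y" by (simp add: ubar_eq)

lemma phi_bounded: "\<exists>B\<ge>0. \<forall>x\<in>{0..L}. \<forall>y\<in>{0..L}. \<bar>\<phi> x y\<bar> \<le> B"
proof -
  have "continuous_on ({0..L} \<times> {0..L}) (\<lambda>(x, y). space_deriv L i j \<phi> x y)" if "i + j \<le> 2" for i j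
    using phi that unfolding C_space_def by blast
  from this[of 0 0] have "continuous_on ({0..L} \<times> {0..L}) (\<lambda>(x, y). \<phi> x y)" by simp
  then have "compact ((\<lambda>(x, y). \<phi> x y) ` ({0..L} \<times> {0..L}))"
    by (intro compact_continuous_image compact_Times) auto
  then have "bounded ((\<lambda>(x, y). \<phi> x y) ` ({0..L} \<times> {0..L}))" by (rule compact_imp_bounded)
  then obtain B where "\<And>z. z \<in> (\<lambda>(x, y). \<phi> x y) ` ({0..L} \<times> {0..L}) \<Longrightarrow> \<bar>z\<bar> \<le> B"
    unfolding bounded_real by blast
  then have "\<forall>x\<in>{0..L}. \<forall>y\<in>{0..L}. \<bar>\<phi> x y\<bar> \<le> max B 0" by force
  then show ?thesis by (intro exI[of _ "max B 0"]) auto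
qed

lemma fourth_derivatives_bounded:
  "\<exists>B. \<forall>s\<in>{0..T}. \<forall>x\<in>{0..L}. \<forall>y\<in>{0..L}.
     \<bar>space_deriv L 4 0 (\<lambda>x y. ubar x y s) x y\<bar> \<le> B \<and> \<bar>space_deriv L 0 4 (\<lambda>x y. ubar x y s) x y\<bar> \<le> B"
proof -
  have b: "\<exists>B. \<forall>s\<in>{0..T}. \<forall>x\<in>{0..L}. \<forall>y\<in>{0..L}. \<bar>space_deriv L i j (\<lambda>x y. ubar x y s) x y\<bar> \<le> B"
    if "i + j \<le> 4" for i j
  proof -
    have "continuous_on ({0..L} \<times> {0..L} \<times> {0..T}) (\<lambda>(x, y, t). space_deriv L i j (\<lambda>x y. ubar x y t) x y)"
      using ubar_smooth that unfolding C_space_time_def by blast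
    then have "compact ((\<lambda>(x, y, t). space_deriv L i j (\<lambda>x y. ubar x y t) x y) ` ({0..L} \<times> {0..L} \<times> {0..T}))"
      by (intro compact_continuous_image compact_Times) auto
    then have "bounded ((\<lambda>(x, y, t). space_deriv L i j (\<lambda>x y. ubar x y t) x y) ` ({0..L} \<times> {0..L} \<times> {0..T}))"
      by (rule compact_imp_bounded)
    then obtain B where "\<And>z. z \<in> (\<lambda>(x, y, t). space_deriv L i j (\<lambda>x y. ubar x y t) x y) ` ({0..L} \<times> {0..L} \<times> {0..T}) \<Longrightarrow> \<bar>z\<bar> \<le> B"
      unfolding bounded_real by blast
    then have "\<forall>s\<in>{0..T}. \<forall>x\<in>{0..L}. \<forall>y\<in>{0..L}. \<bar>space_deriv L i j (\<lambda>x y. ubar x y s) x y\<bar> \<le> B" by force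
    then show ?thesis by blast
  qed
  obtain B1 B2 where "\<forall>s\<in>{0..T}. \<forall>x\<in>{0..L}. \<forall>y\<in>{0..L}. \<bar>space_deriv L 4 0 (\<lambda>x y. ubar x y s) x y\<bar> \<le> B1"
    "\<forall>s\<in>{0..T}. \<forall>x\<in>{0..L}. \<forall>y\<in>{0..L}. \<bar>space_deriv L 0 4 (\<lambda>x y. ubar x y s) x y\<bar> \<le> B2"
    using b[of 4 0] b[of 0 4] by auto
  then show ?thesis by (intro exI[of _ "max B1 B2"]) (auto simp: le_max_iff_disj)
qed

lemma ubar_boundary: "\<lbrakk>x \<in> {0..L}; y \<in> {0..L}; x = 0 \<or> x = L \<or> y = 0 \<or> y = L; s \<in> {0..T}\<rbrakk> \<Longrightarrow> ubar x y s = 0"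
proof -
  assume *: "x \<in> {0..L}" "y \<in> {0..L}" "x = 0 \<or> x = L \<or> y = 0 \<or> y = L" "s \<in> {0..T}"
  have "u x y s = 0" using solution * unfolding sine_gordon_solution_def by blast
  then show "ubar x y s = 0" using phi_boundary[OF *(1-3)] by (simp add: ubar_eq)
qed

lemma p_boundary:
  assumes xy: "x \<in> {0..L}" "y \<in> {0..L}" "x = 0 \<or> x = L \<or> y = 0 \<or> y = L" and s: "s \<in> {0..T}"
  shows "p x y s = 0"
proof -
  have "integral {0..s} (\<lambda>z. (s - z) powr (- \<beta>) * deriv (ubar x y) z) = integral {0..s} (\<lambda>z. 0)"
  proof (rule integral_spike[of "{0, s}"])
    fix z assume z: "z \<in> {0..s} - {0, s}"
    have "eventually (\<lambda>z. z \<in> {0<..<T}) (nhds z)" using z s by (intro eventually_nhds_in_open) auto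
    then have "eventually (\<lambda>z. ubar x y z = 0) (nhds z)" by eventually_elim (use ubar_boundary[OF xy] in auto)
    then have "deriv (ubar x y) z = deriv (\<lambda>z. 0) z" by (intro deriv_cong_ev) auto
    then show "0 = (s - z) powr (- \<beta>) * deriv (ubar x y) z" by simp
  qed auto
  then show ?thesis unfolding p_eq caputo_less_1[OF beta(2)] by simp
qed

text \<open>Subtracting \<open>s * \<phi>\<close> removes the initial velocity.\<close>

lemma ubar_time_deriv_0:
  assumes "x \<in> {0<..<L}" "y \<in> {0<..<L}"
  shows "time_deriv T 1 (ubar x y) 0 = 0"
proof -
  have "(u x y has_real_derivative \<phi> x y) (at 0 within {0..T})"
    using solution assms unfolding sine_gordon_solution_def by auto
  then have "(ubar x y has_real_derivative \<phi> x y - 1 * \<phi> x y) (at 0 within {0..T})"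
    unfolding ubar_eq by (intro DERIV_diff DERIV_cmult_right DERIV_ident)
  then have "(ubar x y has_vector_derivative 0) (at 0 within {0..T})"
    by (simp add: has_real_derivative_iff_has_vector_derivative)
  moreover have "at (0::real) within {0..T} \<noteq> bot"
    using T_pos by (simp add: at_within_Icc_at_right)
  ultimately have "vector_derivative (ubar x y) (at 0 within {0..T}) = 0"
    using vector_derivative_within_cbox vector_derivative_unique_within vector_derivative_works differentiableI_vector by blast
  then show ?thesis by (simp add: time_deriv_Suc dwithin_def)
qed

text \<open>The function \<open>s * \<phi>\<close> has no second time derivative, and \<open>ubar\<close> starts with velocity zero, so
the composition rule applies to \<open>ubar\<close>.\<close>

lemma fractional_equation:
  assumes xy: "x \<in> {0<..<L}" "y \<in> {0<..<L}" and s: "0 < s" "s \<le> T"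
  shows "caputo \<beta> (p x y) s = caputo \<alpha> (u x y) s"
proof -
  have xyc: "x \<in> {0..L}" "y \<in> {0..L}" using xy by auto
  note wU = U.point_weakly_singular[OF xyc] and wP = P.point_weakly_singular[OF xyc]
  define v1 where "v1 = time_deriv T 1 (ubar x y)"
  define v2 where "v2 = time_deriv T 2 (ubar x y)"
  define p1 where "p1 = time_deriv T 1 (p x y)"
  have dU: "(ubar x y has_real_derivative v1 z) (at z)" "(v1 has_real_derivative v2 z) (at z)" if "0 < z" "z < T" for z
    using weakly_singular_deriv[OF wU, of 0 z] weakly_singular_deriv[OF wU, of 1 z] that
    by (auto simp: v1_def v2_def numeral_2_eq_2)
  have dP: "(p x y has_real_derivative p1 z) (at z)" if "0 < z" "z < T" for z
    using weakly_singular_deriv[OF wP, of 0 z] that by (auto simp: p1_def)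
  have c1: "continuous_on {0..T} v1"
    unfolding v1_def using C_space_time_continuous_time[OF ubar_smooth] xyc by auto
  have c2: "continuous_on {0<..<T} v2"
    unfolding v2_def using weakly_singular_continuous[OF wU, of 2] by (rule continuous_on_subset) auto
  have b2: "\<bar>v2 z\<bar> \<le> C * (1 + T powr (2 - 2 * \<beta>)) * z powr (2 * \<beta> - 2)" if z: "0 < z" "z < T" for z
  proof -
    have "\<bar>space_deriv L 0 0 (\<lambda>x y. time_deriv T 2 (ubar x y) z) x y\<bar> \<le> C * (1 + z powr (\<alpha> - real 2))"
      using weakly_singular_bound_terms[OF ubar_bound, of 2 x y z 0 0] xyc z by auto
    then have "\<bar>v2 z\<bar> \<le> C * (1 + z powr (2 * \<beta> - 2))" by (simp add: v2_def alpha)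
    also have "\<dots> \<le> C * (T powr (2 - 2 * \<beta>) * z powr (2 * \<beta> - 2) + z powr (2 * \<beta> - 2))"
    proof (intro mult_left_mono add_right_mono)
      have "1 = z powr (2 - 2 * \<beta>) * z powr (2 * \<beta> - 2)" using z by (simp add: powr_add[symmetric])
      also have "\<dots> \<le> T powr (2 - 2 * \<beta>) * z powr (2 * \<beta> - 2)"
        using z beta by (intro mult_right_mono powr_mono2) auto
      finally show "1 \<le> T powr (2 - 2 * \<beta>) * z powr (2 * \<beta> - 2)" .
    qed (rule U.C_nonneg)
    finally show ?thesis by (simp add: algebra_simps)
  qed
  have p_int: "p x y z = 1 / Gamma (1 - \<beta>) * integral {0..z} (\<lambda>y. (z - y) powr (- \<beta>) * v1 y)" if z: "0 \<le> z" "z \<le> T" for z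
  proof -
    have "integral {0..z} (\<lambda>w. (z - w) powr (- \<beta>) * deriv (ubar x y) w) = integral {0..z} (\<lambda>w. (z - w) powr (- \<beta>) * v1 w)"
    proof (rule integral_spike[of "{0, z}"])
      fix w assume w: "w \<in> {0..z} - {0, z}"
      then have "deriv (ubar x y) w = v1 w" using dU(1)[of w] z by (auto intro: DERIV_imp_deriv)
      then show "(z - w) powr (- \<beta>) * v1 w = (z - w) powr (- \<beta>) * deriv (ubar x y) w" by simp
    qed auto
    then show ?thesis unfolding p_eq caputo_less_1[OF beta(2)] by simp
  qed
  have "1 / Gamma (1 - \<beta>) * integral {0..s} (\<lambda>z. (s - z) powr (- \<beta>) * p1 z) =
    1 / Gamma (2 - 2 * \<beta>) * integral {0..s} (\<lambda>z. (s - z) powr (1 - 2 * \<beta>) * v2 z)"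
  proof (rule fractional_derivative_composition[OF beta T_pos c1 _ dU(2) c2 b2 P.cont[OF xyc] p_int dP s])
    show "v1 0 = 0" unfolding v1_def by (rule ubar_time_deriv_0[OF xy])
  qed auto
  moreover have "caputo \<beta> (p x y) s = 1 / Gamma (1 - \<beta>) * integral {0..s} (\<lambda>z. (s - z) powr (- \<beta>) * p1 z)"
  proof -
    have "integral {0..s} (\<lambda>w. (s - w) powr (- \<beta>) * deriv (p x y) w) = integral {0..s} (\<lambda>w. (s - w) powr (- \<beta>) * p1 w)"
    proof (rule integral_spike[of "{0, s}"])
      fix w assume w: "w \<in> {0..s} - {0, s}"
      then have "deriv (p x y) w = p1 w" using dP[of w] s by (auto intro: DERIV_imp_deriv)
      then show "(s - w) powr (- \<beta>) * p1 w = (s - w) powr (- \<beta>) * deriv (p x y) w" by simp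
    qed auto
    then show ?thesis unfolding caputo_less_1[OF beta(2)] by simp
  qed
  moreover have "caputo \<alpha> (u x y) s = 1 / Gamma (2 - 2 * \<beta>) * integral {0..s} (\<lambda>z. (s - z) powr (1 - 2 * \<beta>) * v2 z)"
  proof -
    have "integral {0..s} (\<lambda>w. (s - w) powr (1 - 2 * \<beta>) * deriv (deriv (u x y)) w) = integral {0..s} (\<lambda>w. (s - w) powr (1 - 2 * \<beta>) * v2 w)"
    proof (rule integral_spike[of "{0, s}"])
      fix w assume w: "w \<in> {0..s} - {0, s}"
      then have wT: "0 < w" "w < T" using s by auto
      have du: "deriv (u x y) z = v1 z + \<phi> x y" if "0 < z" "z < T" for z
      proof -
        have "((\<lambda>s. ubar x y s + s * \<phi> x y) has_real_derivative v1 z + 1 * \<phi> x y) (at z)"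
          using dU(1)[OF that] by (intro DERIV_add DERIV_cmult_right DERIV_ident)
        moreover have "u x y = (\<lambda>s. ubar x y s + s * \<phi> x y)" by (auto simp: u_eq)
        ultimately show ?thesis by (simp add: DERIV_imp_deriv)
      qed
      have "eventually (\<lambda>z. z \<in> {0<..<T}) (nhds w)" using wT by (intro eventually_nhds_in_open) auto
      then have "eventually (\<lambda>z. deriv (u x y) z = v1 z + \<phi> x y) (nhds w)" by eventually_elim (use du in auto)
      then have "deriv (deriv (u x y)) w = deriv (\<lambda>z. v1 z + \<phi> x y) w" by (intro deriv_cong_ev) auto
      also have "\<dots> = v2 w"
      proof (rule DERIV_imp_deriv)
        show "((\<lambda>z. v1 z + \<phi> x y) has_real_derivative v2 w) (at w)"
          using DERIV_add[OF dU(2)[OF wT] DERIV_const[of "\<phi> x y"]] by simp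
      qed
      finally show "(s - w) powr (1 - 2 * \<beta>) * v2 w = (s - w) powr (1 - 2 * \<beta>) * deriv (deriv (u x y)) w" by simp
    qed auto
    then show ?thesis unfolding caputo_def alpha using beta by simp
  qed
  ultimately show ?thesis by simp
qed

lemma system_equation:
  assumes xy: "x \<in> {0<..<L}" "y \<in> {0<..<L}" and s: "0 < s" "s \<le> T"
  shows "caputo \<beta> (p x y) s = \<nu> * (laplacian (\<lambda>x y. ubar x y s) x y + s * laplacian \<phi> x y) - sg_source \<kappa> (u x y s)"
proof -
  have "caputo \<alpha> (u x y) s - \<nu> * laplacian (\<lambda>x y. u x y s) x y + sg_source \<kappa> (u x y s) = 0"
    using solution xy s unfolding sine_gordon_solution_def by auto
  moreover have "laplacian (\<lambda>x y. u x y s) x y = laplacian (\<lambda>x y. ubar x y s) x y + s * laplacian \<phi> x y"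
  proof -
    have "space_differentiable L 4 (\<lambda>x y. ubar x y s)" using ubar_smooth s unfolding C_space_time_def by auto
    then have "space_differentiable L 2 (\<lambda>x y. ubar x y s)" by (simp add: space_differentiable_def)
    moreover have "space_differentiable L 2 \<phi>" using phi by (simp add: C_space_def)
    ultimately show ?thesis unfolding u_eq using xy by (intro laplacian_add_scaled) auto
  qed
  ultimately show ?thesis unfolding fractional_equation[OF xy s] by (simp add: algebra_simps)
qed

text \<open>The linear function \<open>s * \<phi>\<close> is regular, so it changes the constant only.\<close>

lemma u_weakly_singular:
  assumes xy: "x \<in> {0..L}" "y \<in> {0..L}" and B: "\<bar>\<phi> x y\<bar> \<le> B"
  shows "\<exists>v. weakly_singular T \<beta> (U.K + B * (1 + T) ^ 3) v \<and> v 0 = u x y"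
proof -
  define v where "v l s = time_deriv T l (ubar x y) s + (if l = 0 then s * \<phi> x y else if l = 1 then \<phi> x y else 0)" for l s
  have "weakly_singular T \<beta> (U.K + B * (1 + T) ^ 3) v"
    unfolding weakly_singular_def
  proof (intro conjI allI impI ballI)
    show "continuous_on {0..T} (v 0)" unfolding v_def using U.cont[OF xy] by (auto intro!: continuous_intros)
    show "(v l has_real_derivative v (Suc l) s) (at s within {0..T})" if "l < 3" "s \<in> {0<..T}" for l s
    proof -
      have "((\<lambda>s. if l = 0 then s * \<phi> x y else if l = 1 then \<phi> x y else 0) has_real_derivative
         (if Suc l = 0 then s * \<phi> x y else if Suc l = 1 then \<phi> x y else 0)) (at s within {0..T})"
        using that by (cases l) (auto intro!: derivative_eq_intros)
      then show ?thesis unfolding v_def using that by (intro DERIV_add U.time_diff xy) auto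
    qed
    show "\<bar>v l s\<bar> \<le> (U.K + B * (1 + T) ^ 3) * s powr (\<beta> - real l)" if ls: "l \<in> {1..3}" "s \<in> {0<..T}" for l s
    proof -
      have b: "1 / 2 < \<beta>" "0 < \<beta>" using beta by auto
      have "\<bar>v l s\<bar> \<le> \<bar>time_deriv T l (ubar x y) s\<bar> + B * 1"
        unfolding v_def using B ls by auto
      also have "\<dots> \<le> U.K * s powr (\<beta> - real l) + B * ((1 + T) ^ 3 * s powr (\<beta> - real l))"
        using U.space_bound[of l x y s 0 0] singular_power_le(2)[of s T l \<beta> \<beta>] ls xy B b beta
        by (intro add_mono mult_left_mono) auto
      finally show ?thesis by (simp add: algebra_simps)
    qed
  qed
  moreover have "v 0 = u x y" by (auto simp: v_def u_eq)
  ultimately show ?thesis by blast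
qed

end

section \<open>Error equations and the error estimate\<close>

lemma avg_star_diff: "avg_star \<sigma> (\<lambda>k. v k - w k) n = avg_star \<sigma> v n - avg_star \<sigma> w n"
  by (simp add: avg_star_def algebra_simps)

lemma discrete_laplacian_diff:
  "discrete_laplacian h (\<lambda>i j. V i j - W i j) i j = discrete_laplacian h V i j - discrete_laplacian h W i j"
  unfolding discrete_laplacian_def diff_divide_distrib[symmetric] by (simp add: algebra_simps)

lemma discrete_laplacian_avg_star:
  "discrete_laplacian h (\<lambda>i j. avg_star \<sigma> (\<lambda>k. W k i j) n) i j = avg_star \<sigma> (\<lambda>k. discrete_laplacian h (W k) i j) n"
  unfolding discrete_laplacian_def avg_star_def times_divide_eq_right add_divide_distrib[symmetric]
  by (rule arg_cong[where f = "\<lambda>x. x / h\<^sup>2"]) (simp add: algebra_simps)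

context graded_meshes
begin

lemma deriv_diff: "n \<in> {1..N} \<Longrightarrow> \<delta> N (\<lambda>k. v k - w k) n = \<delta> N v n - \<delta> N w n"
  using deriv_linear[of n N 1 v "- 1" w] by simp

lemma avg_star_times: "avg_star \<sigma> (\<lambda>k. v k + t N k * c) n = avg_star \<sigma> v n + ts N n * c"
  by (simp add: avg_star_def t_star_def mesh_step_def algebra_simps)

end

context sine_gordon_problem
begin

text \<open>The residual splits into the truncation error of \<open>p\<close>, the averaging error of the discrete Laplacian of \<open>ubar\<close>,
the error of the five-point formula, and the consistency error of the source; the difference between the source at the exact and
at the discrete values is proportional to the errors.\<close>

lemma momentum_residual:
  assumes gr: "grid L h M" and n: "n \<in> {1..N}" and ij: "i \<in> {1..M-1}" "j \<in> {1..M-1}"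
    and scheme: "\<delta> N (\<lambda>k. P k i j) n - \<nu> * discrete_laplacian h (\<lambda>i j. avg_star \<sigma> (\<lambda>k. Ub k i j) n) i j
       + linearized_source \<kappa> \<sigma> (\<lambda>k. Ub k i j + t N k * \<phi> (real i * h) (real j * h)) n
       = \<nu> * ts N n * laplacian \<phi> (real i * h) (real j * h)"
    and trunc: "\<And>K v. weakly_singular T \<beta> K v \<Longrightarrow> \<bar>\<delta> N (\<lambda>k. v 0 (t N k)) n - caputo \<beta> (v 0) (ts N n)\<bar> \<le> Ct * K * X"
    and avg: "\<And>K v. weakly_singular T \<beta> K v \<Longrightarrow> \<bar>avg_star \<sigma> (\<lambda>k. v 0 (t N k)) n - v 0 (ts N n)\<bar> \<le> Ca * K * Y"
    and sq: "\<And>K v. weakly_singular T \<beta> K v \<Longrightarrow> (v 0 (t N n) - v 0 (t N (n - 1)))\<^sup>2 \<le> Cs * K\<^sup>2 * Y"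
    and B4: "\<And>s x y. \<lbrakk>s \<in> {0..T}; x \<in> {0..L}; y \<in> {0..L}\<rbrakk> \<Longrightarrow>
       \<bar>space_deriv L 4 0 (\<lambda>x y. ubar x y s) x y\<bar> \<le> B4 \<and> \<bar>space_deriv L 0 4 (\<lambda>x y. ubar x y s) x y\<bar> \<le> B4"
    and B: "\<And>x y. \<lbrakk>x \<in> {0..L}; y \<in> {0..L}\<rbrakk> \<Longrightarrow> \<bar>\<phi> x y\<bar> \<le> B"
    and Q: "Cs * (U.K + B * (1 + T) ^ 3)\<^sup>2 * Y \<le> Q"
  shows "\<bar>\<delta> N (\<lambda>k. p (real i * h) (real j * h) (t N k) - P k i j) n -
      \<nu> * discrete_laplacian h (\<lambda>i j. avg_star \<sigma> (\<lambda>k. ubar (real i * h) (real j * h) (t N k) - Ub k i j) n) i j\<bar> \<le>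
    (Ct * U.K * X + \<nu> * (Ca * (4 * U.K) * Y + 4 * B4 * h\<^sup>2) + \<kappa>\<^sup>2 * (Ca * U.K * Y + Cs * (U.K + B * (1 + T) ^ 3)\<^sup>2 * Y)) +
    \<kappa>\<^sup>2 * (3 + Q) * (\<bar>ubar (real i * h) (real j * h) (t N n) - Ub n i j\<bar> +
       \<bar>ubar (real i * h) (real j * h) (t N (n - 1)) - Ub (n - 1) i j\<bar>)"
proof -
  interpret grid L h M by (rule gr)
  define x y where "x = real i * h" and "y = real j * h"
  have xy: "x \<in> {0<..<L}" "y \<in> {0<..<L}" unfolding x_def y_def using node_interior ij by auto
  then have xyc: "x \<in> {0..L}" "y \<in> {0..L}" by auto
  have n1: "1 \<le> n" "n \<le> N" using n by auto
  have ts: "0 < ts N n" "ts N n \<le> T" using ts_pos[OF n1] ts_lt[OF n1] t_le_T[of n N] n1 by auto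
  define dl where "dl s = discrete_laplacian h (\<lambda>i j. ubar (real i * h) (real j * h) s) i j" for s
  define lap where "lap = laplacian (\<lambda>x y. ubar x y (ts N n)) x y"
  define Uu where "Uu k = u x y (t N k)" for k
  define Uh where "Uh k = Ub k i j + t N k * \<phi> x y" for k
  have e1: "\<bar>\<delta> N (\<lambda>k. p x y (t N k)) n - caputo \<beta> (p x y) (ts N n)\<bar> \<le> Ct * U.K * X"
    using trunc[OF P.point_weakly_singular[OF xyc]] by simp
  have e2: "\<bar>avg_star \<sigma> (\<lambda>k. dl (t N k)) n - dl (ts N n)\<bar> \<le> Ca * (4 * U.K) * Y"
    using avg[OF U.laplacian_weakly_singular[OF gr ij]] by (simp add: dl_def)
  have e3: "\<bar>dl (ts N n) - lap\<bar> \<le> 4 * B4 * h\<^sup>2"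
  proof -
    have "space_differentiable L 4 (\<lambda>x y. ubar x y (ts N n))" using ubar_smooth ts unfolding C_space_time_def by auto
    from discrete_laplacian_consistency[OF this ij, of B4] show ?thesis
      unfolding dl_def lap_def x_def y_def using B4[of "ts N n"] ts by auto
  qed
  obtain v where v: "weakly_singular T \<beta> (U.K + B * (1 + T) ^ 3) v" "v 0 = u x y"
    using u_weakly_singular[OF xyc B[OF xyc]] by blast
  have inc2: "(Uu n - Uu (n - 1))\<^sup>2 \<le> Cs * (U.K + B * (1 + T) ^ 3)\<^sup>2 * Y"
    using sq[OF v(1)] unfolding v(2) Uu_def .
  have e4: "\<bar>sg_source \<kappa> (u x y (ts N n)) - linearized_source \<kappa> \<sigma> Uu n\<bar> \<le>
      \<kappa>\<^sup>2 * (Ca * U.K * Y + Cs * (U.K + B * (1 + T) ^ 3)\<^sup>2 * Y)"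
  proof -
    have "avg_star \<sigma> Uu n = avg_star \<sigma> (\<lambda>k. ubar x y (t N k)) n + ts N n * \<phi> x y"
      unfolding Uu_def u_eq by (rule avg_star_times)
    then have "\<bar>u x y (ts N n) - avg_star \<sigma> Uu n\<bar> \<le> Ca * U.K * Y"
      using avg[OF U.point_weakly_singular[OF xyc]] by (simp add: u_eq abs_minus_commute)
    then have "\<kappa>\<^sup>2 * (\<bar>u x y (ts N n) - avg_star \<sigma> Uu n\<bar> + (Uu n - Uu (n - 1))\<^sup>2) \<le>
        \<kappa>\<^sup>2 * (Ca * U.K * Y + Cs * (U.K + B * (1 + T) ^ 3)\<^sup>2 * Y)"
      using inc2 by (intro mult_left_mono add_mono) auto
    then show ?thesis using linearized_source_consistency[of \<sigma> \<kappa> "u x y (ts N n)" Uu n] sigma_bounds by linarith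
  qed
  have e5: "\<bar>linearized_source \<kappa> \<sigma> Uu n - linearized_source \<kappa> \<sigma> Uh n\<bar> \<le>
     \<kappa>\<^sup>2 * (3 + Q) * (\<bar>ubar x y (t N n) - Ub n i j\<bar> + \<bar>ubar x y (t N (n - 1)) - Ub (n - 1) i j\<bar>)"
  proof -
    have "\<bar>Uu n - Uu (n - 1)\<bar> \<le> 1 + (Uu n - Uu (n - 1))\<^sup>2"
    proof -
      \<comment> \<open>the increment itself is only bounded, and the bound of its square already implies this\<close>
      have "\<bar>d\<bar> \<le> 1 + d\<^sup>2" for d :: real
        using zero_le_power2[of "\<bar>d\<bar> - 1"] by (simp add: power2_diff)
      then show ?thesis .
    qed
    also have "\<dots> \<le> 1 + Q" using inc2 Q by simp
    finally have "\<bar>linearized_source \<kappa> \<sigma> Uu n - linearized_source \<kappa> \<sigma> Uh n\<bar> \<le>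
      \<kappa>\<^sup>2 * (2 + (1 + Q)) * (\<bar>Uu n - Uh n\<bar> + \<bar>Uu (n - 1) - Uh (n - 1)\<bar>)"
      using sigma_bounds by (intro linearized_source_stability) auto
    then show ?thesis by (simp add: Uu_def Uh_def u_eq)
  qed
  have eq: "caputo \<beta> (p x y) (ts N n) = \<nu> * (lap + ts N n * laplacian \<phi> x y) - sg_source \<kappa> (u x y (ts N n))"
    unfolding lap_def by (rule system_equation[OF xy ts])
  have d1: "\<delta> N (\<lambda>k. p x y (t N k) - P k i j) n = \<delta> N (\<lambda>k. p x y (t N k)) n - \<delta> N (\<lambda>k. P k i j) n"
    by (rule deriv_diff[OF n])
  have d2: "discrete_laplacian h (\<lambda>i j. avg_star \<sigma> (\<lambda>k. ubar (real i * h) (real j * h) (t N k) - Ub k i j) n) i j =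
      avg_star \<sigma> (\<lambda>k. dl (t N k)) n - discrete_laplacian h (\<lambda>i j. avg_star \<sigma> (\<lambda>k. Ub k i j) n) i j"
    unfolding avg_star_diff discrete_laplacian_diff discrete_laplacian_avg_star dl_def ..
  have d3: "\<delta> N (\<lambda>k. P k i j) n = \<nu> * ts N n * laplacian \<phi> x y + \<nu> * discrete_laplacian h (\<lambda>i j. avg_star \<sigma> (\<lambda>k. Ub k i j) n) i j
       - linearized_source \<kappa> \<sigma> Uh n"
    using scheme unfolding Uh_def x_def y_def by linarith
  have "\<delta> N (\<lambda>k. p x y (t N k) - P k i j) n -
      \<nu> * discrete_laplacian h (\<lambda>i j. avg_star \<sigma> (\<lambda>k. ubar (real i * h) (real j * h) (t N k) - Ub k i j) n) i j =
    (\<delta> N (\<lambda>k. p x y (t N k)) n - caputo \<beta> (p x y) (ts N n))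
    - \<nu> * ((avg_star \<sigma> (\<lambda>k. dl (t N k)) n - dl (ts N n)) + (dl (ts N n) - lap))
    - (sg_source \<kappa> (u x y (ts N n)) - linearized_source \<kappa> \<sigma> Uu n)
    - (linearized_source \<kappa> \<sigma> Uu n - linearized_source \<kappa> \<sigma> Uh n)"
    unfolding d1 d2 d3 eq by (simp add: algebra_simps)
  moreover have "\<bar>\<nu> * ((avg_star \<sigma> (\<lambda>k. dl (t N k)) n - dl (ts N n)) + (dl (ts N n) - lap))\<bar> \<le> \<nu> * (Ca * (4 * U.K) * Y + 4 * B4 * h\<^sup>2)"
  proof -
    have "\<bar>(avg_star \<sigma> (\<lambda>k. dl (t N k)) n - dl (ts N n)) + (dl (ts N n) - lap)\<bar> \<le> Ca * (4 * U.K) * Y + 4 * B4 * h\<^sup>2"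
      using e2 e3 by linarith
    then show ?thesis using nu_pos by (simp add: abs_mult)
  qed
  ultimately show ?thesis
    using e1 e4 e5 unfolding x_def[symmetric] y_def[symmetric] by linarith
qed

text \<open>The second equation holds exactly for the continuous functions, so its residual is a truncation and an
averaging error.  Its difference between two points is the residual of the difference of the functions, and that is
small with the distance.\<close>

lemma velocity_residual_difference:
  assumes n: "n \<in> {1..N}" and xy: "x \<in> {0..L}" "x' \<in> {0..L}" "y \<in> {0..L}" "y' \<in> {0..L}" "x = x' \<or> y = y'"
    and trunc: "\<And>K v. weakly_singular T \<beta> K v \<Longrightarrow> \<bar>\<delta> N (\<lambda>k. v 0 (t N k)) n - caputo \<beta> (v 0) (ts N n)\<bar> \<le> Ct * K * X"
    and avg: "\<And>K v. weakly_singular T \<beta> K v \<Longrightarrow> \<bar>avg_star \<sigma> (\<lambda>k. v 0 (t N k)) n - v 0 (ts N n)\<bar> \<le> Ca * K * Y"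
  shows "\<bar>(\<delta> N (\<lambda>k. ubar x y (t N k)) n - avg_star \<sigma> (\<lambda>k. p x y (t N k)) n) -
     (\<delta> N (\<lambda>k. ubar x' y' (t N k)) n - avg_star \<sigma> (\<lambda>k. p x' y' (t N k)) n)\<bar> \<le>
     (Ct * U.K * X + Ca * U.K * Y) * (\<bar>x - x'\<bar> + \<bar>y - y'\<bar>)"
proof -
  have n1: "1 \<le> n" "n \<le> N" using n by auto
  have ts: "0 < ts N n" "ts N n \<le> T" using ts_pos[OF n1] ts_lt[OF n1] t_le_T[of n N] n1 by auto
  define e where "e = \<bar>x - x'\<bar> + \<bar>y - y'\<bar>"
  note wU = U.difference_weakly_singular[OF xy, folded e_def] and wP = P.difference_weakly_singular[OF xy, folded e_def]
  have 1: "\<bar>\<delta> N (\<lambda>k. ubar x y (t N k) - ubar x' y' (t N k)) n - caputo \<beta> (\<lambda>s. ubar x y s - ubar x' y' s) (ts N n)\<bar> \<le> Ct * (U.K * e) * X"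
    using trunc[OF wU] by simp
  have 2: "\<bar>avg_star \<sigma> (\<lambda>k. p x y (t N k) - p x' y' (t N k)) n - (p x y (ts N n) - p x' y' (ts N n))\<bar> \<le> Ca * (U.K * e) * Y"
    using avg[OF wP] by simp
  have 3: "caputo \<beta> (\<lambda>s. ubar x y s - ubar x' y' s) (ts N n) = p x y (ts N n) - p x' y' (ts N n)"
    using caputo_diff[OF U.point_weakly_singular[OF xy(1,3)] U.point_weakly_singular[OF xy(2,4)] wU ts] by (simp add: p_eq)
  have "\<bar>\<delta> N (\<lambda>k. ubar x y (t N k) - ubar x' y' (t N k)) n - avg_star \<sigma> (\<lambda>k. p x y (t N k) - p x' y' (t N k)) n\<bar> \<le>
      Ct * (U.K * e) * X + Ca * (U.K * e) * Y"
    using 1 2 unfolding 3 by linarith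
  then show ?thesis unfolding deriv_diff[OF n] avg_star_diff e_def[symmetric] by (simp add: algebra_simps)
qed

text \<open>The energy of the error satisfies the scalar inequality to which the stability result applies.  The
velocity equation is used at boundary nodes as well, where all its terms vanish.\<close>

lemma error_estimate:
  assumes m: "0 < m" "m \<le> 1" "m \<le> 2 / r"
  shows "\<exists>K>0. \<exists>\<tau>0>0. \<forall>N\<ge>1. \<forall>M\<ge>1. property_P1 \<beta> \<sigma> (t N) N \<longrightarrow> property_P2 \<beta> \<sigma> (t N) N \<longrightarrow>
    (\<forall>n\<in>{1..N}. dt N n \<le> \<tau>0) \<longrightarrow>
    (\<forall>P Ub. alikhanov_scheme L \<beta> \<sigma> \<nu> \<kappa> \<psi> \<phi> M N (t N) P Ub \<longrightarrow>
       grid_norm (L / real M) M (\<lambda>i j. p (real i * (L / real M)) (real j * (L / real M)) T - P N i j)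
       + grid_grad_norm (L / real M) M (\<lambda>i j. ubar (real i * (L / real M)) (real j * (L / real M)) T - Ub N i j)
       \<le> K * (t N 1 powr m + (L / real M)\<^sup>2))"
proof -
  obtain Ct where Ct: "0 < Ct" "\<And>N n K v. \<lbrakk>n \<in> {1..N}; weakly_singular T \<beta> K v\<rbrakk> \<Longrightarrow>
    \<bar>\<delta> N (\<lambda>k. v 0 (t N k)) n - caputo \<beta> (v 0) (ts N n)\<bar> \<le> Ct * K * xi N n powr (m + eps)"
    using truncation_error[OF m] by blast
  obtain Ca where Ca: "0 < Ca" "\<And>N n K v. \<lbrakk>n \<in> {1..N}; weakly_singular T \<beta> K v\<rbrakk> \<Longrightarrow>
    \<bar>avg_star \<sigma> (\<lambda>k. v 0 (t N k)) n - v 0 (ts N n)\<bar> \<le> Ca * K * (xi N n powr m * t N n powr \<beta>)"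
    using averaging_error[OF m(1,3)] by blast
  obtain Cs where Cs: "0 < Cs" "\<And>N n K v. \<lbrakk>n \<in> {1..N}; weakly_singular T \<beta> K v\<rbrakk> \<Longrightarrow>
    (v 0 (t N n) - v 0 (t N (n - 1)))\<^sup>2 \<le> Cs * K\<^sup>2 * (xi N n powr m * t N n powr \<beta>)"
    using squared_increment_bound[OF m(1,3)] by blast
  obtain B where B: "0 \<le> B" "\<And>x y. \<lbrakk>x \<in> {0..L}; y \<in> {0..L}\<rbrakk> \<Longrightarrow> \<bar>\<phi> x y\<bar> \<le> B"
    using phi_bounded by blast
  obtain B4 where B4: "\<And>s x y. \<lbrakk>s \<in> {0..T}; x \<in> {0..L}; y \<in> {0..L}\<rbrakk> \<Longrightarrow>
       \<bar>space_deriv L 4 0 (\<lambda>x y. ubar x y s) x y\<bar> \<le> B4 \<and> \<bar>space_deriv L 0 4 (\<lambda>x y. ubar x y s) x y\<bar> \<le> B4"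
    using fourth_derivatives_bounded by blast
  have B40: "0 \<le> B4" using B4[of 0 0 0] L_pos T_pos by force
  have K0: "0 \<le> U.K" by (rule U.K_nonneg)
  define S where "S = Cs * (U.K + B * (1 + T) ^ 3)\<^sup>2"
  have S0: "0 \<le> S" using Cs by (simp add: S_def)
  define Q where "Q = S * T powr \<beta>"
  have Q0: "0 \<le> Q" using S0 by (simp add: Q_def)
  define c where "c = \<kappa>\<^sup>2 * (3 + Q)"
  have c0: "0 \<le> c" using Q0 by (simp add: c_def)
  define lam where "lam = c * (L * (1 / sqrt \<nu>))"
  have lam0: "0 \<le> lam" using c0 L_pos nu_pos by (simp add: lam_def)
  define A1 where "A1 = (L + 2 * sqrt \<nu> * L) * (Ct * U.K)"
  define A2 where "A2 = L * (\<nu> * (Ca * (4 * U.K)) + \<kappa>\<^sup>2 * (Ca * U.K + S)) + 2 * sqrt \<nu> * L * (Ca * U.K)"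
  define A3 where "A3 = L * (\<nu> * (4 * B4))"
  have A0: "0 \<le> A1" "0 \<le> A2" "0 \<le> A3"
    using L_pos nu_pos Ct Ca K0 S0 B40 by (auto simp: A1_def A2_def A3_def)
  obtain Ks \<tau>0 where Ks: "0 < Ks" "0 < \<tau>0" and stab: "\<forall>N\<ge>1. property_P1 \<beta> \<sigma> (t N) N \<longrightarrow> (\<forall>n\<in>{1..N}. dt N n \<le> \<tau>0) \<longrightarrow>
      (\<forall>E \<theta>1 \<theta>2. 0 \<le> \<theta>1 \<longrightarrow> 0 \<le> \<theta>2 \<longrightarrow> E 0 = 0 \<longrightarrow>
        (\<forall>n\<in>{1..N}. \<delta> N E n \<le> lam * (E n + E (n - 1)) +
            (\<theta>1 * (xi N n powr eps * t N n powr (- m)) + \<theta>2 * t N n powr (- \<beta>))) \<longrightarrow>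
        E N \<le> Ks * (\<theta>1 + \<theta>2))"
    using stability[OF m(1,2) lam0] by (elim exE conjE) (rule that)
  define A where "A = A1 + A2 * T powr (2 * \<beta> - m) + A3 * T powr \<beta>"
  have A: "0 \<le> A" using A0 by (simp add: A_def)
  define Kf where "Kf = (1 + 1 / sqrt \<nu>) * (Ks * A) + 1"
  have Kf: "0 < Kf" using Ks A nu_pos by (simp add: Kf_def add_nonneg_pos)
  have main: "grid_norm h M (\<lambda>i j. p (real i * h) (real j * h) T - P N i j)
       + grid_grad_norm h M (\<lambda>i j. ubar (real i * h) (real j * h) T - Ub N i j)
       \<le> Kf * (t N 1 powr m + h\<^sup>2)"
    if N: "1 \<le> N" and M: "1 \<le> M" and P1: "property_P1 \<beta> \<sigma> (t N) N" and P2: "property_P2 \<beta> \<sigma> (t N) N"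
      and small: "\<forall>n\<in>{1..N}. dt N n \<le> \<tau>0" and sch: "alikhanov_scheme L \<beta> \<sigma> \<nu> \<kappa> \<psi> \<phi> M N (t N) P Ub"
      and h: "h = L / real M"
    for N M P Ub h
  proof -
    interpret grid L h M using L_pos M h by unfold_locales auto
    have gr: "grid L h M" ..
    have s1: "\<delta> N (\<lambda>k. P k i j) n - \<nu> * discrete_laplacian h (\<lambda>i j. avg_star \<sigma> (\<lambda>k. Ub k i j) n) i j
       + linearized_source \<kappa> \<sigma> (\<lambda>k. Ub k i j + t N k * \<phi> (real i * h) (real j * h)) n
       = \<nu> * ts N n * laplacian \<phi> (real i * h) (real j * h)"
      and s2: "\<delta> N (\<lambda>k. Ub k i j) n = avg_star \<sigma> (\<lambda>k. P k i j) n"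
      if "n \<in> {1..N}" "i \<in> {1..M-1}" "j \<in> {1..M-1}" for n i j
      using sch that unfolding alikhanov_scheme_def Let_def h[symmetric] by blast+
    have s3: "Ub 0 i j = \<psi> (real i * h) (real j * h)" "P 0 i j = 0" if "i \<in> {1..M-1}" "j \<in> {1..M-1}" for i j
      using sch that unfolding alikhanov_scheme_def Let_def h[symmetric] by blast+
    have s4: "Ub n i j = 0" "P n i j = 0" if "n \<le> N" "i \<le> M" "j \<le> M" "i = 0 \<or> i = M \<or> j = 0 \<or> j = M" for n i j
      using sch that unfolding alikhanov_scheme_def Let_def h[symmetric] by blast+
    define a where "a k i j = p (real i * h) (real j * h) (t N k) - P k i j" for k i j
    define w where "w k i j = ubar (real i * h) (real j * h) (t N k) - Ub k i j" for k i j
    have tk: "t N k \<in> {0..T}" if "k \<le> N" for k using t_nonneg[OF that N] t_le_T[OF that N] by auto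
    have edge: "real i * h = 0 \<or> real i * h = L \<or> real j * h = 0 \<or> real j * h = L"
      if "i = 0 \<or> i = M \<or> j = 0 \<or> j = M" for i j using that Mh by auto
    have bd: "a k i j = 0" "w k i j = 0" if "k \<le> N" "i \<le> M" "j \<le> M" "i = 0 \<or> i = M \<or> j = 0 \<or> j = M" for k i j
      using p_boundary[OF node_in node_in edge tk] ubar_boundary[OF node_in node_in edge tk] s4 that
      by (auto simp: a_def w_def)
    have init: "a 0 i j = 0" "w 0 i j = 0" if ij: "i \<le> M" "j \<le> M" for i j
    proof -
      have "a 0 i j = 0 \<and> w 0 i j = 0"
      proof (cases "i = 0 \<or> i = M \<or> j = 0 \<or> j = M")
        case True
        then show ?thesis using bd[of 0 i j] ij by auto
      next
        case False
        then have int: "i \<in> {1..M-1}" "j \<in> {1..M-1}" using ij by auto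
        have "u (real i * h) (real j * h) 0 = \<psi> (real i * h) (real j * h)"
          using solution node_interior[OF int(1)] node_interior[OF int(2)] unfolding sine_gordon_solution_def by auto
        moreover have "p (real i * h) (real j * h) 0 = 0" unfolding p_eq caputo_less_1[OF beta(2)] by simp
        ultimately show ?thesis using s3[OF int] t_0[OF N] by (simp add: a_def w_def ubar_eq)
      qed
      then show "a 0 i j = 0" "w 0 i j = 0" by auto
    qed
    define E where "E k = L2_set (energy_vector \<nu> h (a k) (w k)) (energy_index M)" for k
    have E0: "E 0 = 0"
    proof -
      have "energy_vector \<nu> h (a 0) (w 0) x = 0" if "x \<in> energy_index M" for x
        using that by (auto simp: energy_vector_def energy_index_def init)
      then show ?thesis by (simp add: E_def L2_set_def)
    qed
    have E_nonneg: "0 \<le> E k" for k unfolding E_def by (rule L2_set_nonneg)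
    have wE: "grid_norm h M (w k) \<le> L * (1 / sqrt \<nu>) * E k" if "k \<le> N" for k
    proof -
      have "grid_norm h M (w k) \<le> L * grid_grad_norm h M (w k)"
        using bd(2)[OF that] M by (intro discrete_poincare) auto
      also have "\<dots> \<le> L * (E k / sqrt \<nu>)"
        unfolding E_def using norms_le_energy(2)[OF nu_pos] L_pos by (intro mult_left_mono) auto
      finally show ?thesis by simp
    qed
    define \<theta>1 where "\<theta>1 = A1 * t N 1 powr m"
    define \<theta>2 where "\<theta>2 = A2 * T powr (2 * \<beta> - m) * t N 1 powr m + A3 * T powr \<beta> * h\<^sup>2"
    have th: "0 \<le> \<theta>1" "0 \<le> \<theta>2" using A0 by (auto simp: \<theta>1_def \<theta>2_def)
    have step: "\<delta> N E n \<le> lam * (E n + E (n - 1)) +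
          (\<theta>1 * (xi N n powr eps * t N n powr (- m)) + \<theta>2 * t N n powr (- \<beta>))" if n: "n \<in> {1..N}" for n
    proof -
      have n1: "1 \<le> n" "n \<le> N" "n - 1 \<le> N" using n by auto
      have tn: "0 < t N n" "t N n \<le> T" "0 < t N 1" using t_pos[of n N] t_le_T[of n N] t_pos[of 1 N] n1 N by auto
      have x: "0 < xi N n" "xi N n \<le> 1" using xi_pos[of n N] xi_le_1[of n N] n1 by auto
      define X where "X = xi N n powr (m + eps)"
      define Y where "Y = xi N n powr m * t N n powr \<beta>"
      have XY: "0 \<le> X" "0 \<le> Y" by (auto simp: X_def Y_def)
      have "Y \<le> 1 * T powr \<beta>"
        unfolding Y_def using x tn m beta powr_mono2[of m "xi N n" 1] by (intro mult_mono powr_mono2) auto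
      then have Q: "S * Y \<le> Q" unfolding Q_def using S0 by (intro mult_left_mono) auto
      define r1 where "r1 = Ct * U.K * X + \<nu> * (Ca * (4 * U.K) * Y + 4 * B4 * h\<^sup>2) + \<kappa>\<^sup>2 * (Ca * U.K * Y + S * Y)"
      define r2 where "r2 = Ct * U.K * X + Ca * U.K * Y"
      have r: "0 \<le> r1" "0 \<le> r2" using XY Ct Ca K0 nu_pos B40 S0 by (auto simp: r1_def r2_def)
      define \<rho>1 where "\<rho>1 i j = \<delta> N (\<lambda>k. a k i j) n - \<nu> * discrete_laplacian h (\<lambda>i j. avg_star \<sigma> (\<lambda>k. w k i j) n) i j" for i j
      define \<rho>2 where "\<rho>2 i j = \<delta> N (\<lambda>k. ubar (real i * h) (real j * h) (t N k)) n - avg_star \<sigma> (\<lambda>k. p (real i * h) (real j * h) (t N k)) n" for i j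
      have rho1: "\<bar>\<rho>1 i j\<bar> \<le> r1 + c * (\<bar>w n i j\<bar> + \<bar>w (n - 1) i j\<bar>)" if ij: "i \<in> {1..M-1}" "j \<in> {1..M-1}" for i j
        unfolding \<rho>1_def r1_def c_def a_def w_def S_def X_def Y_def
        by (rule momentum_residual[OF gr n ij, where P = P and Ub = Ub and Ct = Ct and Ca = Ca and Cs = Cs and Q = Q and B = B and ?B4.0 = B4
              and X = "xi N n powr (m + eps)" and Y = "xi N n powr m * t N n powr \<beta>"])
           (fact s1[OF n ij] Ct(2)[OF n] Ca(2)[OF n] Cs(2)[OF n] B4 B(2) Q[unfolded S_def Y_def])+
      have diff: "\<bar>\<rho>2 i j - \<rho>2 i' j'\<bar> \<le> r2 * (\<bar>real i * h - real i' * h\<bar> + \<bar>real j * h - real j' * h\<bar>)"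
        if "i \<le> M" "i' \<le> M" "j \<le> M" "j' \<le> M" "i = i' \<or> j = j'" for i j i' j'
        unfolding \<rho>2_def r2_def X_def Y_def
        by (rule velocity_residual_difference[OF n, where Ct = Ct and Ca = Ca
              and X = "xi N n powr (m + eps)" and Y = "xi N n powr m * t N n powr \<beta>"])
           (fact Ct(2)[OF n] Ca(2)[OF n] | use that node_in in force)+
      have eq2: "\<delta> N (\<lambda>k. w k i j) n = avg_star \<sigma> (\<lambda>k. a k i j) n + \<rho>2 i j" if ij: "i \<le> M" "j \<le> M" for i j
      proof (cases "i = 0 \<or> i = M \<or> j = 0 \<or> j = M")
        case True
        have z: "ubar (real i * h) (real j * h) (t N k) = 0" "p (real i * h) (real j * h) (t N k) = 0" if "k \<le> N" for k
          using ubar_boundary[OF node_in[OF ij(1)] node_in[OF ij(2)] edge[OF True] tk[OF that]]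
            p_boundary[OF node_in[OF ij(1)] node_in[OF ij(2)] edge[OF True] tk[OF that]] by auto
        have "\<delta> N (\<lambda>k. w k i j) n = 0" unfolding deriv_eq_g[OF n]
          using bd(2)[OF _ ij True] n1 by (intro sum.neutral) auto
        moreover have "\<delta> N (\<lambda>k. ubar (real i * h) (real j * h) (t N k)) n = 0" unfolding deriv_eq_g[OF n]
          using z n1 by (intro sum.neutral) auto
        ultimately show ?thesis using z[of n] z[of "n - 1"] bd(1)[OF _ ij True, of n] bd(1)[OF _ ij True, of "n - 1"] n1
          by (simp add: \<rho>2_def avg_star_def)
      next
        case False
        then have int: "i \<in> {1..M-1}" "j \<in> {1..M-1}" using ij by auto
        show ?thesis unfolding w_def a_def deriv_diff[OF n] avg_star_diff s2[OF n int] \<rho>2_def by simp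
      qed
      have "\<delta> N E n \<le> L2_set (energy_vector \<nu> h \<rho>1 \<rho>2) (energy_index M)"
        unfolding deriv_eq_g[OF n] E_def
      proof (rule discrete_energy_estimate[where \<sigma> = \<sigma>])
        show "g N n k \<le> g N n (k + 1)" if "1 \<le> k" "k < n" for k using P1_mono(1)[OF P1 that n1(2)] .
        show "0 \<le> g N n 1" using P1_mono(2)[OF P1, of 1 n] n1 by auto
        show "\<sigma> * g N n (n - 1) \<le> (2 * \<sigma> - 1) * g N n n" if "2 \<le> n"
          using P2 that n1 unfolding property_P2_def by (auto intro: less_imp_le)
        show "(\<Sum>k=1..n. g N n k * (a k i j - a (k - 1) i j)) =
           \<nu> * discrete_laplacian h (\<lambda>i j. avg_star \<sigma> (\<lambda>k. w k i j) n) i j + \<rho>1 i j"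
          if "i \<in> {1..M-1}" "j \<in> {1..M-1}" for i j
          using deriv_eq_g[OF n, of "\<lambda>k. a k i j"] by (simp add: \<rho>1_def)
        show "(\<Sum>k=1..n. g N n k * (w k i j - w (k - 1) i j)) = avg_star \<sigma> (\<lambda>k. a k i j) n + \<rho>2 i j"
          if "i \<le> M" "j \<le> M" for i j
          using eq2[OF that] deriv_eq_g[OF n, of "\<lambda>k. w k i j"] by simp
        show "a k i j = 0" if "k \<le> n" "i \<le> M" "j \<le> M" "i = 0 \<or> i = M \<or> j = 0 \<or> j = M" for k i j
          using bd(1)[of k i j] that n1 by auto
      qed (use n1 sigma_bounds nu_pos in auto)
      also have "\<dots> \<le> L * r1 + c * (grid_norm h M (w n) + grid_norm h M (w (n - 1))) + 2 * sqrt \<nu> * L * r2"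
      proof (rule residual_norm_le[OF _ r c0 rho1])
        show "\<bar>\<rho>2 i j - \<rho>2 (i - 1) j\<bar> \<le> r2 * h" if "i \<in> {1..M}" "j \<in> {1..M-1}" for i j
        proof -
          have "i \<le> M" "i - 1 \<le> M" "j \<le> M" using that by auto
          then show ?thesis using diff[of i "i - 1" j j] that h_pos by (simp add: of_nat_diff algebra_simps)
        qed
        show "\<bar>\<rho>2 i j - \<rho>2 i (j - 1)\<bar> \<le> r2 * h" if "i \<in> {1..M-1}" "j \<in> {1..M}" for i j
        proof -
          have "i \<le> M" "j \<le> M" "j - 1 \<le> M" using that by auto
          then show ?thesis using diff[of i i j "j - 1"] that h_pos by (simp add: of_nat_diff algebra_simps)
        qed
      qed (use nu_pos in auto)
      also have "\<dots> \<le> L * r1 + c * (L * (1 / sqrt \<nu>) * E n + L * (1 / sqrt \<nu>) * E (n - 1)) + 2 * sqrt \<nu> * L * r2"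
        by (rule add_mono[OF add_mono[OF order_refl mult_left_mono[OF add_mono[OF wE[OF n1(2)] wE[OF n1(3)]] c0]] order_refl])
      also have "\<dots> = lam * (E n + E (n - 1)) + (A1 * X + A2 * Y + A3 * h\<^sup>2)"
        unfolding r1_def r2_def lam_def A1_def A2_def A3_def by (simp only: algebra_simps)
      also have "\<dots> \<le> lam * (E n + E (n - 1)) + (\<theta>1 * (xi N n powr eps * t N n powr (- m)) + \<theta>2 * t N n powr (- \<beta>))"
      proof -
        have xim: "xi N n powr m = t N 1 powr m * t N n powr (- m)"
          using tn by (simp add: powr_divide powr_minus_divide)
        have "A1 * X = \<theta>1 * (xi N n powr eps * t N n powr (- m))"
          unfolding X_def \<theta>1_def powr_add xim by (simp add: mult_ac)
        \<comment> \<open>\<open>m \<le> 1 < 2 * \<beta>\<close>, so the power of \<open>t n\<close> left over is bounded by one of \<open>T\<close>\<close>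
        moreover have "A2 * Y \<le> A2 * T powr (2 * \<beta> - m) * t N 1 powr m * t N n powr (- \<beta>)"
        proof -
          have "Y = t N 1 powr m * (t N n powr (2 * \<beta> - m) * t N n powr (- \<beta>))"
            unfolding Y_def xim mult.assoc powr_add[symmetric] by simp
          also have "\<dots> \<le> t N 1 powr m * (T powr (2 * \<beta> - m) * t N n powr (- \<beta>))"
            using tn m beta by (intro mult_left_mono mult_right_mono powr_mono2) auto
          finally have "A2 * Y \<le> A2 * (t N 1 powr m * (T powr (2 * \<beta> - m) * t N n powr (- \<beta>)))"
            using A0 by (intro mult_left_mono) auto
          then show ?thesis by (simp add: mult_ac)
        qed
        moreover have "A3 * h\<^sup>2 \<le> A3 * T powr \<beta> * h\<^sup>2 * t N n powr (- \<beta>)"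
        proof -
          have "1 = t N n powr \<beta> * t N n powr (- \<beta>)" using tn by (simp add: powr_add[symmetric])
          also have "\<dots> \<le> T powr \<beta> * t N n powr (- \<beta>)" using tn beta by (intro mult_right_mono powr_mono2) auto
          finally have "A3 * h\<^sup>2 * 1 \<le> A3 * h\<^sup>2 * (T powr \<beta> * t N n powr (- \<beta>))" using A0 by (intro mult_left_mono) auto
          then show ?thesis by (simp add: mult_ac)
        qed
        ultimately show ?thesis unfolding \<theta>2_def by (simp add: distrib_right)
      qed
      finally show ?thesis .
    qed
    have "E N \<le> Ks * (\<theta>1 + \<theta>2)"
      by (rule stab[rule_format, OF N P1 _ th, where E = E]) (use small E0 step in blast)+
    also have "\<dots> \<le> Ks * (A * (t N 1 powr m + h\<^sup>2))"
    proof (rule mult_left_mono)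
      have "0 \<le> A1 * h\<^sup>2" "0 \<le> A2 * T powr (2 * \<beta> - m) * h\<^sup>2" "0 \<le> A3 * T powr \<beta> * t N 1 powr m"
        using A0 by auto
      then show "\<theta>1 + \<theta>2 \<le> A * (t N 1 powr m + h\<^sup>2)"
        unfolding \<theta>1_def \<theta>2_def A_def by (simp add: distrib_left distrib_right)
    qed (use Ks in auto)
    finally have EN: "E N \<le> Ks * A * (t N 1 powr m + h\<^sup>2)" by (simp add: mult.assoc)
    have "grid_norm h M (a N) + grid_grad_norm h M (w N) \<le> E N + E N / sqrt \<nu>"
      unfolding E_def by (intro add_mono norms_le_energy nu_pos)
    also have "\<dots> = (1 + 1 / sqrt \<nu>) * E N" by (simp add: distrib_right)
    also have "\<dots> \<le> (1 + 1 / sqrt \<nu>) * (Ks * A * (t N 1 powr m + h\<^sup>2))"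
      using EN nu_pos by (intro mult_left_mono) auto
    also have "\<dots> \<le> Kf * (t N 1 powr m + h\<^sup>2)"
      unfolding Kf_def by (simp add: distrib_right mult.assoc)
    finally show ?thesis unfolding a_def w_def t_N[OF N] .
  qed
  show ?thesis using Kf Ks(2) main[OF _ _ _ _ _ _ refl] by blast
qed

end

text \<open>The comparability of neighbouring nodes follows from that of \<open>t n\<close> with \<open>t 1 * n powr r\<close>, as
\<open>n \<le> 2 * (n - 1)\<close>.\<close>

lemma quasi_graded_constants:
  assumes q: "quasi_graded T r t" and T: "0 < T" and r: "1 \<le> r" and beta: "1 / 2 < \<beta>" "\<beta> < 1" and s: "\<sigma> = 1 - \<beta> / 2"
  shows "\<exists>D. graded_meshes T r \<beta> \<sigma> D t"
proof -
  have mesh: "temporal_mesh T N (t N)" if "1 \<le> N" for N using q that by (auto simp: quasi_graded_def)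
  have t0: "t N 0 = 0" if "1 \<le> N" for N using mesh[OF that] by (simp add: temporal_mesh_def)
  have pos: "0 < t N n" if "n \<in> {1..N}" for N n
    using temporal_mesh_less[OF mesh, of N 0 n] t0[of N] that by auto
  have d1: "mesh_step (t N) 1 = t N 1" if "1 \<le> N" for N using t0[OF that] by (simp add: mesh_step_def)
  obtain c C where c: "0 < c" "0 < C" and g: "\<And>N n. n \<in> {1..N} \<Longrightarrow> c \<le> t N n / (mesh_step (t N) 1 * real n powr r) \<and>
      t N n / (mesh_step (t N) 1 * real n powr r) \<le> C"
  proof -
    have "uniformly_equivalent (\<lambda>N n. t N n) (\<lambda>N n. mesh_step (t N) 1 * real n powr r)"
      using q by (simp add: quasi_graded_def)
    then obtain c C where "0 < c" "0 < C" and g: "\<forall>N\<ge>1. \<forall>n\<in>{1..N}. c \<le> t N n / (mesh_step (t N) 1 * real n powr r) \<and>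
        t N n / (mesh_step (t N) 1 * real n powr r) \<le> C"
      unfolding uniformly_equivalent_def by blast
    then show ?thesis by (intro that[of c C]) auto
  qed
  obtain c' C' where c': "0 < c'" "0 < C'" and g': "\<And>N n. n \<in> {1..N} \<Longrightarrow>
      c' \<le> mesh_step (t N) n / (mesh_step (t N) 1 powr (1 / r) * t N n powr (1 - 1 / r)) \<and>
      mesh_step (t N) n / (mesh_step (t N) 1 powr (1 / r) * t N n powr (1 - 1 / r)) \<le> C'"
  proof -
    have "uniformly_equivalent (\<lambda>N n. mesh_step (t N) n) (\<lambda>N n. mesh_step (t N) 1 powr (1 / r) * t N n powr (1 - 1 / r))"
      using q by (simp add: quasi_graded_def)
    then obtain c C where "0 < c" "0 < C" and g: "\<forall>N\<ge>1. \<forall>n\<in>{1..N}.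
        c \<le> mesh_step (t N) n / (mesh_step (t N) 1 powr (1 / r) * t N n powr (1 - 1 / r)) \<and>
        mesh_step (t N) n / (mesh_step (t N) 1 powr (1 / r) * t N n powr (1 - 1 / r)) \<le> C"
      unfolding uniformly_equivalent_def by blast
    then show ?thesis by (intro that[of c C]) auto
  qed
  have grow: "c * (t N 1 * real n powr r) \<le> t N n" "t N n \<le> C * (t N 1 * real n powr r)" if n: "n \<in> {1..N}" for N n
  proof -
    have "0 < t N 1 * real n powr r" using pos[of 1 N] n by auto
    then show "c * (t N 1 * real n powr r) \<le> t N n" "t N n \<le> C * (t N 1 * real n powr r)"
      using g[OF n] d1[of N] n by (auto simp: le_divide_eq divide_le_eq)
  qed
  have step: "c' * (t N n * (t N 1 / t N n) powr (1 / r)) \<le> mesh_step (t N) n"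
    "mesh_step (t N) n \<le> C' * (t N n * (t N 1 / t N n) powr (1 / r))" if n: "n \<in> {1..N}" for N n
  proof -
    have p: "0 < t N 1" "0 < t N n" using pos[of 1 N] pos[OF n] n by auto
    have e: "t N 1 powr (1 / r) * t N n powr (1 - 1 / r) = t N n * (t N 1 / t N n) powr (1 / r)"
      using p by (simp add: powr_divide powr_diff)
    have "0 < t N n * (t N 1 / t N n) powr (1 / r)" using p by auto
    then show "c' * (t N n * (t N 1 / t N n) powr (1 / r)) \<le> mesh_step (t N) n"
      "mesh_step (t N) n \<le> C' * (t N n * (t N 1 / t N n) powr (1 / r))"
      using g'[OF n] d1[of N] n unfolding e[symmetric] by (auto simp: le_divide_eq divide_le_eq)
  qed
  define D where "D = 1 + C' + 1 / c' + C + 1 / c + C * 2 powr r / c"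
  have D: "1 \<le> D" "C' \<le> D" "1 / c' \<le> D" "C \<le> D" "1 / c \<le> D" "C * 2 powr r / c \<le> D"
    using c c' by (auto simp: D_def add_nonneg_nonneg intro!: add_increasing add_increasing2)
  have "graded_meshes T r \<beta> \<sigma> D t"
  proof unfold_locales
    show "mesh_step (t N) n \<le> D * (t N n * (t N 1 / t N n) powr (1 / r))" if n: "n \<in> {1..N}" for N n
      using order_trans[OF step(2)[OF n] mult_right_mono[OF D(2), of "t N n * (t N 1 / t N n) powr (1 / r)"]] pos[OF n]
      by (simp add: less_imp_le)
    show "t N n * (t N 1 / t N n) powr (1 / r) \<le> D * mesh_step (t N) n" if n: "n \<in> {1..N}" for N n
    proof -
      have "0 \<le> mesh_step (t N) n" using temporal_mesh_le[OF mesh, of N "n - 1" n] n by (auto simp: mesh_step_def)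
      then have "1 / c' * mesh_step (t N) n \<le> D * mesh_step (t N) n" using D by (intro mult_right_mono) auto
      moreover have "t N n * (t N 1 / t N n) powr (1 / r) \<le> 1 / c' * mesh_step (t N) n"
        using step(1)[OF n] c' by (simp add: field_simps)
      ultimately show ?thesis by linarith
    qed
    show "t N n \<le> D * (t N 1 * real n powr r)" if n: "n \<in> {1..N}" for N n
      using order_trans[OF grow(2)[OF n] mult_right_mono[OF D(4), of "t N 1 * real n powr r"]] pos[of 1 N] n
      by (simp add: less_imp_le)
    show growth: "t N 1 * real n powr r \<le> D * t N n" if n: "n \<in> {1..N}" for N n
    proof -
      have "t N 1 * real n powr r \<le> 1 / c * t N n" using grow(1)[OF n] c by (simp add: field_simps)
      also have "\<dots> \<le> D * t N n" using D pos[OF n] by (intro mult_right_mono) auto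
      finally show ?thesis .
    qed
    show "t N n \<le> D * t N (n - 1)" if n: "2 \<le> n" "n \<le> N" for N n
    proof -
      have n1: "n \<in> {1..N}" "n - 1 \<in> {1..N}" using n by auto
      have t1: "0 < t N 1" using pos[of 1 N] n by auto
      have "t N n \<le> C * (t N 1 * real n powr r)" by (rule grow(2)[OF n1(1)])
      also have "\<dots> \<le> C * (t N 1 * (2 * real (n - 1)) powr r)"
        using n c r t1 by (intro mult_left_mono powr_mono2) (auto simp: of_nat_diff)
      also have "\<dots> = C * 2 powr r / c * (c * (t N 1 * real (n - 1) powr r))"
        using c by (simp add: powr_mult)
      also have "\<dots> \<le> C * 2 powr r / c * t N (n - 1)"
        using grow(1)[OF n1(2)] c by (intro mult_left_mono) auto
      also have "\<dots> \<le> D * t N (n - 1)" using D pos[OF n1(2)] by (intro mult_right_mono) auto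
      finally show ?thesis .
    qed
  qed (use T r beta s D mesh in auto)
  then show ?thesis by blast
qed

theorem corollary5p1:
  fixes L T \<alpha> \<beta> \<sigma> r \<nu> \<kappa> C :: real
    and \<phi> \<psi> :: "real \<Rightarrow> real \<Rightarrow> real"
    and u ubar p :: "real \<Rightarrow> real \<Rightarrow> real \<Rightarrow> real"
    and t :: "nat \<Rightarrow> nat \<Rightarrow> real"
  assumes "L > 0" and "T > 0" and "\<nu> > 0"
    and "1 < \<alpha>" and "\<alpha> < 2" and "\<beta> = \<alpha> / 2" and "\<sigma> = 1 - \<beta> / 2"
    and "r \<ge> 1" and "r \<noteq> 3 - \<beta>"
    and "C_space L 2 \<phi>"
    and "\<And>x y. \<lbrakk>x \<in> {0..L}; y \<in> {0..L}; x = 0 \<or> x = L \<or> y = 0 \<or> y = L\<rbrakk> \<Longrightarrow> \<phi> x y = 0"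
    and "sine_gordon_solution L T \<alpha> \<nu> \<kappa> \<psi> \<phi> u"
    and "ubar = (\<lambda>x y s. u x y s - s * \<phi> x y)"
    and "p = (\<lambda>x y s. caputo \<beta> (ubar x y) s)"
    and "C_space_time L T 4 1 ubar" and "C_space_time L T 2 0 p"
    and "weakly_singular_bound L T \<alpha> C ubar"
    and "weakly_singular_bound L T (\<alpha> / 2) C p"
    and "quasi_graded T r t"
  shows "\<exists>K>0. \<exists>\<tau>\<^sub>0>0. \<forall>N\<ge>1. \<forall>M\<ge>1.
           property_P1 \<beta> \<sigma> (t N) N \<longrightarrow>
           property_P2 \<beta> \<sigma> (t N) N \<longrightarrow>
           Max (mesh_step (t N) ` {1..N}) \<le> \<tau>\<^sub>0 \<longrightarrow>
           (\<forall>P Ub. alikhanov_scheme L \<beta> \<sigma> \<nu> \<kappa> \<psi> \<phi> M N (t N) P Ub \<longrightarrow>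
              (let h = L / real M in
                grid_norm h M (\<lambda>i j. p (real i * h) (real j * h) T - P N i j)
                + grid_grad_norm h M (\<lambda>i j. ubar (real i * h) (real j * h) T - Ub N i j)
                \<le> K * (mesh_step (t N) 1 powr min 1 (2 / r) + h\<^sup>2)))"
proof -
  have beta: "1 / 2 < \<beta>" "\<beta> < 1" and p_bound: "weakly_singular_bound L T \<beta> C p"
    using assms by auto
  obtain D where "graded_meshes T r \<beta> \<sigma> D t"
    using quasi_graded_constants[OF assms(19,2,8) beta assms(7)] by blast
  then interpret graded_meshes T r \<beta> \<sigma> D t .
  interpret sine_gordon_problem T r \<beta> \<sigma> D t L \<alpha> \<nu> \<kappa> C \<phi> \<psi> u ubar p
    by unfold_locales (use assms p_bound in auto)
  define m where "m = min 1 (2 / r)"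
  have m: "0 < m" "m \<le> 1" "m \<le> 2 / r" using r_ge_1 by (auto simp: m_def)
  obtain K \<tau>0 where K: "0 < K" "0 < \<tau>0" and est: "\<And>N M P Ub. \<lbrakk>1 \<le> N; 1 \<le> M; property_P1 \<beta> \<sigma> (t N) N; property_P2 \<beta> \<sigma> (t N) N;
      \<forall>n\<in>{1..N}. dt N n \<le> \<tau>0; alikhanov_scheme L \<beta> \<sigma> \<nu> \<kappa> \<psi> \<phi> M N (t N) P Ub\<rbrakk> \<Longrightarrow>
       grid_norm (L / real M) M (\<lambda>i j. p (real i * (L / real M)) (real j * (L / real M)) T - P N i j)
       + grid_grad_norm (L / real M) M (\<lambda>i j. ubar (real i * (L / real M)) (real j * (L / real M)) T - Ub N i j)
       \<le> K * (t N 1 powr m + (L / real M)\<^sup>2)"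
    using error_estimate[OF m] by blast
  have small: "\<forall>n\<in>{1..N}. dt N n \<le> \<tau>0" if "Max (mesh_step (t N) ` {1..N}) \<le> \<tau>0" for N
    using that by (meson Max_ge finite_atLeastAtMost finite_imageI imageI order_trans)
  show ?thesis
    unfolding Let_def m_def[symmetric]
    using K est small dt_1 by (intro exI[of _ K] exI[of _ \<tau>0]) auto
qed

end
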